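(* Let $X$ be a circulant graph of order $n$. Then the Weisfeiler–Leman dimension of $X$ with respect to the class of all circulant graphs is at most $\Omega(n)+3$, where $\Omega(n)$ is the total number of prime divisors of $n$ counted with multiplicity. Equivalently: if $m=\Omega(n)+3$ and $X'$ is any circulant graph that is $\mathrm{WL}_m$-equivalent to $X$, then $X'$ is isomorphic to $X$.
   Context: A circulant graph is a Cayley graph $\mathrm{Cay}(G,T)$ of a finite cyclic group $G$ (vertex set $G$, arcs $(g,tg)$ for $g\in G$, $t\in T$, for a subset $T\subseteq G$; directed or undirected). For an integer $m\ge 2$, the $m$-dimensional Weisfeiler–Leman algorithm canonically colors the $m$-tuples of vertices of a graph (so the $2$-dimensional algorithm is the classical Weisfeiler–Leman refinement of vertex pairs); two graphs are $\mathrm{WL}_m$-equivalent if the resulting colorings do not distinguish them. The WL-dimension of a graph $X$ with respect to a class $\mathfrak K$ of graphs containing $X$ is the smallest positive integer $m$ such that every graph $X'\in\mathfrak K$ that is $\mathrm{WL}_m$-equivalent to $X$ is isomorphic to $X$. *)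

theory Defs
  imports
    "HOL-Algebra.Elementary_Groups"
    "HOL-Computational_Algebra.Primes"
    "HOL-Library.Multiset"
    "HOL-Library.Extended_Nat"
    "Graph_Theory.Pair_Digraph"
    "Graph_Theory.Digraph_Isomorphism"
begin

text \<open>
  Graphs are digraphs without parallel arcs; loops are allowed, and an undirected graph is one
  whose arc set is symmetric.
\<close>

definition cayley_graph :: "'a monoid \<Rightarrow> 'a set \<Rightarrow> 'a pair_pre_digraph" where
  "cayley_graph G T =
     \<lparr> pverts = carrier G, parcs = {(g, t \<otimes>\<^bsub>G\<^esub> g) | g t. g \<in> carrier G \<and> t \<in> T} \<rparr>"

definition circulant :: "'a pair_pre_digraph \<Rightarrow> bool" where
  "circulant X \<longleftrightarrow>
     (\<exists>G T. group G \<and> cyclic_group G \<and> finite (carrier G) \<and> T \<subseteq> carrier G \<and> X = cayley_graph G T)"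

definition graph_isomorphic :: "'a pair_pre_digraph \<Rightarrow> 'b pair_pre_digraph \<Rightarrow> bool" where
  "graph_isomorphic X Y \<longleftrightarrow> digraph_iso (with_proj X) (with_proj Y)"

definition tuples :: "nat \<Rightarrow> 'a pair_pre_digraph \<Rightarrow> 'a list set" where
  "tuples m X = {xs. length xs = m \<and> set xs \<subseteq> pverts X}"

type_synonym atomic_type = "(nat \<times> nat) set \<times> (nat \<times> nat) set"

definition atomic_type :: "'a pair_pre_digraph \<Rightarrow> 'a list \<Rightarrow> atomic_type" where
  "atomic_type X xs =
     ({(i, j). i < length xs \<and> j < length xs \<and> xs ! i = xs ! j},
      {(i, j). i < length xs \<and> j < length xs \<and> (xs ! i, xs ! j) \<in> parcs X})"

text \<open>
  Colours are terms that do not refer to vertices, so that colours of tuples of different graphs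
  can be compared.
\<close>

datatype wl_colour =
    Initial atomic_type
  | Refined wl_colour "(atomic_type \<times> wl_colour list) multiset"

text \<open>
  For tuples of length at least 2 the entry \<open>atomic_type X (xs @ [y])\<close> is determined by the
  colours in the list next to it and could be omitted; for length 1 it turns the scheme into
  ordinary colour refinement.
\<close>

fun wl_round :: "'a pair_pre_digraph \<Rightarrow> nat \<Rightarrow> 'a list \<Rightarrow> wl_colour" where
  "wl_round X 0 xs = Initial (atomic_type X xs)"
| "wl_round X (Suc r) xs =
     Refined (wl_round X r xs)
       (image_mset
          (\<lambda>y. (atomic_type X (xs @ [y]), map (\<lambda>i. wl_round X r (xs[i := y])) [0..<length xs]))
          (mset_set (pverts X)))"

text \<open>
  The resulting colour of a tuple is the sequence of its colours in all rounds: two tuples,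
  possibly of different graphs, get the same resulting colour iff no round separates them.
\<close>

definition wl_colouring :: "'a pair_pre_digraph \<Rightarrow> 'a list \<Rightarrow> nat \<Rightarrow> wl_colour" where
  "wl_colouring X xs = (\<lambda>r. wl_round X r xs)"

definition wl_equivalent :: "nat \<Rightarrow> 'a pair_pre_digraph \<Rightarrow> 'b pair_pre_digraph \<Rightarrow> bool" where
  "wl_equivalent m X Y \<longleftrightarrow>
     image_mset (wl_colouring X) (mset_set (tuples m X)) =
     image_mset (wl_colouring Y) (mset_set (tuples m Y))"

text \<open>
  The infimum in \<^typ>\<open>enat\<close> is the least such \<open>m\<close>, and \<open>\<infinity>\<close> if there is none. The class may
  live on a vertex type other than that of \<open>X\<close>.
\<close>

definition wl_dimension :: "'b pair_pre_digraph set \<Rightarrow> 'a pair_pre_digraph \<Rightarrow> enat" where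
  "wl_dimension K X =
     Inf (enat ` {m. m > 0 \<and> (\<forall>Y\<in>K. wl_equivalent m X Y \<longrightarrow> graph_isomorphic X Y)})"

definition big_omega :: "nat \<Rightarrow> nat" where
  "big_omega n = size (prime_factorization n)"

end

theory Submission
  imports Defs "HOL-Number_Theory.Residues"
begin

text \<open>
  For \<open>m \<ge> 3\<close> the \<open>m\<close>-dimensional colours of the tuples \<open>(0, x, ..., x)\<close> partition the cyclic group of
  order \<open>n\<close> into the basic sets of a Schur ring, and matching colours give an algebraic isomorphism
  between the Schur rings of the two graphs. With \<open>\<Omega>(n)\<close> further pebbles one places, for every prime
  power \<open>p ^ j\<close> dividing \<open>n\<close>, the element \<open>n / p ^ j\<close> of order \<open>p ^ j\<close>. Every residue is a unique
  combination of these elements with coefficients in \<open>{0..<p}\<close>. Mapping it to the same combination of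
  the \<open>p\<close>-parts of the responses is a bijection, and it respects the colours of differences. This is
  shown by induction on \<open>n\<close>, for pebbled pairs of Schur rings. A difference in a proper subgroup of the
  Schur ring, or in a class that is a union of cosets of such a subgroup, is handled by a smaller
  Schur ring. Otherwise the class of the difference contains units, and it is either a tensor product
  of a class of a quotient with the nonzero elements of a complement, or so small that the Hall
  subgroups belong to the Schur ring and the responses are the images of the pebbles under
  multiplication by a single unit.
\<close>

section \<open>Schur rings over cyclic groups\<close>

text \<open>No single unit can serve as the isomorphism in general: on subgroups, quotients and
  tensor factors the responses may be scaled by unrelated units. The digit system is built to
  survive this. For a subgroup of the Schur ring, the pairs (\<open>p\<close>, \<open>j\<close>)
  split into those of the subgroup and those of the quotient, so a pebbled pair induces one on each;
  hence every prime power gets a pebble of its own, instead of one generator per Sylow subgroup.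
  Coefficients are digits because the images of the elements of order \<open>p ^ j\<close> need not
  satisfy \<open>p * e p (Suc j) = e p j\<close>. With digits, whether a difference lies in a given
  subgroup is read off from the positions at which the digits differ, and so has the same answer on
  both sides. Colours need not determine orders, so a response may have the wrong order; the values
  of the responses matter only in the unit case, where their order turns out right. The summand 3 in
  the number of pebbles admits triples (0, x, z), whose colours determine the structure constants.
  Both sides are carried in one boolean-indexed structure, so each classical fact on Schur rings is
  proved at once for the ring and for the isomorphism.\<close>

definition cnt :: "int \<Rightarrow> (int \<Rightarrow> bool) \<Rightarrow> nat" where
  "cnt n P = card {z \<in> {0..<n}. P z}"

definition per :: "int \<Rightarrow> (int \<Rightarrow> 'a) \<Rightarrow> bool" where
  "per n f \<longleftrightarrow> (\<forall>x y. n dvd x - y \<longrightarrow> f x = f y)"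

lemma perD: "per n f \<Longrightarrow> n dvd x - y \<Longrightarrow> f x = f y"
  by (auto simp: per_def)

lemma dvd_mod_diff: "(n::int) dvd x mod n - x"
  by (simp add: mod_eq_dvd_iff[symmetric])

lemma per_mod: "per n f \<Longrightarrow> f (x mod n) = f x"
  by (rule perD[OF _ dvd_mod_diff])

lemma finite_residues [simp]: "finite {z::int. 0 \<le> z \<and> z < n \<and> P z}"
  by (rule finite_subset[of _ "{0..<n}"]) auto

lemma dvd_imp_eq: "(n::int) dvd x - y \<Longrightarrow> x \<in> {0..<n} \<Longrightarrow> y \<in> {0..<n} \<Longrightarrow> x = y"
  by (metis atLeastLessThan_iff mod_eq_dvd_iff mod_pos_pos_trivial)

lemma cnt_inj_le:
  assumes "n > 0" and "per n Q"
    and "\<And>z. P z \<Longrightarrow> Q (f z)"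
    and "\<And>z z'. P z \<Longrightarrow> P z' \<Longrightarrow> n dvd f z - f z' \<Longrightarrow> n dvd z - z'"
  shows "cnt n P \<le> cnt n Q"
  unfolding cnt_def
proof (rule card_inj_on_le)
  show "inj_on (\<lambda>z. f z mod n) {z \<in> {0..<n}. P z}"
    by (rule inj_onI) (metis (no_types, lifting) assms(4) dvd_imp_eq mem_Collect_eq mod_eq_dvd_iff)
  show "(\<lambda>z. f z mod n) ` {z \<in> {0..<n}. P z} \<subseteq> {z \<in> {0..<n}. Q z}"
    using assms(1,2,3) per_mod[OF assms(2)] by auto
qed auto

lemma cnt_bij:
  assumes "n > 0" and "per n P" and "per n Q"
    and "\<And>z. P z \<Longrightarrow> Q (f z)" and "\<And>z. Q z \<Longrightarrow> P (g z)"
    and "\<And>z z'. n dvd f z - f z' \<Longrightarrow> n dvd z - z'"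
    and "\<And>z z'. n dvd g z - g z' \<Longrightarrow> n dvd z - z'"
  shows "cnt n P = cnt n Q"
proof (rule antisym)
  show "cnt n P \<le> cnt n Q"
    by (rule cnt_inj_le[OF assms(1,3,4,6)])
  show "cnt n Q \<le> cnt n P"
    by (rule cnt_inj_le[OF assms(1,2,5,7)])
qed

lemma cnt_shift:
  assumes "n > 0" and "per n P"
  shows "cnt n (\<lambda>z. P (z + k)) = cnt n P"
proof (rule cnt_bij[OF assms(1), where f = "\<lambda>z. z + k" and g = "\<lambda>z. z - k"])
  show "per n (\<lambda>z. P (z + k))"
    using perD[OF assms(2)] by (simp add: per_def)
qed (use assms in auto)

lemma cnt_uminus:
  assumes "n > 0" and "per n P"
  shows "cnt n (\<lambda>z. P (- z)) = cnt n P"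
proof (rule cnt_bij[OF assms(1), where f = uminus and g = uminus])
  show "per n (\<lambda>z. P (- z))"
    unfolding per_def
  proof (intro allI impI)
    fix x y assume "n dvd x - y"
    then have "n dvd - x - - y"
      by (simp add: dvd_diff_commute)
    then show "P (- x) = P (- y)"
      by (rule perD[OF assms(2)])
  qed
qed (use assms(2) in \<open>auto simp: dvd_diff_commute\<close>)

lemma cnt_mono: "(\<And>z. P z \<Longrightarrow> Q z) \<Longrightarrow> cnt n P \<le> cnt n Q"
  unfolding cnt_def by (rule card_mono) auto

lemma cnt_pos:
  assumes "n > 0" and "per n P"
  shows "cnt n P > 0 \<longleftrightarrow> (\<exists>z. P z)"
proof -
  have "{z \<in> {0..<n}. P z} \<noteq> {}" if "P z" for z
  proof -
    have "z mod n \<in> {z \<in> {0..<n}. P z}"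
      using that assms per_mod[OF assms(2), of z] by simp
    then show ?thesis by blast
  qed
  then show ?thesis
    unfolding cnt_def by (auto simp: card_gt_0_iff)
qed

lemma cnt_add:
  assumes "\<And>z. \<not> (P z \<and> Q z)"
  shows "cnt n (\<lambda>z. P z \<or> Q z) = cnt n P + cnt n Q"
  unfolding cnt_def using assms by (subst card_Un_disjoint[symmetric]) (auto intro: arg_cong[where f = card])

lemma cnt_split: "cnt n P = cnt n (\<lambda>z. P z \<and> Q z) + cnt n (\<lambda>z. P z \<and> \<not> Q z)"
  by (subst cnt_add[symmetric]) (auto intro: arg_cong[where f = "cnt n"])

lemma cnt_single:
  assumes "n > 0"
  shows "cnt n (\<lambda>z. n dvd z - x) = 1"
proof -
  have "{z \<in> {0..<n}. n dvd z - x} = {x mod n}"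
    using assms by (auto simp: mod_eq_dvd_iff[symmetric])
  then show ?thesis
    by (simp add: cnt_def)
qed

text \<open>\<open>walks n C k y\<close> counts the \<open>k\<close>-tuples of elements of \<open>C\<close> with sum congruent to \<open>y\<close>.\<close>

primrec walks :: "int \<Rightarrow> int set \<Rightarrow> nat \<Rightarrow> int \<Rightarrow> nat" where
  "walks n C 0 y = of_bool (n dvd y)"
| "walks n C (Suc k) y = (\<Sum>z\<in>C. walks n C k (y - z))"

text \<open>The binomial theorem in the group ring: one chooses which \<open>k - j\<close> of the
  \<open>k\<close> steps are \<open>t\<close>.\<close>

lemma walks_insert:
  assumes "finite C" and "t \<notin> C"
  shows "walks n (insert t C) k y = (\<Sum>j\<le>k. (k choose j) * walks n C j (y - int (k - j) * t))"
proof (induction k arbitrary: y)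
  case 0
  then show ?case by simp
next
  case (Suc k)
  let ?w = "walks n C"
  define h where "h i j = (k choose i) * ?w j (y - int (Suc k - j) * t)" for i j
  have 1: "(\<Sum>j\<le>k. (k choose j) * ?w j (y - t - int (k - j) * t)) = (\<Sum>j\<le>k. h j j)"
    unfolding h_def by (intro sum.cong refl) (auto simp: Suc_diff_le algebra_simps)
  have 2: "(\<Sum>z\<in>C. \<Sum>j\<le>k. (k choose j) * ?w j (y - z - int (k - j) * t)) = (\<Sum>j\<le>k. h j (Suc j))"
    unfolding h_def
    by (subst sum.swap) (auto intro!: sum.cong simp: sum_distrib_left algebra_simps)
  have "walks n (insert t C) (Suc k) y = (\<Sum>j\<le>k. h j j) + (\<Sum>j\<le>k. h j (Suc j))"
    using assms by (simp add: Suc 1 2 del: of_nat_diff)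
  also have "\<dots> = (\<Sum>j\<le>Suc k. h j j) + (\<Sum>j\<le>k. h j (Suc j))"
    by (simp add: h_def)
  also have "\<dots> = h 0 0 + (\<Sum>j\<le>k. h (Suc j) (Suc j) + h j (Suc j))"
    by (subst sum.atMost_Suc_shift) (simp add: sum.distrib)
  also have "\<dots> = (\<Sum>j\<le>Suc k. (Suc k choose j) * ?w j (y - int (Suc k - j) * t))"
    by (subst sum.atMost_Suc_shift) (simp add: h_def algebra_simps)
  finally show ?case .
qed

text \<open>The Frobenius identity in characteristic \<open>p\<close>: the \<open>p\<close>-th power
  of the formal sum of \<open>C\<close> is the sum of the multiples \<open>p * t\<close>, since the
  middle binomial coefficients vanish modulo \<open>p\<close>.\<close>

lemma walks_prime_cong:
  assumes "prime p" and "finite C"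
  shows "[walks n C p y = card {t \<in> C. n dvd int p * t - y}] (mod p)"
  using assms(2)
proof (induction C rule: finite_induct)
  case empty
  have "p = Suc (p - 1)"
    using prime_gt_0_nat[OF assms(1)] by simp
  then have "walks n {} p y = 0"
    by (metis walks.simps(2) sum.empty)
  then show ?case by simp
next
  case (insert t C)
  have p: "p > 0"
    using prime_gt_0_nat[OF assms(1)] .
  let ?f = "\<lambda>j. (p choose j) * walks n C j (y - int (p - j) * t)"
  have "[(\<Sum>j\<in>{0<..<p}. ?f j) = (\<Sum>j\<in>{0<..<p}. 0)] (mod p)"
    using assms(1) by (intro cong_sum) (auto simp: cong_0_iff intro!: dvd_mult2 dvd_choose_prime assms(1))
  moreover have "{..p} = insert 0 (insert p {0<..<p})"
    using p by auto
  ultimately have "[walks n (insert t C) p y = ?f 0 + ?f p] (mod p)"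
    using insert p by (simp add: walks_insert cong_add_lcancel_nat cong_add_lcancel_0_nat cong_add_rcancel_0_nat)
  moreover have "?f 0 + ?f p = of_bool (n dvd int p * t - y) + walks n C p y"
    by (simp add: dvd_diff_commute)
  moreover have "[\<dots> = of_bool (n dvd int p * t - y) + card {t \<in> C. n dvd int p * t - y}] (mod p)"
    using insert.IH by (rule cong_add[OF cong_refl])
  moreover have "card {s \<in> insert t C. n dvd int p * s - y} =
      of_bool (n dvd int p * t - y) + card {t \<in> C. n dvd int p * t - y}"
  proof (cases "n dvd int p * t - y")
    case True
    then have "{s \<in> insert t C. n dvd int p * s - y} = insert t {t \<in> C. n dvd int p * t - y}"
      by auto
    then show ?thesis
      using insert True by simp
  next
    case False
    then have "{s \<in> insert t C. n dvd int p * s - y} = {t \<in> C. n dvd int p * t - y}"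
      by auto
    then show ?thesis
      using False by simp
  qed
  ultimately show ?case
    by (metis cong_trans)
qed

text \<open>Two Schur rings over the integers modulo \<open>n\<close> with an algebraic isomorphism: \<open>c True\<close> and
  \<open>c False\<close> colour the basic sets, and corresponding basic sets have the same colour.\<close>

locale sring =
  fixes n :: int and c :: "bool \<Rightarrow> int \<Rightarrow> nat"
  assumes n_pos: "n > 0"
    and per: "n dvd x - y \<Longrightarrow> c s x = c s y"
    and zero: "c s x = c s' 0 \<longleftrightarrow> n dvd x"
    and onto: "\<exists>x'. c s' x' = c s x"
    and neg: "c s x = c s' x' \<Longrightarrow> c s (- x) = c s' (- x')"
    and str: "c s x = c s' x' \<Longrightarrow>
      cnt n (\<lambda>z. c s z = \<alpha> \<and> c s (z - x) = \<beta>) = cnt n (\<lambda>z. c s' z = \<alpha> \<and> c s' (z - x') = \<beta>)"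
begin

lemma per_c: "per n (\<lambda>z. P (c s z))"
  unfolding per_def using per by metis

lemma c_mod: "c s (x mod n) = c s x"
  by (rule per) (rule dvd_mod_diff)

lemma finite_range_c: "finite (range (c s))"
proof -
  have "range (c s) = c s ` {0..<n}"
    using n_pos c_mod by (auto simp: image_iff) (metis atLeastLessThan_iff pos_mod_bound pos_mod_sign)
  then show ?thesis by simp
qed

lemma range_c: "range (c s) = range (c s')"
  using onto by (auto simp: image_iff) metis+

text \<open>Grouping \<open>z\<close> by the colours of \<open>z\<close> and \<open>z - y\<close>
  expresses the sum through structure constants, which \<open>str\<close> makes equal for
  corresponding points.\<close>

lemma sum_inv:
  assumes "c s y = c s' y'" and F: "\<And>s s' w w'. c s w = c s' w' \<Longrightarrow> F s w = F s' w'"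
  shows "(\<Sum>z | z \<in> {0..<n} \<and> A (c s z). F s (z - y)) = (\<Sum>z | z \<in> {0..<n} \<and> A (c s' z). (F s' (z - y') :: nat))"
proof -
  define K where "K = range (c True)"
  \<comment> \<open>\<open>F\<close> factors through the colour; a representative taken on side
    \<open>True\<close> serves both sides because all colours occur there.\<close>
  define G where "G \<gamma> = F True (SOME w. c True w = \<gamma>)" for \<gamma>
  have G: "F s w = G (c s w)" for s w
  proof -
    have "c True (SOME v. c True v = c s w) = c s w"
      using onto[where s' = True] by (rule someI_ex)
    then show ?thesis
      unfolding G_def by (intro F) simp
  qed
  have K: "finite K" "range (c s) = K" for s
    using finite_range_c range_c unfolding K_def by auto
  have "(\<Sum>z | z \<in> {0..<n} \<and> A (c s z). F s (z - y)) =
      (\<Sum>(\<alpha>,\<beta>)\<in>{\<alpha>\<in>K. A \<alpha>} \<times> K. cnt n (\<lambda>z. c s z = \<alpha> \<and> c s (z - y) = \<beta>) * G \<beta>)" for s y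
  proof -
    let ?S = "{z. z \<in> {0..<n} \<and> A (c s z)}" and ?T = "{\<alpha>\<in>K. A \<alpha>} \<times> K" and ?g = "\<lambda>z. (c s z, c s (z - y))"
    have "(\<Sum>z\<in>?S. F s (z - y)) = (\<Sum>q\<in>?T. \<Sum>z | z \<in> ?S \<and> ?g z = q. F s (z - y))"
      using K by (intro sum.group[symmetric]) auto
    also have "\<dots> = (\<Sum>(\<alpha>,\<beta>)\<in>?T. cnt n (\<lambda>z. c s z = \<alpha> \<and> c s (z - y) = \<beta>) * G \<beta>)"
    proof (intro sum.cong refl, clarify)
      fix \<alpha> \<beta> assume "A \<alpha>"
      then have "{z. z \<in> ?S \<and> ?g z = (\<alpha>, \<beta>)} = {z \<in> {0..<n}. c s z = \<alpha> \<and> c s (z - y) = \<beta>}"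
        by auto
      then show "(\<Sum>z | z \<in> ?S \<and> ?g z = (\<alpha>, \<beta>). F s (z - y)) = cnt n (\<lambda>z. c s z = \<alpha> \<and> c s (z - y) = \<beta>) * G \<beta>"
        unfolding cnt_def by (simp add: G)
    qed
    finally show ?thesis .
  qed
  then show ?thesis
    using str[OF assms(1)] by simp
qed

lemma count_inv:
  assumes "c s y = c s' y'"
  shows "cnt n (\<lambda>z. A (c s z) \<and> B (c s (z - y))) = cnt n (\<lambda>z. A (c s' z) \<and> B (c s' (z - y')))"
proof -
  have "cnt n (\<lambda>z. A (c s z) \<and> B (c s (z - y))) = (\<Sum>z | z \<in> {0..<n} \<and> A (c s z). of_bool (B (c s (z - y))))" for s y
  proof -
    have "{z \<in> {0..<n}. A (c s z) \<and> B (c s (z - y))} = {z \<in> {z. z \<in> {0..<n} \<and> A (c s z)}. B (c s (z - y))}"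
      by auto
    then show ?thesis
      unfolding cnt_def by (simp add: Int_def conj_assoc)
  qed
  then show ?thesis
    using sum_inv[OF assms, of "\<lambda>s w. of_bool (B (c s w))" A] by simp
qed

lemma per_count: "per n (\<lambda>z. A (c s z) \<and> B (c s (z - y)))"
proof -
  have "c s x = c s x' \<and> c s (x - y) = c s (x' - y)" if "n dvd x - x'" for x x'
    using that per[of x x' s] per[of "x - y" "x' - y" s] by simp
  then show ?thesis
    unfolding per_def by metis
qed

text \<open>Transfer of triangles: once one edge is copied to the other side, so is any third
  vertex, because a nonzero structure constant stays nonzero.\<close>

lemma tri:
  assumes "c s x = c s' x'"
  obtains z' where "c s' z' = c s z" and "c s' (z' - x') = c s (z - x)"
proof -
  have "cnt n (\<lambda>w. c s w = c s z \<and> c s (w - x) = c s (z - x)) > 0"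
    using cnt_pos[OF n_pos per_count[of "\<lambda>\<gamma>. \<gamma> = c s z" s "\<lambda>\<gamma>. \<gamma> = c s (z - x)" x]] by auto
  then have "cnt n (\<lambda>w. c s' w = c s z \<and> c s' (w - x') = c s (z - x)) > 0"
    using str[OF assms] by simp
  then show ?thesis
    using cnt_pos[OF n_pos per_count[of "\<lambda>\<gamma>. \<gamma> = c s z" s' "\<lambda>\<gamma>. \<gamma> = c s (z - x)" x']] that by auto
qed

lemma class_count: "cnt n (\<lambda>z. A (c s z)) = cnt n (\<lambda>z. A (c s' z))"
  using count_inv[of s 0 s' 0 A "\<lambda>_. True"] zero[of s 0 s'] by simp

lemma walks_inv:
  assumes "c s y = c s' y'"
  shows "walks n {z. z \<in> {0..<n} \<and> c s z = \<gamma>} k y = walks n {z. z \<in> {0..<n} \<and> c s' z = \<gamma>} k y'"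
  using assms
proof (induction k arbitrary: s s' y y')
  case 0
  then show ?case
    using zero[of s y True] zero[of s' y' True] by simp
next
  case (Suc k)
  let ?C = "\<lambda>s. {z. z \<in> {0..<n} \<and> c s z = \<gamma>}"
  let ?F = "\<lambda>s w. walks n (?C s) k (- w)"
  have "(\<Sum>z\<in>?C s. ?F s (z - y)) = (\<Sum>z\<in>?C s'. ?F s' (z - y'))"
    using sum_inv[OF Suc.prems, of ?F "\<lambda>\<alpha>. \<alpha> = \<gamma>"] Suc.IH neg by blast
  then show ?case
    by simp
qed

text \<open>Schur's theorem on \<open>p\<close>-th powers. The \<open>p\<close>-th power of a class
  has coefficients depending only on colours, and modulo \<open>p\<close> they count preimages under
  multiplication by \<open>p\<close>.\<close>

lemma power_count:
  assumes "prime p" and "c s y = c s' y'"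
  shows "[cnt n (\<lambda>t. c s t = \<gamma> \<and> n dvd int p * t - y) = cnt n (\<lambda>t. c s' t = \<gamma> \<and> n dvd int p * t - y')] (mod p)"
proof -
  have *: "[walks n {z. z \<in> {0..<n} \<and> c s z = \<gamma>} p y = cnt n (\<lambda>t. c s t = \<gamma> \<and> n dvd int p * t - y)] (mod p)" for s y
  proof -
    have "finite {z. z \<in> {0..<n} \<and> c s z = \<gamma>}" by simp
    from walks_prime_cong[OF assms(1) this, of n y]
    show ?thesis unfolding cnt_def by (simp add: conj_assoc)
  qed
  from cong_trans[OF cong_sym[OF *[of s y]]] *[of s' y'] show ?thesis
    unfolding walks_inv[OF assms(2)] .
qed

text \<open>Multiplication by \<open>p\<close> is injective, so the number of preimages on the first
  side is 1; on the other side it is then nonzero modulo \<open>p\<close>.\<close>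

lemma mult_prime_inv:
  assumes "prime p" and "coprime (int p) n" and "c s (int p * x) = c s' y"
  obtains x' where "n dvd int p * x' - y" and "c s' x' = c s x"
proof -
  have *: "n dvd int p * t - int p * x \<longleftrightarrow> n dvd t - x" for t
    using assms(2) by (simp add: right_diff_distrib[symmetric] coprime_commute coprime_dvd_mult_right_iff)
  have "(\<lambda>t. c s t = c s x \<and> n dvd int p * t - int p * x) = (\<lambda>t. n dvd t - x)"
    unfolding * using per by blast
  then have "[cnt n (\<lambda>t. c s' t = c s x \<and> n dvd int p * t - y) = 1] (mod p)"
    using power_count[OF assms(1,3), of "c s x"] cnt_single[OF n_pos] by (metis cong_sym)
  then have "{z \<in> {0..<n}. c s' z = c s x \<and> n dvd int p * z - y} \<noteq> {}"
    using assms(1) unfolding cnt_def by (metis card.empty cong_0_1_nat cong_sym not_prime_1)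
  then show ?thesis
    using that by auto
qed

lemma mult_inverse_prime:
  assumes "prime p" and "[int p * q = 1] (mod n)" and "c s x = c s' y"
  shows "c s (q * x) = c s' (q * y)"
proof -
  have pq: "n dvd int p * q - 1"
    using assms(2) by (simp add: cong_iff_dvd_diff)
  have 1: "n dvd int p * (q * z) - z" for z
    using dvd_mult2[OF pq, of z] by (simp add: algebra_simps)
  have cop: "coprime (int p) n"
    using assms(2) coprime_iff_invertible_int by blast
  have "c s (int p * (q * x)) = c s' y"
    using per[OF 1, of s x] assms(3) by simp
  then obtain x' where x': "n dvd int p * x' - y" "c s' x' = c s (q * x)"
    using mult_prime_inv[OF assms(1) cop] by blast
  have "n dvd int p * (q * y - x')"
    using dvd_diff[OF 1[of y] x'(1)] by (simp add: algebra_simps)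
  then have "n dvd q * y - x'"
    using cop by (simp add: coprime_commute coprime_dvd_mult_right_iff)
  then show ?thesis
    using per x'(2) by metis
qed

text \<open>The counting argument handles the inverse of \<open>p\<close>, not \<open>p\<close>
  itself; by Euler's theorem \<open>p\<close> is a power of its inverse.\<close>

lemma mult_prime:
  assumes "prime p" and "coprime (int p) n" and "c s x = c s' y"
  shows "c s (int p * x) = c s' (int p * y)"
proof -
  obtain q where q: "[int p * q = 1] (mod n)"
    using assms(2) coprime_iff_invertible_int by blast
  have pow: "c s (q ^ k * x) = c s' (q ^ k * y)" for k
  proof (induction k)
    case (Suc k)
    then show ?case
      using mult_inverse_prime[OF assms(1) q, of s "q ^ k * x" s' "q ^ k * y"] by (simp add: mult.assoc)
  qed (use assms in simp)
  have "coprime p (nat n)"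
    using assms(2) n_pos by (metis coprime_int_iff int_nat_eq less_imp_le)
  then have "[p ^ totient (nat n) = 1] (mod nat n)"
    by (rule euler_theorem)
  then have 1: "[int p ^ totient (nat n) = 1] (mod n)"
    using n_pos by (metis cong_int_iff int_nat_eq less_imp_le of_nat_1 of_nat_power)
  have "totient (nat n) > 0"
    using n_pos by simp
  then obtain k where k: "totient (nat n) = Suc k"
    using gr0_implies_Suc by blast
  have "[int p * (int p ^ k * q ^ k) = q ^ k] (mod n)"
    using cong_mult[OF 1 cong_refl[of "q ^ k"]] k by (simp add: algebra_simps)
  moreover have "[int p * (int p * q) ^ k = int p * 1 ^ k] (mod n)"
    using q by (intro cong_mult cong_refl cong_pow)
  ultimately have "[q ^ k = int p] (mod n)"
    by (simp add: power_mult_distrib cong_sym_eq) (metis cong_sym cong_trans)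
  then have "n dvd q ^ k * z - int p * z" for z
    by (metis cong_iff_dvd_diff dvd_mult2 left_diff_distrib)
  then show ?thesis
    using pow per by metis
qed

lemma mult_nat:
  assumes "coprime (int m) n" and "m > 0" and "c s x = c s' y"
  shows "c s (int m * x) = c s' (int m * y)"
  using assms
proof (induction m arbitrary: x y rule: prime_divisors_induct)
  case (factor p m)
  then have "c s (int m * x) = c s' (int m * y)"
    by auto
  then show ?case
    using mult_prime[of p s "int m * x" s' "int m * y"] factor by (auto simp: mult.assoc)
next
  case (unit m)
  then show ?case by simp
qed simp

text \<open>Schur's theorem on multipliers, for both sides together: units permute the classes
  compatibly with the algebraic isomorphism.\<close>

lemma mult:
  assumes "coprime m n" and "c s x = c s' y"
  shows "c s (m * x) = c s' (m * y)"
proof -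
  \<comment> \<open>A positive representative of the residue of \<open>m\<close>, so that it factors
    into primes coprime to \<open>n\<close>.\<close>
  define k where "k = nat (m mod n + n)"
  have k: "int k = m mod n + n"
    using n_pos by (simp add: k_def)
  have "coprime (int k) n"
    using assms(1) unfolding k by (metis coprime_mod_left_iff gcd_add1 coprime_iff_gcd_eq_1 gcd.commute n_pos less_irrefl)
  moreover have "k > 0"
    using n_pos by (simp add: k_def add_nonneg_pos)
  ultimately have "c s (int k * x) = c s' (int k * y)"
    using mult_nat assms(2) by blast
  moreover have "n dvd int k * z - m * z" for z
  proof -
    have "n dvd int k - m"
      unfolding k by (simp add: mod_eq_dvd_iff[symmetric])
    then show ?thesis
      by (metis dvd_mult2 left_diff_distrib)
  qed
  ultimately show ?thesis
    using per by metis
qed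

lemma mult_iff:
  assumes "coprime m n"
  shows "c s (m * x) = c s' (m * y) \<longleftrightarrow> c s x = c s' y"
proof
  assume eq: "c s (m * x) = c s' (m * y)"
  obtain q where q: "[m * q = 1] (mod n)"
    using assms coprime_iff_invertible_int by blast
  then have "coprime q n"
    by (metis coprime_iff_invertible_int mult.commute)
  then have "c s (q * (m * x)) = c s' (q * (m * y))"
    using mult eq by blast
  moreover have "n dvd q * (m * z) - z" for z
  proof -
    have "n dvd m * q - 1"
      using q by (simp add: cong_iff_dvd_diff)
    from dvd_mult2[OF this, of z] show ?thesis
      by (simp add: algebra_simps)
  qed
  ultimately show "c s x = c s' y"
    using per by metis
qed (rule mult[OF assms])

end

section \<open>Counting in subgroups and cosets\<close>

lemma cnt_dvd:
  assumes "n > 0" and "a > 0" and "a dvd n"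
  shows "cnt n (\<lambda>z. a dvd z) = nat (n div a)"
proof -
  have "{z \<in> {0..<n}. a dvd z} = (*) a ` {0..<n div a}"
    using assms by (auto simp: image_iff zero_le_mult_iff elim!: dvdE)
  then have "cnt n (\<lambda>z. a dvd z) = card ((*) a ` {0..<n div a})"
    by (simp add: cnt_def)
  also have "\<dots> = nat (n div a)"
    using assms by (subst card_image) (auto simp: inj_on_def)
  finally show ?thesis .
qed

lemma per_dvd: "a dvd n \<Longrightarrow> per n (\<lambda>z. a dvd z - (x::int))"
  unfolding per_def
proof (intro allI impI)
  fix y z assume "a dvd n" and "n dvd y - z"
  then have "a dvd (y - x) - (z - x)"
    using dvd_trans by simp
  then show "a dvd y - x \<longleftrightarrow> a dvd z - x"
    using dvd_diff_commute zdvd_zdiffD by metis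
qed

lemma cnt_coset:
  assumes "n > 0" and "a > 0" and "a dvd n"
  shows "cnt n (\<lambda>z. a dvd z - x) = nat (n div a)"
  using cnt_shift[OF assms(1) per_dvd[OF assms(3)], of x x] cnt_dvd[OF assms] by simp

lemma cnt_dilate:
  assumes "n > 0" and "a > 0" and "a dvd n"
  shows "cnt n (\<lambda>z. a dvd z \<and> P z) = cnt (n div a) (\<lambda>z. P (a * z))"
proof -
  have "{z \<in> {0..<n}. a dvd z \<and> P z} = (*) a ` {z \<in> {0..<n div a}. P (a * z)}"
    using assms by (auto simp: image_iff zero_le_mult_iff elim!: dvdE)
  then have "cnt n (\<lambda>z. a dvd z \<and> P z) = card ((*) a ` {z \<in> {0..<n div a}. P (a * z)})"
    by (simp add: cnt_def)
  also have "\<dots> = cnt (n div a) (\<lambda>z. P (a * z))"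
    using assms unfolding cnt_def by (subst card_image) (auto simp: inj_on_def)
  finally show ?thesis .
qed

lemma cnt_sum:
  assumes "finite I" and "\<And>z. P z \<Longrightarrow> \<exists>!i. i \<in> I \<and> Q i z"
  shows "cnt n P = (\<Sum>i\<in>I. cnt n (\<lambda>z. P z \<and> Q i z))"
proof -
  have "{z \<in> {0..<n}. P z} = (\<Union>i\<in>I. {z \<in> {0..<n}. P z \<and> Q i z})"
    using assms(2) by blast
  also have "card \<dots> = (\<Sum>i\<in>I. card {z \<in> {0..<n}. P z \<and> Q i z})"
    using assms by (intro card_UN_disjoint) auto
  finally show ?thesis
    by (simp add: cnt_def)
qed

lemma cnt_periodic:
  assumes "n > 0" and "a > 0" and "a dvd n" and "per a P"
  shows "cnt n P = nat (n div a) * cnt a P"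
proof -
  have "cnt n P = (\<Sum>i\<in>{0..<a}. cnt n (\<lambda>z. P z \<and> a dvd z - i))"
  proof (rule cnt_sum)
    show "\<exists>!i. i \<in> {0..<a} \<and> a dvd z - i" for z
    proof (rule ex1I)
      show "z mod a \<in> {0..<a} \<and> a dvd z - z mod a"
        using assms(2) by (simp add: minus_mod_eq_mult_div)
      show "i \<in> {0..<a} \<and> a dvd z - i \<Longrightarrow> i = z mod a" for i
        using assms(2) by (metis atLeastLessThan_iff mod_eq_dvd_iff mod_pos_pos_trivial)
    qed
  qed simp
  also have "\<dots> = (\<Sum>i\<in>{0..<a}. if P i then nat (n div a) else 0)"
  proof (intro sum.cong refl)
    fix i
    have "(\<lambda>z. P z \<and> a dvd z - i) = (\<lambda>z. P i \<and> a dvd z - i)"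
      using perD[OF assms(4)] by blast
    then show "cnt n (\<lambda>z. P z \<and> a dvd z - i) = (if P i then nat (n div a) else 0)"
      using cnt_coset[OF assms(1-3)] by (simp add: cnt_def)
  qed
  also have "\<dots> = nat (n div a) * cnt a P"
    by (simp add: sum.If_cases cnt_def Int_def)
  finally show ?thesis .
qed

text \<open>Double counting of the pairs \<open>z\<close>, \<open>w\<close> by their second and by
  their first entry, with \<open>y = z - w\<close>.\<close>

lemma sum_cnt_diff:
  assumes "n > 0" and "per n Q" and "per n B"
  shows "(\<Sum>w | w \<in> {0..<n} \<and> B w. cnt n (\<lambda>z. P z \<and> Q (z - w))) =
    (\<Sum>z | z \<in> {0..<n} \<and> P z. cnt n (\<lambda>y. Q y \<and> B (z - y)))"
proof -
  have "(\<Sum>w | w \<in> {0..<n} \<and> B w. cnt n (\<lambda>z. P z \<and> Q (z - w))) =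
      (\<Sum>w | w \<in> {0..<n} \<and> B w. \<Sum>z | z \<in> {0..<n} \<and> P z. of_bool (Q (z - w)))"
    unfolding cnt_def by (intro sum.cong refl) (simp add: Int_def conj_assoc)
  also have "\<dots> = (\<Sum>z | z \<in> {0..<n} \<and> P z. \<Sum>w | w \<in> {0..<n} \<and> B w. of_bool (Q (z - w)))"
    by (rule sum.swap)
  also have "\<dots> = (\<Sum>z | z \<in> {0..<n} \<and> P z. cnt n (\<lambda>w. B w \<and> Q (z - w)))"
    unfolding cnt_def by (intro sum.cong refl) (simp add: Int_def conj_assoc)
  also have "\<dots> = (\<Sum>z | z \<in> {0..<n} \<and> P z. cnt n (\<lambda>y. Q y \<and> B (z - y)))"
  proof (intro sum.cong refl)
    fix z
    have per: "per n (\<lambda>y. Q y \<and> B (z - y))"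
      unfolding per_def
    proof (intro allI impI)
      fix x y assume xy: "n dvd x - y"
      then have "n dvd (z - x) - (z - y)"
        by (simp add: dvd_diff_commute)
      then show "(Q x \<and> B (z - x)) = (Q y \<and> B (z - y))"
        using perD[OF assms(2) xy] perD[OF assms(3)] by blast
    qed
    then have per': "per n (\<lambda>y. Q (y + z) \<and> B (z - (y + z)))"
      unfolding per_def by (metis add_diff_cancel_right)
    have "cnt n (\<lambda>w. B w \<and> Q (z - w)) = cnt n (\<lambda>w. Q (- w + z) \<and> B (z - (- w + z)))"
      by (simp add: conj_commute)
    also have "\<dots> = cnt n (\<lambda>y. Q y \<and> B (z - y))"
      using cnt_uminus[OF assms(1) per'] cnt_shift[OF assms(1) per, of z] by simp
    finally show "cnt n (\<lambda>w. B w \<and> Q (z - w)) = cnt n (\<lambda>y. Q y \<and> B (z - y))" .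
  qed
  finally show ?thesis .
qed

lemma int_subgroup:
  assumes "n > 0" and "Q (n::int)" and "Q 0" and "\<And>x y. Q x \<Longrightarrow> Q y \<Longrightarrow> Q (x - y)"
  obtains a where "a > 0" and "\<And>x. Q x \<longleftrightarrow> a dvd x"
proof -
  have minus: "Q (- x)" if "Q x" for x
    using assms(4)[OF assms(3) that] by simp
  have add: "Q (x + y)" if "Q x" "Q y" for x y
    using assms(4)[OF that(1) minus[OF that(2)]] by simp
  have mult_nat: "Q (int k * x)" if "Q x" for k x
    by (induction k) (use assms(3) add that in \<open>auto simp: algebra_simps\<close>)
  have mult: "Q (k * x)" if "Q x" for k x
    using mult_nat[OF that, of "nat k"] minus[OF mult_nat[OF that, of "nat (- k)"]] by (cases "k \<ge> 0") auto
  define a where "a = int (LEAST k. k > 0 \<and> Q (int k))"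
  have "nat n > 0 \<and> Q (int (nat n))"
    using assms(1,2) by simp
  from LeastI[of "\<lambda>k. k > 0 \<and> Q (int k)", OF this] have a: "a > 0" "Q a"
    by (auto simp: a_def)
  have "a dvd x" if "Q x" for x
  proof (rule ccontr)
    assume "\<not> a dvd x"
    then have pos: "x mod a > 0"
      using a(1) by (metis dvd_eq_mod_eq_0 order_le_less pos_mod_sign)
    have "Q (x mod a)"
      using assms(4)[OF that mult[OF a(2), of "x div a"]] by (simp add: minus_div_mult_eq_mod)
    then have "nat (x mod a) > 0 \<and> Q (int (nat (x mod a)))"
      using pos by simp
    then have "(LEAST k. k > 0 \<and> Q (int k)) \<le> nat (x mod a)"
      by (rule Least_le)
    then have "a \<le> x mod a"
      using pos unfolding a_def by linarith
    then show False
      using a(1) pos_mod_bound[of a x] by linarith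
  qed
  moreover have "Q x" if "a dvd x" for x
    using mult[OF a(2)] that by (auto simp: mult.commute elim!: dvdE)
  ultimately show ?thesis
    using that a(1) by blast
qed

section \<open>Subgroups that are unions of classes\<close>

context sring
begin

text \<open>A divisor \<open>a\<close> of \<open>n\<close> stands for the subgroup of its multiples, which has index \<open>a\<close> and order
  \<open>n div a\<close>.\<close>

definition asub :: "int \<Rightarrow> bool" where
  "asub a \<longleftrightarrow> a > 0 \<and> a dvd n \<and> (\<forall>s s' x y. c s x = c s' y \<longrightarrow> a dvd x \<longrightarrow> a dvd y)"

lemma asub_pos: "asub a \<Longrightarrow> a > 0" and asub_dvd: "asub a \<Longrightarrow> a dvd n"
  by (auto simp: asub_def)

lemma asub_iff: "asub a \<Longrightarrow> c s x = c s' y \<Longrightarrow> a dvd x \<longleftrightarrow> a dvd y"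
  unfolding asub_def by metis

lemma asub_dvdD: "asub a \<Longrightarrow> c s x = c s' y \<Longrightarrow> a dvd x \<Longrightarrow> a dvd y"
  unfolding asub_def by metis

lemma asubI: "a > 0 \<Longrightarrow> a dvd n \<Longrightarrow> (\<And>s s' x y. c s x = c s' y \<Longrightarrow> a dvd x \<Longrightarrow> a dvd y) \<Longrightarrow> asub a"
  by (auto simp: asub_def)

lemma asub_one: "asub 1"
  by (auto intro: asubI)

lemma asub_lcm: "asub a \<Longrightarrow> asub b \<Longrightarrow> asub (lcm a b)"
proof (rule asubI)
  assume a: "asub a" and b: "asub b"
  show "lcm a b > 0"
    using asub_pos[OF a] asub_pos[OF b] by (simp add: lcm_pos_int)
  show "lcm a b dvd n"
    using asub_dvd[OF a] asub_dvd[OF b] by simp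
  show "lcm a b dvd y" if "c s x = c s' y" "lcm a b dvd x" for s s' x y
    using that asub_iff[OF a that(1)] asub_iff[OF b that(1)] by simp
qed

lemma coset_transfer:
  assumes "asub a" and "c s x = c s' x'" and "a dvd y - x"
  obtains y' where "c s' y' = c s y" and "a dvd y' - x'"
proof -
  obtain y' where y': "c s' y' = c s y" "c s' (y' - x') = c s (y - x)"
    using tri[OF assms(2)] by blast
  then show ?thesis
    using that asub_iff[OF assms(1) y'(2)] assms(3) by blast
qed

text \<open>\<open>gcd a b\<close> stands for the sum of two subgroups. Bezout writes
  \<open>x\<close> as a multiple of \<open>a\<close> plus one of \<open>b\<close>; a coset transfer
  along the second subgroup ends in the first.\<close>

lemma asub_gcd:
  assumes "asub a" and "asub b"
  shows "asub (gcd a b)"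
proof (rule asubI)
  show "gcd a b > 0"
    using asub_pos[OF assms(1)] by (simp add: gcd_pos_int)
  show "gcd a b dvd n"
    using asub_dvd[OF assms(1)] dvd_trans gcd_dvd1 by blast
  fix s s' x y assume eq: "c s x = c s' y" and "gcd a b dvd x"
  then obtain k where k: "x = gcd a b * k" by blast
  obtain u v where "u * a + v * b = gcd a b"
    using bezout_int by blast
  then have "x = (u * k) * a + (v * k) * b"
    unfolding k by (metis distrib_right mult.assoc mult.commute)
  then have "b dvd (u * k) * a - x" "a dvd (u * k) * a"
    by auto
  then obtain y' where "c s' y' = c s (u * k * a)" "b dvd y' - y"
    using coset_transfer[OF assms(2) eq] by blast
  then have "a dvd y'" "b dvd y' - y"
    using asub_iff[OF assms(1), of s' y' s "u * k * a"] by simp_all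
  then have "gcd a b dvd y'" "gcd a b dvd y' - y"
    by (meson dvd_trans gcd_dvd1 gcd_dvd2)+
  from dvd_diff[OF this] show "gcd a b dvd y"
    by simp
qed

text \<open>The two sides could yield different subgroups, but unions of classes of the same colours
  have equal sizes, and a subgroup of a cyclic group is determined by its order.\<close>

lemma subgroup_asub:
  assumes inv: "\<And>s s' x y. c s x = c s' y \<Longrightarrow> Q s x \<Longrightarrow> Q s' y"
    and "\<And>s. Q s 0" and add: "\<And>s x y. Q s x \<Longrightarrow> Q s y \<Longrightarrow> Q s (x + y)"
  obtains a where "asub a" and "\<And>s x. Q s x \<longleftrightarrow> a dvd x"
proof -
  have n: "Q s n" for s
    using inv[of s 0 s n] assms(2) zero[of s n s] by simp
  have mult: "Q s (int k * x)" if "Q s x" for s k x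
    by (induction k) (use assms(2) add that in \<open>auto simp: algebra_simps\<close>)
  have "Q s (x - y)" if "Q s x" "Q s y" for s x y
  proof -
    \<comment> \<open>Closure under subtraction comes from adding \<open>y\<close> another
      \<open>n - 1\<close> times.\<close>
    have "Q s (x + int (nat (n - 1)) * y)"
      using that mult add by blast
    moreover have "c s (x + int (nat (n - 1)) * y) = c s (x - y)"
      using n_pos by (intro per) (simp add: algebra_simps)
    ultimately show ?thesis
      using inv by blast
  qed
  then have "\<exists>a>0. \<forall>x. Q s x \<longleftrightarrow> a dvd x" for s
    using int_subgroup[of n "Q s"] n_pos n assms(2) by metis
  then obtain a where a: "\<And>s. a s > 0" "\<And>s x. Q s x \<longleftrightarrow> a s dvd x"
    by metis
  have dvd: "a s dvd n" for s
    using a n by blast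
  have Q: "\<exists>A. Q = (\<lambda>s x. A (c s x))"
  proof (intro exI ext)
    show "Q s x = (\<exists>s' x'. c s x = c s' x' \<and> Q s' x')" for s x
      using inv by metis
  qed
  have "nat (n div a s) = nat (n div a s')" for s s'
  proof -
    obtain A where A: "Q = (\<lambda>s x. A (c s x))"
      using Q by blast
    have "(\<lambda>x. a t dvd x) = (\<lambda>x. A (c t x))" for t
      using a(2) A by metis
    then show ?thesis
      using class_count[of A s s'] cnt_dvd[OF n_pos a(1) dvd] by metis
  qed
  then have "n div a s = n div a s'" for s s'
    using a(1) n_pos by (metis eq_nat_nat_iff less_imp_le pos_imp_zdiv_nonneg_iff)
  then have "a s = a s'" for s s'
    using dvd n_pos by (metis dvd_div_mult_self mult_cancel_left not_less_iff_gr_or_eq mult_zero_left)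
  then obtain b where b: "a = (\<lambda>_. b)"
    by blast
  have "asub b"
    using a dvd b inv by (intro asubI) auto
  then show ?thesis
    using that a(2) b by blast
qed

inductive gens :: "(nat \<Rightarrow> bool) \<Rightarrow> bool \<Rightarrow> int \<Rightarrow> bool" for A s where
  gens_zero: "n dvd x \<Longrightarrow> gens A s x"
| gens_add: "gens A s x \<Longrightarrow> A (c s t) \<Longrightarrow> gens A s (x + t)"

text \<open>The last summand is peeled off and transported by \<open>tri\<close>; the induction
  hypothesis handles the rest.\<close>

lemma gens_inv: "gens A s x \<Longrightarrow> c s x = c s' y \<Longrightarrow> gens A s' y"
proof (induction arbitrary: y rule: gens.induct)
  case (gens_zero x)
  then show ?case
    using zero[of s x True] zero[of s' y True] by (auto intro: gens.gens_zero)
next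
  case (gens_add x t)
  from tri[OF gens_add.prems, of t] obtain z where z: "c s' z = c s t" "c s' (z - y) = c s (t - (x + t))"
    by blast
  then have "c s x = c s' (y - z)"
    using neg[OF z(2)] by simp
  then have "gens A s' (y - z + z)"
    using gens_add z by (intro gens.gens_add) auto
  then show ?case by simp
qed

lemma gens_sum: "gens A s y \<Longrightarrow> gens A s x \<Longrightarrow> gens A s (x + y)"
proof (induction rule: gens.induct)
  case (gens_zero y)
  then show ?case
    using gens_inv per by (metis add_diff_cancel_left')
next
  case (gens_add y t)
  then show ?case
    using gens.gens_add[of A s "x + y" t] by (simp add: add.assoc)
qed

text \<open>The subgroup generated by a union of classes. Minimality is stated for each single side,
  so that later arguments inspect elements on one side only.\<close>

lemma asub_gen:
  obtains a where "asub a" and "\<And>s x. A (c s x) \<Longrightarrow> a dvd x"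
    and "\<And>s b. b dvd n \<Longrightarrow> (\<And>x. A (c s x) \<Longrightarrow> b dvd x) \<Longrightarrow> b dvd a"
proof -
  obtain a where a: "asub a" "\<And>s x. gens A s x \<longleftrightarrow> a dvd x"
  proof (rule subgroup_asub[of "gens A", OF _ _ _ that])
    show "gens A s' y" if "c s x = c s' y" "gens A s x" for s s' x y
      using gens_inv that by blast
    show "gens A s 0" for s
      by (rule gens_zero) simp
    show "gens A s (x + y)" if "gens A s x" "gens A s y" for s x y
      using gens_sum that by blast
  qed
  have "a dvd x" if "A (c s x)" for s x
    using gens_add[OF gens_zero[of 0], of A s x] that a(2) by simp
  moreover have "b dvd a" if "b dvd n" "\<And>x. A (c s x) \<Longrightarrow> b dvd x" for s b
  proof -
    have "gens A s x \<Longrightarrow> b dvd x" for x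
      by (induction rule: gens.induct) (use that dvd_trans in auto)
    then show ?thesis
      using a(2)[of s a] by simp
  qed
  ultimately show ?thesis
    using that a(1) by blast
qed

text \<open>The radical of a class, that is its stabiliser under translation. Stability under
  \<open>x\<close> is the vanishing of a count that depends only on the colour of
  \<open>x\<close>.\<close>

lemma asub_rad:
  obtains r where "asub r" and "\<And>s x. (\<forall>z. c s z = \<gamma> \<longrightarrow> c s (z - x) = \<gamma>) \<longleftrightarrow> r dvd x"
proof -
  define Q where "Q s x \<longleftrightarrow> (\<forall>z. c s z = \<gamma> \<longrightarrow> c s (z - x) = \<gamma>)" for s x
  have iff: "Q s x \<longleftrightarrow> cnt n (\<lambda>z. c s z = \<gamma> \<and> c s (z - x) \<noteq> \<gamma>) = 0" for s x
    using cnt_pos[OF n_pos per_count[of "\<lambda>\<alpha>. \<alpha> = \<gamma>" s "\<lambda>\<alpha>. \<alpha> \<noteq> \<gamma>" x]] by (auto simp: Q_def)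
  obtain r where "asub r" "\<And>s x. Q s x \<longleftrightarrow> r dvd x"
  proof (rule subgroup_asub[of Q, OF _ _ _ that])
    show "Q s' y" if "c s x = c s' y" "Q s x" for s s' x y
      using that count_inv[OF that(1), of "\<lambda>\<alpha>. \<alpha> = \<gamma>" "\<lambda>\<alpha>. \<alpha> \<noteq> \<gamma>"] unfolding iff by simp
    show "Q s 0" for s
      by (simp add: Q_def)
    show "Q s (x + y)" if "Q s x" "Q s y" for s x y
      using that unfolding Q_def by (metis diff_diff_eq)
  qed
  then show ?thesis
    using that unfolding Q_def by blast
qed

lemma coset_count:
  assumes "asub a" and "c s x = c s' x'"
  shows "cnt n (\<lambda>z. A (c s z) \<and> a dvd z - x) = cnt n (\<lambda>z. A (c s' z) \<and> a dvd z - x')"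
proof -
  let ?B = "\<lambda>\<beta>. \<exists>s w. \<beta> = c s w \<and> a dvd w"
  have "?B (c s w) \<longleftrightarrow> a dvd w" for s w
    using asub_iff[OF assms(1)] by blast
  then show ?thesis
    using count_inv[OF assms(2), of A ?B] by simp
qed

lemma per_coset:
  assumes "a dvd n"
  shows "per n (\<lambda>z. A (c s z) \<and> a dvd z - x)"
  unfolding per_def
proof (intro allI impI)
  fix y z assume "n dvd y - z"
  then show "(A (c s y) \<and> a dvd y - x) = (A (c s z) \<and> a dvd z - x)"
    using per[of y z s] perD[OF per_dvd[OF assms], of y z x] by simp
qed

end

section \<open>Restriction to subgroups and passage to quotients\<close>

lemma div_dvd_self: "d dvd n \<Longrightarrow> n div d dvd (n::int)"
  by (metis dvd_mult_div_cancel dvd_triv_right)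

context sring
begin

lemma sub_sring:
  assumes "asub a"
  shows "sring (n div a) (\<lambda>s x. c s (a * x))"
proof
  have a: "a > 0" "a dvd n" "a * (n div a) = n"
    using asub_pos[OF assms] asub_dvd[OF assms] by auto
  have dvd_iff: "n dvd a * x \<longleftrightarrow> n div a dvd x" for x
    using a by (metis dvd_times_left_cancel_iff less_irrefl)
  show "n div a > 0"
    using a n_pos by (metis zero_less_mult_pos)
  show "c s (a * x) = c s (a * y)" if "n div a dvd x - y" for x y s
    using that by (intro per) (simp add: dvd_iff right_diff_distrib[symmetric])
  show "c s (a * x) = c s' (a * 0) \<longleftrightarrow> n div a dvd x" for s s' x
    using zero dvd_iff by simp
  show "\<exists>x'. c s' (a * x') = c s (a * x)" for s s' x
  proof -
    obtain y where y: "c s' y = c s (a * x)"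
      using onto by blast
    moreover have "a dvd y"
      by (rule asub_dvdD[OF assms y[symmetric]]) simp
    ultimately show ?thesis
      by (metis dvd_def)
  qed
  show "c s (a * - x) = c s' (a * - x')" if "c s (a * x) = c s' (a * x')" for s s' x x'
    using neg[OF that] by simp
  show "cnt (n div a) (\<lambda>z. c s (a * z) = \<alpha> \<and> c s (a * (z - x)) = \<beta>) =
      cnt (n div a) (\<lambda>z. c s' (a * z) = \<alpha> \<and> c s' (a * (z - x')) = \<beta>)"
    if "c s (a * x) = c s' (a * x')" for s x s' x' \<alpha> \<beta>
  proof -
    \<comment> \<open>Lying in the subgroup is a property of the colour, so it can be imposed on
      \<open>z\<close> inside an invariant count.\<close>
    let ?A = "\<lambda>\<gamma>. \<gamma> = \<alpha> \<and> (\<exists>s w. \<gamma> = c s w \<and> a dvd w)"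
    have A: "?A (c s w) \<longleftrightarrow> c s w = \<alpha> \<and> a dvd w" for s w
      using asub_iff[OF assms] by blast
    have "cnt n (\<lambda>z. (c s z = \<alpha> \<and> a dvd z) \<and> c s (z - a * x) = \<beta>) =
        cnt n (\<lambda>z. (c s' z = \<alpha> \<and> a dvd z) \<and> c s' (z - a * x') = \<beta>)"
      using count_inv[OF that, of ?A "\<lambda>\<gamma>. \<gamma> = \<beta>"] unfolding A .
    then have "cnt n (\<lambda>z. a dvd z \<and> c s z = \<alpha> \<and> c s (z - a * x) = \<beta>) =
        cnt n (\<lambda>z. a dvd z \<and> c s' z = \<alpha> \<and> c s' (z - a * x') = \<beta>)"
      by (simp add: conj_ac)
    then show ?thesis
      unfolding cnt_dilate[OF n_pos a(1,2)] by (simp add: right_diff_distrib)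
  qed
qed

text \<open>The least colour in a coset serves as the colour of the coset, so that quotients are
  coloured by natural numbers again.\<close>

definition qcol :: "int \<Rightarrow> bool \<Rightarrow> int \<Rightarrow> nat" where
  "qcol a s x = Min (c s ` {y. a dvd y - x})"

lemma coset_colours_eq:
  assumes "asub a" and "c s x = c s' x'"
  shows "c s ` {y. a dvd y - x} = c s' ` {y. a dvd y - x'}"
proof -
  have "c s ` {y. a dvd y - x} \<subseteq> c s' ` {y. a dvd y - x'}" if "c s x = c s' x'" for s x s' x'
  proof clarify
    fix y assume "a dvd y - x"
    from coset_transfer[OF assms(1) that this] obtain y' where "c s' y' = c s y" "a dvd y' - x'"
      by blast
    then show "c s y \<in> c s' ` {y. a dvd y - x'}"
      by (metis (mono_tags, lifting) image_eqI mem_Collect_eq)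
  qed
  from this[OF assms(2)] this[OF assms(2)[symmetric]] show ?thesis
    by blast
qed

lemma coset_shift: "a dvd x - x' \<Longrightarrow> {y::int. a dvd y - x} = {y. a dvd y - x'}"
proof -
  assume "a dvd x - x'"
  then have "a dvd (y - x) + (x - x') \<longleftrightarrow> a dvd y - x" for y
    by (rule dvd_add_left_iff)
  then show ?thesis
    by simp
qed

lemma qcol_in: "\<exists>y. a dvd y - x \<and> qcol a s x = c s y"
proof -
  have "finite (c s ` {y. a dvd y - x})"
    by (rule finite_subset[OF _ finite_range_c[of s]]) auto
  moreover have "c s ` {y. a dvd y - x} \<noteq> {}"
    by (auto intro: exI[of _ x])
  ultimately have "qcol a s x \<in> c s ` {y. a dvd y - x}"
    unfolding qcol_def by (rule Min_in)
  then show ?thesis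
    by auto
qed

lemma qcol_per: "a dvd x - x' \<Longrightarrow> qcol a s x = qcol a s x'"
  unfolding qcol_def by (simp add: coset_shift)

lemma qcol_cong: "asub a \<Longrightarrow> c s x = c s' x' \<Longrightarrow> qcol a s x = qcol a s' x'"
  unfolding qcol_def by (rule arg_cong[where f = Min]) (rule coset_colours_eq)

text \<open>The common least colour is attained in both cosets; from there a coset transfer reaches
  the colour of \<open>x\<close>.\<close>

lemma qcol_eqD:
  assumes "asub a" and "qcol a s x = qcol a s' x'"
  obtains y where "a dvd y - x'" and "c s' y = c s x"
proof -
  obtain u where u: "a dvd u - x" "qcol a s x = c s u"
    using qcol_in by blast
  obtain v where v: "a dvd v - x'" "qcol a s' x' = c s' v"
    using qcol_in by blast
  have "c s u = c s' v"
    using u v assms(2) by simp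
  moreover have "a dvd x - u"
    using u(1) by (simp add: dvd_diff_commute)
  ultimately obtain y where y: "c s' y = c s x" "a dvd y - v"
    using coset_transfer[OF assms(1)] by blast
  moreover have "a dvd (y - v) + (v - x')"
    using y v by (intro dvd_add)
  ultimately show ?thesis
    using that by simp
qed

lemma quot_sring:
  assumes "asub a"
  shows "sring a (qcol a)"
proof
  show a: "a > 0"
    by (rule asub_pos[OF assms])
  show "qcol a s x = qcol a s y" if "a dvd x - y" for x y s
    by (rule qcol_per[OF that])
  show "qcol a s x = qcol a s' 0 \<longleftrightarrow> a dvd x" for s s' x
  proof
    assume "qcol a s x = qcol a s' 0"
    then obtain y where y: "a dvd y - 0" "c s' y = c s x"
      by (rule qcol_eqD[OF assms])
    then show "a dvd x"
      using asub_dvdD[OF assms y(2)] by simp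
  next
    assume "a dvd x"
    then have "qcol a s x = qcol a s 0"
      by (intro qcol_per) simp
    also have "\<dots> = qcol a s' 0"
      using zero by (intro qcol_cong[OF assms]) simp
    finally show "qcol a s x = qcol a s' 0" .
  qed
  show "\<exists>x'. qcol a s' x' = qcol a s x" for s s' x
    using onto qcol_cong[OF assms] by metis
  show "qcol a s (- x) = qcol a s' (- x')" if eq: "qcol a s x = qcol a s' x'" for s x s' x'
  proof -
    obtain y where y: "a dvd y - x'" "c s' y = c s x"
      by (rule qcol_eqD[OF assms eq])
    have "qcol a s (- x) = qcol a s' (- y)"
      by (intro qcol_cong[OF assms] neg) (simp add: y)
    also have "\<dots> = qcol a s' (- x')"
      using y(1) by (intro qcol_per) (simp add: dvd_diff_commute)
    finally show ?thesis .
  qed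
  show "cnt a (\<lambda>z. qcol a s z = \<alpha> \<and> qcol a s (z - x) = \<beta>) =
      cnt a (\<lambda>z. qcol a s' z = \<alpha> \<and> qcol a s' (z - x') = \<beta>)"
    if eq: "qcol a s x = qcol a s' x'" for s x s' x' \<alpha> \<beta>
  proof -
    obtain y where y: "a dvd y - x'" "c s' y = c s x"
      by (rule qcol_eqD[OF assms eq])
    let ?A = "\<lambda>\<alpha> \<gamma>. \<exists>s w. \<gamma> = c s w \<and> qcol a s w = \<alpha>"
    have A: "?A \<alpha> (c s w) \<longleftrightarrow> qcol a s w = \<alpha>" for s w \<alpha>
      using qcol_cong[OF assms] by metis
    have "cnt n (\<lambda>z. qcol a s z = \<alpha> \<and> qcol a s (z - x) = \<beta>) =
        cnt n (\<lambda>z. qcol a s' z = \<alpha> \<and> qcol a s' (z - y) = \<beta>)"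
      using count_inv[OF y(2)[symmetric], of "?A \<alpha>" "?A \<beta>"] unfolding A .
    moreover have "qcol a s' (z - y) = qcol a s' (z - x')" for z
      using y(1) by (intro qcol_per) (simp add: dvd_diff_commute)
    moreover have "per a (\<lambda>z. qcol a s z = \<alpha> \<and> qcol a s (z - x) = \<beta>)" for s x
      unfolding per_def
    proof (intro allI impI)
      fix u v assume "a dvd u - v"
      then show "(qcol a s u = \<alpha> \<and> qcol a s (u - x) = \<beta>) = (qcol a s v = \<alpha> \<and> qcol a s (v - x) = \<beta>)"
        using qcol_per[of a u v s] qcol_per[of a "u - x" "v - x" s] by simp
    qed
    \<comment> \<open>Counting residues modulo \<open>n\<close> multiplies the counts modulo
      \<open>a\<close> by the positive factor \<open>n div a\<close>, which cancels.\<close>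
    note cnt_periodic[OF n_pos a asub_dvd[OF assms] this]
    moreover have "nat (n div a) > 0"
      using a n_pos asub_dvd[OF assms] by (auto elim!: dvdE simp: zero_less_mult_iff)
    ultimately show ?thesis
      by simp
  qed
qed

text \<open>Schur's theorem: the residues hit by multiplication by \<open>p\<close> with multiplicity not divisible
  by \<open>p\<close> form a union of classes.\<close>

definition powset :: "nat \<Rightarrow> bool \<Rightarrow> nat \<Rightarrow> int \<Rightarrow> bool" where
  "powset p s \<gamma> y \<longleftrightarrow> \<not> p dvd cnt n (\<lambda>t. c s t = \<gamma> \<and> n dvd int p * t - y)"

text \<open>The multiples of \<open>n div p\<close> form the subgroup of order \<open>p\<close>, so
  this is the part of the class in one fibre of multiplication by \<open>p\<close>.\<close>

definition fib :: "nat \<Rightarrow> bool \<Rightarrow> nat \<Rightarrow> int \<Rightarrow> nat" where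
  "fib p s \<gamma> x = cnt n (\<lambda>t. c s t = \<gamma> \<and> n div int p dvd t - x)"

lemma powset_inv:
  assumes "prime p" and "c s y = c s' y'"
  shows "powset p s \<gamma> y \<longleftrightarrow> powset p s' \<gamma> y'"
  using power_count[OF assms, of \<gamma>] unfolding powset_def by (simp add: cong_dvd_iff)

lemma powset_fib:
  assumes "p > 0" and "int p dvd n"
  shows "powset p s \<gamma> (int p * x) \<longleftrightarrow> \<not> p dvd fib p s \<gamma> x"
proof -
  have "n dvd int p * t - int p * x \<longleftrightarrow> n div int p dvd t - x" for t
    using assms by (metis dvd_mult_div_cancel dvd_times_left_cancel_iff of_nat_0_less_iff order_less_irrefl right_diff_distrib)
  then show ?thesis
    by (simp add: powset_def fib_def)
qed

lemma powsetD:
  assumes "powset p s \<gamma> y"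
  obtains t where "c s t = \<gamma>" and "n dvd int p * t - y"
proof -
  have "{t \<in> {0..<n}. c s t = \<gamma> \<and> n dvd int p * t - y} \<noteq> {}"
    using assms unfolding powset_def cnt_def by (metis card.empty dvd_0_right)
  then show ?thesis
    using that by auto
qed

lemma fib_le: "p > 0 \<Longrightarrow> int p dvd n \<Longrightarrow> fib p s \<gamma> x \<le> p"
proof -
  assume p: "p > 0" "int p dvd n"
  then obtain q where q: "n = int p * q"
    by blast
  then have "q > 0"
    using n_pos p by (simp add: zero_less_mult_iff)
  then have "cnt n (\<lambda>t. n div int p dvd t - x) = p"
    using p q cnt_coset[OF n_pos, of "n div int p" x] by simp
  then show ?thesis
    unfolding fib_def by (metis (no_types, lifting) cnt_mono)
qed

lemma fib_pos:
  assumes "int p dvd n"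
  shows "fib p s (c s x) x > 0"
proof -
  have "n div int p dvd n"
    using assms by (rule div_dvd_self)
  from per_coset[OF this, of "\<lambda>\<alpha>. \<alpha> = c s x" s x] cnt_pos[OF n_pos] show ?thesis
    unfolding fib_def by fastforce
qed

lemma fib_full:
  assumes "p > 0" and "int p dvd n" and "p \<le> fib p s \<gamma> x" and "n div int p dvd z - x"
  shows "c s z = \<gamma>"
proof (rule ccontr)
  assume neq: "c s z \<noteq> \<gamma>"
  obtain q where q: "n = int p * q"
    using assms(2) by blast
  then have q0: "q > 0"
    using n_pos assms(1) by (simp add: zero_less_mult_iff)
  have "per n (\<lambda>t. c s t \<noteq> \<gamma> \<and> q dvd t - x)"
    using per_coset[of q "\<lambda>\<alpha>. \<alpha> \<noteq> \<gamma>" s x] q by simp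
  then have "cnt n (\<lambda>t. c s t \<noteq> \<gamma> \<and> q dvd t - x) > 0"
    using cnt_pos[OF n_pos] neq assms(1,4) q by auto
  moreover have "cnt n (\<lambda>t. q dvd t - x) = p"
    using assms(1) q q0 cnt_coset[OF n_pos, of q x] by simp
  moreover have "cnt n (\<lambda>t. q dvd t - x) = cnt n (\<lambda>t. c s t = \<gamma> \<and> q dvd t - x) + cnt n (\<lambda>t. c s t \<noteq> \<gamma> \<and> q dvd t - x)"
    using cnt_split[of n "\<lambda>t. q dvd t - x" "\<lambda>t. c s t = \<gamma>"] by (simp add: conj_commute)
  ultimately show False
    using assms(1,3) q unfolding fib_def by simp
qed


section \<open>Primitive Schur rings of composite order\<close>

text \<open>Suppose a class has at most half of the nonzero elements. Outside the subgroup of order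
  \<open>p\<close> it consists of full cosets, \<open>\<mu>\<close> points in all, so every nonzero
  difference occurs at least \<open>\<mu>\<close> times; the class has too few pairs for
  that.\<close>

lemma primitive_class_size:
  assumes prim: "\<And>a. asub a \<Longrightarrow> a = 1 \<or> a = n" and n: "n > 1" "\<not> prime n"
    and x: "\<not> n dvd x"
  shows "2 * int (cnt n (\<lambda>z. c s z = c s x)) > n - 1"
proof (rule ccontr)
  define \<gamma> where "\<gamma> = c s x"
  assume "\<not> ?thesis"
  then have small: "2 * int (cnt n (\<lambda>z. c s z = \<gamma>)) \<le> n - 1"
    by (simp add: \<gamma>_def)
  have nz: "\<not> n dvd z" if "c s z = \<gamma>" for z
    using that x zero[of s z s] zero[of s x s] by (simp add: \<gamma>_def)
  have "nat n \<noteq> 1"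
    using n by simp
  then obtain p where p: "prime p" "p dvd nat n"
    using prime_factor_nat by blast
  have p0: "p > 0"
    using p(1) by (rule prime_gt_0_nat)
  have pn: "int p dvd n"
    using p(2) n_pos by (metis int_dvd_int_iff int_nat_eq less_imp_le)
  define q where "q = n div int p"
  have npq: "n = int p * q"
    using pn by (simp add: q_def)
  have q: "q > 0" "q dvd n"
    using npq n_pos p0 by (auto simp: zero_less_mult_iff)
  have q1: "q \<noteq> 1"
    using npq n(2) p(1) by auto
  have qn: "q \<noteq> n"
    using npq n_pos prime_gt_1_nat[OF p(1)] by auto
  have qp: "q dvd z \<longleftrightarrow> n dvd int p * z" for z
    using npq p0 by simp
  text \<open>Outside the subgroup of order \<open>p\<close>, the class is a union of cosets of that subgroup.\<close>
  have coset: "c s z = c s y" if "\<not> q dvd y" "q dvd z - y" for y z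
  proof -
    define \<gamma> where "\<gamma> = c s y"
    define A where "A \<delta> \<longleftrightarrow> (\<exists>s y. c s y = \<delta> \<and> powset p s \<gamma> y)" for \<delta>
    have A: "A (c s y) \<longleftrightarrow> powset p s \<gamma> y" for s y
      using powset_inv[OF p(1)] unfolding A_def by blast
    obtain a where a: "asub a" "\<And>s x. A (c s x) \<Longrightarrow> a dvd x"
        "\<And>s b. b dvd n \<Longrightarrow> (\<And>x. A (c s x) \<Longrightarrow> b dvd x) \<Longrightarrow> b dvd a"
      using asub_gen[of A] by blast
    \<comment> \<open>Points of \<open>powset\<close> are multiples of \<open>p\<close>, so they
      generate a proper subgroup, trivial by primitivity. Hence fibres off the subgroup of order
      \<open>p\<close> have size divisible by \<open>p\<close>: they are empty or full.\<close>
    have "int p dvd x" if "A (c s x)" for s x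
    proof -
      from that have "powset p s \<gamma> x"
        by (simp add: A)
      then obtain t where "n dvd int p * t - x"
        by (rule powsetD)
      then have "int p dvd int p * t - x"
        using pn dvd_trans by blast
      then show ?thesis
        using zdvd_zdiffD dvd_triv_left by (metis dvd_diff_commute)
    qed
    then have "int p dvd a"
      using a(3) pn by blast
    then have "a \<noteq> 1"
      using p(1) by auto
    then have "a = n"
      using prim a(1) by blast
    moreover have "\<not> n dvd int p * y"
      using that(1) qp by blast
    ultimately have "\<not> powset p s \<gamma> (int p * y)"
      using a(2)[of s "int p * y"] A by blast
    then have "p dvd fib p s \<gamma> y"
      using powset_fib[OF p0 pn] by blast
    then have "p \<le> fib p s \<gamma> y"
      using fib_pos[OF pn, of s y] by (intro dvd_imp_le) (simp_all add: \<gamma>_def)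
    then show ?thesis
      using fib_full[OF p0 pn, of s \<gamma> y z] that(2) unfolding q_def \<gamma>_def by blast
  qed
  text \<open>Every nonzero class meets the subgroup of order \<open>p\<close>.\<close>
  have meets: "\<exists>u. q dvd u \<and> c s u = c s w" if w: "\<not> n dvd w" for w
  proof (rule ccontr)
    assume "\<not> ?thesis"
    then have "c s (z - q) = c s w" if "c s z = c s w" for z
      using coset[of z "z - q"] that by auto
    then have inv: "\<forall>z. c s z = c s w \<longrightarrow> c s (z - q) = c s w"
      by blast
    obtain r where r: "asub r"
        "\<And>s' x. (\<forall>z. c s' z = c s w \<longrightarrow> c s' (z - x) = c s w) \<longleftrightarrow> r dvd x"
      by (rule asub_rad[of "c s w", OF that])
    have "r dvd q"
      using r(2)[of s q] inv by blast
    moreover have "r \<noteq> 1"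
    proof
      assume "r = 1"
      then have "c s (w - w) = c s w"
        using iffD2[OF r(2)[of s w]] by (metis one_dvd)
      then show False
        using w zero[of s w s] by simp
    qed
    then have "r = n"
      using prim r(1) by blast
    ultimately show False
      using q qn zdvd_imp_le[of n q] zdvd_imp_le[of q n] n_pos by simp
  qed
  let ?T = "\<lambda>z. c s z = \<gamma>"
  obtain x0 where x0: "?T x0" "\<not> q dvd x0"
  proof (rule ccontr)
    assume "\<not> thesis"
    then have all: "q dvd z" if "?T z" for z
      using that \<open>\<And>x0. ?T x0 \<Longrightarrow> \<not> q dvd x0 \<Longrightarrow> thesis\<close> by blast
    obtain a where a: "asub a" "\<And>s x. c s x = \<gamma> \<Longrightarrow> a dvd x"
        "\<And>s b. b dvd n \<Longrightarrow> (\<And>x. c s x = \<gamma> \<Longrightarrow> b dvd x) \<Longrightarrow> b dvd a"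
      using asub_gen[of "\<lambda>\<delta>. \<delta> = \<gamma>"] by blast
    have "q dvd a"
      using a(3) q(2) all by blast
    then have "a \<noteq> 1"
      using q(1) q1 by auto
    then have "a = n"
      using prim a(1) by blast
    then show False
      using a(2)[of s x] x by (simp add: \<gamma>_def)
  qed
  define s0 \<mu> where "s0 = cnt n (\<lambda>z. ?T z \<and> q dvd z)" and "\<mu> = cnt n (\<lambda>z. ?T z \<and> \<not> q dvd z)"
  have card_T: "cnt n ?T = s0 + \<mu>"
    unfolding s0_def \<mu>_def by (rule cnt_split)
  have card_P: "cnt n (\<lambda>z. q dvd z - y) = p" for y
    using cnt_coset[OF n_pos q] npq q by simp
  have "s0 < p"
  proof -
    have "p = cnt n (\<lambda>z. q dvd z \<and> ?T z) + cnt n (\<lambda>z. q dvd z \<and> \<not> ?T z)"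
      using card_P[of 0] cnt_split[of n "\<lambda>z. q dvd z" ?T] by simp
    moreover have "cnt n (\<lambda>z. \<not> ?T z \<and> q dvd z - 0) > 0"
      using cnt_pos[OF n_pos per_coset[OF q(2), of "\<lambda>\<alpha>. \<alpha> \<noteq> \<gamma>" s 0]] nz by fastforce
    ultimately show ?thesis
      by (simp add: s0_def conj_commute)
  qed
  have "p \<le> \<mu>"
  proof -
    have "p = cnt n (\<lambda>z. q dvd z - x0)"
      by (simp add: card_P)
    also have "\<dots> \<le> \<mu>"
      unfolding \<mu>_def
    proof (rule cnt_mono)
      show "?T z \<and> \<not> q dvd z" if "q dvd z - x0" for z
        using coset[OF x0(2) that] x0 that zdvd_zdiffD[of q x0 z] by (metis dvd_diff_commute)
    qed
    finally show ?thesis .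
  qed
  define \<kappa> where "\<kappa> w = cnt n (\<lambda>z. ?T z \<and> ?T (z - w))" for w
  \<comment> \<open>Translation by an element of the subgroup of order \<open>p\<close> keeps the
    outer part of the class inside the class, and by \<open>meets\<close> every nonzero
    \<open>w\<close> shares its colour with such an element.\<close>
  have \<kappa>: "\<mu> \<le> \<kappa> w" if w: "\<not> n dvd w" for w
  proof -
    obtain u where u: "q dvd u" "c s u = c s w"
      using meets[OF w] by blast
    have "\<mu> \<le> \<kappa> u"
      unfolding \<mu>_def \<kappa>_def
    proof (rule cnt_mono)
      show "?T z \<and> ?T (z - u)" if "?T z \<and> \<not> q dvd z" for z
        using that coset[of z "z - u"] u(1) by simp
    qed
    also have "\<kappa> u = \<kappa> w"
      unfolding \<kappa>_def using count_inv[OF u(2), of "\<lambda>\<alpha>. \<alpha> = \<gamma>" "\<lambda>\<alpha>. \<alpha> = \<gamma>"] .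
    finally show ?thesis .
  qed
  have "(\<Sum>w\<in>{0..<n}. \<kappa> w) = cnt n ?T * cnt n ?T"
  proof -
    have "(\<Sum>w | w \<in> {0..<n} \<and> True. \<kappa> w) = (\<Sum>z | z \<in> {0..<n} \<and> ?T z. cnt n (\<lambda>y. ?T y \<and> True))"
      unfolding \<kappa>_def
      by (rule sum_cnt_diff[OF n_pos per_c[of "\<lambda>\<alpha>. \<alpha> = \<gamma>" s]]) (simp add: per_def)
    also have "\<dots> = card {z \<in> {0..<n}. ?T z} * cnt n ?T"
      by (simp only: sum_constant of_nat_id simp_thms)
    also have "{w. w \<in> {0..<n} \<and> True} = {0..<n}"
      by auto
    finally show ?thesis
      by (simp add: cnt_def)
  qed
  moreover have "{0..<n} = insert 0 {1..<n}"
    using n_pos by auto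
  ultimately have "\<kappa> 0 + (\<Sum>w\<in>{1..<n}. \<kappa> w) = cnt n ?T * cnt n ?T"
    by simp
  moreover have "(\<Sum>w\<in>{1..<n}. \<mu>) \<le> (\<Sum>w\<in>{1..<n}. \<kappa> w)"
    by (intro sum_mono \<kappa>) (auto dest: zdvd_imp_le)
  \<comment> \<open>The term at \<open>w = 0\<close> is the class size; the other
    \<open>n - 1\<close> terms are at least \<open>\<mu>\<close>.\<close>
  ultimately have "s0 + \<mu> + nat (n - 1) * \<mu> \<le> (s0 + \<mu>) * (s0 + \<mu>)"
    by (simp add: card_T[symmetric]) (simp add: \<kappa>_def)
  moreover have "2 * (s0 + \<mu>) * \<mu> \<le> nat (n - 1) * \<mu>"
    using small by (intro mult_right_mono) (simp_all add: card_T)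
  ultimately have "(s0 + \<mu>) * (1 + 2 * \<mu>) \<le> (s0 + \<mu>) * (s0 + \<mu>)"
    by (simp add: algebra_simps)
  then have "1 + 2 * \<mu> \<le> s0 + \<mu>"
    using \<open>p \<le> \<mu>\<close> p0 unfolding mult_le_cancel1 by linarith
  then show False
    using \<open>p \<le> \<mu>\<close> \<open>s0 < p\<close> by simp
qed

text \<open>Two distinct classes cannot both contain more than half of the nonzero elements.\<close>

lemma primitive_monochromatic:
  assumes prim: "\<And>a. asub a \<Longrightarrow> a = 1 \<or> a = n" and n: "n > 1" "\<not> prime n"
    and x: "\<not> n dvd x" and y: "\<not> n dvd y"
  shows "c s x = c s' y"
proof -
  have eq: "c s x = c s y" if "\<not> n dvd x" "\<not> n dvd y" for x y
  proof (rule ccontr)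
    assume neq: "c s x \<noteq> c s y"
    have "cnt n (\<lambda>z. c s z = c s x) + cnt n (\<lambda>z. c s z = c s y) = cnt n (\<lambda>z. c s z = c s x \<or> c s z = c s y)"
      using neq by (intro cnt_add[symmetric]) auto
    also have "\<dots> \<le> cnt n (\<lambda>z. \<not> n dvd z)"
    proof (rule cnt_mono)
      show "\<not> n dvd z" if "c s z = c s x \<or> c s z = c s y" for z
        using that \<open>\<not> n dvd x\<close> \<open>\<not> n dvd y\<close> zero[of s z s] zero[of s x s] zero[of s y s] by auto
    qed
    also have "int \<dots> = n - 1"
    proof -
      have "cnt n (\<lambda>z. True) = nat n"
        using cnt_coset[OF n_pos, of 1 0] by simp
      then show ?thesis
        using cnt_split[of n "\<lambda>z. True" "\<lambda>z. n dvd z"] cnt_single[OF n_pos, of 0] n_pos by simp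
    qed
    finally show False
      using primitive_class_size[OF prim n that(1), of s] primitive_class_size[OF prim n that(2), of s] by linarith
  qed
  obtain z where z: "c s z = c s' y"
    using onto by blast
  then have "\<not> n dvd z"
    using y zero[of s z s] zero[of s' y s] by simp
  then show ?thesis
    using eq[OF x] z by simp
qed

text \<open>Minimality makes the Schur ring induced on the subgroup primitive.\<close>

lemma minimal_monochromatic:
  assumes "asub a" and "a \<noteq> n" and min: "\<And>b. asub b \<Longrightarrow> a dvd b \<Longrightarrow> b = a \<or> b = n"
    and "\<not> prime (n div a)" and x: "a dvd x" "\<not> n dvd x" and y: "a dvd y" "\<not> n dvd y"
  shows "c s x = c s' y"
proof -
  interpret S: sring "n div a" "\<lambda>s x. c s (a * x)"
    by (rule sub_sring[OF assms(1)])
  have a: "a > 0" "a dvd n" "a * (n div a) = n"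
    using asub_pos[OF assms(1)] asub_dvd[OF assms(1)] by auto
  have dvd_iff: "n dvd a * x \<longleftrightarrow> n div a dvd x" for x
    using a by (metis dvd_times_left_cancel_iff less_irrefl)
  have "b = 1 \<or> b = n div a" if "S.asub b" for b
  proof -
    have "asub (a * b)"
    proof (rule asubI)
      show "a * b > 0"
        using S.asub_pos[OF that] a by simp
      show "a * b dvd n"
        using S.asub_dvd[OF that] a by (metis dvd_refl mult_dvd_mono)
      show "a * b dvd y" if eq: "c s x = c s' y" and x: "a * b dvd x" for s s' x y
      proof -
        have "a dvd x"
          using x dvd_mult_left by blast
        moreover from this have "a dvd y"
          using asub_dvdD[OF assms(1) eq] by blast
        ultimately obtain x' y' where xy: "x = a * x'" "y = a * y'"
          by (meson dvdE)
        then have "b dvd x'"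
          using x a(1) by simp
        then have "b dvd y'"
          using S.asub_dvdD[OF \<open>S.asub b\<close>] eq xy by blast
        then show ?thesis
          using xy by simp
      qed
    qed
    from min[OF this] have "a * b = a * 1 \<or> a * b = a * (n div a)"
      using a(3) by simp
    then show ?thesis
      using a(1) unfolding mult_cancel_left by simp
  qed
  moreover have "n div a > 1"
    using a assms(2) S.n_pos by (metis mult.right_neutral less_le zless_imp_add1_zle add_0)
  moreover obtain x' y' where xy: "x = a * x'" "y = a * y'"
    using x y by (meson dvdE)
  moreover from this have "\<not> n div a dvd x'" "\<not> n div a dvd y'"
    using x y dvd_iff by auto
  ultimately show ?thesis
    using S.primitive_monochromatic[of x' y' s s'] assms(4) by simp
qed

end

section \<open>Classes and minimal subgroups\<close>

lemma cnt_one_unique: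
  assumes "n > 0" and "per n P" and "cnt n P = 1" and "P x" and "P y"
  shows "n dvd x - y"
proof -
  obtain z where z: "{z \<in> {0..<n}. P z} = {z}"
    using assms(3) unfolding cnt_def by (auto simp: card_1_singleton_iff)
  have "x mod n \<in> {z \<in> {0..<n}. P z}" "y mod n \<in> {z \<in> {0..<n}. P z}"
    using assms(1,4,5) per_mod[OF assms(2)] by auto
  then have "x mod n = y mod n"
    unfolding z by simp
  then show ?thesis
    by (simp add: mod_eq_dvd_iff)
qed

lemma sum_cnt_swap:
  "(\<Sum>x | x \<in> {0..<n} \<and> P x. cnt n (\<lambda>z. Q z \<and> R x z)) =
   (\<Sum>z | z \<in> {0..<n} \<and> Q z. cnt n (\<lambda>x. P x \<and> R x z))"
proof -
  have "(\<Sum>x | x \<in> {0..<n} \<and> P x. cnt n (\<lambda>z. Q z \<and> R x z)) =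
      (\<Sum>x | x \<in> {0..<n} \<and> P x. \<Sum>z | z \<in> {0..<n} \<and> Q z. of_bool (R x z))"
    unfolding cnt_def by (intro sum.cong refl) (simp add: Int_def conj_assoc)
  also have "\<dots> = (\<Sum>z | z \<in> {0..<n} \<and> Q z. \<Sum>x | x \<in> {0..<n} \<and> P x. of_bool (R x z))"
    by (rule sum.swap)
  also have "\<dots> = (\<Sum>z | z \<in> {0..<n} \<and> Q z. cnt n (\<lambda>x. P x \<and> R x z))"
    unfolding cnt_def by (intro sum.cong refl) (simp add: Int_def conj_assoc)
  finally show ?thesis .
qed

lemma sum_const_cnt:
  assumes "\<And>x. P x \<Longrightarrow> f x = k"
  shows "(\<Sum>x | x \<in> {0..<n} \<and> P x. f x) = cnt n P * k"
proof -
  have "(\<Sum>x | x \<in> {0..<n} \<and> P x. f x) = (\<Sum>x | x \<in> {0..<n} \<and> P x. k)"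
    using assms by (intro sum.cong) auto
  then show ?thesis
    by (simp add: cnt_def)
qed

lemma sum_residues_filter:
  "(\<Sum>z | z \<in> {0..<n::int} \<and> (P z \<and> Q z). g z) = (\<Sum>z | z \<in> {0..<n} \<and> P z. if Q z then g z else (0::nat))"
proof -
  have "{z. z \<in> {0..<n} \<and> (P z \<and> Q z)} = {z \<in> {z. z \<in> {0..<n} \<and> P z}. Q z}"
    by auto
  then show ?thesis
    by (simp only:) (rule sum.inter_filter, simp)
qed

lemma coprime_int_primesI:
  assumes "(b::int) \<noteq> 0" and "\<And>q. prime q \<Longrightarrow> q dvd a \<Longrightarrow> q dvd b \<Longrightarrow> False"
  shows "coprime a b"
proof (rule ccontr)
  assume "\<not> coprime a b"
  then have "\<not> is_unit (gcd a b)" "gcd a b \<noteq> 0"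
    using assms(1) by auto
  then obtain q where "prime q" "q dvd gcd a b"
    using prime_divisor_exists by blast
  then show False
    using assms(2) by auto
qed

text \<open>\<open>t\<close> collects the primes of \<open>n\<close> that do not divide
  \<open>r\<close>, so each prime of \<open>n\<close> divides exactly one of \<open>r\<close> and
  \<open>d * t\<close>.\<close>

lemma unit_lift:
  assumes "n > 0" and "(d::int) dvd n" and "coprime r d"
  obtains m where "d dvd m - r" and "coprime m n"
proof -
  define t where "t = \<Prod>{q. prime q \<and> q dvd n \<and> \<not> q dvd r}"
  have fin: "finite {q. prime q \<and> q dvd n \<and> \<not> q dvd r}"
    using assms(1) by (intro finite_subset[OF _ finite_divisors_int[of n]]) auto
  have "coprime (r + d * t) n"
  proof (rule coprime_int_primesI)
    fix q assume q: "prime q" "q dvd r + d * t" "q dvd n"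
    show False
    proof (cases "q dvd r")
      case True
      then have "\<not> q dvd d"
        using assms(3) q(1) by (metis coprime_common_divisor not_prime_unit)
      moreover have "q dvd d * t"
        using True q(2) by (simp add: dvd_add_right_iff)
      ultimately have "q dvd t"
        using q(1) prime_dvd_multD by blast
      then obtain q' where q': "prime q'" "\<not> q' dvd r" "q dvd q'"
        using prime_dvd_prod_iff[OF fin q(1), of "\<lambda>x. x"] unfolding t_def by auto
      then show False
        using True q(1) primes_dvd_imp_eq by blast
    next
      case False
      then have "q dvd t"
        unfolding t_def using fin q by (intro dvd_prodI[of _ _ "\<lambda>x. x", simplified]) auto
      then have "q dvd d * t"
        by simp
      then show False
        using False q(2) by (simp add: dvd_add_left_iff)
    qed
  qed (use assms(1) in auto)
  then show ?thesis
    using that[of "r + d * t"] by simp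
qed

lemma square_zero_unit:
  assumes "(n::int) dvd q * q" and "q dvd n"
  shows "coprime (1 + j * q) n"
proof -
  have "coprime (1 + j * q) q"
    by (metis coprime_1_left coprime_iff_gcd_eq_1 gcd_add_mult mult.commute add.commute gcd.commute)
  then have "coprime (1 + j * q) (q * q)"
    by simp
  then show ?thesis
    using assms(1) coprime_divisors dvd_refl by blast
qed

text \<open>In \<open>lam_cases\<close>, \<open>l\<close> is the share of a class in a coset of
  order \<open>h\<close>, made of \<open>k\<close> full fibres of size \<open>p\<close> and one of
  size \<open>f\<close>. For nonzero \<open>f\<close> put \<open>m = 1 + k + j\<close>: the equation
  says that \<open>p\<close> times a sum of three nonnegative terms is 0, so all three
  vanish.\<close>

lemma fibre_size_cases:
  fixes p h l k f :: int
  assumes p: "p \<ge> 2" and h: "h = p * m" "m \<ge> 2" and l: "l = p * k + f" and k: "k \<ge> 0"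
    and f: "0 \<le> f" "f < p" and range: "1 \<le> l" "l \<le> h"
    and eq: "(h - 1) * (p * p * k + f * f - l) = (p - 1) * (l * (l - 1))"
  shows "l = 1 \<or> l = h - 1 \<or> l = h"
proof -
  have "(p - 1) * (l * (h - l)) = (h - 1) * (f * (p - f))"
  proof -
    have *: "p * p * k + f * f - l = (p - 1) * l - f * (p - f)"
      unfolding l by (simp add: algebra_simps)
    show ?thesis
      using eq unfolding * by (simp add: algebra_simps)
  qed
  show ?thesis
  proof (cases "f = 0")
    case True
    then have "l * (h - l) = 0"
      using \<open>(p - 1) * (l * (h - l)) = _\<close> p by simp
    then show ?thesis
      using range by simp
  next
    case False
    have "p * k < p * m"
      using l range(2) f False unfolding h(1) by linarith
    then have "k < m"
      using p by simp
    define j where "j = m - 1 - k"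
    have j: "j \<ge> 0" "m = 1 + k + j"
      using \<open>k < m\<close> by (auto simp: j_def)
    have "p * (j * (f * (f - 1)) + k * ((p - f) * (p - 1 - f)) + (p - 1) * (p * (k * j))) =
        (p - 1) * (l * (h - l)) - (h - 1) * (f * (p - f))"
      unfolding l h(1) j(2) by (simp add: algebra_simps)
    then have "p * (j * (f * (f - 1)) + k * ((p - f) * (p - 1 - f)) + (p - 1) * (p * (k * j))) = 0"
      using \<open>(p - 1) * (l * (h - l)) = _\<close> by simp
    then have sum: "j * (f * (f - 1)) + k * ((p - f) * (p - 1 - f)) + (p - 1) * (p * (k * j)) = 0"
      using p by simp
    have nonneg: "j * (f * (f - 1)) \<ge> 0" "k * ((p - f) * (p - 1 - f)) \<ge> 0" "(p - 1) * (p * (k * j)) \<ge> 0"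
      using p f k j False by simp_all
    then have zero: "j * (f * (f - 1)) = 0" "k * ((p - f) * (p - 1 - f)) = 0" "(p - 1) * (p * (k * j)) = 0"
      using sum by linarith+
    from zero(3) have "k = 0 \<or> j = 0"
      using p by simp
    then show ?thesis
    proof
      assume "k = 0"
      then have "j \<noteq> 0"
        using h j by auto
      then have "f = 1"
        using zero(1) False by simp
      then show ?thesis
        using l \<open>k = 0\<close> by simp
    next
      assume "j = 0"
      then have "k \<noteq> 0"
        using h j by auto
      then have "f = p - 1"
        using zero(2) f by simp
      then show ?thesis
        using l h(1) j(2) \<open>j = 0\<close> by (simp add: algebra_simps)
    qed
  qed
qed

section \<open>Fibres of a class over a minimal subgroup\<close>

context sring
begin

definition lam :: "int \<Rightarrow> bool \<Rightarrow> int \<Rightarrow> nat" where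
  "lam a s x = cnt n (\<lambda>z. c s z = c s x \<and> a dvd z - x)"

definition cinv :: "int \<Rightarrow> nat \<Rightarrow> bool" where
  "cinv a \<gamma> \<longleftrightarrow> (\<forall>s z y. c s z = \<gamma> \<longrightarrow> a dvd y - z \<longrightarrow> c s y = \<gamma>)"

definition mchr :: "int \<Rightarrow> bool" where
  "mchr a \<longleftrightarrow> (\<forall>s s' x y. a dvd x \<longrightarrow> \<not> n dvd x \<longrightarrow> a dvd y \<longrightarrow> \<not> n dvd y \<longrightarrow> c s x = c s' y)"

text \<open>Subgroups shrink as the divisor grows, so a minimal nontrivial subgroup is a maximal
  divisor other than \<open>n\<close>.\<close>

definition minsub :: "int \<Rightarrow> bool" where
  "minsub a \<longleftrightarrow> asub a \<and> a \<noteq> n \<and> (\<forall>b. asub b \<longrightarrow> a dvd b \<longrightarrow> b = a \<or> b = n)"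

lemma minsub_exists:
  assumes "asub a" and "a \<noteq> n"
  obtains b where "minsub b" and "a dvd b"
proof -
  define S where "S = {b. asub b \<and> b \<noteq> n \<and> a dvd b}"
  have "finite S"
    unfolding S_def using n_pos asub_dvd by (intro finite_subset[OF _ finite_divisors_int[of n]]) auto
  moreover have "a \<in> S"
    using assms by (simp add: S_def)
  ultimately have max: "Max S \<in> S" "\<And>b. b \<in> S \<Longrightarrow> b \<le> Max S"
    by (auto intro: Max_in)
  have "minsub (Max S)"
    unfolding minsub_def
  proof (intro conjI allI impI)
    show "asub (Max S)" "Max S \<noteq> n"
      using max(1) by (auto simp: S_def)
    fix b assume b: "asub b" "Max S dvd b"
    show "b = Max S \<or> b = n"
    proof (cases "b = n")
      case False
      then have "b \<in> S"
        using b max(1) dvd_trans by (auto simp: S_def)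
      then have "b \<le> Max S"
        by (rule max(2))
      moreover have "Max S \<le> b"
        using b asub_pos by (auto intro: zdvd_imp_le)
      ultimately show ?thesis
        by simp
    qed simp
  qed
  then show ?thesis
    using that max(1) by (simp add: S_def)
qed

lemma minsub_mono:
  assumes "minsub a" and "\<not> prime (n div a)"
  shows "mchr a"
  unfolding mchr_def
proof (intro allI impI)
  fix s s' x y assume "a dvd x" "\<not> n dvd x" "a dvd y" "\<not> n dvd y"
  then show "c s x = c s' y"
    using assms unfolding minsub_def by (intro minimal_monochromatic[of a]) blast+
qed

lemma mchrD: "mchr a \<Longrightarrow> a dvd x \<Longrightarrow> \<not> n dvd x \<Longrightarrow> a dvd y \<Longrightarrow> \<not> n dvd y \<Longrightarrow> c s x = c s' y"
  unfolding mchr_def by blast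

lemma mult_fix_iff:
  assumes "coprime m n" and "c s x = c s' y"
  shows "c s (m * x) = c s x \<longleftrightarrow> c s' (m * y) = c s' y"
  using mult[OF assms] assms(2) by simp

text \<open>The radical meets the minimal subgroup in a subgroup of the Schur ring, which contains
  the nonzero element \<open>b\<close> and is therefore the whole minimal subgroup.\<close>

lemma rad_inv:
  assumes "minsub a" and "a dvd b" and "\<not> n dvd b"
    and "\<And>z. c s z = \<gamma> \<Longrightarrow> c s (z - b) = \<gamma>"
  shows "cinv a \<gamma>"
proof -
  obtain r where r: "asub r" "\<And>s x. (\<forall>z. c s z = \<gamma> \<longrightarrow> c s (z - x) = \<gamma>) \<longleftrightarrow> r dvd x"
    by (rule asub_rad[of \<gamma>, OF that])
  have "r dvd b"
    using r(2)[of s b] assms(4) by blast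
  then have "lcm a r dvd b"
    using assms(2) by (rule lcm_least[rotated])
  then have "lcm a r \<noteq> n"
    using assms(3) by auto
  moreover have "asub (lcm a r)"
    using assms(1) r(1) asub_lcm unfolding minsub_def by blast
  ultimately have "lcm a r = a"
    using assms(1) unfolding minsub_def by (metis dvd_lcm1)
  then have ra: "r dvd a"
    by (metis dvd_lcm2)
  show ?thesis
    unfolding cinv_def
  proof (intro allI impI)
    fix s z y assume z: "c s z = \<gamma>" and "a dvd y - z"
    then have "a dvd z - y"
      by (simp add: dvd_diff_commute)
    then have "r dvd z - y"
      using ra dvd_trans by blast
    from iffD2[OF r(2)[of s] this] z have "c s (z - (z - y)) = \<gamma>"
      by blast
    then show "c s y = \<gamma>"
      by simp
  qed
qed

lemma lam_cong:
  assumes "asub a" and "c s x = c s' x'"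
  shows "lam a s x = lam a s' x'"
  using coset_count[OF assms, of "\<lambda>\<alpha>. \<alpha> = c s x"] assms(2) unfolding lam_def by simp

lemma lam_pos: "a dvd n \<Longrightarrow> lam a s x > 0"
  unfolding lam_def using cnt_pos[OF n_pos per_coset[of a "\<lambda>\<alpha>. \<alpha> = c s x" s x]] by fastforce

lemma coset_split:
  assumes "asub a"
  shows "nat (n div a) = cnt n (\<lambda>z. A (c s z) \<and> a dvd z - x) + cnt n (\<lambda>z. \<not> A (c s z) \<and> a dvd z - x)"
  using cnt_coset[OF n_pos asub_pos[OF assms] asub_dvd[OF assms], of x]
    cnt_split[of n "\<lambda>z. a dvd z - x" "\<lambda>z. A (c s z)"] by (simp add: conj_commute)

lemma lam_le: "asub a \<Longrightarrow> lam a s x \<le> nat (n div a)"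
  unfolding lam_def by (subst coset_split[where A = "\<lambda>\<alpha>. \<alpha> = c s x" and s = s and x = x]) simp_all

lemma lam_full:
  assumes "asub a" and "nat (n div a) \<le> lam a s x" and "a dvd y - x"
  shows "c s y = c s x"
proof (rule ccontr)
  assume neq: "c s y \<noteq> c s x"
  have "cnt n (\<lambda>z. c s z \<noteq> c s x \<and> a dvd z - x) = 0"
    using assms(2) coset_split[OF assms(1), of "\<lambda>\<alpha>. \<alpha> = c s x" s x] unfolding lam_def by simp
  then show False
    using cnt_pos[OF n_pos per_coset[OF asub_dvd[OF assms(1)], of "\<lambda>\<alpha>. \<alpha> \<noteq> c s x" s x]] neq assms(3) by auto
qed

text \<open>Pairs of class elements in a common coset of \<open>a\<close>, counted by their
  difference and by one of the two elements.\<close>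

lemma sum_class_subgroup:
  assumes "asub a"
  shows "(\<Sum>w | w \<in> {0..<n} \<and> a dvd w. cnt n (\<lambda>z. c s z = c s x \<and> c s (z - w) = c s x)) =
    cnt n (\<lambda>z. c s z = c s x) * lam a s x"
proof -
  have "(\<Sum>w | w \<in> {0..<n} \<and> a dvd w. cnt n (\<lambda>z. c s z = c s x \<and> c s (z - w) = c s x)) =
      (\<Sum>z | z \<in> {0..<n} \<and> c s z = c s x. cnt n (\<lambda>y. c s y = c s x \<and> a dvd z - y))"
    by (rule sum_cnt_diff[OF n_pos per_c[of "\<lambda>\<alpha>. \<alpha> = c s x" s]])
      (use per_dvd[OF asub_dvd[OF assms], of 0] in simp)
  also have "\<dots> = cnt n (\<lambda>z. c s z = c s x) * lam a s x"
  proof (rule sum_const_cnt)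
    fix z assume "c s z = c s x"
    then have "lam a s z = lam a s x"
      by (rule lam_cong[OF assms])
    then show "cnt n (\<lambda>y. c s y = c s x \<and> a dvd z - y) = lam a s x"
      using \<open>c s z = c s x\<close> unfolding lam_def by (simp add: dvd_diff_commute)
  qed
  finally show ?thesis .
qed

text \<open>All nonzero differences in the subgroup share a colour and hence a number of
  representations, which turns the sum over differences into a product.\<close>

lemma mono_pair_count:
  assumes "asub a" and "mchr a" and u: "a dvd u" "\<not> n dvd u"
  shows "cnt n (\<lambda>z. c s z = c s x) + (nat (n div a) - 1) * cnt n (\<lambda>z. c s z = c s x \<and> c s (z - u) = c s x) =
    cnt n (\<lambda>z. c s z = c s x) * lam a s x"
proof -
  let ?\<kappa> = "\<lambda>w. cnt n (\<lambda>z. c s z = c s x \<and> c s (z - w) = c s x)"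
  have \<kappa>: "?\<kappa> w = ?\<kappa> u" if "a dvd w" "\<not> n dvd w" for w
    using count_inv[OF mchrD[OF assms(2) that u, of s s], of "\<lambda>\<alpha>. \<alpha> = c s x" "\<lambda>\<alpha>. \<alpha> = c s x"] .
  have "{w. w \<in> {0..<n} \<and> a dvd w} = insert 0 {w. w \<in> {0..<n} \<and> (a dvd w \<and> \<not> n dvd w)}"
    using n_pos by (auto dest: zdvd_imp_le)
  then have "(\<Sum>w | w \<in> {0..<n} \<and> a dvd w. ?\<kappa> w) = ?\<kappa> 0 + (\<Sum>w | w \<in> {0..<n} \<and> (a dvd w \<and> \<not> n dvd w). ?\<kappa> w)"
    by (subst \<open>_ = insert 0 _\<close>) (subst sum.insert; simp)
  also have "(\<Sum>w | w \<in> {0..<n} \<and> (a dvd w \<and> \<not> n dvd w). ?\<kappa> w) = cnt n (\<lambda>w. a dvd w \<and> \<not> n dvd w) * ?\<kappa> u"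
    by (rule sum_const_cnt) (use \<kappa> in blast)
  also have "cnt n (\<lambda>w. a dvd w \<and> \<not> n dvd w) = nat (n div a) - 1"
  proof -
    have "cnt n (\<lambda>w. a dvd w \<and> n dvd w) = 1"
    proof -
      have "(\<lambda>w. a dvd w \<and> n dvd w) = (\<lambda>w. n dvd w - 0)"
        using asub_dvd[OF assms(1)] dvd_trans by auto
      then show ?thesis
        using cnt_single[OF n_pos, of 0] by simp
    qed
    then show ?thesis
      using cnt_split[of n "\<lambda>w. a dvd w" "\<lambda>w. n dvd w"] cnt_coset[OF n_pos asub_pos asub_dvd, OF assms(1) assms(1), of 0]
      by simp
  qed
  finally show ?thesis
    using sum_class_subgroup[OF assms(1), of s x] by simp
qed


text \<open>Two such fibres would differ by an element of the subgroup of index \<open>a\<close>, whereas all its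
  nonzero elements have the same colour and not all of them are divisible by \<open>p\<close>.\<close>

lemma fib_partial_unique:
  assumes "asub a" and "mchr a" and p: "prime p" "int p dvd n" "\<not> int p dvd a"
    and "a dvd x - y" and ps: "powset p s \<gamma> (int p * x)" "powset p s \<delta> (int p * y)"
  shows "n dvd int p * (x - y)"
proof (rule ccontr)
  assume nz: "\<not> n dvd int p * (x - y)"
  have "\<not> n dvd a"
    using p(2,3) dvd_trans by blast
  then have "c s (int p * (x - y)) = c s a"
    using mchrD[OF assms(2) _ nz, of a s s] assms(6) by simp
  then obtain z where z: "c s z = c s (int p * x)" "c s (z - a) = c s (int p * x - int p * (x - y))"
    by (rule tri)
  have "powset p s \<gamma> z"
    using powset_inv[OF p(1) z(1)] ps(1) by simp
  then obtain t where "n dvd int p * t - z"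
    by (rule powsetD)
  then have 1: "int p dvd z"
    using p(2) by (meson dvd_trans dvd_triv_left zdvd_zdiffD dvd_diff_commute)
  have "powset p s \<delta> (z - a)"
    using powset_inv[OF p(1) z(2)] ps(2) by (simp add: algebra_simps)
  then obtain t where "n dvd int p * t - (z - a)"
    by (rule powsetD)
  then have "int p dvd z - a"
    using p(2) by (meson dvd_trans dvd_triv_left zdvd_zdiffD dvd_diff_commute)
  then show False
    using 1 p(3) dvd_diff[of "int p" z "z - a"] by simp
qed

text \<open>By \<open>fib_partial_unique\<close>, a coset of \<open>a\<close> contains at most one
  fibre that is neither empty nor full, so its share of the class is \<open>p * k + f\<close>.
  Counting pairs in cosets of order \<open>n div a\<close> and of order \<open>p\<close> gives two
  relations with the same number \<open>\<kappa>\<close> of pairs per nonzero difference.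
  Eliminating \<open>\<kappa>\<close> leaves the equation of
  \<open>fibre_size_cases\<close>.\<close>

lemma lam_cases:
  assumes a: "asub a" and m: "mchr a" and p: "prime p" "int p dvd n div a" "\<not> int p dvd a"
    and composite: "n div a \<noteq> int p"
  shows "lam a s x = 1 \<or> int (lam a s x) = n div a - 1 \<or> int (lam a s x) = n div a"
proof -
  define h where "h = n div a"
  define q where "q = n div int p"
  define \<gamma> where "\<gamma> = c s x"
  let ?T = "\<lambda>z. c s z = \<gamma>"
  have an: "n = a * h" "a > 0" "a dvd n"
    using asub_pos[OF a] asub_dvd[OF a] by (auto simp: h_def)
  obtain m' where hm: "h = int p * m'"
    using p(2) by (auto simp: h_def)
  have p0: "p > 0" "int p \<ge> 2"
    using prime_gt_0_nat[OF p(1)] prime_ge_2_nat[OF p(1)] by auto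
  have pn: "int p dvd n"
    using an hm by simp
  have npq: "n = int p * q"
    using pn by (simp add: q_def)
  have q: "q > 0" "q dvd n" "q = a * m'"
  proof -
    show "q > 0"
      using npq n_pos p0(2) by (metis less_le_trans zero_less_mult_pos zero_less_numeral)
    show "q dvd n"
      using npq by simp
    have "int p * q = int p * (a * m')"
      unfolding npq[symmetric] using an(1) unfolding hm by (simp only: mult.left_commute)
    then show "q = a * m'"
      using p0 by simp
  qed
  have n_div_q: "nat (n div q) = p"
    unfolding npq using q(1) by simp
  have m'0: "m' > 0"
    using q(1,3) an(2) by (metis zero_less_mult_pos)
  have "m' \<noteq> 1"
    using composite hm by (auto simp: h_def)
  then have m'2: "m' \<ge> 2"
    using m'0 by simp
  have qn: "\<not> n dvd q"
    using q(1) npq p0(2) by (auto dest!: zdvd_imp_le)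
  have fib_q: "fib p s \<gamma> z = fib p s \<gamma> z'" if "q dvd z - z'" for z z'
  proof -
    have "q dvd t - z \<longleftrightarrow> q dvd t - z'" for t
      using coset_shift[OF that] by auto
    then show ?thesis
      by (simp add: fib_def q_def)
  qed
  have fib_lam: "fib p s \<gamma> z = lam q s z" if "?T z" for z
    using that by (simp add: fib_def lam_def q_def)
  have lam_x: "lam a s z = lam a s x" if "?T z" for z
    by (rule lam_cong[OF a]) (use that in \<open>simp add: \<gamma>_def\<close>)
  define k f where "k = lam a s x div p" and "f = lam a s x mod p"
  have lam_kf: "lam a s x = p * k + f"
    by (simp add: k_def f_def)
  text \<open>The sum of the fibre sizes over the points of the class in one coset.\<close>
  have coset_sum: "(\<Sum>z | z \<in> {0..<n} \<and> (?T z \<and> a dvd z - y). fib p s \<gamma> z) = p * p * k + f * f" if y: "?T y" for y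
  proof -
    let ?F = "\<lambda>z. a dvd z - y \<and> fib p s \<gamma> z = p"
    have full_T: "?T z" if "fib p s \<gamma> z = p" for z
      using fib_full[OF p0(1) pn, of s \<gamma> z z] that by simp
    \<comment> \<open>Full fibres are whole cosets of order \<open>p\<close>, so their points come
      in multiples of \<open>p\<close>.\<close>
    have "per q ?F"
      unfolding per_def
    proof (intro allI impI)
      fix z z' assume zz': "q dvd z - z'"
      then have "a dvd z - z'"
        using q(3) dvd_trans by auto
      then have "a dvd z - y \<longleftrightarrow> a dvd z' - y"
        using dvd_add_right_iff[of a "z - z'" "z' - y"] by simp
      then show "?F z = ?F z'"
        using fib_q[OF zz'] by simp
    qed
    from cnt_periodic[OF n_pos q(1,2) this] obtain j where j: "cnt n ?F = p * j"
      unfolding n_div_q by blast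
    have partial: "q dvd z - z'" if "?T z" "a dvd z - y" "fib p s \<gamma> z \<noteq> p" "?T z'" "a dvd z' - y" "fib p s \<gamma> z' \<noteq> p" for z z'
    proof -
      have "\<not> p dvd fib p s \<gamma> w" if "?T w" "fib p s \<gamma> w \<noteq> p" for w
      proof
        assume "p dvd fib p s \<gamma> w"
        then have "p \<le> fib p s \<gamma> w"
          using fib_pos[OF pn, of s w] that(1) by (auto dest: dvd_imp_le)
        then show False
          using fib_le[OF p0(1) pn, of s \<gamma> w] that(2) by simp
      qed
      then have "powset p s \<gamma> (int p * z)" "powset p s \<gamma> (int p * z')"
        using that powset_fib[OF p0(1) pn] by blast+
      moreover have "a dvd z - z'"
        using dvd_diff[OF that(2,5)] by simp
      ultimately have "n dvd int p * (z - z')"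
        by (intro fib_partial_unique[OF a m p(1) pn p(3)])
      then show ?thesis
        using npq p0(1) by simp
    qed
    have lam_y: "lam a s x = cnt n ?F + cnt n (\<lambda>z. ?T z \<and> a dvd z - y \<and> fib p s \<gamma> z \<noteq> p)"
    proof -
      have "lam a s x = cnt n (\<lambda>z. ?T z \<and> a dvd z - y)"
        using lam_x[OF y] y by (simp add: lam_def)
      also have "\<dots> = cnt n (\<lambda>z. (?T z \<and> a dvd z - y) \<and> fib p s \<gamma> z = p) + cnt n (\<lambda>z. (?T z \<and> a dvd z - y) \<and> fib p s \<gamma> z \<noteq> p)"
        by (rule cnt_split)
      also have "(\<lambda>z. (?T z \<and> a dvd z - y) \<and> fib p s \<gamma> z = p) = ?F"
        using full_T by blast
      finally show ?thesis
        by (simp add: conj_assoc)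
    qed
    have split: "(\<Sum>z | z \<in> {0..<n} \<and> (?T z \<and> a dvd z - y). fib p s \<gamma> z) =
        (\<Sum>z | z \<in> {0..<n} \<and> ?F z. fib p s \<gamma> z) + (\<Sum>z | z \<in> {0..<n} \<and> (?T z \<and> a dvd z - y \<and> fib p s \<gamma> z \<noteq> p). fib p s \<gamma> z)"
    proof -
      have "{z. z \<in> {0..<n} \<and> (?T z \<and> a dvd z - y)} =
          {z. z \<in> {0..<n} \<and> ?F z} \<union> {z. z \<in> {0..<n} \<and> (?T z \<and> a dvd z - y \<and> fib p s \<gamma> z \<noteq> p)}"
        using full_T by blast
      then show ?thesis
        by (simp only:) (subst sum.union_disjoint; auto)
    qed
    have sum_F: "(\<Sum>z | z \<in> {0..<n} \<and> ?F z. fib p s \<gamma> z) = cnt n ?F * p"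
      by (rule sum_const_cnt) simp
    show ?thesis
    proof (cases "\<exists>z. ?T z \<and> a dvd z - y \<and> fib p s \<gamma> z \<noteq> p")
      case False
      then have "cnt n (\<lambda>z. ?T z \<and> a dvd z - y \<and> fib p s \<gamma> z \<noteq> p) = 0"
        by (simp add: cnt_def) 
      moreover have "{z. z \<in> {0..<n} \<and> (?T z \<and> a dvd z - y \<and> fib p s \<gamma> z \<noteq> p)} = {}"
        using False by blast
      ultimately show ?thesis
        unfolding split sum_F using lam_y j p0 by (simp add: k_def f_def)
    next
      case True
      then obtain z0 where z0: "?T z0" "a dvd z0 - y" "fib p s \<gamma> z0 \<noteq> p"
        by blast
      have partial_iff: "(?T z \<and> a dvd z - y \<and> fib p s \<gamma> z \<noteq> p) \<longleftrightarrow> (?T z \<and> q dvd z - z0)" for z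
      proof
        assume "?T z \<and> a dvd z - y \<and> fib p s \<gamma> z \<noteq> p"
        then show "?T z \<and> q dvd z - z0"
          using partial[of z z0] z0 by blast
      next
        assume z: "?T z \<and> q dvd z - z0"
        then have "a dvd z - z0"
          using q(3) dvd_mult_left by blast
        then have "a dvd z - y"
          using z0(2) dvd_add[of a "z - z0" "z0 - y"] by simp
        then show "?T z \<and> a dvd z - y \<and> fib p s \<gamma> z \<noteq> p"
          using z z0(3) fib_q[of z z0] by simp
      qed
      define f0 where "f0 = fib p s \<gamma> z0"
      have cnt_p: "cnt n (\<lambda>z. ?T z \<and> a dvd z - y \<and> fib p s \<gamma> z \<noteq> p) = f0"
        unfolding partial_iff by (simp add: f0_def fib_def q_def)
      have "(\<Sum>z | z \<in> {0..<n} \<and> (?T z \<and> a dvd z - y \<and> fib p s \<gamma> z \<noteq> p). fib p s \<gamma> z) = f0 * f0"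
        unfolding cnt_p[symmetric] 
      proof (rule sum_const_cnt)
        fix z assume "?T z \<and> a dvd z - y \<and> fib p s \<gamma> z \<noteq> p"
        then have "q dvd z - z0"
          unfolding partial_iff by blast
        then show "fib p s \<gamma> z = cnt n (\<lambda>z. ?T z \<and> a dvd z - y \<and> fib p s \<gamma> z \<noteq> p)"
          unfolding cnt_p f0_def by (rule fib_q)
      qed
      moreover have "f0 < p"
        using fib_le[OF p0(1) pn, of s \<gamma> z0] z0(3) by (simp add: f0_def)
      moreover have "k = j" "f = f0"
        using lam_y \<open>f0 < p\<close> p0 unfolding cnt_p j k_def f_def by simp_all
      ultimately show ?thesis
        unfolding split sum_F j by simp
    qed
  qed
  define t where "t = cnt n ?T"
  define L where "L = lam a s x"
  define \<Sigma> where "\<Sigma> = (\<Sum>z | z \<in> {0..<n} \<and> ?T z. fib p s \<gamma> z)"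
  have t0: "t > 0"
    using cnt_pos[OF n_pos per_c[of "\<lambda>\<alpha>. \<alpha> = \<gamma>" s]] unfolding t_def by (auto simp: \<gamma>_def)
  \<comment> \<open>The fibre sizes at \<open>z\<close>, summed over pairs \<open>y\<close>,
    \<open>z\<close> of class elements in a common coset of \<open>a\<close>, once by
    \<open>y\<close> and once by \<open>z\<close>.\<close>
  have L: "L * \<Sigma> = t * (p * p * k + f * f)"
  proof -
    have "(\<Sum>y | y \<in> {0..<n} \<and> ?T y. \<Sum>z | z \<in> {0..<n} \<and> (?T z \<and> a dvd z - y). fib p s \<gamma> z) = t * (p * p * k + f * f)"
      unfolding t_def by (rule sum_const_cnt) (rule coset_sum)
    moreover have "(\<Sum>y | y \<in> {0..<n} \<and> ?T y. \<Sum>z | z \<in> {0..<n} \<and> (?T z \<and> a dvd z - y). fib p s \<gamma> z) =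
        (\<Sum>y | y \<in> {0..<n} \<and> ?T y. \<Sum>z | z \<in> {0..<n} \<and> ?T z. if a dvd z - y then fib p s \<gamma> z else 0)"
      by (simp only: sum_residues_filter)
    moreover have "\<dots> = (\<Sum>z | z \<in> {0..<n} \<and> ?T z. \<Sum>y | y \<in> {0..<n} \<and> ?T y. if a dvd z - y then fib p s \<gamma> z else 0)"
      by (rule sum.swap)
    moreover have "\<dots> = (\<Sum>z | z \<in> {0..<n} \<and> ?T z. L * fib p s \<gamma> z)"
    proof (intro sum.cong refl)
      fix z assume "z \<in> {z. z \<in> {0..<n} \<and> ?T z}"
      then have z: "?T z"
        by simp
      have "(\<Sum>y | y \<in> {0..<n} \<and> ?T y. if a dvd z - y then fib p s \<gamma> z else 0) =
          (\<Sum>y | y \<in> {0..<n} \<and> (?T y \<and> a dvd z - y). fib p s \<gamma> z)"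
        by (simp only: sum_residues_filter)
      also have "\<dots> = cnt n (\<lambda>y. ?T y \<and> a dvd z - y) * fib p s \<gamma> z"
        by (simp add: cnt_def)
      also have "cnt n (\<lambda>y. ?T y \<and> a dvd z - y) = L"
        using lam_x[OF z] z unfolding lam_def L_def by (simp add: dvd_diff_commute)
      finally show "(\<Sum>y | y \<in> {0..<n} \<and> ?T y. if a dvd z - y then fib p s \<gamma> z else 0) = L * fib p s \<gamma> z" .
    qed
    ultimately show ?thesis
      by (simp add: \<Sigma>_def sum_distrib_left)
  qed
  define \<kappa> where "\<kappa> = cnt n (\<lambda>z. ?T z \<and> ?T (z - q))"
  have aq: "a dvd q"
    using q(3) by simp
  have 1: "t + (nat h - 1) * \<kappa> = t * L"
    using mono_pair_count[OF a m aq qn, of s x] by (simp add: t_def \<kappa>_def L_def \<gamma>_def h_def)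
  \<comment> \<open>\<open>\<Sigma>\<close> counts pairs of class elements in a common coset of
    order \<open>p\<close>; their nonzero differences all have the colour of
    \<open>q\<close>.\<close>
  have 2: "t + (p - 1) * \<kappa> = \<Sigma>"
  proof -
    let ?\<kappa> = "\<lambda>w. cnt n (\<lambda>z. ?T z \<and> ?T (z - w))"
    have "{w. w \<in> {0..<n} \<and> q dvd w} = insert 0 {w. w \<in> {0..<n} \<and> (q dvd w \<and> \<not> n dvd w)}"
      using n_pos by (auto dest: zdvd_imp_le)
    then have "(\<Sum>w | w \<in> {0..<n} \<and> q dvd w. ?\<kappa> w) = t + (\<Sum>w | w \<in> {0..<n} \<and> (q dvd w \<and> \<not> n dvd w). ?\<kappa> w)"
      by (subst \<open>_ = insert 0 _\<close>) (subst sum.insert; simp add: t_def)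
    also have "(\<Sum>w | w \<in> {0..<n} \<and> (q dvd w \<and> \<not> n dvd w). ?\<kappa> w) = cnt n (\<lambda>w. q dvd w \<and> \<not> n dvd w) * \<kappa>"
    proof (rule sum_const_cnt)
      fix w assume "q dvd w \<and> \<not> n dvd w"
      then have "c s w = c s q"
        using mchrD[OF m _ _ aq qn] aq dvd_trans by blast
      from count_inv[OF this, of "\<lambda>\<alpha>. \<alpha> = \<gamma>" "\<lambda>\<alpha>. \<alpha> = \<gamma>"] show "?\<kappa> w = \<kappa>"
        by (simp add: \<kappa>_def)
    qed
    also have "cnt n (\<lambda>w. q dvd w \<and> \<not> n dvd w) = p - 1"
    proof -
      have "(\<lambda>w. q dvd w \<and> n dvd w) = (\<lambda>w. n dvd w - 0)"
        using q(2) dvd_trans by auto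
      then have "cnt n (\<lambda>w. q dvd w \<and> n dvd w) = 1"
        using cnt_single[OF n_pos, of 0] by simp
      then show ?thesis
        using cnt_split[of n "\<lambda>w. q dvd w" "\<lambda>w. n dvd w"] cnt_coset[OF n_pos q(1,2), of 0] n_div_q by simp
    qed
    also have "(\<Sum>w | w \<in> {0..<n} \<and> q dvd w. ?\<kappa> w) = (\<Sum>z | z \<in> {0..<n} \<and> ?T z. cnt n (\<lambda>y. ?T y \<and> q dvd z - y))"
      by (rule sum_cnt_diff[OF n_pos per_c[of "\<lambda>\<alpha>. \<alpha> = \<gamma>" s]]) (use per_dvd[OF q(2), of 0] in simp)
    also have "\<dots> = \<Sigma>"
      unfolding \<Sigma>_def fib_def q_def by (intro sum.cong refl) (simp add: dvd_diff_commute)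
    finally show ?thesis by simp
  qed
  have h: "h \<ge> 1" "int (nat h) = h"
  proof -
    have "h > 0"
      unfolding hm using m'0 p0(1) by simp
    then show "h \<ge> 1" "int (nat h) = h"
      by auto
  qed
  have "(h - 1) * (int p * int p * int k + int f * int f - int L) = (int p - 1) * (int L * (int L - 1))"
  proof -
    have e1: "int t + (h - 1) * int \<kappa> = int t * int L"
      using arg_cong[OF 1, of int] h by (simp add: of_nat_diff)
    have e2: "int t + (int p - 1) * int \<kappa> = int \<Sigma>"
      using arg_cong[OF 2, of int] p0 by (simp add: of_nat_diff)
    have e3: "int L * int \<Sigma> = int t * (int p * int p * int k + int f * int f)"
      using arg_cong[OF L, of int] by simp
    have "int t * ((h - 1) * (int p * int p * int k + int f * int f - int L)) =
        (h - 1) * (int L * int \<Sigma> - int t * int L)"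
      unfolding e3 by (simp add: algebra_simps)
    also have "\<dots> = (int p - 1) * (int L * ((h - 1) * int \<kappa>))"
      unfolding e2[symmetric] by (simp add: algebra_simps)
    also have "(h - 1) * int \<kappa> = int t * (int L - 1)"
      using e1 by (simp add: algebra_simps)
    finally have "int t * ((h - 1) * (int p * int p * int k + int f * int f - int L)) =
        int t * ((int p - 1) * (int L * (int L - 1)))"
      by (simp add: algebra_simps)
    then show ?thesis
      using t0 by simp
  qed
  moreover have "L > 0" "int L \<le> h"
    using lam_pos[OF an(3), of s x] lam_le[OF a, of s x] h unfolding L_def h_def by auto
  moreover have "int L = int p * int k + int f"
    using lam_kf by (simp add: L_def)
  ultimately have "int L = 1 \<or> int L = h - 1 \<or> int L = h"
    using p0 hm m'2 by (intro fibre_size_cases[of "int p" h m' "int L" "int k" "int f"]) (auto simp: f_def)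
  then show ?thesis
    by (simp add: L_def h_def)
qed

end

section \<open>Minimal subgroups whose order and index share a prime\<close>

text \<open>The hypotheses force \<open>2 * (H - L) \<le> H - 1\<close> and
  \<open>2 * L \<le> H - 1\<close>, whose sum is absurd. In the application \<open>t\<close> is the
  class size, \<open>H\<close> the subgroup order, \<open>L\<close> the share of the class in a
  coset, \<open>N\<close> the number of class elements that a translation moves out of the class,
  and \<open>B\<close> bounds \<open>N\<close>.\<close>

lemma half_class_contradiction:
  fixes t N B L H k :: int
  assumes "t = k + N" and "t + (H - 1) * k = t * L" and "N \<le> B" and "L < H" and "2 * B \<le> t"
    and "L * N \<le> B * (H - L)" and "t > 0" and "L > 0"
  shows False
proof -
  have N: "N * (H - 1) = t * (H - L)"
    using assms(1,2) by (simp add: algebra_simps)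
  have "t * (2 * (H - L)) = (2 * N) * (H - 1)"
    using N by (simp add: algebra_simps)
  also have "\<dots> \<le> t * (H - 1)"
    using assms by (intro mult_right_mono) auto
  finally have 1: "2 * (H - L) \<le> H - 1"
    using assms(7) by simp
  have "2 * (L * N) * (H - 1) = 2 * L * (N * (H - 1))"
    by (simp only: ac_simps)
  then have "(2 * L * t) * (H - L) = 2 * (L * N) * (H - 1)"
    unfolding N by (simp only: ac_simps)
  also have "\<dots> \<le> 2 * (B * (H - L)) * (H - 1)"
    using assms by (intro mult_right_mono mult_left_mono) auto
  also have "\<dots> = (2 * B) * ((H - L) * (H - 1))"
    by (simp add: ac_simps)
  also have "\<dots> \<le> t * ((H - L) * (H - 1))"
    using assms by (intro mult_right_mono) auto
  also have "\<dots> = ((H - 1) * t) * (H - L)"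
    by (simp add: ac_simps)
  finally have "2 * L * t \<le> (H - 1) * t"
    by (rule mult_right_le_imp_le) (use assms(4) in simp)
  then have "2 * L \<le> H - 1"
    using assms(7) by simp
  then show False
    using 1 by simp
qed

context sring
begin

text \<open>Since \<open>q * q\<close> vanishes modulo \<open>n\<close>, multiplying the units
  \<open>1 + q * i\<close> adds the parameters \<open>i\<close>.\<close>

lemma fix_power:
  assumes "n dvd q * q" and "q dvd n" and "c s (1 + q * i) = c s 1"
  shows "c s (1 + q * (i * int l)) = c s 1"
proof (induction l)
  case (Suc l)
  have "coprime (1 + q * i) n"
    using square_zero_unit[OF assms(1,2), of i] by (simp add: mult.commute)
  from mult[OF this Suc] have "c s ((1 + q * i) * (1 + q * (i * int l))) = c s 1"
    using assms(3) by simp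
  moreover have "n dvd (1 + q * i) * (1 + q * (i * int l)) - (1 + q * (i * int (Suc l)))"
  proof -
    have "(1 + q * i) * (1 + q * (i * int l)) - (1 + q * (i * int (Suc l))) = q * q * (i * i * int l)"
      by (simp add: algebra_simps)
    then show ?thesis
      using assms(1) by simp
  qed
  ultimately show ?case
    using per by metis
qed simp

text \<open>The units \<open>1 + q * i\<close>, \<open>q = n div p\<close>, form a group of order
  \<open>p\<close>. If it moves the class of 1, no two class elements differ by a nonzero element of
  the minimal subgroup, which contradicts a triangle transfer. If it fixes the class, the elements
  that spoil invariance lie in a subgroup holding at most half of the class.\<close>

lemma class_one_invariant:
  assumes min: "minsub a" and m: "mchr a" and p: "prime p" "int p dvd n div a" "int p dvd a"
    and composite: "n div a \<noteq> int p"
  shows "cinv a (c s 1)"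
proof (rule ccontr)
  assume not_inv: "\<not> cinv a (c s 1)"
  define h where "h = n div a"
  define q where "q = n div int p"
  define \<gamma> where "\<gamma> = c s 1"
  let ?T = "\<lambda>z. c s z = \<gamma>"
  have a: "asub a" "a \<noteq> n"
    using min by (auto simp: minsub_def)
  have an: "n = a * h" "a > 0" "a dvd n"
    using asub_pos[OF a(1)] asub_dvd[OF a(1)] by (auto simp: h_def)
  obtain m' where hm: "h = int p * m'"
    using p(2) by (auto simp: h_def)
  obtain a' where ap: "a = int p * a'"
    using p(3) by auto
  have p0: "p > 0" "int p \<ge> 2"
    using prime_gt_0_nat[OF p(1)] prime_ge_2_nat[OF p(1)] by auto
  have pn: "int p dvd n"
    using an hm by simp
  have npq: "n = int p * q"
    using pn by (simp add: q_def)
  have qa: "q = a * m'"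
  proof -
    have "int p * q = int p * (a * m')"
      unfolding npq[symmetric] using an(1) unfolding hm by (simp only: mult.left_commute)
    then show ?thesis
      using p0 by simp
  qed
  have aq: "a dvd q" and pq: "int p dvd q" and qn: "q dvd n"
    using qa ap npq by simp_all
  have q0: "q > 0"
    using npq n_pos p0(2) by (metis less_le_trans zero_less_mult_pos zero_less_numeral)
  have q_n: "\<not> n dvd q"
    using q0 npq p0(2) by (auto dest!: zdvd_imp_le)
  have nqq: "n dvd q * q"
    using npq pq by (metis mult_dvd_mono dvd_refl)
  have nqp: "n dvd q * x \<longleftrightarrow> int p dvd x" for x
    using npq q0 by (simp add: mult.commute)
  have a_n: "\<not> n dvd a"
    using an(2) a(2) zdvd_imp_le[OF an(3) n_pos] zdvd_imp_le[of n a] by auto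
  have unit: "coprime (1 + q * i) n" for i
    using square_zero_unit[OF nqq qn, of i] by (simp add: mult.commute)
  have mult_q: "c s ((1 + q * i) * x) = c s (x + q * (i * x))" for i x
    by (simp add: algebra_simps)
  show False
  proof (cases "c s (1 + q) = \<gamma>")
    case False
    text \<open>The class contains no multiples of \<open>p\<close> and no two elements that differ by a nonzero
      element of the subgroup.\<close>
    have notp: "\<not> int p dvd x" if "?T x" for x
    proof
      assume "int p dvd x"
      then have "c s ((1 + q * 1) * x) = c s x"
        by (intro per) (simp add: nqp algebra_simps)
      then have "c s ((1 + q * 1) * 1) = c s 1"
        using mult_fix_iff[OF unit[of 1], of s x s 1] that by (simp add: \<gamma>_def)
      then show False
        using False by (simp add: \<gamma>_def)
    qed
    have "\<not> ?T (x - q)" if x: "?T x" for x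
    proof
      assume xq: "?T (x - q)"
      have "coprime x (int p)"
        using notp[OF x] prime_imp_coprime[of "int p" x] p(1) by (simp add: coprime_commute)
      then obtain i where i: "[x * i = 1] (mod int p)"
        using coprime_iff_invertible_int by blast
      then have "int p dvd i * x - 1"
        by (simp add: cong_iff_dvd_diff mult.commute)
      then have "n dvd q * (i * x - 1)"
        using nqp by blast
      then have "c s ((1 + q * (- i)) * x) = c s (x - q)"
        by (intro per) (simp add: algebra_simps dvd_diff_commute)
      then have "c s ((1 + q * (- i)) * 1) = c s 1"
        using mult_fix_iff[OF unit[of "- i"], of s x s 1] x xq by (simp add: \<gamma>_def)
      then have fix_i: "c s (1 + q * (- i)) = c s 1"
        by simp
      \<comment> \<open>\<open>i\<close> inverts \<open>x\<close> modulo \<open>p\<close>, so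
        \<open>i * l\<close> is \<open>-1\<close> modulo \<open>p\<close> and the
        \<open>l\<close>-th power of \<open>1 - q * i\<close> is \<open>1 + q\<close>.\<close>
      define l where "l = nat ((- x) mod int p)"
      have l: "int l = (- x) mod int p"
        using p0 by (simp add: l_def)
      have "int p dvd int l + x"
        unfolding l by (metis dvd_mod_diff diff_minus_eq_add)
      moreover have "int p dvd i * (int l + x) - (i * x - 1)  - (1 + i * int l)"
        by (simp add: algebra_simps)
      ultimately have "int p dvd 1 + i * int l"
        using \<open>int p dvd i * x - 1\<close> by (meson dvd_diff dvd_diff_commute dvd_mult zdvd_zdiffD)
      then have "n dvd q * (1 + i * int l)"
        using nqp by blast
      then have "c s (1 + q) = c s (1 + q * (- i * int l))"
        by (intro per) (simp add: algebra_simps)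
      then show False
        using fix_power[OF nqq qn fix_i, of l] False by (simp add: \<gamma>_def)
    qed
    then have "cnt n (\<lambda>z. ?T z \<and> ?T (z - q)) = 0"
      by (simp add: cnt_def)
    then have no_diff: "n dvd w" if "?T z" "?T (z - w)" "a dvd w" for z w
    proof -
      have False if "\<not> n dvd w"
      proof -
        have "cnt n (\<lambda>z. ?T z \<and> ?T (z - w)) = 0"
          using count_inv[OF mchrD[where s = s and s' = s, OF m \<open>a dvd w\<close> that aq q_n], of "\<lambda>\<alpha>. \<alpha> = \<gamma>" "\<lambda>\<alpha>. \<alpha> = \<gamma>"]
            \<open>cnt n (\<lambda>z. ?T z \<and> ?T (z - q)) = 0\<close> by simp
        then show False
          using cnt_pos[OF n_pos per_count[of "\<lambda>\<alpha>. \<alpha> = \<gamma>" s "\<lambda>\<alpha>. \<alpha> = \<gamma>" w]] \<open>?T z\<close> \<open>?T (z - w)\<close> by auto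
      qed
      then show ?thesis by blast
    qed
    \<comment> \<open>The transfer replaces the difference \<open>q\<close> by \<open>a\<close>.
      Multiplication by \<open>1 - q\<close> brings \<open>z\<close> into the class of 1, which also
      contains \<open>z - a\<close>; the difference \<open>a - q * z\<close> lies in the subgroup,
      so it vanishes, and then \<open>h\<close> divides \<open>p\<close>.\<close>
    have "c s q = c s a"
      using mchrD[OF m aq q_n _ a_n] by simp
    then obtain z where z: "c s z = c s (1 + q)" "c s (z - a) = c s (1 + q - q)"
      by (rule tri)
    have "c s ((1 + q * (- 1)) * z) = c s ((1 + q * (- 1)) * (1 + q))"
      using mult[OF unit z(1)] .
    also have "\<dots> = c s 1"
    proof (rule per)
      have "(1 + q * (- 1)) * (1 + q) - 1 = - (q * q)"
        by (simp add: algebra_simps)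
      then show "n dvd (1 + q * (- 1)) * (1 + q) - 1"
        using nqq by simp
    qed
    finally have 1: "?T (z - q * z)"
      by (simp add: \<gamma>_def algebra_simps)
    have 2: "?T ((z - q * z) - (a - q * z))"
      using z(2) by (simp add: \<gamma>_def)
    have "a dvd a - q * z"
      using aq by simp
    from no_diff[OF 1 2 this] have "n dvd int p * (a - q * z)"
      by simp
    moreover have "int p * (a - q * z) = int p * a - n * z"
      by (subst npq) (simp add: algebra_simps)
    ultimately have "n dvd int p * a - n * z"
      by simp
    then have "n dvd a * int p"
      using zdvd_zdiffD[of n "int p * a" "n * z"] by (simp add: mult.commute)
    then have "h dvd int p"
      using an by simp
    then have "h = 1 \<or> h = int p"
      using p(1) hm p0 prime_int_iff[of "int p"] by (metis an(1) an(2) n_pos order_less_imp_le prime_nat_int_transfer zero_less_mult_pos)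
    moreover have "h \<noteq> 1"
      using a(2) an(1) by auto
    ultimately show False
      using composite by (simp add: h_def)
  next
    case True
    text \<open>Off the multiples of \<open>p\<close>, the class is invariant under the subgroup of order \<open>p\<close>.\<close>
    have shift: "?T (x + q * j)" if x: "?T x" "\<not> int p dvd x" for x j
    proof -
      have "coprime x (int p)"
        using x(2) prime_imp_coprime[of "int p" x] p(1) by (simp add: coprime_commute)
      then obtain v where v: "[x * v = 1] (mod int p)"
        using coprime_iff_invertible_int by blast
      define i where "i = nat ((v * j) mod int p)"
      have i: "int i = (v * j) mod int p"
        using p0 by (simp add: i_def)
      have "int p dvd int i * x - j"
      proof -
        have "int p dvd (int i - v * j) * x + (x * v - 1) * j"
          unfolding i using v by (intro dvd_add dvd_mult2 dvd_mod_diff) (simp add: cong_iff_dvd_diff)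
        then show ?thesis
          by (simp add: algebra_simps)
      qed
      then have "n dvd q * (int i * x - j)"
        using nqp by blast
      then have "n dvd (1 + q * int i) * x - (x + q * j)"
        by (simp add: algebra_simps)
      then have "c s ((1 + q * int i) * x) = c s (x + q * j)"
        by (rule per)
      moreover have "c s ((1 + q * int i) * 1) = c s 1"
        using fix_power[OF nqq qn, of s 1 i] True by (simp add: \<gamma>_def)
      then have "c s ((1 + q * int i) * x) = c s x"
        using mult_fix_iff[OF unit[of "int i"], of s x s 1] x(1) by (simp add: \<gamma>_def)
      ultimately show ?thesis
        using x(1) by simp
    qed
    \<comment> \<open>A class stable under the single translation by \<open>q\<close> would be
      invariant under the whole minimal subgroup.\<close>
    obtain t0 where t0: "?T t0" "\<not> ?T (t0 - q)"
      using rad_inv[OF min aq q_n, of s \<gamma>] not_inv by (auto simp: \<gamma>_def)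
    define A where "A \<delta> \<longleftrightarrow> (\<exists>s y. c s y = \<delta> \<and> powset p s \<gamma> y)" for \<delta>
    have A: "A (c s y) \<longleftrightarrow> powset p s \<gamma> y" for s y
      using powset_inv[OF p(1)] unfolding A_def by blast
    \<comment> \<open>The subgroup generated by \<open>powset\<close>: class elements with an
      incomplete fibre enter it after multiplication by \<open>p\<close>.\<close>
    obtain b where b: "asub b" "\<And>s x. A (c s x) \<Longrightarrow> b dvd x"
        "\<And>s b'. b' dvd n \<Longrightarrow> (\<And>x. A (c s x) \<Longrightarrow> b' dvd x) \<Longrightarrow> b' dvd b"
      using asub_gen[of A] by blast
    have bad: "b dvd int p * t" if "?T t" "\<not> ?T (t - q)" for t
    proof -
      have "\<not> p dvd fib p s \<gamma> t"
      proof
        assume "p dvd fib p s \<gamma> t"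
        then have "p \<le> fib p s \<gamma> t"
          using fib_pos[OF pn, of s t] that(1) by (auto dest: dvd_imp_le)
        then show False
          using fib_full[OF p0(1) pn, of s \<gamma> t "t - q"] that(2) by (simp add: q_def)
      qed
      then have "powset p s \<gamma> (int p * t)"
        using powset_fib[OF p0(1) pn] by blast
      then show ?thesis
        using b(2) A by blast
    qed
    \<comment> \<open>Fibres at elements prime to \<open>p\<close> are full by \<open>shift\<close>
      and contribute nothing to \<open>powset\<close>; multiples of \<open>p\<close> contribute
      multiples of \<open>p * p\<close>.\<close>
    have ppb: "int p * int p dvd b"
    proof (rule b(3)[of _ s])
      show ppn: "int p * int p dvd n"
        unfolding npq using pq by simp
      fix y assume "A (c s y)"
      then have y: "powset p s \<gamma> y"
        by (simp add: A)
      then obtain t where t: "?T t" "n dvd int p * t - y"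
        by (rule powsetD)
      have "powset p s \<gamma> (int p * t)"
        using powset_inv[OF p(1) per[OF t(2)]] y by blast
      then have nd: "\<not> p dvd fib p s \<gamma> t"
        using powset_fib[OF p0(1) pn] by blast
      have "int p dvd t"
      proof (rule ccontr)
        assume "\<not> int p dvd t"
        then have "?T z" if "q dvd z - t" for z
          using shift[OF t(1), of "(z - t) div q"] that by simp
        then have "fib p s \<gamma> t = cnt n (\<lambda>z. q dvd z - t)"
          unfolding fib_def q_def[symmetric] by (intro arg_cong[where f = "cnt n"]) auto
        also have "\<dots> = p"
          unfolding cnt_coset[OF n_pos q0 qn] by (subst npq) (use q0 in simp)
        finally show False
          using nd by simp
      qed
      then have "int p * int p dvd int p * t"
        by simp
      then show "int p * int p dvd y"
        using ppn t(2) by (meson dvd_trans zdvd_zdiffD dvd_diff_commute)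
    qed
    have b_class: "\<not> b dvd x" if "?T x" for x
    proof
      assume "b dvd x"
      then have "b dvd 1"
        using asub_dvdD[OF b(1), of s x s 1] that by (simp add: \<gamma>_def)
      then have "int p * int p dvd 1"
        using ppb dvd_trans by blast
      then have "int p dvd 1"
        using dvd_mult_left by blast
      then show False
        using p0(2) by simp
    qed
    define b' where "b' = b div int p"
    have bb': "b = int p * b'"
      using ppb dvd_mult_left unfolding b'_def by (metis dvd_mult_div_cancel)
    have pb': "int p dvd b'"
      using ppb p0(1) unfolding bb' by simp
    have b0: "b > 0" "b' > 0"
      using asub_pos[OF b(1)] bb' p0(1) by (auto simp: zero_less_mult_iff)
    have pb: "int p dvd b"
      using bb' by simp
    have bad': "b' dvd t" if "?T t" "\<not> ?T (t - q)" for t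
      using bad[OF that] p0(1) unfolding bb' by simp
    \<comment> \<open>Otherwise the two subgroups intersect trivially. Comparing orders, their sum
      then contains the multiples of \<open>b'\<close> and thus \<open>t0\<close>, hence also 1,
      although \<open>p\<close> divides its index.\<close>
    have ba: "b dvd a"
    proof -
      have "asub (lcm a b)"
        using asub_lcm a(1) b(1) by blast
      then have "lcm a b = a \<or> lcm a b = n"
        using min unfolding minsub_def by simp
      moreover have False if lcm: "lcm a b = n"
      proof -
        have "gcd a b * n = a * b"
          using prod_gcd_lcm_int[of a b] lcm an(2) b0(1) by simp
        then have "a * (gcd a b * h) = a * b"
          unfolding an(1) by (simp add: ac_simps)
        then have "gcd a b * h = b"
          using an(2) by simp
        then have "int p * (gcd a b * m') = int p * b'"
          using hm bb' by (simp add: ac_simps)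
        then have "gcd a b dvd b'"
          using p0(1) by (metis dvd_triv_left mult_cancel_left of_nat_0_less_iff less_irrefl)
        then have "gcd a b dvd t0"
          using bad'[OF t0] dvd_trans by blast
        then have "gcd a b dvd 1"
          using asub_dvdD[OF asub_gcd[OF a(1) b(1)], of s t0 s 1] t0(1) by (simp add: \<gamma>_def)
        moreover have "int p dvd gcd a b"
          using p(3) pb by simp
        ultimately have "int p dvd 1"
          by (rule dvd_trans[rotated])
        then show False
          using p0(2) by simp
      qed
      ultimately show ?thesis
        by (metis dvd_lcm2)
    qed
    have b'a: "b' dvd a"
      using ba bb' dvd_mult_left by (metis dvd_mult_right)
    obtain k0 where k0: "t0 = b' * k0"
      using bad'[OF t0] by blast
    have pk0: "\<not> int p dvd k0"
      using b_class[OF t0(1)] b0 unfolding k0 bb' by (auto simp: mult.commute)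
    define t where "t = cnt n ?T"
    define B where "B = cnt n (\<lambda>z. ?T z \<and> b' dvd z)"
    define \<mu> where "\<mu> = lam b s 1"
    have \<mu>: "cnt n (\<lambda>z. ?T z \<and> b dvd z - x) = \<mu>" if "?T x" for x
      using coset_count[OF b(1), of s x s 1 "\<lambda>\<alpha>. \<alpha> = \<gamma>"] that by (simp add: \<mu>_def lam_def \<gamma>_def)
    text \<open>At most half of the class lies in the subgroup generated by \<open>b'\<close>: each coset of the
      subgroup generated by \<open>b\<close> that the class meets there is matched with a coset of
      units.\<close>
    have half: "2 * B \<le> t"
    proof -
      define I where "I = {1..<int p}"
      have pI: "\<not> int p dvd k" if "k \<in> I" for k
        using that by (auto simp: I_def dest: zdvd_imp_le)
      have I_eq: "k = k'" if "k \<in> I" "k' \<in> I" "int p dvd k - k'" for k k'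
        using dvd_imp_eq[OF that(3)] that(1,2) by (auto simp: I_def)
      \<comment> \<open>With \<open>t0 = b' * k0\<close>, such a unit \<open>m\<close> sends
        \<open>t0\<close> into the coset of \<open>b' * k\<close> modulo \<open>b\<close>.\<close>
      have "\<exists>m. coprime m n \<and> int p dvd m * k0 - k" if k: "k \<in> I" for k
      proof -
        have "coprime k0 (int p)"
          using pk0 prime_imp_coprime[of "int p" k0] p(1) by (simp add: coprime_commute)
        then obtain v where v: "[k0 * v = 1] (mod int p)"
          using coprime_iff_invertible_int by blast
        then have "coprime v (int p)"
          by (metis coprime_iff_invertible_int mult.commute)
        moreover have "coprime k (int p)"
          using pI[OF k] prime_imp_coprime[of "int p" k] p(1) by (simp add: coprime_commute)
        ultimately have "coprime (k * v) (int p)"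
          by simp
        then obtain m where m: "int p dvd m - k * v" "coprime m n"
          by (rule unit_lift[OF n_pos pn])
        have "int p dvd (m - k * v) * k0 + (k0 * v - 1) * k"
          using m(1) v by (intro dvd_add dvd_mult2) (simp_all add: cong_iff_dvd_diff)
        then have "int p dvd m * k0 - k"
          by (simp add: algebra_simps)
        then show ?thesis
          using m(2) by blast
      qed
      then obtain m where m: "\<And>k. k \<in> I \<Longrightarrow> coprime (m k) n" "\<And>k. k \<in> I \<Longrightarrow> int p dvd m k * k0 - k"
        by metis
      have "B = (\<Sum>k\<in>I. cnt n (\<lambda>z. (?T z \<and> b' dvd z) \<and> b dvd z - b' * k))"
        unfolding B_def
      proof (rule cnt_sum)
        fix z assume z: "?T z \<and> b' dvd z"
        then obtain z1 where z1: "z = b' * z1"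
          by blast
        have iff: "b dvd z - b' * k \<longleftrightarrow> int p dvd z1 - k" for k
          unfolding z1 bb' using b0(2) by (simp add: right_diff_distrib[symmetric] mult.commute)
        have "\<not> int p dvd z1"
          using b_class[of z] z b0(2) unfolding z1 bb' by (auto simp: mult.commute)
        then have "z1 mod int p \<noteq> 0"
          by (simp add: dvd_eq_mod_eq_0)
        moreover have "z1 mod int p \<ge> 0" "z1 mod int p < int p"
          using p0 by simp_all
        ultimately have "z1 mod int p \<in> I"
          by (simp add: I_def)
        moreover have "int p dvd z1 - z1 mod int p"
          by (simp add: minus_mod_eq_mult_div)
        moreover have "k = z1 mod int p" if "k \<in> I" "int p dvd z1 - k" for k
        proof (rule I_eq[OF that(1) \<open>z1 mod int p \<in> I\<close>])
          show "int p dvd k - z1 mod int p"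
            using dvd_diff[OF \<open>int p dvd z1 - z1 mod int p\<close> that(2)] by simp
        qed
        ultimately show "\<exists>!k. k \<in> I \<and> b dvd z - b' * k"
          unfolding iff by blast
      qed (simp add: I_def)
      also have "\<dots> \<le> (\<Sum>k\<in>I. cnt n (\<lambda>z. ?T z \<and> b dvd z - m k))"
      proof (rule sum_mono)
        fix k assume k: "k \<in> I"
        show "cnt n (\<lambda>z. (?T z \<and> b' dvd z) \<and> b dvd z - b' * k) \<le> cnt n (\<lambda>z. ?T z \<and> b dvd z - m k)"
        proof (cases "\<exists>z. ?T z \<and> b dvd z - b' * k")
          case False
          then have "cnt n (\<lambda>z. (?T z \<and> b' dvd z) \<and> b dvd z - b' * k) = 0"
            by (auto simp: cnt_def)
          then show ?thesis by simp
        next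
          case True
          then obtain z where z: "?T z" "b dvd z - b' * k"
            by blast
          have "b dvd b' * (m k * k0 - k)"
            using m(2)[OF k] unfolding bb' by (simp add: mult.commute)
          then have mk: "b dvd m k * t0 - b' * k"
            unfolding k0 by (simp add: algebra_simps)
          have "b dvd z - m k * t0"
            using dvd_diff[OF z(2) mk] by simp
          \<comment> \<open>If the class meets the coset of \<open>m k * t0\<close>, it also meets
            that of \<open>m k\<close>, by a coset transfer; the two counts are then both
            \<open>\<mu>\<close>.\<close>
          moreover have "c s (m k * t0) = c s (m k * 1)"
            using mult[OF m(1)[OF k], of s t0 s 1] t0(1) by (simp add: \<gamma>_def)
          ultimately obtain y where y: "c s y = c s z" "b dvd y - m k * 1"
            using coset_transfer[OF b(1)] by blast
          have "cnt n (\<lambda>z. (?T z \<and> b' dvd z) \<and> b dvd z - b' * k) \<le> cnt n (\<lambda>w. ?T w \<and> b dvd w - b' * k)"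
            by (rule cnt_mono) simp
          also have "\<dots> = cnt n (\<lambda>w. ?T w \<and> b dvd w - z)"
            using coset_shift[OF z(2)] by (intro arg_cong[where f = "cnt n"]) auto
          also have "\<dots> = cnt n (\<lambda>w. ?T w \<and> b dvd w - y)"
            using \<mu> z(1) y(1) by simp
          also have "\<dots> = cnt n (\<lambda>w. ?T w \<and> b dvd w - m k)"
            using coset_shift[OF y(2)] by (intro arg_cong[where f = "cnt n"]) auto
          finally show ?thesis .
        qed
      qed
      also have "\<dots> = (\<Sum>k\<in>I. cnt n (\<lambda>z. (?T z \<and> (\<exists>k\<in>I. b dvd z - m k)) \<and> b dvd z - m k))"
        by (intro sum.cong refl arg_cong[where f = "cnt n"]) auto
      also have "\<dots> = cnt n (\<lambda>z. ?T z \<and> (\<exists>k\<in>I. b dvd z - m k))"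
      proof (rule cnt_sum[symmetric])
        fix z assume "?T z \<and> (\<exists>k\<in>I. b dvd z - m k)"
        moreover have "k = k'" if "k \<in> I" "k' \<in> I" "b dvd z - m k" "b dvd z - m k'" for k k'
        proof (rule I_eq[OF that(1,2)])
          have "int p dvd m k - m k'"
            using dvd_diff[OF that(4,3)] pb dvd_trans by auto
          then have "int p dvd (m k - m k') * k0 - (m k * k0 - k) + (m k' * k0 - k')"
            by (rule dvd_add[OF dvd_diff[OF dvd_mult2] m(2)]) (use m(2) that(1,2) in simp_all)
          then show "int p dvd k - k'"
            by (simp add: algebra_simps)
        qed
        ultimately show "\<exists>!k. k \<in> I \<and> b dvd z - m k"
          by blast
      qed (simp add: I_def)
      also have "\<dots> \<le> cnt n (\<lambda>z. ?T z \<and> \<not> b' dvd z)"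
      proof (rule cnt_mono)
        fix z assume z: "?T z \<and> (\<exists>k\<in>I. b dvd z - m k)"
        then obtain k where k: "k \<in> I" "b dvd z - m k"
          by blast
        have "\<not> b' dvd z"
        proof
          assume "b' dvd z"
          then have "int p dvd z"
            using pb' dvd_trans by blast
          then have "int p dvd m k"
            using dvd_diff[of "int p" z "z - m k"] k(2) pb dvd_trans by auto
          then have "int p dvd m k * k0 - (m k * k0 - k)"
            using m(2)[OF k(1)] by (rule dvd_diff[OF dvd_mult2])
          then show False
            using pI[OF k(1)] by simp
        qed
        then show "?T z \<and> \<not> b' dvd z"
          using z by blast
      qed
      finally have "B \<le> cnt n (\<lambda>z. ?T z \<and> \<not> b' dvd z)" .
      then show ?thesis
        using cnt_split[of n ?T "\<lambda>z. b' dvd z"] by (simp add: t_def B_def)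
    qed
    define L where "L = lam a s 1"
    define H where "H = nat h"
    let ?N = "\<lambda>z. ?T z \<and> \<not> ?T (z - q)"
    define N where "N = cnt n ?N"
    define \<kappa> where "\<kappa> = cnt n (\<lambda>z. ?T z \<and> ?T (z - q))"
    have L: "cnt n (\<lambda>z. ?T z \<and> a dvd z - x) = L" if "?T x" for x
      using coset_count[OF a(1), of s x s 1 "\<lambda>\<alpha>. \<alpha> = \<gamma>"] that by (simp add: L_def lam_def \<gamma>_def)
    have t_eq: "t = \<kappa> + N"
      unfolding t_def \<kappa>_def N_def by (rule cnt_split)
    have pairs: "t + (H - 1) * \<kappa> = t * L"
      using mono_pair_count[OF a(1) m aq q_n, of s 1] by (simp add: t_def \<kappa>_def L_def \<gamma>_def H_def h_def)
    have NB: "N \<le> B"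
      unfolding N_def B_def using bad' by (intro cnt_mono) blast
    have LH: "L < H"
    proof (rule ccontr)
      assume "\<not> L < H"
      then have "nat (n div a) \<le> lam a s t0"
        using lam_cong[OF a(1), of s t0 s 1] t0(1) by (simp add: L_def H_def h_def \<gamma>_def)
      then have "c s (t0 - q) = c s t0"
        by (rule lam_full[OF a(1)]) (use aq in simp)
      then show False
        using t0 by simp
    qed
    \<comment> \<open>Pairs of a spoiling element \<open>z\<close> and a class element
      \<open>x\<close> in a common coset. Each \<open>z\<close> has \<open>L\<close> partners; for
      fixed \<open>x\<close>, which lies in the multiples of \<open>b'\<close>, translation by
      \<open>-q\<close> sends the possible \<open>z\<close> injectively to the \<open>H - L\<close>
      points of the coset outside the class.\<close>
    have "L * N \<le> B * (H - L)"
    proof -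
      have "L * N = (\<Sum>z | z \<in> {0..<n} \<and> ?N z. cnt n (\<lambda>x. ?T x \<and> a dvd x - z))"
        unfolding N_def by (subst sum_const_cnt[where k = L]) (use L in auto)
      also have "\<dots> = (\<Sum>x | x \<in> {0..<n} \<and> ?T x. cnt n (\<lambda>z. ?N z \<and> a dvd x - z))"
        by (rule sum_cnt_swap[symmetric])
      also have "\<dots> \<le> (\<Sum>x | x \<in> {0..<n} \<and> ?T x. if b' dvd x then H - L else 0)"
      proof (rule sum_mono)
        fix x assume "x \<in> {x. x \<in> {0..<n} \<and> ?T x}"
        then have x: "?T x" by simp
        show "cnt n (\<lambda>z. ?N z \<and> a dvd x - z) \<le> (if b' dvd x then H - L else 0)"
        proof (cases "b' dvd x")
          case True
          have "cnt n (\<lambda>z. ?N z \<and> a dvd x - z) \<le> cnt n (\<lambda>z. c s z \<noteq> \<gamma> \<and> a dvd z - x)"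
          proof (rule cnt_inj_le[OF n_pos, where f = "\<lambda>z. z - q"])
            show "per n (\<lambda>z. c s z \<noteq> \<gamma> \<and> a dvd z - x)"
              by (rule per_coset[OF an(3), of "\<lambda>\<alpha>. \<alpha> \<noteq> \<gamma>"])
            fix z assume z: "?N z \<and> a dvd x - z"
            then have "a dvd - (x - z) - q"
              using aq by (intro dvd_diff) (simp_all only: dvd_minus_iff)
            then show "c s (z - q) \<noteq> \<gamma> \<and> a dvd z - q - x"
              using z by (simp add: algebra_simps)
          qed simp
          also have "\<dots> = H - L"
            using coset_split[OF a(1), of "\<lambda>\<alpha>. \<alpha> = \<gamma>" s x] L[OF x] by (simp add: H_def h_def)
          finally show ?thesis
            using True by simp
        next
          case False
          have "\<not> (?N z \<and> a dvd x - z)" for z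
          proof
            assume z: "?N z \<and> a dvd x - z"
            then have "b' dvd (x - z) + z"
              using bad'[of z] b'a dvd_trans by (intro dvd_add) blast+
            then show False
              using False by simp
          qed
          then have "{z \<in> {0..<n}. ?N z \<and> a dvd x - z} = {}"
            by blast
          then show ?thesis
            unfolding cnt_def by (simp only: card.empty)
        qed
      qed
      also have "\<dots> = (\<Sum>x | x \<in> {0..<n} \<and> (?T x \<and> b' dvd x). H - L)"
        by (rule sum_residues_filter[symmetric])
      also have "\<dots> = B * (H - L)"
        by (simp add: B_def cnt_def)
      finally show ?thesis .
    qed
    then have "int L * int N \<le> int B * (int H - int L)"
      using LH by (metis of_nat_diff less_imp_le of_nat_mult of_nat_le_iff)
    moreover have "t > 0"
      unfolding t_def using cnt_pos[OF n_pos per_c[of "\<lambda>\<alpha>. \<alpha> = \<gamma>" s]] by (auto simp: \<gamma>_def)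
    moreover have "L > 0"
      unfolding L_def by (rule lam_pos[OF an(3)])
    moreover have "int t + (int H - 1) * int \<kappa> = int t * int L"
      using arg_cong[OF pairs, of int] LH by (simp add: of_nat_diff)
    moreover have "int t = int \<kappa> + int N"
      using t_eq by simp
    moreover have "int N \<le> int B" "int L < int H" "2 * int B \<le> int t"
      using NB LH half by simp_all
    ultimately show False
      by (intro half_class_contradiction[of "int t" "int \<kappa>" "int N" "int H" "int L" "int B"]) simp_all
  qed
qed

end

section \<open>Coprime order and index: tensor products\<close>

text \<open>The Chinese remainder idempotent: modulo \<open>a * h\<close>, \<open>E\<close> projects
  onto the multiples of \<open>h\<close> along the multiples of \<open>a\<close>.\<close>

lemma coprime_projection:
  assumes "coprime a (h::int)"
  obtains E where "a dvd E - 1" and "h dvd E"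
proof -
  obtain u v where "u * a + v * h = 1"
    using assms bezout_int[of a h] by auto
  then have "v * h - 1 = a * (- u)"
    by (simp add: algebra_simps)
  then show ?thesis
    using that[of "v * h"] by simp
qed

lemma dvd_mult_coprime: "n = a * h \<Longrightarrow> coprime a h \<Longrightarrow> a dvd x \<Longrightarrow> h dvd (x::int) \<Longrightarrow> n dvd x"
  by (simp add: divides_mult)

context sring
begin

lemma coset_unique:
  assumes "a dvd n" and "cnt n (\<lambda>z. A (c s z) \<and> a dvd z - x) = 1"
    and "A (c s y)" and "a dvd y - x" and "A (c s y')" and "a dvd y' - x"
  shows "n dvd y - y'"
  by (rule cnt_one_unique[OF n_pos per_coset[OF assms(1), of A] assms(2)]) (simp_all add: assms)

text \<open>A coset of \<open>a\<close> that meets the class misses it in one point only. This is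
  the projection by \<open>E\<close>, since it lies in the subgroup of multiples of
  \<open>h\<close>, which the class avoids.\<close>

lemma tensor_class:
  assumes a: "asub a" and n: "n = a * h" and cop: "coprime a h" and h: "asub h" "\<not> h dvd g"
    and lam: "int (lam a s g) = h - 1" and E: "a dvd E - 1" "h dvd E"
  shows "\<exists>\<delta>. \<forall>s' x. c s' x = c s g \<longleftrightarrow> \<not> h dvd x \<and> c s' (E * x) = \<delta>"
proof -
  define \<gamma> where "\<gamma> = c s g"
  have a0: "a > 0"
    by (rule asub_pos[OF a])
  have nh: "n div a = h"
    using n a0 by simp
  have aE: "a dvd E * x - x" for x
    using dvd_mult2[OF E(1), of x] by (simp add: algebra_simps)
  have hE: "h dvd E * x" for x
    using E(2) by simp
  have other: "cnt n (\<lambda>z. c s z \<noteq> \<gamma> \<and> a dvd z - g) = 1"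
    using coset_split[OF a, of "\<lambda>\<alpha>. \<alpha> = \<gamma>" s g] lam unfolding lam_def nh \<gamma>_def by linarith
  have "c s (E * g) \<noteq> \<gamma>"
    using asub_dvdD[OF h(1), of s "E * g" s g] hE h(2) unfolding \<gamma>_def by blast
  define \<delta> where "\<delta> = c s (E * g)"
  have "c s' x = \<gamma> \<longleftrightarrow> \<not> h dvd x \<and> c s' (E * x) = \<delta>" for s' x
  proof (intro iffI conjI)
    assume x: "c s' x = \<gamma>"
    then show "\<not> h dvd x"
      using asub_dvdD[OF h(1), of s' x s g] h(2) unfolding \<gamma>_def by blast
    have "c s g = c s' x"
      using x by (simp add: \<gamma>_def)
    then obtain y where y: "c s' y = c s (E * g)" "a dvd y - x"
      using coset_transfer[OF a _ aE] by blast
    have "h dvd y"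
      by (rule asub_dvdD[OF h(1) y(1)[symmetric]]) (rule hE)
    then have "n dvd E * x - y"
      using dvd_diff[OF aE[of x] y(2)] hE[of x] by (intro dvd_mult_coprime[OF n cop]) simp_all
    then show "c s' (E * x) = \<delta>"
      using per y(1) by (simp add: \<delta>_def)
  next
    assume x: "\<not> h dvd x \<and> c s' (E * x) = \<delta>"
    show "c s' x = \<gamma>"
    proof (rule ccontr)
      assume neq: "c s' x \<noteq> \<gamma>"
      have "cnt n (\<lambda>z. c s' z \<noteq> \<gamma> \<and> a dvd z - E * x) = cnt n (\<lambda>z. c s z \<noteq> \<gamma> \<and> a dvd z - E * g)"
        by (rule coset_count[OF a, of _ _ _ _ "\<lambda>\<alpha>. \<alpha> \<noteq> \<gamma>"]) (use x in \<open>simp add: \<delta>_def\<close>)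
      also have "\<dots> = cnt n (\<lambda>z. c s z \<noteq> \<gamma> \<and> a dvd z - g)"
        using coset_shift[OF aE[of g]] by (intro arg_cong[where f = "cnt n"]) auto
      finally have one: "cnt n (\<lambda>z. c s' z \<noteq> \<gamma> \<and> a dvd z - E * x) = 1"
        using other by simp
      have "n dvd x - E * x"
      proof (rule cnt_one_unique[OF n_pos per_coset[OF asub_dvd[OF a], of "\<lambda>\<alpha>. \<alpha> \<noteq> \<gamma>"] one])
        show "c s' x \<noteq> \<gamma> \<and> a dvd x - E * x"
          using neq aE[of x] by (simp add: dvd_diff_commute)
        show "c s' (E * x) \<noteq> \<gamma> \<and> a dvd E * x - E * x"
          using x \<open>c s (E * g) \<noteq> \<gamma>\<close> by (simp add: \<delta>_def)
      qed
      then have "h dvd x - E * x + E * x"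
        using n hE[of x] by (intro dvd_add) (auto dest: dvd_mult_right)
      then show False
        using x by simp
    qed
  qed
  then show ?thesis
    unfolding \<gamma>_def by blast
qed

lemma minsub_facts:
  assumes "minsub a"
  shows "asub a" and "a > 0" and "n = a * (n div a)" and "n div a > 1" and "\<not> n dvd a" and "a dvd n"
proof -
  show a: "asub a"
    using assms by (simp add: minsub_def)
  show a0: "a > 0" and an: "a dvd n"
    using asub_pos[OF a] asub_dvd[OF a] .
  then show n: "n = a * (n div a)"
    by simp
  have "a \<noteq> n"
    using assms by (simp add: minsub_def)
  then have "a < n"
    using zdvd_imp_le[OF an n_pos] by simp
  then show "\<not> n dvd a"
    using a0 by (auto dest: zdvd_imp_le)
  have "n div a > 0" "n div a \<noteq> 1"
    using n n_pos a0 \<open>a \<noteq> n\<close> by (metis zero_less_mult_pos, auto)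
  then show "n div a > 1"
    by simp
qed

lemma lam_full_cinv:
  assumes "minsub a" and "int (lam a s x) = n div a"
  shows "cinv a (c s x)"
proof (rule rad_inv[OF assms(1), of a s])
  note f = minsub_facts[OF assms(1)]
  show "\<not> n dvd a"
    by (rule f(5))
  fix z assume z: "c s z = c s x"
  have "nat (n div a) \<le> lam a s z"
    using lam_cong[OF f(1) z] assms(2) by simp
  then have "c s (z - a) = c s z"
    by (rule lam_full[OF f(1)]) simp
  then show "c s (z - a) = c s x"
    using z by simp
qed simp

lemma composite_facts:
  assumes "(h::int) > 1" and "\<not> prime h"
  shows "h > 3" and "prime p \<Longrightarrow> p dvd h \<Longrightarrow> h \<noteq> p" and "prime p \<Longrightarrow> p dvd h \<Longrightarrow> \<not> h dvd p"
proof -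
  have "h \<noteq> 2" "h \<noteq> 3"
    using assms(2) by auto
  then show "h > 3"
    using assms(1) by simp
  show ne: "h \<noteq> p" if "prime p" for p
    using that assms(2) by auto
  show "\<not> h dvd p" if "prime p" "p dvd h"
  proof
    assume "h dvd p"
    then have "h = p"
      using that(2) assms(1) prime_ge_0_int[OF that(1)] by (intro zdvd_antisym_nonneg) auto
    then show False
      using ne[OF that(1)] by simp
  qed
qed

text \<open>\<open>lam_cases\<close> leaves 1 and \<open>h - 1\<close>. The value 1 would give both
  \<open>g\<close> and its projection a fibre of size 1, against \<open>fib_partial_unique\<close>.
  For \<open>h - 1\<close>, the class of the one missing point of the coset generates the
  complement, after doubling if \<open>h\<close> is even.\<close>

lemma coprime_composite_class:
  assumes min: "minsub a" and composite: "\<not> prime (n div a)" and cop: "coprime a (n div a)"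
    and g: "coprime g n" and not_inv: "\<not> cinv a (c s g)"
  shows "asub (n div a)" and "int (lam a s g) = n div a - 1"
proof -
  define h where "h = n div a"
  define \<gamma> where "\<gamma> = c s g"
  note f = minsub_facts[OF min]
  have n: "n = a * h"
    using f(3) by (simp add: h_def)
  have h1: "h > 1"
    using f(4) by (simp add: h_def)
  have m: "mchr a"
    by (rule minsub_mono[OF min composite])
  have h: "h > 3" "\<And>p. prime p \<Longrightarrow> p dvd h \<Longrightarrow> h \<noteq> p" "\<And>p. prime p \<Longrightarrow> p dvd h \<Longrightarrow> \<not> h dvd p"
    using composite_facts[OF h1] composite by (auto simp: h_def)
  have cop': "coprime a h"
    using cop by (simp add: h_def)
  obtain E where E: "a dvd E - 1" "h dvd E"
    by (rule coprime_projection[OF cop'])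
  have aE: "a dvd E * x - x" for x
    using dvd_mult2[OF E(1), of x] by (simp add: algebra_simps)
  have hE: "h dvd E * x" for x
    using E(2) by simp
  have gh: "coprime g h"
    using g n by simp
  have hn: "h dvd n"
    using n by simp
  text \<open>The unit \<open>v\<close> acts as the identity modulo \<open>a\<close> and as negation modulo \<open>h\<close>.\<close>
  define v where "v = 2 * E - 1"
  have v: "a dvd v * x - x" "h dvd v * x + x" for x
  proof -
    have "v * x - x = 2 * (E * x - x)" "v * x + x = 2 * (E * x)"
      by (simp_all add: v_def algebra_simps)
    then show "a dvd v * x - x" "h dvd v * x + x"
      using aE[of x] hE[of x] by (metis dvd_mult)+
  qed
  have "n dvd v * v - 1"
  proof (rule dvd_mult_coprime[OF n cop'])
    show "a dvd v * v - 1"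
      using dvd_add[OF v(1)[of v] v(1)[of 1]] by simp
    show "h dvd v * v - 1"
      using dvd_diff[OF v(2)[of v] v(2)[of 1]] by simp
  qed
  then have v_unit: "coprime v n"
    using coprime_iff_invertible_int[of v n] by (auto simp: cong_iff_dvd_diff)
  obtain p where p: "prime p" "int p dvd h"
  proof -
    have "nat h \<noteq> 1"
      using h1 by simp
    then obtain p where "prime p" "p dvd nat h"
      using prime_factor_nat by blast
    then show ?thesis
      using that h1 by (metis int_dvd_int_iff int_nat_eq less_imp_le less_trans zero_less_one)
  qed
  have pa: "\<not> int p dvd a"
    using cop' p by (metis coprime_common_divisor prime_nat_int_transfer not_prime_unit)
  have php: "h \<noteq> int p" "\<not> h dvd int p"
    using h(2,3)[of "int p"] p by simp_all
  have p0: "p > 0" and pn: "int p dvd n"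
    using prime_gt_0_nat[OF p(1)] p(2) n by auto
  have cases: "lam a s x = 1 \<or> int (lam a s x) = h - 1 \<or> int (lam a s x) = h" for x
    using lam_cases[OF f(1) m p(1) _ pa] p(2) php(1) unfolding h_def by blast
  have aq: "a dvd n div int p"
  proof -
    obtain m' where "h = int p * m'"
      using p(2) by blast
    then have "n = int p * (a * m')"
      using n by simp
    then show ?thesis
      using p0 by simp
  qed
  have pow1: "powset p s (c s x) (int p * x)" if "lam a s x = 1" for x
  proof -
    have "fib p s (c s x) x \<le> lam a s x"
      unfolding fib_def lam_def using aq dvd_trans by (intro cnt_mono) blast
    moreover have "fib p s (c s x) x > 0"
      by (rule fib_pos[OF pn])
    ultimately have "fib p s (c s x) x = 1"
      using that by simp
    then show ?thesis
      using powset_fib[OF p0 pn, of s "c s x" x] p(1) by auto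
  qed
  have lam_ne_1: "lam a s g \<noteq> 1"
  proof
    assume lam1: "lam a s g = 1"
    define e where "e = E * g"
    have ge: "a dvd g - e"
      using aE[of g] by (simp add: e_def dvd_diff_commute)
    have nge: "\<not> h dvd int p * (g - e)"
    proof
      assume "h dvd int p * (g - e)"
      then have "h dvd int p * (g - e) + int p * e"
        by (rule dvd_add) (simp add: e_def hE)
      then have "h dvd int p * g"
        by (simp add: algebra_simps)
      then show False
        using gh php(2) by (simp add: coprime_commute coprime_dvd_mult_left_iff)
    qed
    have "c s e \<noteq> \<gamma>"
    proof
      assume e: "c s e = \<gamma>"
      have one: "cnt n (\<lambda>z. c s z = \<gamma> \<and> a dvd z - g) = 1"
        using lam1 by (simp add: lam_def \<gamma>_def)
      have "n dvd g - e"
      proof (rule cnt_one_unique[OF n_pos per_coset[OF f(6), of "\<lambda>\<alpha>. \<alpha> = \<gamma>"] one])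
        show "c s g = \<gamma> \<and> a dvd g - g"
          by (simp add: \<gamma>_def)
        show "c s e = \<gamma> \<and> a dvd e - g"
          using e ge dvd_diff_commute by blast
      qed
      then have "n dvd int p * (g - e)"
        by simp
      then show False
        using nge hn dvd_trans by blast
    qed
    have "lam a s e = 1"
    proof (rule ccontr)
      assume "lam a s e \<noteq> 1"
      then have big: "int (lam a s e) \<ge> h - 1"
        using cases[of e] by auto
      have ve: "c s (v * e) = c s e"
      proof (rule per, rule dvd_mult_coprime[OF n cop' v(1)])
        have "h dvd (v * e + e) - 2 * e"
          using hE[of g] by (intro dvd_diff v(2) dvd_mult) (simp add: e_def)
        then show "h dvd v * e - e"
          by (simp add: algebra_simps)
      qed
      have "cnt n (\<lambda>z. c s z \<noteq> c s e \<and> a dvd z - e) \<le> 1"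
        using coset_split[OF f(1), of "\<lambda>\<alpha>. \<alpha> = c s e" s e] big h1 unfolding lam_def h_def by linarith
      moreover have "cnt n (\<lambda>z. c s z \<noteq> c s e \<and> a dvd z - e) > 0"
        unfolding cnt_pos[OF n_pos per_coset[OF f(6), of "\<lambda>\<alpha>. \<alpha> \<noteq> c s e" s e]]
        using ge \<open>c s e \<noteq> \<gamma>\<close> unfolding \<gamma>_def by metis
      ultimately have one: "cnt n (\<lambda>z. c s z \<noteq> c s e \<and> a dvd z - e) = 1"
        by simp
      have vg: "a dvd v * g - e"
        using dvd_add[OF v(1)[of g] ge] by simp
      \<comment> \<open>\<open>g\<close> would be the only point of the coset outside the class of
        \<open>e\<close>, while \<open>v * g\<close> is another point, as \<open>h\<close> does not
        divide 2. Since \<open>v\<close> fixes \<open>e\<close>, this would put \<open>g\<close>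
        into the class of \<open>e\<close>.\<close>
      have "c s (v * g) = c s e"
      proof (rule ccontr)
        assume "c s (v * g) \<noteq> c s e"
        then have "n dvd v * g - g"
          by (rule coset_unique[OF f(6), of "\<lambda>\<alpha>. \<alpha> \<noteq> c s e", OF one _ vg _ ge])
            (use \<open>c s e \<noteq> \<gamma>\<close> in \<open>simp add: \<gamma>_def\<close>)
        from dvd_diff[OF v(2) dvd_trans[OF hn this]] have "h dvd (v * g + g) - (v * g - g)" .
        then have "h dvd 2 * g"
          by simp
        then have "h dvd 2"
          using gh by (simp add: coprime_commute coprime_dvd_mult_left_iff)
        then show False
          using h(1) by (auto dest: zdvd_imp_le)
      qed
      then have "c s (v * g) = c s (v * e)"
        using ve by simp
      then have "c s g = c s e"
        using mult_iff[OF v_unit] by blast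
      then show False
        using \<open>c s e \<noteq> \<gamma>\<close> by (simp add: \<gamma>_def)
    qed
    then have "n dvd int p * (g - e)"
      using fib_partial_unique[OF f(1) m p(1) pn pa ge pow1[OF lam1] pow1] by blast
    then show False
      using nge hn dvd_trans by blast
  qed
  have "int (lam a s g) \<noteq> h"
    using lam_full_cinv[OF min, of s g] not_inv by (auto simp: h_def)
  then have lam: "int (lam a s g) = h - 1"
    using cases[of g] lam_ne_1 by blast
  then show "int (lam a s g) = n div a - 1"
    by (simp add: h_def)
  have other: "cnt n (\<lambda>z. c s z \<noteq> \<gamma> \<and> a dvd z - g) = 1"
    using coset_split[OF f(1), of "\<lambda>\<alpha>. \<alpha> = \<gamma>" s g] lam unfolding lam_def h_def \<gamma>_def by linarith
  then obtain z0 where z0: "c s z0 \<noteq> \<gamma>" "a dvd z0 - g"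
    using cnt_pos[OF n_pos per_coset[OF f(6), of "\<lambda>\<alpha>. \<alpha> \<noteq> \<gamma>" s g]] by auto
  define \<delta> where "\<delta> = c s z0"
  have uniq: "n dvd x - z0" if "c s x \<noteq> \<gamma>" "a dvd x - g" for x
    by (rule coset_unique[OF f(6), of "\<lambda>\<alpha>. \<alpha> \<noteq> \<gamma>", OF other that z0])
  text \<open>The remaining point \<open>z0\<close> of the coset is fixed by \<open>v\<close>, so twice it lies in the
    complementary subgroup.\<close>
  have v_z0: "n dvd v * z0 - z0"
  proof -
    have az0: "a dvd v * z0 - g"
      using dvd_add[OF v(1)[of z0] z0(2)] by simp
    \<comment> \<open>At most one class element of the coset is sent to \<open>z0\<close> by
      \<open>v\<close>, so some class element stays in the class. If \<open>v * z0\<close> were in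
      the class too, the multiplier \<open>v\<close> would put \<open>z0\<close> there.\<close>
    have "c s (v * z0) \<noteq> \<gamma>"
    proof
      assume vz0: "c s (v * z0) = \<gamma>"
      have vv: "n dvd v * (v * y) - y" for y
        using dvd_mult2[OF \<open>n dvd v * v - 1\<close>, of y] by (simp add: algebra_simps)
      have "cnt n (\<lambda>z. (c s z = \<gamma> \<and> a dvd z - g) \<and> n dvd z - v * z0) \<le> 1"
        unfolding cnt_single[OF n_pos, of "v * z0", symmetric] by (rule cnt_mono) blast
      moreover have "int (cnt n (\<lambda>z. c s z = \<gamma> \<and> a dvd z - g)) = h - 1"
        using lam by (simp add: lam_def \<gamma>_def)
      ultimately have "cnt n (\<lambda>z. (c s z = \<gamma> \<and> a dvd z - g) \<and> \<not> n dvd z - v * z0) > 0"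
        using cnt_split[of n "\<lambda>z. c s z = \<gamma> \<and> a dvd z - g" "\<lambda>z. n dvd z - v * z0"] h(1) by linarith
      then have "{z \<in> {0..<n}. (c s z = \<gamma> \<and> a dvd z - g) \<and> \<not> n dvd z - v * z0} \<noteq> {}"
        unfolding cnt_def by (metis card.empty less_irrefl)
      then obtain x where x: "c s x = \<gamma>" "a dvd x - g" "\<not> n dvd x - v * z0"
        by blast
      have "c s (v * x) = \<gamma>"
      proof (rule ccontr)
        assume "c s (v * x) \<noteq> \<gamma>"
        moreover have "a dvd v * x - g"
          using dvd_add[OF v(1)[of x] x(2)] by simp
        ultimately have "n dvd v * x - z0"
          using uniq by blast
        then have "n dvd v * (v * x) - v * z0"
          using dvd_mult[of n "v * x - z0" v] by (simp add: right_diff_distrib)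
        then have "n dvd (v * (v * x) - v * z0) - (v * (v * x) - x)"
          by (rule dvd_diff[OF _ vv])
        then show False
          using x(3) by simp
      qed
      then have "\<exists>x. c s x = \<gamma> \<and> c s (v * x) = \<gamma>"
        using x(1) by blast
      then obtain x where "c s x = \<gamma>" "c s (v * x) = \<gamma>"
        by blast
      then have "c s (v * z0) = c s (v * x)"
        using vz0 by simp
      then show False
        using mult_iff[OF v_unit] z0(1) \<open>c s x = \<gamma>\<close> by metis
    qed
    then show ?thesis
      using uniq az0 by blast
  qed
  have v_\<delta>: "h dvd 2 * t" if t: "c s' t = \<delta>" for s' t
  proof -
    have "c s' (v * t) = c s' t"
      using mult_fix_iff[OF v_unit, of s z0 s' t] per[OF v_z0] t by (simp add: \<delta>_def)
    moreover have "cnt n (\<lambda>z. c s' z = \<delta> \<and> a dvd z - t) = cnt n (\<lambda>z. c s z = \<delta> \<and> a dvd z - z0)"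
      by (rule coset_count[OF f(1), of _ _ _ _ "\<lambda>\<alpha>. \<alpha> = \<delta>"]) (use t in \<open>simp add: \<delta>_def\<close>)
    moreover have "\<dots> = cnt n (\<lambda>z. n dvd z - z0)"
    proof (intro arg_cong[where f = "cnt n"] ext iffI conjI)
      fix z
      assume "c s z = \<delta> \<and> a dvd z - z0"
      then show "n dvd z - z0"
        using uniq[of z] z0 dvd_add[of a "z - z0" "z0 - g"] by (simp add: \<delta>_def)
    next
      fix z
      assume z: "n dvd z - z0"
      then show "c s z = \<delta>"
        using per by (simp add: \<delta>_def)
      show "a dvd z - z0"
        using z f(6) dvd_trans by blast
    qed
    ultimately have one: "cnt n (\<lambda>z. c s' z = \<delta> \<and> a dvd z - t) = 1" and "c s' (v * t) = \<delta>"
      using cnt_single[OF n_pos, of z0] t by simp_all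
    have "n dvd v * t - t"
      by (rule coset_unique[OF f(6), of "\<lambda>\<alpha>. \<alpha> = \<delta>", OF one \<open>c s' (v * t) = \<delta>\<close> v(1) t]) simp
    from dvd_diff[OF v(2) dvd_trans[OF hn this]] have "h dvd (v * t + t) - (v * t - t)" .
    then show ?thesis
      by simp
  qed
  have z0a: "coprime z0 a"
  proof -
    have "coprime g a"
      using g n by simp
    moreover have "[z0 = g] (mod a)"
      using z0(2) by (simp add: cong_iff_dvd_diff)
    ultimately show ?thesis
      using cong_imp_coprime cong_sym by blast
  qed
  \<comment> \<open>The cofactor of \<open>h\<close> in \<open>b\<close> divides \<open>a\<close>,
    and divides \<open>z0\<close> up to a factor 2; as \<open>z0\<close> is prime to
    \<open>a\<close>, the cofactor is 1.\<close>
  have gen: "asub h" if b: "asub b" "h dvd b" "b dvd 2 * z0" "coprime 2 a \<or> b dvd z0" for b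
  proof -
    obtain b1 where b1: "b = h * b1"
      using b(2) by blast
    have "b1 dvd a"
      using asub_dvd[OF b(1)] h1 unfolding b1 n by (simp add: mult.commute)
    moreover have "coprime a b \<or> coprime b1 a"
    proof -
      have "b1 dvd 2 * z0" "b dvd z0 \<Longrightarrow> b1 dvd z0"
        using b(3) unfolding b1 by (auto dest: dvd_mult_right)
      moreover have "coprime (2 * z0) a" if "coprime 2 a"
        using that z0a by simp
      ultimately show ?thesis
        using b(4) z0a coprime_divisors dvd_refl by blast
    qed
    ultimately have "is_unit b1"
      unfolding b1 by (metis coprime_absorb_left coprime_commute coprime_mult_left_iff coprime_mult_right_iff coprime_self coprime_divisors dvd_refl)
    moreover have "b1 > 0"
      using asub_pos[OF b(1)] h1 unfolding b1 by (simp add: zero_less_mult_iff)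
    ultimately show ?thesis
      using b(1) b1 by simp
  qed
  have "asub h"
  proof (cases "even h")
    case False
    then have h\<delta>: "h dvd t" if "c s' t = \<delta>" for s' t
      using v_\<delta>[OF that] by (simp add: coprime_dvd_mult_right_iff)
    obtain b where b: "asub b" "\<And>s x. c s x = \<delta> \<Longrightarrow> b dvd x"
        "\<And>s b'. b' dvd n \<Longrightarrow> (\<And>x. c s x = \<delta> \<Longrightarrow> b' dvd x) \<Longrightarrow> b' dvd b"
      using asub_gen[of "\<lambda>\<alpha>. \<alpha> = \<delta>"] by blast
    show ?thesis
    proof (rule gen[OF b(1)])
      show "h dvd b"
        using b(3)[OF hn] h\<delta> by blast
      have "b dvd z0"
        using b(2) by (simp add: \<delta>_def)
      then show "b dvd 2 * z0" "coprime 2 a \<or> b dvd z0"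
        by simp_all
    qed
  next
    case True
    then have a2: "coprime 2 a"
      using cop' by (metis coprime_commute coprime_divisors dvd_refl)
    have n2: "int 2 dvd n"
      using True n by simp
    \<comment> \<open>For even \<open>h\<close>, only the doubles of elements of class
      \<open>\<delta>\<close> are known to be multiples of \<open>h\<close>, so Schur's theorem for
      the prime 2 takes the place of the class itself.\<close>
    define A where "A \<alpha> \<longleftrightarrow> (\<exists>s y. c s y = \<alpha> \<and> powset 2 s \<delta> y)" for \<alpha>
    have A: "A (c s y) \<longleftrightarrow> powset 2 s \<delta> y" for s y
      using powset_inv[OF two_is_prime_nat] unfolding A_def by blast
    obtain b where b: "asub b" "\<And>s x. A (c s x) \<Longrightarrow> b dvd x"
        "\<And>s b'. b' dvd n \<Longrightarrow> (\<And>x. A (c s x) \<Longrightarrow> b' dvd x) \<Longrightarrow> b' dvd b"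
      using asub_gen[of A] by blast
    have "powset 2 s \<delta> (int 2 * z0)"
    proof -
      have "fib 2 s \<delta> z0 = 1"
      proof -
        have "fib 2 s \<delta> z0 \<le> cnt n (\<lambda>z. n dvd z - z0)"
          unfolding fib_def
        proof (rule cnt_mono)
          fix z assume z: "c s z = \<delta> \<and> n div int 2 dvd z - z0"
          have "n div 2 = a * (h div 2)"
            using True n by (simp add: div_mult_swap)
          then have "a dvd z - z0"
            using z by (auto dest: dvd_mult_left)
          then show "n dvd z - z0"
            using z uniq[of z] z0 dvd_add[of a "z - z0" "z0 - g"] by (simp add: \<delta>_def)
        qed
        then show ?thesis
          using cnt_single[OF n_pos, of z0] fib_pos[OF n2, of s z0] by (simp add: \<delta>_def)
      qed
      then show ?thesis
        using powset_fib[OF _ n2, of s \<delta> z0] by simp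
    qed
    then have "b dvd 2 * z0"
      using b(2) A by simp
    moreover have "h dvd b"
    proof (rule b(3)[OF hn])
      fix y assume "A (c s y)"
      then have "powset 2 s \<delta> y"
        by (simp add: A)
      then obtain t where t: "c s t = \<delta>" "n dvd int 2 * t - y"
        by (rule powsetD)
      have "h dvd 2 * t - (int 2 * t - y)"
        by (rule dvd_diff[OF v_\<delta>[OF t(1)] dvd_trans[OF hn t(2)]])
      then show "h dvd y"
        by simp
    qed
    ultimately show ?thesis
      using gen[OF b(1)] a2 by blast
  qed
  then show "asub (n div a)"
    by (simp add: h_def)
qed

end

section \<open>Units in generating classes\<close>

context sring
begin

lemma powset_gen:
  assumes "prime p" and "int p dvd n"
  obtains b where "asub b" and "int p dvd b" and "\<And>s x. powset p s \<gamma> x \<Longrightarrow> b dvd x"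
proof -
  define A where "A \<alpha> \<longleftrightarrow> (\<exists>s y. c s y = \<alpha> \<and> powset p s \<gamma> y)" for \<alpha>
  have A: "A (c s y) \<longleftrightarrow> powset p s \<gamma> y" for s y
    using powset_inv[OF assms(1)] unfolding A_def by blast
  obtain b where b: "asub b" "\<And>s x. A (c s x) \<Longrightarrow> b dvd x"
      "\<And>s b'. b' dvd n \<Longrightarrow> (\<And>x. A (c s x) \<Longrightarrow> b' dvd x) \<Longrightarrow> b' dvd b"
    using asub_gen[of A] by blast
  have "int p dvd b"
  proof (rule b(3)[OF assms(2), of True])
    fix y assume "A (c True y)"
    then have "powset p True \<gamma> y"
      by (simp add: A)
    then obtain t where t: "n dvd int p * t - y"
      by (rule powsetD)
    from dvd_diff[OF dvd_triv_left dvd_trans[OF assms(2) t]] have "int p dvd int p * t - (int p * t - y)" .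
    then show "int p dvd y" by simp
  qed
  then show ?thesis
    using that b(1,2) A by blast
qed

text \<open>A class element alone in its coset of \<open>a\<close> is alone in the smaller coset of
  order \<open>p\<close>, and \<open>p\<close> does not divide 1.\<close>

lemma powset_fib_one:
  assumes "prime p" and "int p dvd n" and "cnt n (\<lambda>z. c s z = \<gamma> \<and> a dvd z - x) = 1"
    and "a dvd n div int p" and "c s x = \<gamma>"
  shows "powset p s \<gamma> (int p * x)"
proof -
  have p0: "p > 0"
    using assms(1) by (rule prime_gt_0_nat)
  have "fib p s \<gamma> x \<le> 1"
    unfolding fib_def assms(3)[symmetric] using assms(4) dvd_trans by (intro cnt_mono) blast
  then have "fib p s \<gamma> x = 1"
    using fib_pos[OF assms(2), of s x] assms(5) by simp
  then show ?thesis
    using powset_fib[OF p0 assms(2), of s \<gamma> x] assms(1) by auto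
qed

text \<open>The second unit is the first one times \<open>2 * E - 1\<close>, which changes the sign
  modulo \<open>h\<close>, or times \<open>1 + n div r\<close> for a prime \<open>r\<close> dividing
  both \<open>a\<close> and \<open>h\<close>.\<close>

lemma units_in_coset:
  assumes n: "n = a * h" and h: "h > 2" and y: "coprime y a"
  obtains m m' where "coprime m n" and "a dvd m - y" and "coprime m' n" and "a dvd m' - y"
    and "\<not> n dvd m - m'"
proof -
  have an: "a dvd n"
    using n by simp
  obtain m where m: "a dvd m - y" "coprime m n"
    using unit_lift[OF n_pos an y] by blast
  have "\<exists>m'. coprime m' n \<and> a dvd m' - m \<and> \<not> n dvd m' - m"
  proof (cases "coprime a h")
    case True
    then obtain E where E: "a dvd E - 1" "h dvd E"
      by (rule coprime_projection)
    have "[(2 * E - 1) * (2 * E - 1) = 1] (mod n)"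
    proof -
      have "(2 * E - 1) * (2 * E - 1) - 1 = (E - 1) * E * 4"
        by (simp add: algebra_simps)
      moreover have "n dvd (E - 1) * E"
        unfolding n by (rule mult_dvd_mono[OF E])
      ultimately show ?thesis
        by (simp add: cong_iff_dvd_diff)
    qed
    then have "coprime (2 * E - 1) n"
      using coprime_iff_invertible_int by blast
    then have "coprime (m * (2 * E - 1)) n"
      using m(2) by simp
    moreover have eq: "m * (2 * E - 1) - m = m * 2 * (E - 1)"
      by (simp add: algebra_simps)
    moreover have "a dvd m * 2 * (E - 1)"
      using E(1) by simp
    moreover have "\<not> n dvd m * 2 * (E - 1)"
    proof
      assume "n dvd m * 2 * (E - 1)"
      then have "h dvd m * 2 * (E - 1)"
        using n by (auto dest: dvd_mult_right)
      moreover have "coprime h m"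
        using m(2) n by (simp add: coprime_commute)
      moreover have "coprime h (E - 1)"
      proof (rule coprimeI)
        fix d assume d: "d dvd h" "d dvd E - 1"
        from dvd_diff[OF dvd_trans[OF d(1) E(2)] d(2)] show "is_unit d" by simp
      qed
      ultimately have "h dvd 2"
        by (simp add: coprime_dvd_mult_left_iff coprime_dvd_mult_right_iff)
      then show False
        using h by (auto dest: zdvd_imp_le)
    qed
    ultimately show ?thesis
      by metis
  next
    case False
    have "h \<noteq> 0" using h by simp
    then obtain r where r: "prime r" "r dvd a" "r dvd h"
      using False coprime_int_primesI[of h a] by blast
    obtain a' h' where ah: "a = r * a'" "h = r * h'"
      using r by blast
    define q where "q = a * h'"
    have nq: "n = r * q"
      using n ah(2) by (simp add: q_def)
    have rq: "r dvd q" and qn: "q dvd n"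
      using r(2) nq by (simp_all add: q_def)
    have "n dvd q * q"
      unfolding nq using rq by (rule mult_dvd_mono) simp
    then have u: "coprime (1 + 1 * q) n"
      using square_zero_unit[OF _ qn] by blast
    then have "coprime (m * (1 + 1 * q)) n"
      using m(2) by simp
    moreover have "m * (1 + 1 * q) - m = m * q"
      by (simp add: algebra_simps)
    moreover have "a dvd m * q"
      by (simp add: q_def)
    moreover have "\<not> n dvd m * q"
    proof
      assume "n dvd m * q"
      then have "r dvd m"
        using n_pos nq by auto
      then show False
        using m(2) r(1) nq by (metis coprime_common_divisor dvd_triv_left not_prime_unit)
    qed
    ultimately show ?thesis
      by metis
  qed
  then obtain m' where m': "coprime m' n" "a dvd m' - m" "\<not> n dvd m' - m"
    by blast
  have "a dvd m' - y"
    using dvd_add[OF m'(2) m(1)] by simp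
  then show ?thesis
    using that m m' by blast
qed

end

text \<open>The hypothesis says that \<open>d\<close> lies in no proper subgroup of the Schur ring.
  By induction on the quotient by a minimal subgroup, the class contains some \<open>y\<close> prime
  to \<open>a\<close>. If it contains no unit, a prime of \<open>h\<close> not dividing
  \<open>a\<close> divides \<open>y\<close>, and Schur's theorem for this prime yields a subgroup
  that contradicts the hypothesis or a triangle transfer.\<close>

lemma class_has_unit:
  assumes "sring n c" and "\<And>a. sring.asub n c a \<Longrightarrow> a dvd d \<Longrightarrow> a = 1"
  shows "\<exists>g. coprime g n \<and> c s g = c s d"
  using assms
proof (induction "nat n" arbitrary: n c d rule: less_induct)
  case less
  interpret sring n c
    by (rule less.prems(1))
  have gen: "a = 1" if "asub a" "a dvd d" for a
    using less.prems(2) that by blast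
  show ?case
  proof (cases "n = 1")
    case True
    then show ?thesis
      by (intro exI[of _ d]) simp
  next
    case False
    then obtain a where min: "minsub a"
      using minsub_exists[OF asub_one] by metis
    note f = minsub_facts[OF min]
    define h where "h = n div a"
    have n: "n = a * h" and h1: "h > 1"
      using f(3,4) by (simp_all add: h_def)
    have hn: "h dvd n"
      using n by simp
    have an: "nat a < nat n"
    proof -
      have "a * 1 < a * h"
        using f(2) h1 by (intro mult_strict_left_mono)
      then show ?thesis
        using n f(2) by simp
    qed
    interpret Q: sring a "qcol a"
      by (rule quot_sring[OF f(1)])
    have "b = 1" if b: "Q.asub b" "b dvd d" for b
    proof (rule gen[OF _ b(2)], rule asubI)
      show "b > 0"
        by (rule Q.asub_pos[OF b(1)])
      show "b dvd n"
        using Q.asub_dvd[OF b(1)] f(6) dvd_trans by blast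
      show "b dvd y" if "c s x = c s' y" "b dvd x" for s s' x y
        using Q.asub_dvdD[OF b(1) qcol_cong[OF f(1) that(1)] that(2)] .
    qed
    from less.hyps[OF an Q.sring_axioms this] obtain g where g: "coprime g a" "qcol a s g = qcol a s d"
      by blast
    from qcol_eqD[OF f(1) g(2)[symmetric]] obtain y where y: "a dvd y - g" "c s y = c s d"
      by blast
    have coset_coprime: "coprime z a" if "a dvd z - y" for z
    proof -
      have "a dvd z - g"
        using dvd_add[OF that y(1)] by simp
      then have "[z = g] (mod a)"
        by (simp add: cong_iff_dvd_diff)
      then show ?thesis
        using g(1) cong_imp_coprime cong_sym by blast
    qed
    have unitI: "coprime z n" if "a dvd z - y" "\<And>p. prime p \<Longrightarrow> p dvd h \<Longrightarrow> \<not> p dvd a \<Longrightarrow> \<not> p dvd z" for z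
    proof (rule coprime_int_primesI)
      show "n \<noteq> 0" using n_pos by simp
      fix p assume p: "prime p" "p dvd z" "p dvd n"
      have "p dvd a \<or> p dvd h"
        using p(1,3) unfolding n by (rule prime_dvd_multD)
      moreover have "\<not> p dvd a"
        using coset_coprime[OF that(1)] p(1,2) by (metis coprime_common_divisor not_prime_unit)
      ultimately show False
        using that(2) p by blast
    qed
    have no_sub: False if "asub b" "b dvd y" "b \<noteq> 1" for b
      using gen[OF that(1) asub_dvdD[OF that(1) y(2) that(2)]] that(3) by simp
    show ?thesis
    proof (rule ccontr)
      assume no: "\<not> ?thesis"
      then have no_unit: "\<not> coprime z n" if "c s z = c s y" for z
        using that y(2) by metis
      then obtain p where p: "prime p" "p dvd h" "\<not> p dvd a" "p dvd y"
        using unitI[of y] by auto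
      define P where "P = nat p"
      have P: "p = int P"
        using prime_ge_0_int[OF p(1)] by (simp add: P_def)
      have primeP: "prime P"
        using p(1) P by simp
      have pn: "int P dvd n"
        using p(2) n P by simp
      have ya: "coprime y a"
        by (rule coset_coprime) simp
      have pa: "coprime p a"
        using p(1,3) by (rule prime_imp_coprime)
      have anp: "a dvd n div int P"
      proof -
        obtain h' where "h = p * h'"
          using p(2) by blast
        then have "n = int P * (a * h')"
          using n P by simp
        then show ?thesis
          using prime_gt_0_nat[OF primeP] by simp
      qed
      show False
      proof (cases "prime h")
        case True
        then have hp: "h = p"
          using p(1,2) primes_dvd_imp_eq by blast
        \<comment> \<open>\<open>p\<close> is the only prime at which \<open>unitI\<close> can fail,
          so every class point of the coset is a multiple of \<open>p\<close>; the coset has only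
          one such point.\<close>
        have "p dvd z" if "c s z = c s y" "a dvd z - y" for z
          using no_unit[OF that(1)] unitI[OF that(2)] hp True primes_dvd_imp_eq by blast
        then have "n dvd z - y" if "c s z = c s y" "a dvd z - y" for z
          using that p(4) hp by (intro dvd_mult_coprime[OF n]) (use pa in \<open>simp_all add: coprime_commute\<close>)
        then have "(\<lambda>z. c s z = c s y \<and> a dvd z - y) = (\<lambda>z. n dvd z - y)"
          using per f(6) dvd_trans by blast
        then have "cnt n (\<lambda>z. c s z = c s y \<and> a dvd z - y) = 1"
          using cnt_single[OF n_pos, of y] by simp
        from powset_fib_one[OF primeP pn this anp] have "powset P s (c s y) (int P * y)"
          by simp
        moreover obtain b where b: "asub b" "int P dvd b" "\<And>s' x. powset P s' (c s y) x \<Longrightarrow> b dvd x"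
          by (rule powset_gen[OF primeP pn, of "c s y", OF that])
        ultimately have "b dvd int P * y"
          by blast
        obtain b1 where b1: "b = p * b1"
          using b(2) P by blast
        have "p \<noteq> 0"
          using p(1) by auto
        have "b1 dvd y"
          using \<open>b dvd int P * y\<close> \<open>p \<noteq> 0\<close> unfolding b1 P[symmetric] by simp
        moreover have "b1 dvd a"
          using asub_dvd[OF b(1)] \<open>p \<noteq> 0\<close> unfolding b1 n hp by (simp add: mult.commute)
        ultimately have "is_unit b1"
          using ya coprime_common_divisor by blast
        then have "b dvd y"
          using p(4) unfolding b1 by (simp add: mult_unit_dvd_iff)
        moreover have "b \<noteq> 1"
          using b(2) p(1) P by auto
        ultimately show False
          using no_sub b(1) by blast
      next
        case False
        have m: "mchr a"
          using minsub_mono[OF min] False by (simp add: h_def)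
        have hf: "h > 3" "h \<noteq> p" "\<not> h dvd p"
          using composite_facts[OF h1 False] p by auto
        have cases: "lam a s y = 1 \<or> int (lam a s y) = h - 1 \<or> int (lam a s y) = h"
          using lam_cases[OF f(1) m primeP, of s y] p(2,3) hf(2) unfolding h_def P by blast
        obtain u u' where u: "coprime u n" "a dvd u - y" "coprime u' n" "a dvd u' - y" "\<not> n dvd u - u'"
          by (rule units_in_coset[OF n _ ya]) (use hf(1) in simp_all)
        \<comment> \<open>The coset contains two distinct units, and neither lies in the
          class.\<close>
        have "\<not> int (lam a s y) \<ge> h - 1"
        proof
          assume big: "int (lam a s y) \<ge> h - 1"
          have "cnt n (\<lambda>z. c s z \<noteq> c s y \<and> a dvd z - y) \<le> 1"
            using coset_split[OF f(1), of "\<lambda>\<alpha>. \<alpha> = c s y" s y] big h1 unfolding lam_def h_def by linarith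
          moreover have "c s u \<noteq> c s y" "c s u' \<noteq> c s y"
            using no_unit u(1,3) by blast+
          moreover have "cnt n (\<lambda>z. c s z \<noteq> c s y \<and> a dvd z - y) > 0"
            unfolding cnt_pos[OF n_pos per_coset[OF f(6), of "\<lambda>\<alpha>. \<alpha> \<noteq> c s y" s y]]
            using \<open>c s u \<noteq> c s y\<close> u(2) by blast
          ultimately have one: "cnt n (\<lambda>z. c s z \<noteq> c s y \<and> a dvd z - y) = 1"
            by simp
          have "n dvd u - u'"
            by (rule coset_unique[OF f(6), of "\<lambda>\<alpha>. \<alpha> \<noteq> c s y", OF one \<open>c s u \<noteq> c s y\<close> u(2) \<open>c s u' \<noteq> c s y\<close> u(4)])
          then show False
            using u(5) by blast
        qed
        then have lam1: "lam a s y = 1"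
          using cases by auto
        have pow: "powset P s (c s y) (int P * t)" if "c s t = c s y" for t
        proof (rule powset_fib_one[OF primeP pn _ anp that])
          show "cnt n (\<lambda>z. c s z = c s y \<and> a dvd z - t) = 1"
            using lam_cong[OF f(1) that] lam1 that by (simp add: lam_def)
        qed
        obtain b where b: "asub b" "int P dvd b" "\<And>s' x. powset P s' (c s y) x \<Longrightarrow> b dvd x"
          by (rule powset_gen[OF primeP pn, of "c s y", OF that])
        have bt: "b dvd p * t" if "c s t = c s y" for t
          using b(3)[OF pow[OF that]] P by simp
        have "coprime (p * y) a"
          using pa ya by simp
        then have ba: "coprime a b"
          using bt[of y] coprime_divisors dvd_refl coprime_commute by blast
        have "b dvd h"
          using asub_dvd[OF b(1)] ba unfolding n by (simp add: coprime_commute coprime_dvd_mult_right_iff)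
        have "asub (lcm a b)"
          by (rule asub_lcm[OF f(1) b(1)])
        then have "lcm a b = a \<or> lcm a b = n"
          using min unfolding minsub_def by simp
        moreover have "lcm a b \<noteq> a"
        proof
          assume "lcm a b = a"
          then have "int P dvd a"
            using b(2) dvd_lcm2[of b a] dvd_trans by metis
          then show False
            using p(3) P by simp
        qed
        moreover have "lcm a b = a * b"
          using ba lcm_coprime[of a b] f(2) asub_pos[OF b(1)] by simp
        ultimately have "b = h"
          using n f(2) by simp
        then have h: "asub h" "h dvd p * y" and ht: "\<And>t. c s t = c s y \<Longrightarrow> h dvd p * t"
          using b(1) bt by auto
        have "\<not> h dvd y"
          using no_sub[OF h(1)] h1 by auto
        have ah: "coprime a h"
          using ba \<open>b = h\<close> by simp
        then obtain E where E: "a dvd E - 1" "h dvd E"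
          by (rule coprime_projection)
        have Ey: "a dvd y - E * y" "\<not> n dvd y - E * y"
        proof -
          show "a dvd y - E * y"
            using dvd_mult2[OF E(1), of y] dvd_diff_commute[of a y "E * y"] by (simp add: algebra_simps)
          show "\<not> n dvd y - E * y"
          proof
            assume "n dvd y - E * y"
            from dvd_add[OF dvd_trans[OF hn this] dvd_mult2[OF E(2), of y]] show False
              using \<open>\<not> h dvd y\<close> by simp
          qed
        qed
        \<comment> \<open>Monochromaticity lets \<open>a\<close> replace the difference
          \<open>y - E * y\<close>. The resulting class element \<open>z\<close> is congruent to
          \<open>a\<close> modulo \<open>h\<close>, while \<open>h\<close> divides
          \<open>p * z\<close>.\<close>
        have "c s (y - E * y) = c s a"
          by (rule mchrD[OF m Ey dvd_refl f(5)])
        then obtain z where z: "c s z = c s y" "c s (z - a) = c s (y - (y - E * y))"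
          by (rule tri)
        have "h dvd z - a"
          by (rule asub_dvdD[OF h(1) z(2)[symmetric]]) (use E(2) in simp)
        from dvd_diff[OF ht[OF z(1)] dvd_mult[OF this, of p]] have "h dvd p * a"
          by (simp add: algebra_simps)
        then have "h dvd p"
          using ah by (simp add: coprime_commute coprime_dvd_mult_left_iff)
        then show False
          using hf(3) by blast
      qed
    qed
  qed
qed

section \<open>Classes with trivial fibres\<close>

lemma coprime_primeI: "prime p \<Longrightarrow> \<not> p dvd x \<Longrightarrow> coprime x (p::int)"
  using prime_imp_coprime[of p x] by (simp add: coprime_commute)

lemma int_coprime_inverse:
  assumes "coprime x (m::int)"
  obtains v where "m dvd x * v - 1" and "coprime v m"
proof -
  obtain v where v: "[x * v = 1] (mod m)"
    using assms coprime_iff_invertible_int by blast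
  then have "coprime v m"
    by (metis coprime_iff_invertible_int mult.commute)
  then show ?thesis
    using that v by (simp add: cong_iff_dvd_diff)
qed

text \<open>Lifting the exponent: the \<open>p\<close>-th power adds exactly one factor
  \<open>p\<close> to \<open>v\<close>. For \<open>p = 2\<close> and \<open>v = 2\<close> it adds
  two, whence the last hypothesis.\<close>

lemma one_plus_power_minus_one:
  fixes v :: int
  assumes "prime p" and "p dvd v" and "odd p \<or> 4 dvd v"
  obtains w where "(1 + v) ^ nat p - 1 = v * (p * w)" and "\<not> p dvd w"
proof -
  have p0: "p > 0" and p2: "p \<ge> 2"
    using assms(1) prime_gt_0_int prime_ge_2_int by auto
  have sum: "(1 + v) ^ m - 1 = v * (\<Sum>i<m. (1 + v) ^ i)" for m
    by (induction m) (simp_all add: algebra_simps)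
  have "v * v dvd (1 + v) ^ i - (1 + int i * v)" for i
  proof (induction i)
    case (Suc i)
    have "(1 + v) ^ Suc i - (1 + int (Suc i) * v) = (1 + v) * ((1 + v) ^ i - (1 + int i * v)) + v * v * int i"
      by (simp add: algebra_simps)
    then show ?case
      using Suc by (metis dvd_add dvd_mult dvd_triv_left)
  qed simp
  then have "v * v dvd (\<Sum>i<m. (1 + v) ^ i - (1 + int i * v))" for m
    by (intro dvd_sum)
  then have sum2: "v * v dvd (\<Sum>i<m. (1 + v) ^ i) - (int m + (\<Sum>i<m. int i) * v)" for m
    by (simp add: sum_subtractf sum.distrib sum_distrib_right)
  have gauss: "2 * (\<Sum>i<m. int i) = int m * (int m - 1)" for m
    by (induction m) (simp_all add: algebra_simps)
  \<comment> \<open>Modulo \<open>v * v\<close> the sum of powers is \<open>p\<close> plus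
    \<open>v\<close> times the sum of the exponents, and for odd \<open>p\<close> the latter sum has
    a factor \<open>p\<close> as well.\<close>
  have "p * p dvd (\<Sum>i<nat p. (1 + v) ^ i) - p"
  proof (cases "odd p")
    case True
    then have "even (p - 1)" by simp
    then obtain k where k: "p - 1 = 2 * k" by blast
    have "(\<Sum>i<nat p. int i) = p * k"
      using gauss[of "nat p"] p0 k by simp
    moreover obtain u where "v = p * u"
      using assms(2) by blast
    ultimately have pp: "p * p dvd (\<Sum>i<nat p. int i) * v" "p * p dvd v * v"
      by (auto intro: mult_dvd_mono)
    have "(\<Sum>i<nat p. (1 + v) ^ i) - p =
        ((\<Sum>i<nat p. (1 + v) ^ i) - (int (nat p) + (\<Sum>i<nat p. int i) * v)) + (\<Sum>i<nat p. int i) * v"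
      using p0 by simp
    then show ?thesis
      using dvd_add[OF dvd_trans[OF pp(2) sum2[of "nat p"]] pp(1)] by simp
  next
    case False
    then have "2 dvd p" by simp
    then have "p = 2"
      using assms(1) primes_dvd_imp_eq[of 2 p] by simp
    moreover have "4 dvd v"
      using assms(3) False by blast
    ultimately show ?thesis
      by (simp add: numeral_2_eq_2)
  qed
  then obtain k where "(\<Sum>i<nat p. (1 + v) ^ i) = p * (1 + p * k)"
    by (metis (no_types, opaque_lifting) add.commute diff_eq_eq distrib_left dvdE mult.assoc mult.right_neutral)
  moreover have "\<not> p dvd 1 + p * k"
  proof
    assume "p dvd 1 + p * k"
    then have "p dvd 1"
      by (simp add: dvd_add_left_iff)
    then show False
      using p2 by simp
  qed
  ultimately show ?thesis
    using that[of "1 + p * k"] sum[of "nat p"] by simp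
qed

section \<open>The stabiliser of a class among the units\<close>

text \<open>What remains when no reduction applies to a class containing units: all minimal
  subgroups have prime order, the class is invariant under none of them, and where the order is
  prime to the index, it does not hold all but one point of the coset of \<open>g s\<close>.\<close>

locale normal_class = sring +
  fixes \<gamma> :: nat and g :: "bool \<Rightarrow> int"
  assumes n1: "n > 1"
    and g_unit: "coprime (g s) n" and g_col: "c s (g s) = \<gamma>"
    and min_prime: "minsub a \<Longrightarrow> prime (n div a)"
    and not_cinv: "minsub a \<Longrightarrow> \<not> cinv a \<gamma>"
    and lam_ne: "minsub a \<Longrightarrow> \<not> n div a dvd a \<Longrightarrow> int (lam a s (g s)) \<noteq> n div a - 1"
begin

text \<open>The stabiliser of the class. Evaluating it at one point of side \<open>True\<close> is
  enough, because multipliers respect the correspondence; see \<open>fx_iff\<close>.\<close>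

definition fx :: "int \<Rightarrow> bool" where
  "fx m \<longleftrightarrow> coprime m n \<and> c True (m * g True) = \<gamma>"

lemma fx_coprime: "fx m \<Longrightarrow> coprime m n"
  by (simp add: fx_def)

lemma fx_iff:
  assumes "coprime m n" and "c s x = \<gamma>"
  shows "fx m \<longleftrightarrow> c s (m * x) = \<gamma>"
  using mult_fix_iff[OF assms(1), of True "g True" s x] assms g_col[of True] by (simp add: fx_def)

lemma fx_col: "fx m \<Longrightarrow> c s x = \<gamma> \<Longrightarrow> c s (m * x) = \<gamma>"
  using fx_iff[of m s x] fx_coprime by blast

lemma fx_one: "fx 1"
  by (simp add: fx_def g_col)

lemma fx_mult: "fx m \<Longrightarrow> fx m' \<Longrightarrow> fx (m * m')"
  using fx_col[of m True "m' * g True"] by (simp add: fx_def mult.assoc)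

lemma fx_power: "fx m \<Longrightarrow> fx (m ^ i)"
  by (induction i) (simp_all add: fx_one fx_mult)

lemma fx_cong:
  assumes "fx m" and "n dvd m - m'"
  shows "fx m'"
proof -
  have "[m = m'] (mod n)"
    using assms(2) by (simp add: cong_iff_dvd_diff)
  then have "coprime m' n"
    using cong_imp_coprime fx_coprime[OF assms(1)] by blast
  moreover have "c True (m * g True) = c True (m' * g True)"
    using dvd_mult2[OF assms(2), of "g True"] by (intro per) (simp add: left_diff_distrib)
  ultimately show ?thesis
    using assms(1) by (simp add: fx_def)
qed

lemma units_fx:
  assumes "coprime x n" and "coprime y n" and "c s x = \<gamma>" and "c s y = \<gamma>"
  obtains t where "fx t" and "n dvd t * x - y"
proof -
  obtain v where v: "n dvd x * v - 1" "coprime v n"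
    by (rule int_coprime_inverse[OF assms(1)])
  define t where "t = v * y"
  have t: "n dvd t * x - y"
    using dvd_mult2[OF v(1), of y] by (simp add: t_def algebra_simps)
  have "coprime t n"
    using v(2) assms(2) by (simp add: t_def)
  then have "fx t"
    using fx_iff[of t s x] per[OF t, of s] assms by simp
  then show ?thesis
    using that t by blast
qed

lemma lam_lt:
  assumes "minsub a"
  shows "int (lam a s (g s)) < n div a"
proof -
  have "int (lam a s (g s)) \<noteq> n div a"
    using lam_full_cinv[OF assms, of s "g s"] not_cinv[OF assms] g_col[of s] by auto
  moreover have "int (lam a s (g s)) \<le> n div a"
    using lam_le[of a s "g s"] minsub_facts[OF assms] by linarith
  ultimately show ?thesis by simp
qed

text \<open>The powers of \<open>1 + a * i\<close> move \<open>g s\<close> through its whole coset,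
  which the class would then fill.\<close>

lemma not_fx_unipotent:
  assumes min: "minsub a" and p: "p = n div a" "p dvd a" and i: "\<not> p dvd i"
  shows "\<not> fx (1 + a * i)"
proof
  assume fx: "fx (1 + a * i)"
  note f = minsub_facts[OF min]
  have n: "n = a * p"
    using f(3) p(1) by simp
  have pr: "prime p"
    using min_prime[OF min] p(1) by simp
  have naa: "n dvd a * a"
    unfolding n using p(2) by (intro mult_dvd_mono) auto
  have pow: "fx (1 + a * (i * int l))" for l
  proof (induction l)
    case (Suc l)
    have "fx ((1 + a * i) * (1 + a * (i * int l)))"
      using fx_mult[OF fx Suc] .
    moreover have "(1 + a * i) * (1 + a * (i * int l)) - (1 + a * (i * int (Suc l))) = a * a * (i * i * int l)"
      by (simp add: algebra_simps)
    then have "n dvd (1 + a * i) * (1 + a * (i * int l)) - (1 + a * (i * int (Suc l)))"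
      using naa by simp
    ultimately show ?case
      by (rule fx_cong)
  qed (simp add: fx_one)
  define s where "s = True"
  have "c s z = \<gamma>" if z: "a dvd z - g s" for z
  proof -
    obtain j where j: "z - g s = a * j"
      using z by blast
    have "\<not> p dvd g s"
      using g_unit[of s] n pr by (metis coprime_common_divisor dvd_triv_right not_prime_unit)
    then have "coprime (i * g s) p"
      using coprime_primeI[OF pr i] coprime_primeI[OF pr] by simp
    then obtain v where v: "p dvd (i * g s) * v - 1"
      by (rule int_coprime_inverse)
    define l where "l = nat ((v * j) mod p)"
    have l: "int l = (v * j) mod p"
      using prime_gt_0_int[OF pr] by (simp add: l_def)
    have "p dvd (int l - v * j) * (i * g s) + ((i * g s) * v - 1) * j"
      unfolding l by (rule dvd_add[OF dvd_mult2[OF dvd_mod_diff] dvd_mult2[OF v]])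
    then have "p dvd i * int l * g s - j"
      by (simp add: algebra_simps)
    then have "n dvd a * (i * int l * g s - j)"
      unfolding n by simp
    then have "n dvd (1 + a * (i * int l)) * g s - (g s + a * j)"
      by (simp add: algebra_simps)
    from per[OF this, of s] show ?thesis
      using fx_col[OF pow[of l], of s "g s"] g_col j by (simp add: algebra_simps)
  qed
  then have "cnt n (\<lambda>z. a dvd z - g s) \<le> lam a s (g s)"
    unfolding lam_def by (intro cnt_mono) (simp add: g_col)
  then have "int (lam a s (g s)) \<ge> n div a"
    using cnt_coset[OF n_pos f(2,6), of "g s"] by linarith
  then show False
    using lam_lt[OF min, of s] by simp
qed

text \<open>Units congruent to 1 modulo \<open>a\<close> fix every multiple of \<open>p\<close>. If
  the class contained such a multiple, they would stabilise it and spread \<open>g s\<close> over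
  its coset, leaving out at most one point.\<close>

lemma class_coprime:
  assumes min: "minsub a" and p: "p = n div a" and x: "c s x = \<gamma>"
  shows "\<not> p dvd x"
proof
  assume px: "p dvd x"
  note f = minsub_facts[OF min]
  have n: "n = a * p"
    using f(3) p(1) by simp
  have pr: "prime p"
    using min_prime[OF min] p(1) by simp
  show False
  proof (cases "p dvd a")
    case True
    have naa: "n dvd a * a"
      unfolding n using True by (intro mult_dvd_mono) auto
    have "coprime (1 + a * 1) n"
      using square_zero_unit[OF naa f(6), of 1] by simp
    moreover have "n dvd (1 + a * 1) * x - x"
      using px unfolding n by (simp add: algebra_simps)
    then have "c s ((1 + a * 1) * x) = \<gamma>"
      using per x by metis
    ultimately have "fx (1 + a * 1)"
      using fx_iff x by blast
    moreover have "\<not> p dvd 1"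
      using pr by auto
    ultimately show False
      using not_fx_unipotent[OF min p True] by blast
  next
    case False
    have cop: "coprime a p"
      using False pr prime_imp_coprime[of p a] by (simp add: coprime_commute)
    have "c s z = \<gamma>" if z: "a dvd z - g s" "\<not> p dvd z" for z
    proof -
      obtain v where v: "n dvd g s * v - 1" "coprime v n"
        by (rule int_coprime_inverse[OF g_unit])
      have "coprime z a"
      proof -
        have "[z = g s] (mod a)"
          using z(1) by (simp add: cong_iff_dvd_diff)
        moreover have "coprime (g s) a"
          using g_unit[of s] n by simp
        ultimately show ?thesis
          using cong_imp_coprime cong_sym by blast
      qed
      moreover have "coprime z p"
        using z(2) pr prime_imp_coprime[of p z] by (simp add: coprime_commute)
      ultimately have u: "coprime (v * z) n"
        using v(2) n by simp
      have "a dvd v * (z - g s) + (g s * v - 1)"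
        using z(1) dvd_trans[OF f(6) v(1)] by (intro dvd_add) simp_all
      then have "a dvd v * z - 1"
        by (simp add: algebra_simps)
      then have "n dvd (v * z - 1) * x"
        unfolding n using px by (rule mult_dvd_mono)
      then have "n dvd (v * z) * x - x"
        by (simp add: algebra_simps)
      then have "c s ((v * z) * x) = \<gamma>"
        using per x by metis
      then have "fx (v * z)"
        using fx_iff[OF u x] by blast
      then have "c s ((v * z) * g s) = \<gamma>"
        using fx_col g_col by blast
      moreover have "n dvd (v * z) * g s - z"
        using dvd_mult2[OF v(1), of z] by (simp add: algebra_simps)
      ultimately show ?thesis
        using per by metis
    qed
    then have "cnt n (\<lambda>z. a dvd z - g s \<and> \<not> p dvd z) \<le> lam a s (g s)"
      unfolding lam_def by (intro cnt_mono) (simp add: g_col)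
    moreover have "cnt n (\<lambda>z. a dvd z - g s \<and> p dvd z) \<le> 1"
    proof -
      obtain E where E: "a dvd E - 1" "p dvd E"
        by (rule coprime_projection[OF cop])
      have "n dvd z - E * g s" if "a dvd z - g s" "p dvd z" for z
      proof (rule dvd_mult_coprime[OF n cop])
        have "a dvd (z - g s) - (E - 1) * g s"
          using that(1) dvd_mult2[OF E(1)] by (rule dvd_diff)
        then show "a dvd z - E * g s"
          by (simp add: algebra_simps)
        show "p dvd z - E * g s"
          using that(2) dvd_mult2[OF E(2)] by (rule dvd_diff)
      qed
      then have "cnt n (\<lambda>z. a dvd z - g s \<and> p dvd z) \<le> cnt n (\<lambda>z. n dvd z - E * g s)"
        by (intro cnt_mono) blast
      then show ?thesis
        using cnt_single[OF n_pos, of "E * g s"] by simp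
    qed
    moreover have "nat p = cnt n (\<lambda>z. a dvd z - g s \<and> p dvd z) + cnt n (\<lambda>z. a dvd z - g s \<and> \<not> p dvd z)"
      using cnt_split[of n "\<lambda>z. a dvd z - g s" "\<lambda>z. p dvd z"] cnt_coset[OF n_pos f(2,6), of "g s"] p by simp
    ultimately have "int (lam a s (g s)) \<ge> n div a - 1"
      using p by linarith
    then show False
      using lam_lt[OF min, of s] lam_ne[OF min, of s] False p by auto
  qed
qed

text \<open>Raising \<open>1 + v\<close> to the power \<open>p\<close> lifts the valuation
  \<open>b\<close> of \<open>v\<close> by one, until \<open>Suc b = k\<close> and
  \<open>not_fx_unipotent\<close> applies. For \<open>p = 2\<close> the lifting is exact only from
  \<open>b = 2\<close> on.\<close>

lemma not_fx_tower:
  assumes min: "minsub a" and p: "p = n div a" and k: "n = p ^ k * n'" "\<not> p dvd n'"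
    and v: "n' dvd v" "p ^ b dvd v" "\<not> p ^ Suc b dvd v" and b: "b \<ge> 1" "b < k" "odd p \<or> b \<ge> 2 \<or> Suc b = k"
  shows "\<not> fx (1 + v)"
  using v b
proof (induction "k - b" arbitrary: b v rule: less_induct)
  case less
  note f = minsub_facts[OF min]
  have n: "n = a * p"
    using f(3) p(1) by simp
  have pr: "prime p"
    using min_prime[OF min] p(1) by simp
  have p0: "p > 0"
    using prime_gt_0_int[OF pr] .
  obtain w where w: "v = p ^ b * w"
    using less.prems(2) by blast
  have pw: "\<not> p dvd w"
    using less.prems(3) p0 unfolding w by (auto simp: mult.commute)
  show ?case
  proof (cases "Suc b = k")
    case True
    have a: "a = p ^ b * n'"
    proof -
      have "a * p = n"
        by (rule n[symmetric])
      also have "\<dots> = (p ^ b * n') * p"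
        unfolding k(1) True[symmetric] by (simp add: ac_simps)
      finally show ?thesis
        using p0 unfolding mult_cancel_right by simp
    qed
    have pa: "p dvd a"
      unfolding a using less.prems(4) by (simp add: dvd_power)
    have "a dvd v"
      unfolding a using less.prems(1,2) prime_imp_power_coprime[OF pr k(2), of b]
      by (intro divides_mult) (simp_all add: coprime_commute)
    then obtain i where i: "v = a * i"
      by blast
    have "\<not> p dvd i"
    proof
      assume "p dvd i"
      then have "p ^ b * n' * p dvd v"
        unfolding i a by (intro mult_dvd_mono) auto
      then have "p ^ Suc b dvd v"
        by (metis dvd_mult_left mult.assoc mult.commute power_Suc)
      then show False
        using less.prems(3) by blast
    qed
    then show ?thesis
      using not_fx_unipotent[OF min p pa] i by blast
  next
    case False
    have Sb: "Suc b < k"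
      using False less.prems(5) by simp
    have "p dvd v"
      using less.prems(2,4) by (meson dvd_power dvd_trans less_le_trans zero_less_one)
    moreover have "odd p \<or> 4 dvd v"
    proof (cases "odd p")
      case False
      have "2 dvd p" using False by simp
      then have "p = 2"
        using pr primes_dvd_imp_eq[of 2 p] by simp
      moreover have "b \<ge> 2"
        using less.prems(6) False \<open>Suc b \<noteq> k\<close> by blast
      then have "p ^ 2 dvd v"
        using less.prems(2) le_imp_power_dvd dvd_trans by blast
      ultimately show ?thesis
        by simp
    qed simp
    ultimately obtain u where u: "(1 + v) ^ nat p - 1 = v * (p * u)" "\<not> p dvd u"
      using one_plus_power_minus_one[OF pr] by blast
    have "\<not> fx (1 + v * (p * u))"
    proof (rule less.hyps[of "Suc b"])
      show "k - Suc b < k - b" "1 \<le> Suc b" "Suc b < k"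
        using Sb by auto
      show "n' dvd v * (p * u)"
        using less.prems(1) by simp
      show "p ^ Suc b dvd v * (p * u)"
        unfolding w by (simp add: mult_dvd_mono)
      show "\<not> p ^ Suc (Suc b) dvd v * (p * u)"
      proof
        assume "p ^ Suc (Suc b) dvd v * (p * u)"
        then have "p dvd w * u"
          using p0 unfolding w by (simp add: ac_simps)
        then show False
          using pw u(2) pr prime_dvd_multD by blast
      qed
      show "odd p \<or> 2 \<le> Suc b \<or> Suc (Suc b) = k"
        using less.prems(4) by simp
    qed
    then show ?thesis
      using fx_power[of "1 + v" "nat p"] u(1) by (auto simp: algebra_simps)
  qed
qed

end

text \<open>The commuting involutions generate a Klein four-group that acts freely, so all orbits
  have four elements.\<close>

lemma card_two_involutions:
  assumes "finite S" and "\<And>x. x \<in> S \<Longrightarrow> f x \<in> S" and "\<And>x. x \<in> S \<Longrightarrow> h x \<in> S"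
    and "\<And>x. x \<in> S \<Longrightarrow> f (f x) = x" and "\<And>x. x \<in> S \<Longrightarrow> h (h x) = x"
    and "\<And>x. x \<in> S \<Longrightarrow> f (h x) = h (f x)"
    and "\<And>x. x \<in> S \<Longrightarrow> f x \<noteq> x" and "\<And>x. x \<in> S \<Longrightarrow> h x \<noteq> x" and "\<And>x. x \<in> S \<Longrightarrow> f (h x) \<noteq> x"
  shows "4 dvd card S"
  using assms
proof (induction S rule: finite_psubset_induct)
  case (psubset S)
  show ?case
  proof (cases "S = {}")
    case False
    then obtain x where x: "x \<in> S" by blast
    define Q where "Q = {x, f x, h x, f (h x)}"
    have Q: "Q \<subseteq> S"
      using x psubset.prems(1,2) by (auto simp: Q_def)
    have closed: "y \<in> S - Q \<Longrightarrow> f y \<in> S - Q" "y \<in> S - Q \<Longrightarrow> h y \<in> S - Q" for y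
    proof -
      assume y: "y \<in> S - Q"
      have "f y \<in> S" "h y \<in> S" "f (f y) = y" "h (h y) = y"
        using y psubset.prems by auto
      moreover have "f ` Q \<subseteq> Q" "h ` Q \<subseteq> Q"
        using x psubset.prems(1-5) unfolding Q_def by auto
      ultimately show "f y \<in> S - Q" "h y \<in> S - Q"
        using y by (metis DiffD2 DiffI image_subset_iff)+
    qed
    have "4 dvd card (S - Q)"
    proof (rule psubset.IH)
      show "S - Q \<subset> S"
        using x by (auto simp: Q_def)
    qed (use closed psubset.prems(3-8) in auto)
    moreover have "card Q = 4"
    proof -
      have "f x \<noteq> h x"
        using psubset.prems(4,8) x by (metis psubset.prems(2) psubset.prems(3))
      moreover have "f x \<noteq> f (h x)"
        using psubset.prems x by metis
      moreover have "h x \<noteq> f (h x)"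
        using psubset.prems x by metis
      ultimately show ?thesis
        using psubset.prems(6-8) x unfolding Q_def by (simp add: card_insert_if) (metis)
    qed
    moreover have "card S = card Q + card (S - Q)"
      using Q psubset.hyps by (metis card_Diff_subset card_mono finite_subset le_add_diff_inverse)
    ultimately show ?thesis
      by simp
  qed simp
qed

context sring
begin

lemma powset_gen_min:
  assumes "prime p"
  obtains b where "asub b" and "\<And>s x. powset p s \<gamma> x \<Longrightarrow> b dvd x"
    and "\<And>s b'. b' dvd n \<Longrightarrow> (\<And>x. powset p s \<gamma> x \<Longrightarrow> b' dvd x) \<Longrightarrow> b' dvd b"
proof -
  define A where "A \<alpha> \<longleftrightarrow> (\<exists>s y. c s y = \<alpha> \<and> powset p s \<gamma> y)" for \<alpha>
  have A: "A (c s y) \<longleftrightarrow> powset p s \<gamma> y" for s y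
    using powset_inv[OF assms] unfolding A_def by blast
  show ?thesis
    by (rule asub_gen[of A]) (use that in \<open>unfold A, blast\<close>)
qed

end

context normal_class
begin

text \<open>As \<open>g s\<close> is a unit, \<open>q * g s\<close> generates the multiples of
  \<open>q\<close>, and the hypothesis keeps the rest of its class among them.\<close>

lemma asub_of_class:
  assumes "q > 0" and "q dvd n" and "\<And>x. c s x = c s (q * g s) \<Longrightarrow> q dvd x"
  shows "asub q"
proof -
  define \<eta> where "\<eta> = c s (q * g s)"
  obtain b where b: "asub b" "\<And>s x. c s x = \<eta> \<Longrightarrow> b dvd x"
      "\<And>s b'. b' dvd n \<Longrightarrow> (\<And>x. c s x = \<eta> \<Longrightarrow> b' dvd x) \<Longrightarrow> b' dvd b"
    using asub_gen[of "\<lambda>\<alpha>. \<alpha> = \<eta>"] by blast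
  have "q dvd b"
    by (rule b(3)[OF assms(2), of s]) (use assms(3) in \<open>simp add: \<eta>_def\<close>)
  moreover have "b dvd q"
  proof -
    have "b dvd q * g s"
      using b(2) by (simp add: \<eta>_def)
    moreover have "coprime b (g s)"
      using asub_dvd[OF b(1)] g_unit[of s] coprime_divisors[of b n "g s" "g s"] by (simp add: coprime_commute)
    ultimately show ?thesis
      by (simp add: coprime_dvd_mult_left_iff)
  qed
  ultimately have "b = q"
    using assms(1) asub_pos[OF b(1)] by (intro zdvd_antisym_nonneg) auto
  then show ?thesis
    using b(1) by simp
qed

end

section \<open>Multiples of the class by prime powers, and Hall subgroups\<close>

locale normal_prime = normal_class +
  fixes a p k n'
  assumes min: "minsub a" and p_def: "p = n div a" and n_eq: "n = p ^ k * n'" and pn': "\<not> p dvd n'"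
begin

lemma pr: "prime p"
  using min_prime[OF min] p_def by simp

lemma p0: "p > 0"
  using prime_gt_0_int[OF pr] .

lemma n_ap: "n = a * p"
  using minsub_facts(3)[OF min] p_def by simp

lemma k1: "k \<ge> 1"
proof (rule ccontr)
  assume "\<not> k \<ge> 1"
  then have "k = 0" by simp
  then have "n' = a * p"
    using n_eq n_ap by simp
  then show False
    using pn' by simp
qed

lemma a_eq: "a = p ^ (k - 1) * n'"
proof -
  have "p * p ^ (k - 1) = p ^ k"
    using k1 by (metis power_eq_if not_one_le_zero)
  then have "a * p = (p ^ (k - 1) * n') * p"
    using n_ap n_eq by (metis mult.commute mult.left_commute)
  then show ?thesis
    using p0 unfolding mult_cancel_right by simp
qed

lemma pos_n': "n' > 0"
  using n_pos p0 unfolding n_eq by (simp add: zero_less_mult_iff)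

lemma coprime_n': "coprime n' (p ^ i)"
  using prime_imp_power_coprime[OF pr pn'] .

lemma class_not_dvd: "c s x = \<gamma> \<Longrightarrow> \<not> p dvd x"
  using class_coprime[OF min p_def] .

text \<open>\<open>not_fx_tower\<close> at the exact valuation of \<open>v\<close>: among units
  acting only on the \<open>p\<close>-part and congruent to 1 modulo \<open>p\<close>, none but 1
  stabilises the class, leaving aside those that are -1 modulo 4 for \<open>p = 2\<close>.\<close>

lemma fx_tower_trivial:
  assumes "fx (1 + v)" and "n' dvd v" and "p dvd v" and "odd p \<or> 4 dvd v \<or> k \<le> 2"
  shows "n dvd v"
proof (cases "p ^ k dvd v")
  case True
  then show ?thesis
    unfolding n_eq using assms(2) coprime_n'[of k] by (intro divides_mult) (simp_all add: coprime_commute)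
next
  case False
  then have v0: "v \<noteq> 0" by auto
  define b where "b = multiplicity p v"
  have b: "p ^ b dvd v" "\<not> p ^ Suc b dvd v"
  proof -
    have "\<not> is_unit p"
      using pr by auto
    then show "p ^ b dvd v" "\<not> p ^ Suc b dvd v"
      using v0 power_dvd_iff_le_multiplicity[of v p "Suc b"] by (simp_all add: b_def multiplicity_dvd)
  qed
  have "b < k"
    using False b(1) le_imp_power_dvd[of k b p] dvd_trans by (meson not_le)
  moreover have "b \<ge> 1"
    using assms(3) b(2) by (cases b) auto
  moreover have "odd p \<or> b \<ge> 2 \<or> Suc b = k"
  proof (cases "4 dvd v \<and> \<not> odd p")
    case True
    then have "2 dvd p" by simp
    then have "p = 2"
      using pr primes_dvd_imp_eq[of 2 p] by simp
    have "b \<ge> 2"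
    proof (rule ccontr)
      assume "\<not> b \<ge> 2"
      then have "Suc b \<le> 2" by simp
      then have "p ^ Suc b dvd p ^ 2"
        by (rule le_imp_power_dvd)
      then show False
        using b(2) True \<open>p = 2\<close> dvd_trans by auto
    qed
    then show ?thesis by blast
  next
    case False
    then show ?thesis
      using assms(4) \<open>b < k\<close> \<open>b \<ge> 1\<close> by auto
  qed
  ultimately have "\<not> fx (1 + v)"
    using not_fx_tower[OF min p_def n_eq pn' assms(2) b] by blast
  then show ?thesis
    using assms(1) by blast
qed

text \<open>Stated so that Schur's theorem for \<open>p\<close> climbs from \<open>i\<close> to
  \<open>Suc i\<close>; at \<open>i = k\<close> it yields the Hall subgroup of order
  \<open>n'\<close>.\<close>

definition pow_class :: "nat \<Rightarrow> bool" where
  "pow_class i \<longleftrightarrow> (\<forall>s s' x. c s' x = c s (p ^ i * g s) \<longrightarrow> (\<exists>t. c s' t = \<gamma> \<and> n dvd x - p ^ i * t))"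

lemma pow_class_0: "pow_class 0"
  unfolding pow_class_def by (auto simp: g_col)

text \<open>Unless \<open>p\<close> divides the fibre size at \<open>p ^ i * g s\<close>, the
  \<open>p\<close>-fold lies in \<open>powset\<close>, and so does its whole class. A full fibre
  would contain \<open>p ^ i\<close> times a class element that is divisible by \<open>p\<close>, or
  would put some \<open>1 + v\<close> with \<open>v\<close> of valuation \<open>k - 1 - i\<close>
  into the stabiliser.\<close>

lemma pow_class_Suc:
  assumes C: "pow_class i" and i: "i < k"
    and nofx: "\<And>v. Suc i < k \<Longrightarrow> n' dvd v \<Longrightarrow> p ^ (k - 1 - i) dvd v \<Longrightarrow> \<not> p ^ (k - i) dvd v \<Longrightarrow> \<not> fx (1 + v)"
  shows "pow_class (Suc i)"
  unfolding pow_class_def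
proof (intro allI impI)
  fix s s' x assume x: "c s' x = c s (p ^ Suc i * g s)"
  define P where "P = nat p"
  have P: "int P = p"
    using p0 by (simp add: P_def)
  have primeP: "prime P"
    using pr P by (metis prime_nat_int_transfer)
  have P0: "P > 0"
    using prime_gt_0_nat[OF primeP] .
  have Pn: "int P dvd n"
    using n_ap P by simp
  have nP: "n div int P = a"
    using n_ap P P0 by simp
  define \<eta> where "\<eta> = c s (p ^ i * g s)"
  have \<eta>: "\<exists>t. c s' t = \<gamma> \<and> n dvd x - p ^ i * t" if "c s' x = \<eta>" for s' x
    using C that unfolding pow_class_def \<eta>_def by blast
  have "\<not> P dvd fib P s \<eta> (p ^ i * g s)"
  proof
    assume "P dvd fib P s \<eta> (p ^ i * g s)"
    then have "P \<le> fib P s \<eta> (p ^ i * g s)"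
      using fib_pos[OF Pn, of s "p ^ i * g s"] by (auto simp: \<eta>_def dest: dvd_imp_le)
    then have full: "c s z = \<eta>" if "a dvd z - p ^ i * g s" for z
      using fib_full[OF P0 Pn] that nP by blast
    show False
    proof (cases "Suc i = k")
      case True
      \<comment> \<open>\<open>n' * v\<close> is 1 modulo \<open>p\<close>, so \<open>z\<close>
        below is the point of the coset that is divisible by \<open>p ^ k\<close>.\<close>
      obtain v where v: "p dvd n' * v - 1"
        using int_coprime_inverse[of n' p] coprime_n'[of 1] by auto
      define z where "z = p ^ i * (g s - n' * v * g s)"
      have "a dvd z - p ^ i * g s"
        unfolding a_eq z_def True[symmetric] by (simp add: algebra_simps)
      then have "c s z = \<eta>"
        by (rule full)
      then obtain t where t: "c s t = \<gamma>" "n dvd z - p ^ i * t"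
        using \<eta> by blast
      have "p ^ k dvd z - p ^ i * t"
        using t(2) n_eq by (auto dest: dvd_mult_left)
      moreover have "p dvd g s - n' * v * g s"
        using dvd_mult2[OF v, of "- g s"] by (simp add: algebra_simps)
      then have "p ^ k dvd z"
        unfolding z_def True[symmetric] by (simp add: mult.commute mult_dvd_mono)
      ultimately have "p ^ k dvd z - (z - p ^ i * t)"
        by (intro dvd_diff[of _ z "z - p ^ i * t"])
      then have "p dvd t"
        using p0 unfolding True[symmetric] by (simp add: mult.commute)
      then show False
        using class_not_dvd[OF t(1)] by blast
    next
      case False
      then have Si: "Suc i < k"
        using i by simp
      define b where "b = k - 1 - i"
      have b: "b \<ge> 1" "k - 1 = i + b" "k - i = Suc b" "k = i + Suc b"
        using Si by (auto simp: b_def)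
      \<comment> \<open>The neighbour by \<open>a\<close> in a full fibre is again
        \<open>p ^ i * t\<close> with \<open>t\<close> in the class; the quotient of
        \<open>t\<close> by \<open>g s\<close> is an element of the stabiliser whose distance from 1
        has valuation exactly \<open>b\<close>.\<close>
      have "c s (p ^ i * g s + a) = \<eta>"
        by (rule full) simp
      then obtain t where t: "c s t = \<gamma>" "n dvd p ^ i * g s + a - p ^ i * t"
        using \<eta> by blast
      have "p ^ i * (p ^ Suc b * n') dvd p ^ i * (g s + p ^ b * n' - t)"
      proof -
        have "n = p ^ i * (p ^ Suc b * n')"
          unfolding n_eq b(4) power_add by (simp only: mult.assoc)
        moreover have "p ^ i * g s + a - p ^ i * t = p ^ i * (g s + p ^ b * n' - t)"
          unfolding a_eq b(2) power_add by (simp add: distrib_left right_diff_distrib mult.assoc)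
        ultimately show ?thesis
          using t(2) by simp
      qed
      then have t': "p ^ Suc b * n' dvd g s + p ^ b * n' - t"
        using p0 by simp
      \<comment> \<open>Modulo \<open>p ^ b * n'\<close> with \<open>b > 0\<close>, \<open>t\<close>
        agrees with the unit \<open>g s\<close>, and this modulus has all primes of
        \<open>n\<close>.\<close>
      have "coprime t n"
      proof (rule coprime_int_primesI)
        show "n \<noteq> 0" using n_pos by simp
        fix r assume r: "prime r" "r dvd t" "r dvd n"
        have "r dvd p ^ k \<or> r dvd n'"
          using r(1,3) unfolding n_eq by (rule prime_dvd_multD)
        then have "r dvd p ^ b * n'"
        proof
          assume "r dvd p ^ k"
          then have "r dvd p"
            using r(1) prime_dvd_power by blast
          then show ?thesis
            using b(1) by (metis dvd_mult2 dvd_power dvd_trans less_le_trans zero_less_one)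
        qed simp
        then have 1: "r dvd p ^ b * n'" "r dvd p ^ Suc b * n'"
          by (simp_all add: mult.assoc)
        have "r dvd (g s + p ^ b * n' - t) - p ^ b * n' + t"
          by (rule dvd_add[OF dvd_diff[OF dvd_trans[OF 1(2) t'] 1(1)] r(2)])
        then have "r dvd g s"
          by simp
        then show False
          using g_unit[of s] r(1,3) by (metis coprime_common_divisor not_prime_unit)
      qed
      then obtain m where m: "fx m" "n dvd m * g s - t"
        using units_fx[OF g_unit _ g_col t(1)] by blast
      define v where "v = m - 1"
      have "p ^ Suc b * n' dvd n"
        unfolding n_eq b(4) power_add by (simp add: mult.assoc)
      from dvd_diff[OF dvd_trans[OF this m(2)] t'] have "p ^ Suc b * n' dvd (m * g s - t) - (g s + p ^ b * n' - t)" .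
      then have v: "p ^ Suc b * n' dvd v * g s - p ^ b * n'"
        by (simp add: v_def algebra_simps)
      have gn': "coprime (g s) n'" and gp: "coprime (g s) (p ^ i)" for i
        using g_unit[of s] n_eq k1 by (simp_all add: n_eq)
      have "p ^ b * n' dvd p ^ Suc b * n'"
        by simp
      from dvd_add[OF dvd_trans[OF this v] dvd_refl] have "p ^ b * n' dvd v * g s"
        by simp
      then have "p ^ b dvd v * g s" "n' dvd v * g s"
        by (auto dest: dvd_mult_left dvd_mult_right)
      then have pv: "p ^ b dvd v" "n' dvd v"
        using gn' gp[of b] by (simp_all add: coprime_dvd_mult_left_iff coprime_commute)
      have "\<not> p ^ Suc b dvd v"
      proof
        assume "p ^ Suc b dvd v"
        moreover have "p ^ Suc b dvd v * g s - p ^ b * n'"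
          using v dvd_mult_left by blast
        ultimately have "p ^ Suc b dvd v * g s - (v * g s - p ^ b * n')"
          by (rule dvd_diff[OF dvd_mult2])
        then have "p dvd n'"
          using p0 by (simp add: mult.commute)
        then show False
          using pn' by blast
      qed
      then have "\<not> p ^ (k - i) dvd v"
        unfolding b(3) .
      then have "\<not> fx (1 + v)"
        by (rule nofx[OF Si pv(2) pv(1)[unfolded b_def]])
      then show False
        using m(1) by (simp add: v_def)
    qed
  qed
  then have "powset P s \<eta> (int P * (p ^ i * g s))"
    using powset_fib[OF P0 Pn] by blast
  then have "powset P s' \<eta> x"
    using powset_inv[OF primeP x] P by (simp add: mult.assoc)
  then obtain t' where t': "c s' t' = \<eta>" "n dvd p * t' - x"
    unfolding P[symmetric] by (rule powsetD)
  then obtain t where t: "c s' t = \<gamma>" "n dvd t' - p ^ i * t"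
    using \<eta> by blast
  have "n dvd p * (t' - p ^ i * t) - (p * t' - x)"
    by (rule dvd_diff[OF dvd_mult[OF t(2)] t'(2)])
  then have "n dvd x - p ^ Suc i * t"
    by (simp add: algebra_simps)
  then show "\<exists>t. c s' t = \<gamma> \<and> n dvd x - p ^ Suc i * t"
    using t(1) by blast
qed

text \<open>For \<open>p = 2\<close> the step from \<open>i\<close> needs the valuation
  \<open>k - 1 - i\<close> to be at least 2, so for larger \<open>k\<close> the climb stops at
  \<open>k - 2\<close>.\<close>

lemma pow_class_regular:
  assumes "i \<le> k" and "odd p \<or> k \<le> 2 \<or> i + 2 \<le> k"
  shows "pow_class i"
  using assms
proof (induction i)
  case (Suc i)
  show ?case
  proof (rule pow_class_Suc)
    show "pow_class i"
      using Suc by auto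
    show "i < k"
      using Suc.prems by simp
    show "\<not> fx (1 + v)" if "Suc i < k" "n' dvd v" "p ^ (k - 1 - i) dvd v" "\<not> p ^ (k - i) dvd v" for v
    proof (rule not_fx_tower[OF min p_def n_eq pn' that(2,3)])
      have "Suc (k - 1 - i) = k - i"
        using that(1) by simp
      then show "\<not> p ^ Suc (k - 1 - i) dvd v"
        using that(4) by simp
      show "1 \<le> k - 1 - i" "k - 1 - i < k" "odd p \<or> 2 \<le> k - 1 - i \<or> Suc (k - 1 - i) = k"
        using that(1) Suc.prems(2) by auto
    qed
  qed
qed (rule pow_class_0)

lemma pow_class_asub:
  assumes "pow_class i" and "i \<le> k"
  shows "asub (p ^ i)"
proof (rule asub_of_class[of _ True])
  show "p ^ i > 0"
    using p0 by simp
  show pn: "p ^ i dvd n"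
    unfolding n_eq using assms(2) by (simp add: le_imp_power_dvd)
  fix x assume "c True x = c True (p ^ i * g True)"
  then obtain t where t: "n dvd x - p ^ i * t"
    using assms(1) unfolding pow_class_def by blast
  from dvd_add[OF dvd_trans[OF pn t] dvd_triv_left[of _ t]] show "p ^ i dvd x"
    by simp
qed

end

section \<open>The exceptional dyadic case\<close>

context normal_prime
begin

text \<open>The exceptional case: \<open>p = 2\<close> and the class is fixed by a unit \<open>1 + v\<close> that acts as
  \<open>-1\<close> or \<open>2 ^ (k - 1) - 1\<close> modulo \<open>2 ^ k\<close> and trivially modulo \<open>n'\<close>. The number of ways to write
  \<open>y = (2 + v) * g\<close> as a sum of two elements of the class is \<open>2\<close> modulo \<open>4\<close>, whereas for \<open>y + n div 2\<close>
  it is divisible by \<open>4\<close>, since both \<open>x \<mapsto> y - x\<close> and \<open>x \<mapsto> (1 + v) * x\<close> act on the set of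
  summands.\<close>

context
  fixes v :: int
  assumes two: "p = 2" and k3: "k \<ge> 3" and fx_v: "fx (1 + v)" and n'_v: "n' dvd v"
    and v2: "2 dvd v" "\<not> 4 dvd v"
begin

text \<open>The square of \<open>1 + v\<close> lies in the stabiliser and is 1 modulo 4, where
  \<open>fx_tower_trivial\<close> applies.\<close>

lemma v_sq: "n dvd v * (2 + v)"
proof (rule fx_tower_trivial)
  have "fx ((1 + v) * (1 + v))"
    by (rule fx_mult[OF fx_v fx_v])
  then show "fx (1 + v * (2 + v))"
    by (simp add: algebra_simps)
  show "n' dvd v * (2 + v)" "p dvd v * (2 + v)"
    using n'_v v2 two by simp_all
  have "2 * 2 dvd v * (2 + v)"
    using v2(1) by (intro mult_dvd_mono) simp_all
  then show "odd p \<or> 4 dvd v * (2 + v) \<or> k \<le> 2"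
    by simp
qed

text \<open>\<open>v\<close> is twice an odd number, so \<open>2 + v\<close> must supply all but one
  of the \<open>k\<close> factors 2.\<close>

lemma half_dvd: "2 ^ (k - 1) dvd 2 + v"
proof -
  obtain w where w: "v = 2 * w"
    using v2(1) by blast
  then have "odd w"
    using v2(2) by auto
  have "2 ^ k dvd v * (2 + v)"
    using v_sq two unfolding n_eq by (auto dest: dvd_mult_left)
  moreover have "(2::int) ^ k = 2 * 2 ^ (k - 1)"
    using k3 by (metis power_eq_if not_numeral_le_zero)
  ultimately have "2 ^ (k - 1) dvd w * (2 + v)"
    unfolding w by (simp add: mult.assoc)
  moreover have "coprime ((2::int) ^ (k - 1)) w"
    using \<open>odd w\<close> by simp
  ultimately show ?thesis
    by (simp add: coprime_dvd_mult_right_iff)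
qed

lemma four_half: "(4::int) dvd 2 ^ (k - 1)"
  using le_imp_power_dvd[of 2 "k - 1" "2::int"] k3 by simp

lemma a_half: "a = 2 ^ (k - 1) * n'" and n_2a: "n = a * 2"
  using a_eq n_ap two by simp_all

lemma four_n: "4 dvd n" and four_a: "4 dvd a" and four_v: "4 dvd 2 + v"
  using four_half a_half n_2a half_dvd dvd_trans by (auto intro: dvd_mult2)

lemma class_odd: "c s x = \<gamma> \<Longrightarrow> odd x"
  using class_not_dvd two by blast

text \<open>The second condition on \<open>Y\<close> lets \<open>1 + v\<close> act on the summands.
  On odd residues neither involution has fixed points, since 4 divides \<open>Y\<close> but not
  \<open>v\<close>; the set on the right consists of the fixed points of their product, and off it
  the orbits have size 4.\<close>

lemma sum_card:
  assumes Y: "4 dvd Y" "n dvd (1 + v) * Y - Y"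
  shows "[card {x \<in> {0..<n}. c s x = \<gamma> \<and> c s (Y - x) = \<gamma>} =
    card {x \<in> {0..<n}. (c s x = \<gamma> \<and> c s (Y - x) = \<gamma>) \<and> n dvd Y - (1 + v) * x - x}] (mod 4)"
proof -
  define S where "S = {x \<in> {0..<n}. c s x = \<gamma> \<and> c s (Y - x) = \<gamma>}"
  define F where "F = {x \<in> {0..<n}. (c s x = \<gamma> \<and> c s (Y - x) = \<gamma>) \<and> n dvd Y - (1 + v) * x - x}"
  define f where "f x = (Y - x) mod n" for x
  define h where "h x = ((1 + v) * x) mod n" for x
  have range: "x mod n \<in> {0..<n}" for x
    using n_pos by simp
  have eqI: "x = z" if "n dvd x - z" "x \<in> {0..<n}" "z \<in> {0..<n}" for x z
    using dvd_imp_eq that by blast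
  have fd: "n dvd f x - (Y - x)" and hd: "n dvd h x - (1 + v) * x" for x
    unfolding f_def h_def by (rule dvd_mod_diff)+
  have tt: "n dvd (1 + v) * ((1 + v) * x) - x" for x
    using dvd_mult2[OF v_sq, of x] by (simp add: algebra_simps)
  have f_mem: "f x \<in> {0..<n}" and h_mem: "h x \<in> {0..<n}" for x
    unfolding f_def h_def using range by blast+
  have four: "4 dvd z" if "n dvd z" for z
    using that four_n dvd_trans by blast
  have fS: "f x \<in> S" if "x \<in> S" for x
  proof -
    have "c s (f x) = c s (Y - x)"
      by (rule per[OF fd])
    moreover have "n dvd (Y - f x) - x"
      using fd[of x] by (simp add: dvd_diff_commute algebra_simps)
    then have "c s (Y - f x) = c s x"
      by (rule per)
    ultimately show ?thesis
      using that f_mem by (simp add: S_def)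
  qed
  have hS: "h x \<in> S" if "x \<in> S" for x
  proof -
    have x: "c s x = \<gamma>" "c s (Y - x) = \<gamma>"
      using that by (simp_all add: S_def)
    have "c s (h x) = \<gamma>"
      using per[OF hd] fx_col[OF fx_v x(1)] by simp
    moreover have "n dvd (Y - h x) - (1 + v) * (Y - x)"
      using dvd_diff[OF dvd_minus_iff[THEN iffD2, OF hd[of x]] Y(2)] by (simp add: algebra_simps)
    then have "c s (Y - h x) = \<gamma>"
      using per fx_col[OF fx_v x(2)] by metis
    ultimately show ?thesis
      using h_mem by (simp add: S_def)
  qed
  have fF: "n dvd Y - (1 + v) * x - x" if "n dvd Y - (1 + v) * f x - f x" for x
  proof -
    have "n dvd (1 + v) * (f x - (Y - x)) + (f x - (Y - x))"
      using fd by (intro dvd_add dvd_mult)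
    from dvd_add[OF dvd_add[OF that this] Y(2)] have "n dvd (1 + v) * x + x - Y"
      by (simp add: algebra_simps)
    then show ?thesis
      by (simp add: dvd_diff_commute algebra_simps)
  qed
  have hF: "n dvd Y - (1 + v) * x - x" if "n dvd Y - (1 + v) * h x - h x" for x
  proof -
    have "n dvd (1 + v) * (h x - (1 + v) * x) + (h x - (1 + v) * x)"
      using hd by (intro dvd_add dvd_mult)
    from dvd_add[OF dvd_add[OF that this] tt[of x]] show ?thesis
      by (simp add: algebra_simps)
  qed
  have "4 dvd card (S - F)"
  proof (rule card_two_involutions[of _ f h])
    show "finite (S - F)"
      by (simp add: S_def)
    fix x assume "x \<in> S - F"
    then have x: "x \<in> S" "x \<in> {0..<n}" "odd x" "\<not> n dvd Y - (1 + v) * x - x"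
      using class_odd by (auto simp: S_def F_def)
    show "f x \<in> S - F" "h x \<in> S - F"
      using fS[OF x(1)] hS[OF x(1)] fF[of x] hF[of x] x(4) by (auto simp: F_def)
    show "f (f x) = x"
    proof (rule eqI[OF _ f_mem x(2)])
      show "n dvd f (f x) - x"
        using dvd_diff[OF fd[of "f x"] fd[of x]] by simp
    qed
    show "h (h x) = x"
    proof (rule eqI[OF _ h_mem x(2)])
      show "n dvd h (h x) - x"
        using dvd_add[OF dvd_add[OF hd[of "h x"] dvd_mult[OF hd[of x], of "1 + v"]] tt[of x]]
        by (simp add: algebra_simps)
    qed
    have fh: "n dvd f (h x) - (Y - (1 + v) * x)"
      using dvd_diff[OF fd[of "h x"] hd[of x]] by (simp add: algebra_simps)
    show "f (h x) = h (f x)"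
    proof (rule eqI[OF _ f_mem h_mem])
      have "n dvd h (f x) - ((1 + v) * Y - (1 + v) * x)"
        using dvd_add[OF hd[of "f x"] dvd_mult[OF fd[of x], of "1 + v"]] by (simp add: algebra_simps)
      from dvd_diff[OF fh dvd_add[OF this Y(2)]] show "n dvd f (h x) - h (f x)"
        by (simp add: algebra_simps)
    qed
    show "f x \<noteq> x"
    proof
      assume "f x = x"
      then have "4 dvd x - (Y - x)"
        using fd[of x] four by simp
      from dvd_add[OF this Y(1)] have "4 dvd 2 * x"
        by simp
      then show False
        using x(3) by presburger
    qed
    show "h x \<noteq> x"
    proof
      assume "h x = x"
      then have "4 dvd x - (1 + v) * x"
        using hd[of x] four by simp
      then have "4 dvd v * x"
        by (simp add: algebra_simps)
      moreover have "coprime 4 x"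
        using x(3) coprime_power_left_iff[of "2::int" 2 x] by simp
      ultimately show False
        using v2(2) by (simp add: coprime_dvd_mult_left_iff)
    qed
    show "f (h x) \<noteq> x"
    proof
      assume "f (h x) = x"
      then have "n dvd x - (Y - (1 + v) * x)"
        using fh by simp
      then show False
        using x(4) by (simp add: dvd_diff_commute)
    qed
  qed
  moreover have "card S = card F + card (S - F)"
  proof -
    have "F \<subseteq> S" "finite S"
      by (auto simp: S_def F_def)
    then show ?thesis
      by (metis card_Diff_subset card_mono finite_subset le_add_diff_inverse)
  qed
  ultimately show ?thesis
    unfolding S_def[symmetric] F_def[symmetric] by (auto simp: cong_def elim!: dvdE)
qed

lemma colour_differs: "c s ((2 + v) * g s) \<noteq> c s ((2 + v) * g s + a)"
proof
  define y where "y = (2 + v) * g s"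
  let ?N = "\<lambda>Y. card {x \<in> {0..<n}. c s x = \<gamma> \<and> c s (Y - x) = \<gamma>}"
  let ?F = "\<lambda>Y. {x \<in> {0..<n}. (c s x = \<gamma> \<and> c s (Y - x) = \<gamma>) \<and> n dvd Y - (1 + v) * x - x}"
  assume "c s ((2 + v) * g s) = c s ((2 + v) * g s + a)"
  then have eq: "c s y = c s (y + a)"
    by (simp add: y_def)
  have "?N y = ?N (y + a)"
  proof -
    define B where "B \<beta> \<longleftrightarrow> (\<exists>s w. c s w = \<beta> \<and> c s (- w) = \<gamma>)" for \<beta>
    have B: "B (c s w) \<longleftrightarrow> c s (- w) = \<gamma>" for s w
      using neg unfolding B_def by metis
    show ?thesis
      using count_inv[OF eq, of "\<lambda>\<alpha>. \<alpha> = \<gamma>" B] unfolding B cnt_def by simp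
  qed
  moreover have "[?N y = 2] (mod 4)"
  proof -
    have Y: "4 dvd y" "n dvd (1 + v) * y - y"
    proof -
      show "4 dvd y"
        unfolding y_def using four_v by (rule dvd_mult2)
      show "n dvd (1 + v) * y - y"
        using dvd_mult2[OF v_sq, of "g s"] by (simp add: y_def algebra_simps)
    qed
    \<comment> \<open>A solution is a unit congruent to \<open>g s\<close> modulo \<open>n'\<close>,
      so it is \<open>m * g s\<close> with \<open>m\<close> in the stabiliser. Either
      \<open>m\<close> or \<open>(1 + v) * m\<close> is 1 modulo 4, and is then 1 modulo
      \<open>n\<close>.\<close>
    have "?F y = {g s mod n, ((1 + v) * g s) mod n}"
    proof (intro equalityI subsetI)
      fix x assume "x \<in> ?F y"
      then have x: "x \<in> {0..<n}" "c s x = \<gamma>" "n dvd (2 + v) * (g s - x)"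
        by (simp_all add: y_def algebra_simps)
      have "odd n'"
        using pn' two by simp
      then have "coprime n' 2"
        by simp
      moreover have "n' dvd (2 + v) * (g s - x) - v * (g s - x)"
        using x(3) n_eq n'_v by (intro dvd_diff[of _ "(2 + v) * (g s - x)"]) (auto dest: dvd_mult_right)
      then have "n' dvd 2 * (g s - x)"
        by (simp add: distrib_right)
      ultimately have n'x: "n' dvd g s - x"
        using coprime_dvd_mult_right_iff by blast
      have "coprime x n"
      proof (rule coprime_int_primesI)
        show "n \<noteq> 0" using n_pos by simp
        fix r assume r: "prime r" "r dvd x" "r dvd n"
        have "r dvd p ^ k \<or> r dvd n'"
          using r(1,3) unfolding n_eq by (rule prime_dvd_multD)
        then show False
        proof
          assume "r dvd p ^ k"
          then have "r dvd 2"
            using r(1) prime_dvd_power two by blast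
          then have "r = 2"
            using r(1) primes_dvd_imp_eq[of r 2] by simp
          then show False
            using r(2) class_odd[OF x(2)] by simp
        next
          assume "r dvd n'"
          from dvd_add[OF dvd_trans[OF this n'x] r(2)] have "r dvd g s"
            by simp
          then show False
            using g_unit[of s] r(1,3) by (metis coprime_common_divisor not_prime_unit)
        qed
      qed
      then obtain m where m: "fx m" "n dvd m * g s - x"
        using units_fx[OF g_unit _ g_col x(2)] by blast
      have n'n: "n' dvd n"
        by (simp add: n_eq)
      have "n' dvd (m * g s - x) - (g s - x)"
        by (rule dvd_diff[OF dvd_trans[OF n'n m(2)] n'x])
      then have "n' dvd (m - 1) * g s"
        by (simp add: algebra_simps)
      moreover have "coprime n' (g s)"
        using g_unit[of s] n_eq by (simp add: coprime_commute)
      ultimately have n'm: "n' dvd m - 1"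
        by (simp add: coprime_dvd_mult_left_iff)
      have "2 dvd n"
        using n_2a by simp
      have "odd m"
        using fx_coprime[OF m(1)] \<open>2 dvd n\<close> coprime_common_divisor[of m n 2] by auto
      show "x \<in> {g s mod n, ((1 + v) * g s) mod n}"
      proof (cases "4 dvd m - 1")
        case True
        have "n dvd m - 1"
          by (rule fx_tower_trivial) (use m(1) n'm True two \<open>odd m\<close> in auto)
        from dvd_diff[OF m(2) dvd_mult2[OF this, of "g s"]] have "n dvd g s - x"
          by (simp add: algebra_simps)
        then have "g s mod n = x"
          using x(1) n_pos by (metis atLeastLessThan_iff mod_eq_dvd_iff mod_pos_pos_trivial)
        then show ?thesis by simp
      next
        case False
        have "4 dvd (1 + v) * m - 1"
        proof -
          have "even (m - 1)"
            using \<open>odd m\<close> by simp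
          then obtain u where u: "m - 1 = 2 * u"
            by blast
          obtain w where w: "v = 2 * w"
            using v2(1) by blast
          have "odd u" "odd w"
            using False v2(2) u w by auto
          then have "even (u + w)"
            by simp
          then obtain q where "u + w = 2 * q"
            by blast
          moreover have "(1 + v) * m - 1 = 2 * (u + w) + 4 * (u * w)"
            using u unfolding w by (simp add: algebra_simps)
          ultimately show ?thesis
            by simp
        qed
        moreover have "n' dvd v * m + (m - 1)"
          using n'_v n'm by (intro dvd_add) simp_all
        then have "n' dvd (1 + v) * m - 1"
          by (simp add: algebra_simps)
        moreover have "fx (1 + ((1 + v) * m - 1))"
          using fx_mult[OF fx_v m(1)] by simp
        moreover have "2 dvd (1 + v) * m - 1"
          using \<open>4 dvd (1 + v) * m - 1\<close> by presburger
        ultimately have nm: "n dvd (1 + v) * m - 1"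
          using two fx_tower_trivial by blast
        have "n dvd (1 + v) * g s - x"
        proof -
          have "(1 + v) * g s - x = (m * g s - x) + (v * (2 + v)) * (m * g s) - (1 + v) * g s * ((1 + v) * m - 1)"
            by (simp add: algebra_simps)
          then show ?thesis
            using m(2) v_sq nm by (metis dvd_add dvd_diff dvd_mult dvd_mult2)
        qed
        then have "((1 + v) * g s) mod n = x"
          using x(1) n_pos by (metis atLeastLessThan_iff mod_eq_dvd_iff mod_pos_pos_trivial)
        then show ?thesis by simp
      qed
    next
      fix x assume "x \<in> {g s mod n, ((1 + v) * g s) mod n}"
      then obtain z where z: "x = z mod n" "z = g s \<or> z = (1 + v) * g s"
        by blast
      have "z = g s \<and> y - z = (1 + v) * g s \<or> z = (1 + v) * g s \<and> y - z = g s"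
        using z(2) by (auto simp: y_def distrib_right)
      moreover have "c s (g s) = \<gamma>" "c s ((1 + v) * g s) = \<gamma>"
        using g_col fx_col[OF fx_v g_col] by blast+
      ultimately have 1: "c s z = \<gamma>" "c s (y - z) = \<gamma>"
        by metis+
      have 2: "n dvd y - (1 + v) * z - z"
        using z(2) dvd_mult2[OF v_sq, of "- g s"] by (auto simp: y_def algebra_simps)
      have xz: "n dvd x - z"
        unfolding z(1) by (rule dvd_mod_diff)
      have "c s x = \<gamma>"
        using per[OF xz] 1(1) by simp
      moreover have "c s (y - x) = \<gamma>"
      proof -
        have "n dvd - (x - z)"
          using xz by (simp only: dvd_minus_iff)
        moreover have "- (x - z) = (y - x) - (y - z)"
          by simp
        ultimately have "c s (y - x) = c s (y - z)"
          by (intro per) simp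
        then show ?thesis
          using 1(2) by simp
      qed
      moreover have "n dvd (y - (1 + v) * z - z) - ((1 + v) * (x - z) + (x - z))"
        by (rule dvd_diff[OF 2 dvd_add[OF dvd_mult[OF xz] xz]])
      then have "n dvd y - (1 + v) * x - x"
        by (simp add: algebra_simps)
      moreover have "x \<in> {0..<n}"
        using z(1) n_pos by simp
      ultimately show "x \<in> ?F y"
        by simp
    qed
    moreover have "g s mod n \<noteq> ((1 + v) * g s) mod n"
    proof
      assume "g s mod n = ((1 + v) * g s) mod n"
      then have "n dvd (1 + v) * g s - g s"
        by (simp add: mod_eq_dvd_iff dvd_diff_commute)
      then have "n dvd v * g s"
        by (simp add: algebra_simps)
      then have "n dvd v"
        using g_unit[of s] by (simp add: coprime_dvd_mult_left_iff coprime_commute)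
      then show False
        using v2(2) four_n dvd_trans by blast
    qed
    ultimately have "card (?F y) = 2"
      by simp
    with sum_card[OF Y, of s] show ?thesis
      by (simp only:)
  qed
  moreover have "[?N (y + a) = 0] (mod 4)"
  proof -
    have ta: "n dvd v * a"
      using v2(1) unfolding n_2a by (auto simp: mult.commute)
    have Y: "4 dvd y + a" "n dvd (1 + v) * (y + a) - (y + a)"
    proof -
      show "4 dvd y + a"
        using four_v four_a by (simp add: y_def)
      show "n dvd (1 + v) * (y + a) - (y + a)"
        using dvd_add[OF dvd_mult2[OF v_sq, of "g s"] ta] by (simp add: y_def algebra_simps)
    qed
    \<comment> \<open>\<open>2 + v\<close> supplies \<open>k - 1\<close> factors 2 and
      \<open>g s - x\<close> is even, so a solution would make \<open>a\<close> divisible by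
      \<open>2 ^ k\<close>.\<close>
    have "?F (y + a) = {}"
    proof -
      have False if x: "c s x = \<gamma>" "n dvd (y + a) - (1 + v) * x - x" for x
      proof -
        have "n dvd (2 + v) * (g s - x) + a"
          using x(2) by (simp add: y_def algebra_simps)
        moreover have "2 ^ k dvd n"
          using n_eq two by simp
        moreover have "2 ^ (k - 1) * 2 dvd (2 + v) * (g s - x)"
          using half_dvd class_odd[OF x(1)] class_odd[OF g_col[of s]] by (intro mult_dvd_mono) auto
        moreover have pk: "(2::int) ^ k = 2 ^ (k - 1) * 2"
          using k3 by (metis mult.commute power_eq_if not_numeral_le_zero)
        ultimately have "2 ^ (k - 1) * 2 dvd (2 + v) * (g s - x) + a - (2 + v) * (g s - x)"
          by (intro dvd_diff[of _ "(2 + v) * (g s - x) + a"]) (auto dest: dvd_trans)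
        then have "2 dvd n'"
          unfolding a_half by simp
        then show False
          using pn' two by simp
      qed
      then show ?thesis
        by blast
    qed
    with sum_card[OF Y, of s] show ?thesis
      by (simp only: card.empty)
  qed
  ultimately show False
    by (auto simp: cong_def)
qed

text \<open>\<open>2 ^ (k - 1) * g s\<close> is twice \<open>2 ^ (k - 2) * g s\<close>. By triangle
  transfer each element of its class is a sum of two elements from the class of the latter, which
  modulo \<open>n\<close> are odd multiples of \<open>2 ^ (k - 2)\<close>.\<close>

lemma dyadic_half_asub: "asub (2 ^ (k - 1))"
proof (rule asub_of_class[of _ True])
  define s where "s = True"
  have C: "pow_class (k - 2)"
    using k3 by (intro pow_class_regular) auto
  have pk: "(2::int) ^ (k - 1) = 2 ^ (k - 2) * 2" "(2::int) ^ k = 2 ^ (k - 1) * 2"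
    using k3 power_Suc2[of "2::int" "k - 2"] power_Suc2[of "2::int" "k - 1"] by (simp_all add: Suc_diff_Suc numeral_2_eq_2)
  have hn: "2 ^ (k - 1) dvd n"
    unfolding n_eq two pk(2) by simp
  then show "(2::int) ^ (k - 1) dvd n" .
  fix x assume "c True x = c True (2 ^ (k - 1) * g True)"
  then have x: "c s (2 ^ (k - 1) * g s) = c s x"
    by (simp add: s_def)
  from tri[OF x, of "2 ^ (k - 2) * g s"] obtain z where z: "c s z = c s (2 ^ (k - 2) * g s)"
      "c s (z - x) = c s (2 ^ (k - 2) * g s - 2 ^ (k - 1) * g s)"
    by blast
  have "c s (- (z - x)) = c s (- (2 ^ (k - 2) * g s - 2 ^ (k - 1) * g s))"
    by (rule neg[OF z(2)])
  then have "c s (x - z) = c s (2 ^ (k - 2) * g s)"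
    unfolding pk(1) by (simp add: algebra_simps)
  then obtain t where t: "c s t = \<gamma>" "n dvd (x - z) - 2 ^ (k - 2) * t"
    using C two unfolding pow_class_def by blast
  obtain t' where t': "c s t' = \<gamma>" "n dvd z - 2 ^ (k - 2) * t'"
    using C two z(1) unfolding pow_class_def by blast
  have "n dvd x - 2 ^ (k - 2) * (t + t')"
    using dvd_add[OF t(2) t'(2)] by (simp add: algebra_simps)
  moreover have "2 ^ (k - 1) dvd 2 ^ (k - 2) * (t + t')"
    unfolding pk(1) using class_odd[OF t(1)] class_odd[OF t'(1)] by (intro mult_dvd_mono) auto
  ultimately show "2 ^ (k - 1) dvd x"
    using dvd_add[of "2 ^ (k - 1)" "x - 2 ^ (k - 2) * (t + t')" "2 ^ (k - 2) * (t + t')"] hn dvd_trans by auto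
qed simp

text \<open>By \<open>colour_differs\<close> the fibre at \<open>y\<close> is a single point, so
  doubling the class of \<open>y\<close> gives a nonempty \<open>powset\<close> of multiples of
  \<open>2 ^ k\<close>. Any further factor of the generator is odd, divides \<open>n'\<close> and
  hence \<open>v\<close>, and so divides \<open>4 * g s\<close>; it is 1.\<close>

lemma dyadic_asub: "asub (2 ^ k)"
proof -
  define s where "s = True"
  define y where "y = (2 + v) * g s"
  define \<eta> where "\<eta> = c s y"
  have pk: "(2::int) ^ k = 2 ^ (k - 1) * 2"
    using k3 by (metis mult.commute power_eq_if not_numeral_le_zero)
  have n2: "int 2 dvd n"
    using n_2a by simp
  have na: "n div int 2 = a"
    using n_2a by simp
  have kn: "2 ^ k dvd n"
    using n_eq two by simp
  have hy: "2 ^ (k - 1) dvd y"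
    unfolding y_def using half_dvd by (rule dvd_mult2)
  have "fib 2 s \<eta> y \<le> cnt n (\<lambda>z. n dvd z - y)"
    unfolding fib_def na
  proof (rule cnt_mono)
    fix z assume z: "c s z = \<eta> \<and> a dvd z - y"
    then obtain j where j: "z - y = a * j"
      by blast
    show "n dvd z - y"
    proof (cases "even j")
      case True
      then show ?thesis
        unfolding j n_2a by (intro mult_dvd_mono) auto
    next
      case False
      then obtain i where "j = 2 * i + 1"
        by (metis oddE)
      then have "n dvd z - (y + a)"
        using j unfolding n_2a by (simp add: algebra_simps)
      then have "c s z = c s (y + a)"
        by (rule per)
      then show ?thesis
        using z colour_differs[of s] by (simp add: \<eta>_def y_def)
    qed
  qed
  then have "fib 2 s \<eta> y = 1"
    using cnt_single[OF n_pos, of y] fib_pos[OF n2, of s y] by (simp add: \<eta>_def)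
  then have pow: "powset 2 s \<eta> (2 * y)"
    using powset_fib[OF _ n2, of s \<eta> y] by simp
  obtain b where b: "asub b" "\<And>s x. powset 2 s \<eta> x \<Longrightarrow> b dvd x"
      "\<And>s b'. b' dvd n \<Longrightarrow> (\<And>x. powset 2 s \<eta> x \<Longrightarrow> b' dvd x) \<Longrightarrow> b' dvd b"
    using powset_gen_min[OF two_is_prime_nat, of \<eta>] by blast
  have "2 ^ k dvd b"
  proof (rule b(3)[OF kn, of s])
    fix x assume "powset 2 s \<eta> x"
    then obtain t where t: "c s t = \<eta>" "n dvd int 2 * t - x"
      by (rule powsetD)
    have "2 ^ (k - 1) dvd t"
      by (rule asub_dvdD[OF dyadic_half_asub t(1)[symmetric, unfolded \<eta>_def] hy])
    then have "2 ^ k dvd int 2 * t"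
      unfolding pk by (simp add: mult.commute)
    from dvd_diff[OF this dvd_trans[OF kn t(2)]] show "2 ^ k dvd x"
      by simp
  qed
  then obtain b1 where b1: "b = 2 ^ k * b1"
    by blast
  have "b1 dvd n'"
    using asub_dvd[OF b(1)] unfolding b1 n_eq two by simp
  have "b1 dvd 4 * g s"
  proof -
    have "b1 dvd 2 * y"
      using b(2)[OF pow] unfolding b1 by (auto dest: dvd_mult_right)
    moreover have "b1 dvd 2 * (v * g s)"
      using dvd_trans[OF \<open>b1 dvd n'\<close> n'_v] by simp
    ultimately have "b1 dvd 2 * y - 2 * (v * g s)"
      by (rule dvd_diff)
    then show ?thesis
      by (simp add: y_def algebra_simps)
  qed
  moreover have "coprime b1 (g s)"
    using \<open>b1 dvd n'\<close> g_unit[of s] n_eq coprime_divisors[of b1 n "g s" "g s"] by (simp add: coprime_commute)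
  moreover have "coprime b1 4"
  proof -
    have "odd b1"
      using \<open>b1 dvd n'\<close> pn' two dvd_trans by blast
    then show ?thesis
      using coprime_power_right_iff[of b1 "2::int" 2] by simp
  qed
  ultimately have "is_unit b1"
    by (metis coprime_absorb_left coprime_dvd_mult_left_iff)
  moreover have "b1 > 0"
    using asub_pos[OF b(1)] unfolding b1 by (simp add: zero_less_mult_iff)
  ultimately show ?thesis
    using b(1) b1 by simp
qed

end

text \<open>For \<open>p = 2\<close> only the step from \<open>k - 2\<close> can fail, and it fails
  only if the stabiliser contains a unit of the exceptional kind.\<close>

lemma hall_asub: "asub (p ^ k)"
proof (cases "odd p \<or> k \<le> 2")
  case True
  then show ?thesis
    by (intro pow_class_asub pow_class_regular) auto
next
  case False
  then have two: "p = 2"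
    using pr primes_dvd_imp_eq[of 2 p] by simp
  have k3: "k \<ge> 3"
    using False by simp
  show ?thesis
  proof (cases "\<exists>v. fx (1 + v) \<and> n' dvd v \<and> 2 dvd v \<and> \<not> 4 dvd v")
    case True
    then show ?thesis
      using dyadic_asub[OF two k3] two by blast
  next
    case False
    have "pow_class (Suc (k - 2))"
    proof (rule pow_class_Suc)
      show "pow_class (k - 2)"
        using k3 by (intro pow_class_regular) auto
      show "k - 2 < k"
        using k3 by simp
      fix v assume v: "n' dvd v" "p ^ (k - 1 - (k - 2)) dvd v" "\<not> p ^ (k - (k - 2)) dvd v"
      have "k - 1 - (k - 2) = 1" "k - (k - 2) = 2"
        using k3 by simp_all
      then show "\<not> fx (1 + v)"
        using v False two by auto
    qed
    then have "pow_class (Suc (Suc (k - 2)))"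
      by (rule pow_class_Suc) (use k3 in simp_all)
    then have "pow_class k"
      using k3 by (simp add: Suc_diff_Suc numeral_2_eq_2)
    then show ?thesis
      by (rule pow_class_asub) simp
  qed
qed

end

section \<open>Minimal and Hall subgroups for all primes\<close>

lemma prime_power_split:
  assumes "prime (p::int)" and "n > 0"
  obtains n' where "n = p ^ multiplicity p n * n'" and "\<not> p dvd n'"
proof -
  have "n \<noteq> 0" "\<not> is_unit p"
    using assms by auto
  then obtain n' where "n = p ^ multiplicity p n * n'" "\<not> p dvd n'"
    using multiplicity_decompose'[of n p] by blast
  then show ?thesis
    using that by blast
qed

lemma prime_power_maximal:
  assumes "prime (p::int)" and "n > 0"
  shows "\<not> p ^ Suc (multiplicity p n) dvd n"
proof -
  obtain n' where n': "n = p ^ multiplicity p n * n'" "\<not> p dvd n'"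
    by (rule prime_power_split[OF assms])
  show ?thesis
  proof
    assume "p ^ Suc (multiplicity p n) dvd n"
    then have "p ^ multiplicity p n * p dvd p ^ multiplicity p n * n'"
      unfolding n'(1)[symmetric] by (simp add: mult.commute)
    then show False
      using n'(2) prime_gt_0_int[OF assms(1)] by simp
  qed
qed

context normal_class
begin

lemma normal_primeI:
  assumes "minsub a" and "n = (n div a) ^ k * n'" and "\<not> n div a dvd n'"
  shows "normal_prime n c \<gamma> g a (n div a) k n'"
  by unfold_locales (use assms in auto)

lemma minsub_power_asub:
  assumes "minsub a"
  shows "asub ((n div a) ^ multiplicity (n div a) n)"
proof -
  have "prime (n div a)"
    by (rule min_prime[OF assms])
  then obtain n' where n': "n = (n div a) ^ multiplicity (n div a) n * n'" "\<not> n div a dvd n'"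
    using prime_power_split n_pos by blast
  interpret normal_prime n c \<gamma> g a "n div a" "multiplicity (n div a) n" n'
    by (rule normal_primeI[OF assms n'])
  show ?thesis
    by (rule hall_asub)
qed

text \<open>Take a smallest subgroup of the Schur ring with order divisible by \<open>r\<close>, and
  a minimal one inside it. If the latter had another prime order \<open>p\<close>, intersecting with
  the Hall subgroup of order prime to \<open>p\<close> shows that the chosen subgroup has order
  prime to \<open>p\<close>, a contradiction.\<close>

lemma prime_minsub:
  assumes r: "prime r" "r dvd n"
  shows "minsub (n div r)"
proof -
  define q where "q = r ^ multiplicity r n"
  have "\<not> is_unit r" "n \<noteq> 0"
    using r n_pos by auto
  then have "multiplicity r n > 0"
    using r(2) by (simp add: multiplicity_gt_zero_iff)
  then have "r dvd q"
    unfolding q_def by (rule dvd_power[OF disjI1])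
  then have q1: "\<not> q dvd 1" and qn: "q dvd n"
    using \<open>\<not> is_unit r\<close> dvd_trans unfolding q_def by (blast, intro multiplicity_dvd)
  \<comment> \<open>\<open>\<not> q dvd D\<close> says that \<open>r\<close> divides the order
    \<open>n div D\<close>.\<close>
  define S where "S = {D. asub D \<and> \<not> q dvd D}"
  have "finite S"
    unfolding S_def using n_pos asub_dvd by (intro finite_subset[OF _ finite_divisors_int[of n]]) auto
  moreover have "1 \<in> S"
    using asub_one q1 by (simp add: S_def)
  ultimately have max: "Max S \<in> S" "\<And>D. D \<in> S \<Longrightarrow> D \<le> Max S"
    by (auto intro: Max_in)
  define D where "D = Max S"
  have D: "asub D" "\<not> q dvd D"
    using max(1) by (auto simp: S_def D_def)
  then have "D \<noteq> n"
    using qn by auto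
  then obtain b where b: "minsub b" "D dvd b"
    using minsub_exists[OF D(1)] by blast
  define p where "p = n div b"
  have p: "prime p"
    using min_prime[OF b(1)] by (simp add: p_def)
  have nb: "n = b * p"
    using minsub_facts(3)[OF b(1)] by (simp add: p_def)
  show ?thesis
  proof (cases "p = r")
    case True
    have "n div r = b"
      using nb True prime_gt_0_int[OF r(1)] by simp
    then show ?thesis
      using b(1) by simp
  next
    case False
    define P where "P = p ^ multiplicity p n"
    have P: "asub P"
      using minsub_power_asub[OF b(1)] by (simp add: P_def p_def)
    have "coprime q P"
      unfolding q_def P_def using primes_coprime[OF r(1) p] False by simp
    have "\<not> q dvd lcm D P"
    proof
      assume "q dvd lcm D P"
      moreover have "lcm D P dvd D * P"
        by (simp add: lcm_least)
      ultimately have "q dvd D * P"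
        using dvd_trans by blast
      then show False
        using \<open>coprime q P\<close> D(2) by (simp add: coprime_dvd_mult_left_iff)
    qed
    then have "lcm D P \<in> S"
      using asub_lcm[OF D(1) P] by (simp add: S_def)
    then have "lcm D P \<le> D"
      unfolding D_def by (rule max(2))
    moreover have "D \<le> lcm D P"
      using asub_pos[OF asub_lcm[OF D(1) P]] by (intro zdvd_imp_le) simp_all
    ultimately have "P dvd D"
      by (metis dvd_lcm2 order_antisym)
    then have "P dvd b"
      using b(2) dvd_trans by blast
    then have "p ^ Suc (multiplicity p n) dvd n"
      unfolding P_def nb by (simp add: mult.commute mult_dvd_mono)
    then show ?thesis
      using prime_power_maximal[OF p n_pos] by blast
  qed
qed

lemma prime_power_asub:
  assumes "prime r" and "r dvd n"
  shows "asub (r ^ multiplicity r n)"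
proof -
  have "n div (n div r) = r"
    using assms n_pos prime_gt_0_int[OF assms(1)] by (auto elim!: dvdE)
  then show ?thesis
    using minsub_power_asub[OF prime_minsub[OF assms]] by simp
qed

lemma class_units:
  assumes "c s x = \<gamma>"
  shows "coprime x n"
proof (rule coprime_int_primesI)
  show "n \<noteq> 0" using n_pos by simp
  fix r assume r: "prime r" "r dvd x" "r dvd n"
  have "r = n div (n div r)"
    using r n_pos prime_gt_0_int[OF r(1)] by (auto elim!: dvdE)
  then show False
    using class_coprime[OF prime_minsub[OF r(1,3)] _ assms] r(2) by blast
qed

end

section \<open>Responses as multiples by one unit\<close>

context normal_prime
begin

text \<open>The Sylow subgroup of order \<open>p ^ k\<close> is the intersection of the Hall
  subgroups for the other primes; a maximal \<open>D\<close> spares forming the intersection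
  explicitly.\<close>

lemma complement_asub: "asub n'"
proof -
  define S where "S = {D. asub D \<and> D dvd n'}"
  have "finite S"
    unfolding S_def using n_pos asub_dvd by (intro finite_subset[OF _ finite_divisors_int[of n]]) auto
  moreover have "1 \<in> S"
    using asub_one by (simp add: S_def)
  ultimately have max: "Max S \<in> S" "\<And>D. D \<in> S \<Longrightarrow> D \<le> Max S"
    by (auto intro: Max_in)
  define D where "D = Max S"
  have D: "asub D" "D dvd n'"
    using max(1) by (auto simp: S_def D_def)
  have "D = n'"
  proof (rule ccontr)
    assume neq: "D \<noteq> n'"
    obtain d where d: "n' = D * d"
      using D(2) by blast
    have "d > 0"
      using pos_n' asub_pos[OF D(1)] unfolding d by (simp add: zero_less_mult_iff)
    then have "\<not> is_unit d" "d \<noteq> 0"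
      using neq d by auto
    then obtain r where r: "prime r" "r dvd d"
      using prime_divisor_exists by blast
    have rn': "r dvd n'"
      using r(2) d by simp
    then have rn: "r dvd n"
      using n_eq by simp
    have "r \<noteq> p"
      using rn' pn' by auto
    define R where "R = r ^ multiplicity r n"
    have R: "asub R"
      using prime_power_asub[OF r(1) rn] by (simp add: R_def)
    have "coprime R (p ^ k)"
      unfolding R_def using primes_coprime[OF r(1) pr \<open>r \<noteq> p\<close>] by simp
    moreover have "R dvd p ^ k * n'"
      using multiplicity_dvd[of r n] unfolding R_def n_eq[symmetric] by simp
    ultimately have "R dvd n'"
      by (simp add: coprime_dvd_mult_right_iff)
    then have "lcm D R \<in> S"
      using asub_lcm[OF D(1) R] D(2) by (simp add: S_def)
    then have "lcm D R \<le> D"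
      unfolding D_def by (rule max(2))
    moreover have "D \<le> lcm D R"
      using asub_pos[OF asub_lcm[OF D(1) R]] by (intro zdvd_imp_le) simp_all
    ultimately have "R dvd D"
      by (metis dvd_lcm2 order_antisym)
    then have "R * r dvd n'"
      unfolding d using r(2) by (rule mult_dvd_mono)
    then have "r ^ Suc (multiplicity r n) dvd n"
      unfolding R_def using n_eq by (simp add: mult.commute)
    then show False
      using prime_power_maximal[OF r(1) n_pos] by blast
  qed
  then show ?thesis
    using D(1) by simp
qed

text \<open>On units, \<open>\<sigma>\<close> matches the two sides up to the stabiliser: the
  multiplier that takes \<open>x\<close> to \<open>g True\<close> takes \<open>y\<close> into the
  class itself.\<close>

lemma unit_colours:
  assumes \<sigma>: "n dvd \<sigma> * g True - g False" and x: "coprime x n" and y: "c False y = c True x"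
  obtains t where "fx t" and "n dvd y - t * (\<sigma> * x)"
proof -
  obtain u where u: "n dvd g True * u - 1" "coprime u n"
    by (rule int_coprime_inverse[OF g_unit])
  define m where "m = u * x"
  have m: "coprime m n" and mx: "n dvd m * g True - x"
    using u(2) x dvd_mult2[OF u(1), of x] by (simp_all add: m_def algebra_simps)
  obtain w where w: "n dvd m * w - 1" "coprime w n"
    by (rule int_coprime_inverse[OF m])
  have "c False (w * y) = c True (w * x)"
    by (rule mult[OF w(2) y])
  also have "\<dots> = c True (g True)"
  proof (rule per)
    have "n dvd (m * w - 1) * g True - w * (m * g True - x)"
      by (rule dvd_diff[OF dvd_mult2[OF w(1)] dvd_mult[OF mx]])
    then show "n dvd w * x - g True"
      by (simp add: algebra_simps)
  qed
  finally have wy: "c False (w * y) = \<gamma>"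
    by (simp add: g_col)
  then obtain t where t: "fx t" "n dvd t * g False - w * y"
    using units_fx[OF g_unit class_units g_col] by blast
  have "n dvd m * (t * g False - w * y) + (m * w - 1) * y + t * m * (\<sigma> * g True - g False) - t * \<sigma> * (m * g True - x)"
    by (rule dvd_diff[OF dvd_add[OF dvd_add[OF dvd_mult[OF t(2)] dvd_mult2[OF w(1)]] dvd_mult[OF \<sigma>]] dvd_mult[OF mx]])
  then have "n dvd t * (\<sigma> * x) - y"
    by (simp add: algebra_simps)
  then have "n dvd y - t * (\<sigma> * x)"
    by (simp add: dvd_diff_commute)
  then show ?thesis
    using that t(1) by blast
qed

lemma n_dvdI: "p ^ k dvd x \<Longrightarrow> n' dvd x \<Longrightarrow> n dvd x"
  unfolding n_eq using coprime_n'[of k] by (intro divides_mult) (simp_all add: coprime_commute)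

lemma pk_n: "p ^ k dvd n" and n'_n: "n' dvd n"
  by (simp_all add: n_eq)

text \<open>Both the Sylow subgroup and its complement belong to the Schur ring. A coset transfer
  therefore lifts \<open>y\<close> to a point with the colour of \<open>p ^ i * g True\<close>, to
  which \<open>pow_class\<close> applies, and projecting back recovers \<open>y\<close>.\<close>

lemma projection_colours:
  assumes \<sigma>: "n dvd \<sigma> * g True - g False" and E: "p ^ k dvd E - 1" "n' dvd E"
    and C: "pow_class i" and y: "c False y = c True (E * (p ^ i * g True))"
  obtains t where "fx t" and "n dvd y - t * (\<sigma> * (E * (p ^ i * g True)))"
proof -
  define w where "w = p ^ i * g True"
  have n'y: "n' dvd y"
    by (rule asub_dvdD[OF complement_asub y[symmetric]]) (use E(2) in simp)
  have "p ^ k dvd (E - 1) * - w"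
    using E(1) by (rule dvd_mult2)
  then have "p ^ k dvd w - E * w"
    by (simp add: algebra_simps)
  from coset_transfer[OF hall_asub y[symmetric] this[unfolded w_def]]
  obtain x where x: "c False x = c True (p ^ i * g True)" "p ^ k dvd x - y"
    by blast
  then obtain t0 where t0: "c False t0 = \<gamma>" "n dvd x - p ^ i * t0"
    using C unfolding pow_class_def by blast
  obtain t where t: "fx t" "n dvd t * g False - t0"
    using units_fx[OF g_unit class_units[OF t0(1)] g_col t0(1)] by blast
  have yx: "n dvd y - E * x"
  proof (rule n_dvdI)
    have "p ^ k dvd - (x - y) - (E - 1) * x"
      by (rule dvd_diff[OF dvd_minus_iff[THEN iffD2, OF x(2)] dvd_mult2[OF E(1)]])
    then show "p ^ k dvd y - E * x"
      by (simp add: algebra_simps)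
    show "n' dvd y - E * x"
      by (rule dvd_diff[OF n'y dvd_mult2[OF E(2)]])
  qed
  have "n dvd (y - E * x) + E * (x - p ^ i * t0) - E * p ^ i * (t * g False - t0) - E * p ^ i * t * (\<sigma> * g True - g False)"
    by (rule dvd_diff[OF dvd_diff[OF dvd_add[OF yx dvd_mult[OF t0(2)]] dvd_mult[OF t(2)]] dvd_mult[OF \<sigma>]])
  then have "n dvd y - t * (\<sigma> * (E * (p ^ i * g True)))"
    by (simp add: algebra_simps)
  then show ?thesis
    using that t(1) by blast
qed

lemma complement_colours:
  assumes \<sigma>: "n dvd \<sigma> * g True - g False" and E: "p ^ k dvd E - 1" "n' dvd E"
    and y: "c False y = c True ((1 - E) * g True)"
  obtains t where "fx t" and "n dvd y - t * (\<sigma> * ((1 - E) * g True))"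
proof -
  have E': "p ^ k dvd 1 - E"
    using E(1) by (simp add: dvd_diff_commute)
  have py: "p ^ k dvd y"
    by (rule asub_dvdD[OF hall_asub y[symmetric]]) (use E' in simp)
  have "n' dvd g True - (1 - E) * g True"
    using dvd_mult2[OF E(2), of "g True"] by (simp add: algebra_simps)
  from coset_transfer[OF complement_asub y[symmetric] this]
  obtain x where x: "c False x = c True (g True)" "n' dvd x - y"
    by blast
  then have xg: "c False x = \<gamma>"
    by (simp add: g_col)
  obtain t where t: "fx t" "n dvd t * g False - x"
    using units_fx[OF g_unit class_units[OF xg] g_col xg] by blast
  have yx: "n dvd y - (1 - E) * x"
  proof (rule n_dvdI)
    show "p ^ k dvd y - (1 - E) * x"
      by (rule dvd_diff[OF py dvd_mult2[OF E']])
    have "n' dvd - (x - y) + E * x"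
      by (rule dvd_add[OF dvd_minus_iff[THEN iffD2, OF x(2)] dvd_mult2[OF E(2)]])
    then show "n' dvd y - (1 - E) * x"
      by (simp add: algebra_simps)
  qed
  have "n dvd (y - (1 - E) * x) - (1 - E) * (t * g False - x) - (1 - E) * t * (\<sigma> * g True - g False)"
    by (rule dvd_diff[OF dvd_diff[OF yx dvd_mult[OF t(2)]] dvd_mult[OF \<sigma>]])
  then have "n dvd y - t * (\<sigma> * ((1 - E) * g True))"
    by (simp add: algebra_simps)
  then show ?thesis
    using that t(1) by blast
qed

text \<open>The pebbled element \<open>e\<close> and its distance to the unit \<open>g True\<close>
  are each answered correctly up to a factor of the stabiliser. Comparing the two answers forces
  these factors to act trivially.\<close>

lemma pebble_linear:
  assumes \<sigma>: "n dvd \<sigma> * g True - g False" "coprime \<sigma> n" and E: "p ^ k dvd E - 1" "n' dvd E"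
    and i: "i < k" and e: "n dvd e - E * (p ^ i * g True)"
    and r: "c False r = c True e" and zr: "c False (g False - r) = c True (g True - e)"
  shows "n dvd r - \<sigma> * e"
proof -
  define z where "z = g True"
  have e_col: "c True e = c True (E * (p ^ i * g True))"
    by (rule per[OF e])
  have n'e: "n' dvd e"
    using dvd_add[OF dvd_trans[OF n'_n e] dvd_mult2[OF E(2), of "p ^ i * g True"]] by simp
  have pie: "p ^ i dvd e"
  proof -
    have "p ^ i dvd n"
      using le_imp_power_dvd[of i k p] i pk_n dvd_trans by auto
    from dvd_add[OF dvd_trans[OF this e], of "E * (p ^ i * g True)"] show ?thesis
      by simp
  qed
  have pE: "\<not> p dvd E"
  proof
    assume "p dvd E"
    moreover have "p dvd E - 1"
      using E(1) k1 by (meson dvd_power dvd_trans less_le_trans zero_less_one)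
    ultimately have "p dvd E - (E - 1)"
      by (rule dvd_diff)
    then show False
      using pr by auto
  qed
  have pz: "\<not> p dvd z" and p\<sigma>: "\<not> p dvd \<sigma>"
  proof -
    show "\<not> p dvd z"
      using class_not_dvd[OF g_col] by (simp add: z_def)
    have "p dvd n"
      using n_ap by simp
    then show "\<not> p dvd \<sigma>"
      using \<sigma>(2) pr by (metis coprime_common_divisor not_prime_unit)
  qed
  have pie': "\<not> p ^ Suc i dvd e"
  proof
    assume a: "p ^ Suc i dvd e"
    have "p ^ Suc i dvd n"
      using le_imp_power_dvd[of "Suc i" k p] i pk_n dvd_trans by auto
    from dvd_diff[OF a dvd_trans[OF this e]] have "p ^ Suc i dvd p ^ i * (E * z)"
      by (simp add: z_def ac_simps)
    then have "p dvd E * z"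
      using p0 by (simp add: mult.commute)
    then show False
      using pE pz pr prime_dvd_multD by blast
  qed
  show ?thesis
  proof (cases "p = 2 \<and> Suc i = k")
    case True
    have a: "a = p ^ i * n'"
      using a_eq True by auto
    have "a dvd e"
      unfolding a using pie n'e coprime_n'[of i] by (intro divides_mult) (simp_all add: coprime_commute)
    have "asub a"
      using minsub_facts(1)[OF min] .
    then have "a dvd r"
      using asub_dvdD[OF _ r[symmetric] \<open>a dvd e\<close>] by blast
    have "\<not> n dvd e"
      using pie' True pk_n dvd_trans by blast
    then have "\<not> n dvd r"
      using zero[of False r True] zero[of True e True] r by simp
    obtain e1 r1 where er: "e = a * e1" "r = a * r1"
      using \<open>a dvd e\<close> \<open>a dvd r\<close> by blast
    have "odd e1" "odd r1"
      using \<open>\<not> n dvd e\<close> \<open>\<not> n dvd r\<close> n_ap True unfolding er by auto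
    then have "even (r1 - \<sigma> * e1)"
      using p\<sigma> True by simp
    then have "a * 2 dvd a * (r1 - \<sigma> * e1)"
      by (rule mult_dvd_mono[OF dvd_refl])
    then show ?thesis
      unfolding er using n_ap True by (simp add: algebra_simps)
  next
    case False
    have C: "pow_class i"
    proof (rule pow_class_regular)
      show "odd p \<or> k \<le> 2 \<or> i + 2 \<le> k"
      proof (cases "odd p")
        case even: False
        then have "p = 2"
          using pr primes_dvd_imp_eq[of 2 p] by simp
        then show ?thesis
          using False i by linarith
      qed simp
    qed (use i in simp)
    obtain t where t: "fx t" "n dvd r - t * (\<sigma> * (E * (p ^ i * g True)))"
      using projection_colours[OF \<sigma>(1) E C] r e_col by metis
    have EE: "n dvd E * (1 - E)"
    proof (rule n_dvdI)
      have "p ^ k dvd E * - (E - 1)"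
        by (rule dvd_mult) (simp only: dvd_minus_iff E(1))
      then show "p ^ k dvd E * (1 - E)"
        by simp
      show "n' dvd E * (1 - E)"
        using E(2) by simp
    qed
    show ?thesis
    proof (cases "i = 0")
      case True
      have "n dvd (g True - e) - (1 - E) * g True"
        using e True dvd_minus_iff[THEN iffD2, OF e] by (simp add: algebra_simps)
      then have "c False (g False - r) = c True ((1 - E) * g True)"
        using zr per by metis
      then obtain t' where t': "n dvd (g False - r) - t' * (\<sigma> * ((1 - E) * g True))"
        using complement_colours[OF \<sigma>(1) E] by metis
      have "n dvd E * (g False - r - t' * (\<sigma> * ((1 - E) * g True))) + E * (1 - E) * (t' * \<sigma> * g True)"
        by (rule dvd_add[OF dvd_mult[OF t'] dvd_mult2[OF EE]])
      then have 1: "n dvd E * g False - E * r"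
        by (simp add: algebra_simps)
      have "n dvd (1 - E) * (r - t * (\<sigma> * (E * g True))) + E * (1 - E) * (t * \<sigma> * g True)"
        using t(2) True by (intro dvd_add[OF dvd_mult dvd_mult2[OF EE]]) simp
      then have 2: "n dvd r - E * r"
        by (simp add: algebra_simps)
      have 3: "n dvd e - E * g True"
        using e True by simp
      have "n dvd (r - E * r) - (E * g False - E * r) - E * (\<sigma> * g True - g False) - \<sigma> * (e - E * g True) + 2 * 0"
        by (rule dvd_add[OF dvd_diff[OF dvd_diff[OF dvd_diff[OF 2 1] dvd_mult[OF \<sigma>(1)]] dvd_mult[OF 3]]]) simp
      then show ?thesis
        by (simp add: algebra_simps)
    next
      case i0: False
      have pe: "p dvd e"
        using pie i0 by (meson dvd_power dvd_trans neq0_conv)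
      have "coprime (g True - e) n"
      proof (rule coprime_int_primesI)
        show "n \<noteq> 0" using n_pos by simp
        fix q assume q: "prime q" "q dvd g True - e" "q dvd n"
        have "q dvd p ^ k \<or> q dvd n'"
          using q(1,3) unfolding n_eq by (rule prime_dvd_multD)
        then have "q dvd e"
        proof
          assume "q dvd p ^ k"
          then have "q dvd p"
            using q(1) prime_dvd_power by blast
          then show ?thesis
            using pe by (rule dvd_trans)
        next
          assume "q dvd n'"
          then show ?thesis
            using n'e by (rule dvd_trans)
        qed
        from dvd_add[OF q(2) this] show False
          using g_unit[of True] q(1,3) by (metis coprime_common_divisor diff_add_cancel not_prime_unit)
      qed
      then obtain t' where t': "fx t'" "n dvd (g False - r) - t' * (\<sigma> * (g True - e))"
        using unit_colours[OF \<sigma>(1)] zr by metis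
      define v where "v = t' - 1"
      have te: "n dvd r - t * (\<sigma> * e)"
      proof -
        have "n dvd (r - t * (\<sigma> * (E * (p ^ i * g True)))) - t * \<sigma> * (e - E * (p ^ i * g True))"
          by (rule dvd_diff[OF t(2) dvd_mult[OF e]])
        then show ?thesis
          by (simp add: algebra_simps)
      qed
      \<comment> \<open>Wherever \<open>e\<close> vanishes, so does \<open>r\<close>, and the answer
        for the distance reduces to \<open>g False = t' * \<sigma> * g True\<close>; hence
        \<open>t'\<close> is 1 there.\<close>
      have d_v: "d dvd v" if d: "d dvd n" "d dvd e" for d
      proof -
        have dr: "d dvd r"
          using dvd_add[OF dvd_trans[OF d(1) te] dvd_mult[OF dvd_mult[OF d(2)], of t \<sigma>]] by simp
        have "d dvd - ((g False - r) - t' * (\<sigma> * (g True - e))) - r + t' * \<sigma> * e - t' * (\<sigma> * g True - g False)"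
          by (rule dvd_diff[OF dvd_add[OF dvd_diff[OF dvd_minus_iff[THEN iffD2, OF dvd_trans[OF d(1) t'(2)]] dr] dvd_mult[OF d(2)]]
                dvd_mult[OF dvd_trans[OF d(1) \<sigma>(1)]]])
        then have "d dvd v * g False"
          by (simp add: v_def algebra_simps)
        moreover have "coprime d (g False)"
          using d(1) g_unit[of False] coprime_divisors[of d n "g False" "g False"] by (simp add: coprime_commute)
        ultimately show ?thesis
          by (simp add: coprime_dvd_mult_left_iff)
      qed
      have n'v: "n' dvd v"
        by (rule d_v[OF n'_n n'e])
      have pin: "p ^ i dvd n"
        using le_imp_power_dvd[of i k p] i pk_n dvd_trans by auto
      have piv: "p ^ i dvd v"
        by (rule d_v[OF pin pie])
      then have pv: "p dvd v"
        using i0 by (meson dvd_power dvd_trans neq0_conv)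
      have fxv: "fx (1 + v)"
        using t'(1) by (simp add: v_def)
      show ?thesis
      proof (cases "odd p \<or> 4 dvd v \<or> k \<le> 2")
        case True
        then have "n dvd v"
          using fx_tower_trivial[OF fxv n'v pv] by blast
        then have "n dvd - ((g False - r) - t' * (\<sigma> * (g True - e))) - v * (\<sigma> * (g True - e)) - (\<sigma> * g True - g False)"
          by (intro dvd_diff[OF dvd_diff[OF dvd_minus_iff[THEN iffD2, OF t'(2)] dvd_mult2] \<sigma>(1)])
        then show ?thesis
          by (simp add: v_def algebra_simps)
      next
        case False
        then have two: "p = 2" and k3: "k \<ge> 3"
          using pr primes_dvd_imp_eq[of 2 p] by auto
        have "i = 1"
        proof (rule ccontr)
          assume "i \<noteq> 1"
          then have "2 ^ 2 dvd p ^ i"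
            using i0 unfolding two by (intro le_imp_power_dvd) simp
          then have "4 dvd v"
            using piv dvd_trans by fastforce
          then show False
            using False by blast
        qed
        \<comment> \<open>The exceptional unit is -1 modulo 4. Then the distance forces 4 to divide
          \<open>r\<close>, whereas \<open>r\<close> is an odd multiple of \<open>e\<close>, which
          is 2 modulo 4.\<close>
        have half: "2 ^ (k - 1) dvd 2 + v"
          by (rule half_dvd[OF two k3 fxv n'v]) (use pv two False in auto)
        have four: "4 dvd n" "4 dvd 2 + v"
        proof -
          have 4: "(4::int) dvd 2 ^ (k - 1)"
            using le_imp_power_dvd[of 2 "k - 1" "2::int"] k3 by simp
          then show "4 dvd 2 + v"
            using half by (rule dvd_trans)
          have "4 dvd p ^ k"
            using le_imp_power_dvd[of 2 k "2::int"] k3 two by simp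
          then show "4 dvd n"
            using pk_n by (rule dvd_trans)
        qed
        have "4 dvd E - 1"
          using dvd_trans[OF _ E(1), of 4] le_imp_power_dvd[of 2 k "2::int"] k3 two by simp
        have e4: "4 dvd e - 2 * g True"
        proof -
          have "4 dvd (e - E * (p ^ i * g True)) + (E - 1) * (2 * g True)"
            by (rule dvd_add[OF dvd_trans[OF four(1) e] dvd_mult2[OF \<open>4 dvd E - 1\<close>]])
          then show ?thesis
            using two \<open>i = 1\<close> by (simp add: algebra_simps)
        qed
        have "4 dvd - ((g False - r) - t' * (\<sigma> * (g True - e))) - (2 + v) * (\<sigma> * (g True - e))
            - (\<sigma> * g True - g False) - \<sigma> * (e - 2 * g True)"
          by (rule dvd_diff[OF dvd_diff[OF dvd_diff[OF dvd_minus_iff[THEN iffD2, OF dvd_trans[OF four(1) t'(2)]] dvd_mult2[OF four(2)]]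
             dvd_trans[OF four(1) \<sigma>(1)]] dvd_mult[OF e4]])
        then have r4: "4 dvd r"
          by (simp add: v_def algebra_simps)
        have "4 dvd r - (r - t * (\<sigma> * e)) - t * \<sigma> * (e - 2 * g True)"
          by (rule dvd_diff[OF dvd_diff[OF r4 dvd_trans[OF four(1) te]] dvd_mult[OF e4]])
        then have "4 dvd 2 * (t * \<sigma> * g True)"
          by (simp add: algebra_simps)
        moreover have "odd (t * \<sigma> * g True)"
        proof -
          have "2 dvd n"
            using four(1) by presburger
          then have "odd t"
            using fx_coprime[OF t(1)] coprime_common_divisor[of t n 2] by auto
          then show ?thesis
            using p\<sigma> pz two by (simp add: z_def)
        qed
        moreover have "even x" if "4 dvd 2 * x" for x :: int
          using that by presburger
        ultimately show ?thesis
          by blast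
      qed
    qed
  qed
qed

end

section \<open>Pebbled Schur rings\<close>

text \<open>One position for each composition factor of the cyclic group, \<open>\<Omega>(n)\<close>
  in all.\<close>

definition digit_index :: "int \<Rightarrow> (int \<times> nat) set" where
  "digit_index n = {(p, j). prime p \<and> 0 < j \<and> p ^ j dvd n}"

definition exact_order :: "int \<Rightarrow> int \<Rightarrow> nat \<Rightarrow> int \<Rightarrow> bool" where
  "exact_order n p j x \<longleftrightarrow> (\<exists>w. x = n div p ^ j * w \<and> \<not> p dvd w)"

definition digits :: "int \<Rightarrow> (int \<Rightarrow> nat \<Rightarrow> int) \<Rightarrow> bool" where
  "digits n a \<longleftrightarrow> (\<forall>(p, j) \<in> digit_index n. 0 \<le> a p j \<and> a p j < p)"

definition digit_val :: "int \<Rightarrow> (int \<Rightarrow> nat \<Rightarrow> int) \<Rightarrow> (int \<Rightarrow> nat \<Rightarrow> int) \<Rightarrow> int" where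
  "digit_val n e a = (\<Sum>(p, j) \<in> digit_index n. a p j * e p j)"

text \<open>The points \<open>e True p j\<close> and \<open>r p j\<close> are pebbled on the two sides. The point \<open>r p j\<close> need
  not have order \<open>p ^ j\<close>; if its \<open>p\<close>-part does, then \<open>e False p j\<close> is that part.\<close>

locale pebbled = sring +
  fixes e :: "bool \<Rightarrow> int \<Rightarrow> nat \<Rightarrow> int" and r :: "int \<Rightarrow> nat \<Rightarrow> int"
  assumes ord: "(p, j) \<in> digit_index n \<Longrightarrow> exact_order n p j (e s p j)"
    and std: "(p, Suc j) \<in> digit_index n \<Longrightarrow> 0 < j \<Longrightarrow> n dvd e True p j - p * e True p (Suc j)"
    and peb: "\<exists>x'. c True x = c False x' \<and>
      (\<forall>(p, j) \<in> digit_index n. c True (x - e True p j) = c False (x' - r p j))"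
    and rel: "(p, j) \<in> digit_index n \<Longrightarrow> p ^ (multiplicity p n - j) dvd r p j \<Longrightarrow>
      \<not> p ^ Suc (multiplicity p n - j) dvd r p j \<Longrightarrow> p ^ multiplicity p n dvd e False p j - r p j"

lemma digit_indexD:
  assumes "(p, j) \<in> digit_index n"
  shows "prime p" and "0 < j" and "p ^ j dvd n" and "p dvd n"
proof -
  show "prime p" "0 < j" and pj: "p ^ j dvd n"
    using assms by (auto simp: digit_index_def)
  then show "p dvd n"
    using dvd_power[of j p] dvd_trans by blast
qed

lemma digit_index_le:
  assumes "(p, j) \<in> digit_index n" and "n > 0"
  shows "j \<le> multiplicity p n"
proof (rule multiplicity_geI)
  show "n \<noteq> 0" using assms by simp
  show "\<not> is_unit p" "p ^ j dvd n"
    using digit_indexD[OF assms(1)] by auto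
qed

lemma digit_index_multiplicity:
  assumes "prime p" and "n > 0" and "0 < j" and "j \<le> multiplicity p n"
  shows "(p, j) \<in> digit_index n"
  using assms multiplicity_dvd'[of j p n] by (simp add: digit_index_def)

lemma finite_digit_index: "n > 0 \<Longrightarrow> finite (digit_index n)"
proof -
  assume n: "n > 0"
  have "digit_index n \<subseteq> (SIGMA p:{p. p dvd n}. {..multiplicity p n})"
    using digit_index_le[OF _ n] digit_indexD(4)[of _ _ n] by (auto simp del: One_nat_def)
  then show ?thesis
    by (rule finite_subset) (use n in auto)
qed

lemma digit_index_mono: "m dvd n \<Longrightarrow> digit_index m \<subseteq> digit_index n"
  by (auto simp: digit_index_def intro: dvd_trans)

lemma multiplicity_mult_int:
  assumes "prime (p::int)" and "x > 0" and "y > 0"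
  shows "multiplicity p (x * y) = multiplicity p x + multiplicity p y"
  using assms by (intro prime_elem_multiplicity_mult_distrib) auto

lemma exact_orderD:
  assumes "exact_order n p j x" and "(p, j) \<in> digit_index n" and "n > 0"
  shows "p ^ (multiplicity p n - j) dvd x" and "\<not> p ^ Suc (multiplicity p n - j) dvd x"
    and "m dvd n \<Longrightarrow> \<not> p dvd m \<Longrightarrow> m dvd x"
proof -
  note d = digit_indexD[OF assms(2)]
  define k where "k = multiplicity p n"
  have jk: "j \<le> k"
    using digit_index_le[OF assms(2,3)] by (simp add: k_def)
  have p0: "p > 0"
    using prime_gt_0_int[OF d(1)] .
  obtain w where w: "x = n div p ^ j * w" "\<not> p dvd w"
    using assms(1) unfolding exact_order_def by blast
  obtain n' where n': "n = p ^ k * n'" "\<not> p dvd n'"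
    using prime_power_split[OF d(1) assms(3)] unfolding k_def by blast
  have "n = p ^ j * (p ^ (k - j) * n')"
    using n'(1) jk by (simp add: mult.assoc[symmetric] power_add[symmetric])
  then have q: "n div p ^ j = p ^ (k - j) * n'"
    using p0 by simp
  have x: "x = p ^ (k - j) * (n' * w)"
    using w(1) q by simp
  then show "p ^ (multiplicity p n - j) dvd x"
    by (simp add: k_def)
  show "\<not> p ^ Suc (multiplicity p n - j) dvd x"
  proof
    assume "p ^ Suc (multiplicity p n - j) dvd x"
    then have "p ^ (k - j) * p dvd p ^ (k - j) * (n' * w)"
      using x by (simp add: k_def mult.commute)
    then have "p dvd n' * w"
      using p0 by simp
    then show False
      using d(1) n'(2) w(2) prime_dvd_multD by blast
  qed
  show "m dvd x" if m: "m dvd n" "\<not> p dvd m"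
  proof -
    have "coprime m (p ^ k)"
      using m(2) d(1) by (rule prime_imp_power_coprime[rotated])
    then have "m dvd n'"
      using m(1) n'(1) by (simp add: coprime_dvd_mult_right_iff)
    then show ?thesis
      using x by simp
  qed
qed

text \<open>Let \<open>M\<close> be the last position of \<open>p\<close> where the digits differ.
  Lower positions carry elements of higher \<open>p\<close>-valuation, other primes contribute
  multiples of the \<open>p\<close>-part, and the digit difference is prime to \<open>p\<close>. So
  the difference has the valuation of \<open>e p M\<close>, which is too small for divisibility by
  \<open>u\<close>.\<close>

lemma digit_val_agree:
  assumes n: "n > 0" and u: "u dvd n" "u > 0"
    and e: "\<And>p j. (p, j) \<in> digit_index n \<Longrightarrow> exact_order n p j (e p j)"
    and "digits n a" and "digits n b" and dvd: "u dvd digit_val n e a - digit_val n e b"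
    and pj: "(p, j) \<in> digit_index n" "(p, j) \<notin> digit_index (n div u)"
  shows "a p j = b p j"
proof (rule ccontr)
  assume neq: "a p j \<noteq> b p j"
  define D where "D p j = a p j - b p j" for p j
  define k where "k = multiplicity p n"
  define m where "m = multiplicity p (n div u)"
  have p: "prime p"
    using digit_indexD(1)[OF pj(1)] .
  define M where "M = Max {j. (p, j) \<in> digit_index n \<and> D p j \<noteq> 0}"
  have fin: "finite {j. (p, j) \<in> digit_index n \<and> D p j \<noteq> 0}"
    by (rule finite_subset[of _ "{..k}"]) (use digit_index_le n in \<open>auto simp: k_def\<close>)
  have mem: "j \<in> {j. (p, j) \<in> digit_index n \<and> D p j \<noteq> 0}"
    using pj(1) neq by (simp add: D_def)
  have M: "(p, M) \<in> digit_index n" "D p M \<noteq> 0" "j \<le> M"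
    using Max_in[OF fin] Max_ge[OF fin mem] mem unfolding M_def by auto
  have above: "D p i = 0" if "(p, i) \<in> digit_index n" "i > M" for i
    using Max_ge[OF fin, of i] that unfolding M_def[symmetric] by auto
  have "n div u > 0"
    using n u by (auto elim!: dvdE simp: zero_less_mult_iff)
  have "M > m"
  proof (rule ccontr)
    assume "\<not> M > m"
    then have "j \<le> m"
      using M(3) by simp
    then have "(p, j) \<in> digit_index (n div u)"
      using digit_index_multiplicity[OF p \<open>n div u > 0\<close>] digit_indexD(2)[OF pj(1)] by (simp add: m_def)
    then show False
      using pj(2) by blast
  qed
  have Mk: "M \<le> k"
    using digit_index_le[OF M(1) n] by (simp add: k_def)
  have u_mult: "multiplicity p u + m = k"
  proof -
    have "k = multiplicity p (u * (n div u))"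
      using u by (simp add: k_def)
    then show ?thesis
      using multiplicity_mult_int[OF p u(2) \<open>n div u > 0\<close>] by (simp add: m_def)
  qed
  define q where "q = p ^ Suc (k - M)"
  have qu: "q dvd u"
  proof -
    have "Suc (k - M) \<le> multiplicity p u"
      using u_mult \<open>M > m\<close> Mk by simp
    then show ?thesis
      unfolding q_def by (rule multiplicity_dvd')
  qed
  have "q dvd digit_val n e a - digit_val n e b"
    using qu dvd by (rule dvd_trans)
  also have "digit_val n e a - digit_val n e b = (\<Sum>(p, j) \<in> digit_index n. D p j * e p j)"
    unfolding digit_val_def D_def by (simp add: sum_subtractf[symmetric] case_prod_unfold left_diff_distrib)
  also have "\<dots> = D p M * e p M + (\<Sum>(p, j) \<in> digit_index n - {(p, M)}. D p j * e p j)"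
    using sum.remove[OF finite_digit_index[OF n] M(1), of "\<lambda>(p, j). D p j * e p j"] by simp
  finally have q_sum: "q dvd D p M * e p M + (\<Sum>(p, j) \<in> digit_index n - {(p, M)}. D p j * e p j)" .
  have qn: "q dvd n"
    using qu u(1) by (rule dvd_trans)
  have "q dvd (\<Sum>(p, j) \<in> digit_index n - {(p, M)}. D p j * e p j)"
  proof (rule dvd_sum)
    fix z assume z: "z \<in> digit_index n - {(p, M)}"
    obtain p' i where pi: "z = (p', i)"
      by (cases z)
    have i: "(p', i) \<in> digit_index n" "(p', i) \<notin> {(p, M)}"
      using z pi by auto
    have "q dvd D p' i * e p' i"
    proof (cases "p' = p")
      case False
      have "\<not> p' dvd q"
      proof
        assume "p' dvd q"
        then have "p' dvd p"
          unfolding q_def using digit_indexD(1)[OF i(1)] prime_dvd_power by blast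
        then show False
          using False primes_dvd_imp_eq digit_indexD(1)[OF i(1)] p by blast
      qed
      then have "q dvd e p' i"
        using exact_orderD(3)[OF e[OF i(1)] i(1) n qn] by blast
      then show ?thesis
        by simp
    next
      case True
      show ?thesis
      proof (cases "i > M")
        case True
        then show ?thesis
          using above[of i] i(1) \<open>p' = p\<close> by simp
      next
        case False
        then have "i < M"
          using i(2) True by (simp add: linorder_neq_iff)
        then have "Suc (k - M) \<le> k - i"
          using Mk by simp
        then have "q dvd p ^ (k - i)"
          unfolding q_def by (rule le_imp_power_dvd)
        moreover have "p ^ (k - i) dvd e p i"
          using exact_orderD(1)[OF e i(1)[unfolded True] n] i(1) True by (simp add: k_def)
        ultimately show ?thesis
          using True dvd_trans by (metis dvd_mult)
      qed
    qed
    then show "q dvd (case z of (p, j) \<Rightarrow> D p j * e p j)"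
      using pi by simp
  qed
  then have "q dvd D p M * e p M"
    using q_sum by (simp add: dvd_add_left_iff)
  moreover have "\<not> p dvd D p M"
  proof
    assume "p dvd D p M"
    then have "p dvd a p M - b p M"
      by (simp add: D_def)
    then have "a p M = b p M"
      by (rule dvd_imp_eq) (use assms(5,6) M(1) in \<open>auto simp: digits_def\<close>)
    then show False
      using M(2) by (simp add: D_def)
  qed
  then have "coprime (D p M) q"
    unfolding q_def by (rule prime_imp_power_coprime[OF p])
  ultimately have "q dvd e p M"
    by (simp add: coprime_dvd_mult_right_iff coprime_commute)
  then show False
    using exact_orderD(2)[OF e[OF M(1)] M(1) n] by (simp add: q_def k_def)
qed

lemma exact_order_sub:
  assumes "n > 0" and "u > 0" and "u dvd n" and "(p, j) \<in> digit_index (n div u)" and "exact_order n p j x"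
  shows "u dvd x" and "exact_order (n div u) p j (x div u)"
proof -
  obtain w where w: "x = n div p ^ j * w" "\<not> p dvd w"
    using assms(5) unfolding exact_order_def by blast
  have p: "prime p" "p ^ j dvd n div u"
    using digit_indexD[OF assms(4)] by auto
  then obtain m where m: "n div u = p ^ j * m"
    by blast
  have "p ^ j > 0"
    using prime_gt_0_int[OF p(1)] by simp
  have "n = u * (n div u)"
    using assms(3) by simp
  then have "n = p ^ j * (u * m)"
    unfolding m by (simp only: mult.left_commute)
  then have "n div p ^ j = u * m"
    using \<open>p ^ j > 0\<close> by (metis nonzero_mult_div_cancel_left less_irrefl)
  moreover have "n div u div p ^ j = m"
    using \<open>p ^ j > 0\<close> m by (metis nonzero_mult_div_cancel_left less_irrefl)
  ultimately show "u dvd x" "exact_order (n div u) p j (x div u)"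
    using w assms(2) unfolding exact_order_def by auto
qed

lemma digit_val_sub:
  assumes "n > 0" and "u > 0" and "u dvd n"
    and e: "\<And>p j. (p, j) \<in> digit_index n \<Longrightarrow> exact_order n p j (e p j)"
    and agree: "\<And>p j. (p, j) \<in> digit_index n \<Longrightarrow> (p, j) \<notin> digit_index (n div u) \<Longrightarrow> a p j = b p j"
  shows "digit_val n e a - digit_val n e b =
    u * (digit_val (n div u) (\<lambda>p j. e p j div u) a - digit_val (n div u) (\<lambda>p j. e p j div u) b)"
proof -
  have sub: "digit_index (n div u) \<subseteq> digit_index n"
    using assms(3) by (intro digit_index_mono) (rule div_dvd_self)
  have "digit_val n e a - digit_val n e b = (\<Sum>(p, j) \<in> digit_index n. (a p j - b p j) * e p j)"
    unfolding digit_val_def by (simp add: sum_subtractf[symmetric] case_prod_unfold left_diff_distrib)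
  also have "\<dots> = (\<Sum>(p, j) \<in> digit_index (n div u). (a p j - b p j) * e p j)"
    by (rule sum.mono_neutral_right[OF finite_digit_index[OF assms(1)] sub]) (use agree in auto)
  also have "\<dots> = (\<Sum>(p, j) \<in> digit_index (n div u). u * ((a p j - b p j) * (e p j div u)))"
  proof (intro sum.cong refl, clarify)
    fix p j assume pj: "(p, j) \<in> digit_index (n div u)"
    have "u dvd e p j"
      using exact_order_sub(1)[OF assms(1-3) pj e] pj sub by blast
    then show "(a p j - b p j) * e p j = u * ((a p j - b p j) * (e p j div u))"
      by simp
  qed
  also have "\<dots> = u * (digit_val (n div u) (\<lambda>p j. e p j div u) a - digit_val (n div u) (\<lambda>p j. e p j div u) b)"
    unfolding digit_val_def by (simp add: sum_subtractf[symmetric] case_prod_unfold left_diff_distrib sum_distrib_left)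
  finally show ?thesis .
qed

context pebbled
begin

text \<open>The right side mentions digits only, so membership of a difference in a subgroup does
  not depend on the side.\<close>

lemma digit_val_dvd:
  assumes u: "u > 0" "u dvd n" and "digits n a" and "digits n b"
  shows "u dvd digit_val n (e s) a - digit_val n (e s) b \<longleftrightarrow>
    (\<forall>(p, j) \<in> digit_index n - digit_index (n div u). a p j = b p j)"
proof
  assume "u dvd digit_val n (e s) a - digit_val n (e s) b"
  then show "\<forall>(p, j) \<in> digit_index n - digit_index (n div u). a p j = b p j"
    using digit_val_agree[OF n_pos u(2,1) ord[where s = s] assms(3,4)] by blast
next
  assume agree: "\<forall>(p, j) \<in> digit_index n - digit_index (n div u). a p j = b p j"
  have agree: "a p j = b p j" if "(p, j) \<in> digit_index n" "(p, j) \<notin> digit_index (n div u)" for p j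
    using bspec[OF agree, of "(p, j)"] that by simp
  have "digit_val n (e s) a - digit_val n (e s) b = u * (digit_val (n div u) (\<lambda>p j. e s p j div u) a -
      digit_val (n div u) (\<lambda>p j. e s p j div u) b)"
    by (rule digit_val_sub[OF n_pos u ord agree])
  then show "u dvd digit_val n (e s) a - digit_val n (e s) b"
    by (simp only: dvd_triv_left)
qed

text \<open>A free pebble at 0 can only be answered by 0.\<close>

lemma r_col:
  assumes "(p, j) \<in> digit_index n"
  shows "c False (r p j) = c True (e True p j)"
proof -
  obtain x where x: "c True 0 = c False x" "\<forall>(p, j) \<in> digit_index n. c True (0 - e True p j) = c False (x - r p j)"
    using peb by blast
  have "n dvd x"
    using zero[of False x True] x(1) by simp
  then have "c False (x - r p j) = c False (- r p j)"
    by (intro per) simp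
  then have "c True (- e True p j) = c False (- r p j)"
    using x(2) assms by auto
  from neg[OF this] show ?thesis
    by simp
qed

text \<open>The positions of the subgroup are those whose elements lie in it; their responses lie in
  it too, because it is a union of classes.\<close>

lemma sub_pebbled:
  assumes "asub u"
  shows "pebbled (n div u) (\<lambda>s x. c s (u * x)) (\<lambda>s p j. e s p j div u) (\<lambda>p j. r p j div u)"
proof -
  have u: "u > 0" "u dvd n"
    using asub_pos[OF assms] asub_dvd[OF assms] .
  have nu: "n = u * (n div u)"
    using u by simp
  have sub: "digit_index (n div u) \<subseteq> digit_index n"
    using u(2) by (intro digit_index_mono) (rule div_dvd_self)
  interpret S: sring "n div u" "\<lambda>s x. c s (u * x)"
    by (rule sub_sring[OF assms])
  have ue: "u dvd e s p j" if "(p, j) \<in> digit_index (n div u)" for s p j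
    using exact_order_sub(1)[OF n_pos u that ord] that sub by blast
  have ur: "u dvd r p j" if "(p, j) \<in> digit_index (n div u)" for p j
    using asub_dvdD[OF assms r_col[symmetric] ue[OF that]] that sub by blast
  show ?thesis
  proof unfold_locales
    fix p j s assume pj: "(p, j) \<in> digit_index (n div u)"
    show "exact_order (n div u) p j (e s p j div u)"
      using exact_order_sub(2)[OF n_pos u pj ord] pj sub by blast
  next
    fix p j assume pj: "(p, Suc j) \<in> digit_index (n div u)" "0 < j"
    have "(p, j) \<in> digit_index (n div u)"
      using pj by (auto simp: digit_index_def intro: dvd_mult_right)
    then obtain x y where xy: "e True p j = u * x" "e True p (Suc j) = u * y"
      using ue[of p j True] ue[OF pj(1), of True] by (meson dvdE)
    have "n dvd u * x - p * (u * y)"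
      using std[of p j] pj sub xy by auto
    then have "u * (n div u) dvd u * (x - p * y)"
      unfolding nu[symmetric] by (simp add: algebra_simps)
    then show "n div u dvd e True p j div u - p * (e True p (Suc j) div u)"
      using u(1) xy by simp
  next
    fix x
    obtain x' where x': "c True (u * x) = c False x'"
        "\<forall>(p, j) \<in> digit_index n. c True (u * x - e True p j) = c False (x' - r p j)"
      using peb by blast
    have "u dvd x'"
      by (rule asub_dvdD[OF assms x'(1)]) simp
    then obtain y where y: "x' = u * y"
      by blast
    have "c True (u * (x - e True p j div u)) = c False (u * (y - r p j div u))"
      if "(p, j) \<in> digit_index (n div u)" for p j
    proof -
      have "u * (x - e True p j div u) = u * x - e True p j" "u * (y - r p j div u) = x' - r p j"
        using ue[OF that] ur[OF that] y by (simp_all add: right_diff_distrib)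
      then show ?thesis
        using x'(2) that sub by auto
    qed
    then show "\<exists>x'. c True (u * x) = c False (u * x') \<and>
        (\<forall>(p, j) \<in> digit_index (n div u). c True (u * (x - e True p j div u)) = c False (u * (x' - r p j div u)))"
      using x'(1) y by blast
  next
    fix p j assume pj: "(p, j) \<in> digit_index (n div u)"
    assume r1: "p ^ (multiplicity p (n div u) - j) dvd r p j div u"
      and r2: "\<not> p ^ Suc (multiplicity p (n div u) - j) dvd r p j div u"
    have p: "prime p"
      using digit_indexD(1)[OF pj] .
    have p0: "p > 0"
      using prime_gt_0_int[OF p] .
    define m where "m = multiplicity p u"
    define k where "k = multiplicity p (n div u)"
    have mk: "multiplicity p n = m + k"
      using multiplicity_mult_int[OF p u(1) S.n_pos] nu by (simp add: m_def k_def)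
    \<comment> \<open>Division by \<open>u\<close> lowers \<open>p\<close>-valuations by
      \<open>m\<close>, so the order condition in \<open>rel\<close> is the same before and
      after.\<close>
    have jk: "j \<le> k"
      using digit_index_le[OF pj S.n_pos] by (simp add: k_def)
    obtain u' where u': "u = p ^ m * u'" "\<not> p dvd u'"
      using prime_power_split[OF p u(1)] unfolding m_def by blast
    obtain x y where xy: "e False p j = u * x" "r p j = u * y"
      using ue[OF pj, of False] ur[OF pj] by (meson dvdE)
    have y: "r p j div u = y" "e False p j div u = x"
      using xy u(1) by simp_all
    have "p ^ (m + k - j) dvd r p j"
    proof -
      have "p ^ (k - j) dvd y"
        using r1 y(1) by (simp add: k_def)
      moreover have "p ^ m dvd u"
        using u'(1) by simp
      ultimately have "p ^ m * p ^ (k - j) dvd u * y"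
        by (intro mult_dvd_mono)
      then show ?thesis
        using jk xy by (simp add: power_add[symmetric])
    qed
    moreover have "\<not> p ^ Suc (m + k - j) dvd r p j"
    proof
      assume "p ^ Suc (m + k - j) dvd r p j"
      moreover have "Suc (m + k - j) = m + Suc (k - j)"
        using jk by simp
      then have "p ^ Suc (m + k - j) = p ^ m * p ^ Suc (k - j)"
        by (simp only: power_add)
      moreover have "r p j = p ^ m * (u' * y)"
        unfolding xy by (subst u'(1)) (simp only: mult.assoc)
      ultimately have "p ^ m * p ^ Suc (k - j) dvd p ^ m * (u' * y)"
        by (simp only:)
      then have "p ^ Suc (k - j) dvd u' * y"
        using p0 by simp
      moreover have "coprime u' (p ^ Suc (k - j))"
        using u'(2) by (rule prime_imp_power_coprime[OF p])
      ultimately have "p ^ Suc (k - j) dvd y"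
        by (simp add: coprime_dvd_mult_right_iff coprime_commute)
      then show False
        using r2 y k_def by simp
    qed
    ultimately have "p ^ (m + k) dvd e False p j - r p j"
      using rel[of p j] pj sub mk by auto
    then have "p ^ m * p ^ k dvd p ^ m * (u' * (x - y))"
      unfolding xy u'(1) by (simp add: power_add algebra_simps)
    then have "p ^ k dvd u' * (x - y)"
      using p0 by simp
    moreover have "coprime u' (p ^ k)"
      using u'(2) by (rule prime_imp_power_coprime[OF p])
    ultimately show "p ^ multiplicity p (n div u) dvd e False p j div u - r p j div u"
      unfolding y k_def[symmetric] by (simp add: coprime_dvd_mult_right_iff coprime_commute)
  qed
qed

end

text \<open>The positions outside the subgroup are those of the quotient, with exponents raised by
  the \<open>p\<close>-valuation of the subgroup order.\<close>

lemma digit_index_quotient: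
  assumes "n > 0" and "u > 0" and "u dvd n"
  shows "bij_betw (\<lambda>(p, j). (p, j + multiplicity p (n div u))) (digit_index u)
    (digit_index n - digit_index (n div u))"
proof -
  have nu: "n div u > 0" "n = u * (n div u)"
    using assms by (auto elim!: dvdE simp: zero_less_mult_iff)
  have mult: "multiplicity p n = multiplicity p u + multiplicity p (n div u)" if "prime p" for p
    using multiplicity_mult_int[OF that assms(2) nu(1)] nu(2) by simp
  show ?thesis
  proof (rule bij_betw_imageI)
    show "inj_on (\<lambda>(p, j). (p, j + multiplicity p (n div u))) (digit_index u)"
      by (auto simp: inj_on_def)
    show "(\<lambda>(p, j). (p, j + multiplicity p (n div u))) ` digit_index u = digit_index n - digit_index (n div u)"
    proof (intro equalityI subsetI)
      fix z assume "z \<in> (\<lambda>(p, j). (p, j + multiplicity p (n div u))) ` digit_index u"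
      then obtain p j where pj: "(p, j) \<in> digit_index u" "z = (p, j + multiplicity p (n div u))"
        by auto
      note d = digit_indexD[OF pj(1)]
      have "j \<le> multiplicity p u"
        by (rule digit_index_le[OF pj(1) assms(2)])
      then have "(p, j + multiplicity p (n div u)) \<in> digit_index n"
        using d(2) mult[OF d(1)] by (intro digit_index_multiplicity[OF d(1) assms(1)]) auto
      moreover have "(p, j + multiplicity p (n div u)) \<notin> digit_index (n div u)"
        using digit_index_le[OF _ nu(1)] d(2) by fastforce
      ultimately show "z \<in> digit_index n - digit_index (n div u)"
        using pj(2) by simp
    next
      fix z assume z: "z \<in> digit_index n - digit_index (n div u)"
      obtain p i where pi: "z = (p, i)"
        by (cases z)
      have i: "(p, i) \<in> digit_index n" "(p, i) \<notin> digit_index (n div u)"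
        using z pi by auto
      note d = digit_indexD[OF i(1)]
      have gt: "i > multiplicity p (n div u)"
        using i(2) digit_index_multiplicity[OF d(1) nu(1) d(2)] by (meson not_le)
      have "i \<le> multiplicity p u + multiplicity p (n div u)"
        using digit_index_le[OF i(1) assms(1)] mult[OF d(1)] by simp
      then have "(p, i - multiplicity p (n div u)) \<in> digit_index u"
        using gt by (intro digit_index_multiplicity[OF d(1) assms(2)]) auto
      then show "z \<in> (\<lambda>(p, j). (p, j + multiplicity p (n div u))) ` digit_index u"
        using gt pi by (intro image_eqI[of _ _ "(p, i - multiplicity p (n div u))"]) auto
    qed
  qed
qed

lemma digit_index_shift:
  assumes "n > 0" and "u > 0" and "u dvd n" and "(p, j) \<in> digit_index u"
  shows "(p, j + multiplicity p (n div u)) \<in> digit_index n"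
  using bij_betwE[OF digit_index_quotient[OF assms(1-3)]] assms(4) by fastforce

lemma digits_quotient:
  assumes "n > 0" and "u > 0" and "u dvd n" and "digits n a"
  shows "digits u (\<lambda>p j. a p (j + multiplicity p (n div u)))"
  using digit_index_shift[OF assms(1-3)] assms(4) unfolding digits_def by fastforce

lemma digits_sub: "m dvd n \<Longrightarrow> digits n a \<Longrightarrow> digits m a"
  using digit_index_mono unfolding digits_def by blast

lemma digit_val_quotient:
  assumes "n > 0" and "u > 0" and "u dvd n"
    and e: "\<And>p j. (p, j) \<in> digit_index n \<Longrightarrow> exact_order n p j (e p j)"
  shows "u dvd digit_val n e a - digit_val u (\<lambda>p j. e p (j + multiplicity p (n div u)))
    (\<lambda>p j. a p (j + multiplicity p (n div u)))"
proof -
  let ?f = "\<lambda>(p, j). a p j * e p j"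
  have sub: "digit_index (n div u) \<subseteq> digit_index n"
    using assms(3) by (intro digit_index_mono) (rule div_dvd_self)
  have "digit_val u (\<lambda>p j. e p (j + multiplicity p (n div u))) (\<lambda>p j. a p (j + multiplicity p (n div u)))
      = sum ?f (digit_index n - digit_index (n div u))"
    unfolding digit_val_def
    by (subst sum.reindex_bij_betw[OF digit_index_quotient[OF assms(1-3)], symmetric])
      (simp add: case_prod_unfold)
  moreover have "digit_val n e a = sum ?f (digit_index n - digit_index (n div u)) + sum ?f (digit_index (n div u))"
    unfolding digit_val_def by (rule sum.subset_diff[OF sub finite_digit_index[OF assms(1)]])
  moreover have "u dvd sum ?f (digit_index (n div u))"
  proof (rule dvd_sum)
    fix z assume z: "z \<in> digit_index (n div u)"
    obtain p j where pj: "z = (p, j)"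
      by (cases z)
    have "u dvd e p j"
      using exact_order_sub(1)[OF assms(1-3) _ e] z pj sub by blast
    then show "u dvd ?f z"
      using pj by simp
  qed
  ultimately show ?thesis
    by simp
qed

context pebbled
begin

text \<open>An element of order \<open>p ^ (j + q)\<close> has order \<open>p ^ j\<close> modulo a
  subgroup whose order has \<open>p\<close>-part \<open>p ^ q\<close>; equal colours give equal
  coset colours.\<close>

lemma quot_pebbled:
  assumes "asub u"
  shows "pebbled u (qcol u) (\<lambda>s p j. e s p (j + multiplicity p (n div u)))
    (\<lambda>p j. r p (j + multiplicity p (n div u)))"
proof -
  have u: "u > 0" "u dvd n"
    using asub_pos[OF assms] asub_dvd[OF assms] .
  have nu: "n div u > 0" "n = u * (n div u)"
    using u n_pos by (auto elim!: dvdE simp: zero_less_mult_iff)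
  have mult: "multiplicity p n = multiplicity p u + multiplicity p (n div u)" if "prime p" for p
    using multiplicity_mult_int[OF that u(1) nu(1)] nu(2) by simp
  note shift = digit_index_shift[OF n_pos u]
  interpret Q: sring u "qcol u"
    by (rule quot_sring[OF assms])
  show ?thesis
  proof unfold_locales
    fix p j s assume pj: "(p, j) \<in> digit_index u"
    define q where "q = multiplicity p (n div u)"
    note d = digit_indexD[OF pj]
    have p0: "p > 0"
      using prime_gt_0_int[OF d(1)] .
    obtain w where w: "e s p (j + q) = n div p ^ (j + q) * w" "\<not> p dvd w"
      using ord[OF shift[OF pj], of s] unfolding exact_order_def q_def by blast
    obtain m where m: "n div u = p ^ q * m" "\<not> p dvd m"
      using prime_power_split[OF d(1) nu(1)] unfolding q_def by blast
    obtain u' where u': "u = p ^ j * u'"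
      using d(3) by blast
    have "n = p ^ (j + q) * (u' * m)"
      using arg_cong2[OF u' m(1), of "(*)"] nu(2) by (simp add: power_add algebra_simps)
    then have "n div p ^ (j + q) = u' * m"
      using p0 by (metis nonzero_mult_div_cancel_left less_irrefl zero_less_power)
    moreover have "u div p ^ j = u'"
      using p0 u' by simp
    ultimately have "e s p (j + q) = u div p ^ j * (m * w)"
      using w(1) by simp
    moreover have "\<not> p dvd m * w"
      using m(2) w(2) d(1) prime_dvd_multD by blast
    ultimately show "exact_order u p j (e s p (j + multiplicity p (n div u)))"
      unfolding exact_order_def q_def by blast
  next
    fix p j assume pj: "(p, Suc j) \<in> digit_index u" "0 < j"
    have "n dvd e True p (j + multiplicity p (n div u)) - p * e True p (Suc (j + multiplicity p (n div u)))"
      using std[of p "j + multiplicity p (n div u)"] shift[OF pj(1)] pj(2) by simp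
    then show "u dvd e True p (j + multiplicity p (n div u)) - p * e True p (Suc j + multiplicity p (n div u))"
      using u(2) dvd_trans by simp blast
  next
    fix x
    obtain x' where x': "c True x = c False x'"
        "\<forall>(p, j) \<in> digit_index n. c True (x - e True p j) = c False (x' - r p j)"
      using peb by blast
    have "qcol u True (x - e True p (j + multiplicity p (n div u))) =
        qcol u False (x' - r p (j + multiplicity p (n div u)))" if "(p, j) \<in> digit_index u" for p j
      by (rule qcol_cong[OF assms]) (use x'(2) shift[OF that] in auto)
    then show "\<exists>x'. qcol u True x = qcol u False x' \<and> (\<forall>(p, j) \<in> digit_index u.
        qcol u True (x - e True p (j + multiplicity p (n div u))) =
        qcol u False (x' - r p (j + multiplicity p (n div u))))"
      using qcol_cong[OF assms x'(1)] by blast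
  next
    fix p j assume pj: "(p, j) \<in> digit_index u"
    assume r1: "p ^ (multiplicity p u - j) dvd r p (j + multiplicity p (n div u))"
      and r2: "\<not> p ^ Suc (multiplicity p u - j) dvd r p (j + multiplicity p (n div u))"
    have m: "multiplicity p n = multiplicity p u + multiplicity p (n div u)"
      by (rule mult) (rule digit_indexD[OF pj])
    have "multiplicity p n - (j + multiplicity p (n div u)) = multiplicity p u - j"
      using m by simp
    then have "p ^ multiplicity p n dvd e False p (j + multiplicity p (n div u)) - r p (j + multiplicity p (n div u))"
      using rel[OF shift[OF pj]] r1 r2 by simp
    moreover have "p ^ multiplicity p u dvd p ^ multiplicity p n"
      using m by (intro le_imp_power_dvd) simp
    ultimately show "p ^ multiplicity p u dvd e False p (j + multiplicity p (n div u)) - r p (j + multiplicity p (n div u))"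
      using dvd_trans by blast
  qed
qed

definition gap :: "bool \<Rightarrow> (int \<Rightarrow> nat \<Rightarrow> int) \<Rightarrow> (int \<Rightarrow> nat \<Rightarrow> int) \<Rightarrow> int" where
  "gap s a b = digit_val n (e s) a - digit_val n (e s) b"

lemma gap_dvd_iff:
  assumes "u > 0" and "u dvd n" and "digits n a" and "digits n b"
  shows "u dvd gap s a b \<longleftrightarrow> u dvd gap s' a b"
  unfolding gap_def by (simp only: digit_val_dvd[OF assms])

end

text \<open>The claim of the main induction, for all moduli below \<open>m\<close>.\<close>

definition linear_below :: "int \<Rightarrow> bool" where
  "linear_below m \<longleftrightarrow> (\<forall>n c e r a b. n < m \<longrightarrow> pebbled n c e r \<longrightarrow> digits n a \<longrightarrow> digits n b \<longrightarrow>
    c True (pebbled.gap n e True a b) = c False (pebbled.gap n e False a b))"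

lemma linear_belowD:
  assumes "linear_below m" and "n < m" and "pebbled n c e r" and "digits n a" and "digits n b"
  shows "c True (digit_val n (e True) a - digit_val n (e True) b) = c False (digit_val n (e False) a - digit_val n (e False) b)"
proof -
  have "c True (pebbled.gap n e True a b) = c False (pebbled.gap n e False a b)"
    using assms(1)[unfolded linear_below_def] assms(2-5) by blast
  then show ?thesis
    unfolding pebbled.gap_def[OF assms(3)] .
qed

section \<open>Differences in subgroups, quotients and tensor products\<close>

context pebbled
begin

text \<open>The digits agree at all positions outside the subgroup, so the difference is computed
  inside it.\<close>

lemma gap_in_subgroup:
  assumes below: "linear_below n" and u: "asub u" "u > 1" and a: "digits n a" and b: "digits n b"
    and dvd: "u dvd gap True a b"
  shows "c True (gap True a b) = c False (gap False a b)"
proof -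
  note u' = asub_pos[OF u(1)] asub_dvd[OF u(1)]
  have "\<forall>(p, j) \<in> digit_index n - digit_index (n div u). a p j = b p j"
    using dvd digit_val_dvd[OF u' a b] unfolding gap_def by blast
  then have agree: "a p j = b p j" if "(p, j) \<in> digit_index n" "(p, j) \<notin> digit_index (n div u)" for p j
    using that by blast
  have gap: "gap s a b = u * (digit_val (n div u) (\<lambda>p j. e s p j div u) a -
      digit_val (n div u) (\<lambda>p j. e s p j div u) b)" for s
    unfolding gap_def by (rule digit_val_sub[OF n_pos u' ord agree])
  have sub: "n div u dvd n"
    by (rule div_dvd_self[OF u'(2)])
  have "n div u < n"
    using n_pos u(2) by (intro int_div_less_self) auto
  from linear_belowD[OF below this sub_pebbled[OF u(1)] digits_sub[OF sub a] digits_sub[OF sub b]]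
  show ?thesis
    unfolding gap .
qed

text \<open>The induction provides only the colour of the coset, but an invariant class contains
  every coset it meets.\<close>

lemma gap_in_quotient:
  assumes below: "linear_below n" and u: "asub u" "u \<noteq> n" and a: "digits n a" and b: "digits n b"
    and inv: "cinv u (c True (gap True a b))"
  shows "c True (gap True a b) = c False (gap False a b)"
proof -
  note u' = asub_pos[OF u(1)] asub_dvd[OF u(1)]
  define q where "q p = multiplicity p (n div u)" for p
  define G where "G s = digit_val u (\<lambda>p j. e s p (j + q p)) (\<lambda>p j. a p (j + q p)) -
    digit_val u (\<lambda>p j. e s p (j + q p)) (\<lambda>p j. b p (j + q p))" for s
  have "u < n"
    using zdvd_imp_le[OF u'(2) n_pos] u(2) by simp
  from linear_belowD[OF below this quot_pebbled[OF u(1)] digits_quotient[OF n_pos u' a] digits_quotient[OF n_pos u' b]]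
  have "qcol u True (G True) = qcol u False (G False)"
    unfolding G_def q_def .
  moreover have per: "qcol u s (gap s a b) = qcol u s (G s)" for s
  proof (rule qcol_per)
    have *: "u dvd digit_val n (e s) x - digit_val u (\<lambda>p j. e s p (j + q p)) (\<lambda>p j. x p (j + q p))" for x
      unfolding q_def by (rule digit_val_quotient[OF n_pos u' ord])
    show "u dvd gap s a b - G s"
      using dvd_diff[OF *[of a] *[of b]] unfolding gap_def G_def by (simp add: algebra_simps)
  qed
  ultimately have "qcol u True (gap True a b) = qcol u False (gap False a b)"
    by simp
  then obtain y where y: "u dvd y - gap False a b" "c False y = c True (gap True a b)"
    by (rule qcol_eqD[OF u(1)])
  have "u dvd gap False a b - y"
    using y(1) by (simp add: dvd_diff_commute)
  then show ?thesis
    using inv y(2) unfolding cinv_def by metis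
qed

text \<open>\<open>tensor_class\<close> reduces the colour to two facts: the difference is no
  multiple of \<open>h\<close>, which the digits decide, and its projection has colour
  \<open>\<delta>\<close>, which is a statement inside a proper subgroup.\<close>

lemma gap_in_tensor:
  assumes below: "linear_below n" and v: "asub v" "asub (n div v)" "n div v > 1" "coprime v (n div v)"
    and g: "coprime g n" "c True g = c True (gap True a b)" and lam: "int (lam v True g) = n div v - 1"
    and a: "digits n a" and b: "digits n b"
  shows "c True (gap True a b) = c False (gap False a b)"
proof -
  define h where "h = n div v"
  note v' = asub_pos[OF v(1)] asub_dvd[OF v(1)]
  have n: "n = v * h"
    using v' by (simp add: h_def)
  have h: "h > 0" "h dvd n" "n div h = v"
    using v(3) n v'(1) unfolding h_def[symmetric] by auto
  obtain E where E: "v dvd E - 1" "h dvd E"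
    using coprime_projection v(4) unfolding h_def by blast
  have "\<not> h dvd g"
  proof
    assume "h dvd g"
    then have "is_unit h"
      using g(1) h(2) by (meson coprime_common_divisor)
    then show False
      using v(3) by (simp add: h_def)
  qed
  then obtain \<delta> where \<delta>: "\<And>s' x. c s' x = c True g \<longleftrightarrow> \<not> h dvd x \<and> c s' (E * x) = \<delta>"
    using tensor_class[OF v(1) n v(4)[folded h_def] v(2)[folded h_def] _ lam[folded h_def] E] by blast
  \<comment> \<open>Projection by \<open>E\<close> keeps the digits at the primes of
    \<open>v\<close> and erases those at the primes of \<open>h\<close>.\<close>
  define cut where "cut x = (\<lambda>p j. if (p, j) \<in> digit_index v then x p j else (0::int))" for x
  have cut: "digits n (cut x)" if "digits n x" for x
    using that digit_indexD(1)[THEN prime_gt_0_int] unfolding digits_def cut_def by fastforce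
  have proj: "n dvd E * digit_val n (e s) x - digit_val n (e s) (cut x)" for s x
  proof -
    have "n dvd (\<Sum>(p, j) \<in> digit_index n. E * (x p j * e s p j) - cut x p j * e s p j)"
    proof (rule dvd_sum)
      fix z assume z: "z \<in> digit_index n"
      obtain p j where pj: "z = (p, j)"
        by (cases z)
      have mem: "(p, j) \<in> digit_index n"
        using z pj by simp
      note d = digit_indexD[OF mem]
      have "n dvd E * (x p j * e s p j) - cut x p j * e s p j"
      proof (cases "(p, j) \<in> digit_index v")
        case True
        then have "h dvd e s p j"
          using exact_order_sub(1)[OF n_pos h(1,2) _ ord[OF mem]] h(3) by simp
        then have "v * h dvd (E - 1) * e s p j"
          using E(1) by (rule mult_dvd_mono[rotated])
        then have "n dvd ((E - 1) * e s p j) * x p j"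
          unfolding n[symmetric] by (rule dvd_mult2)
        then show ?thesis
          using True by (simp add: cut_def algebra_simps)
      next
        case False
        have "\<not> p dvd v"
        proof
          assume pv: "p dvd v"
          then have "\<not> p dvd h"
            using v(4) d(1) not_prime_unit coprime_common_divisor unfolding h_def by blast
          then have "coprime (p ^ j) h"
            using d(1) by (metis coprime_commute prime_imp_power_coprime)
          then have "p ^ j dvd v"
            using d(3) n coprime_dvd_mult_left_iff by metis
          then show False
            using False d(1,2) by (simp add: digit_index_def)
        qed
        then have "v dvd e s p j"
          by (rule exact_orderD(3)[OF ord[OF mem] mem n_pos v'(2)])
        then have "v * h dvd e s p j * E"
          using E(2) by (rule mult_dvd_mono)
        then have "n dvd (e s p j * E) * x p j"
          unfolding n[symmetric] by (rule dvd_mult2)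
        then show ?thesis
          using False by (simp add: cut_def algebra_simps)
      qed
      then show "n dvd (case z of (p, j) \<Rightarrow> E * (x p j * e s p j) - cut x p j * e s p j)"
        using pj by simp
    qed
    then show ?thesis
      unfolding digit_val_def by (simp add: sum_distrib_left sum_subtractf case_prod_unfold)
  qed
  have proj_gap: "c s (E * gap s a b) = c s (gap s (cut a) (cut b))" for s
  proof (rule per)
    have "n dvd (E * digit_val n (e s) a - digit_val n (e s) (cut a)) -
        (E * digit_val n (e s) b - digit_val n (e s) (cut b))"
      by (rule dvd_diff[OF proj proj])
    then show "n dvd E * gap s a b - gap s (cut a) (cut b)"
      unfolding gap_def by (simp add: algebra_simps)
  qed
  have agree: "cut a p j = cut b p j" if "(p, j) \<in> digit_index n" "(p, j) \<notin> digit_index v" for p j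
    using that(2) by (simp add: cut_def)
  have "\<forall>(p, j) \<in> digit_index n - digit_index (n div h). cut a p j = cut b p j"
    unfolding h(3) using agree by blast
  then have "h dvd gap True (cut a) (cut b)"
    unfolding gap_def digit_val_dvd[OF h(1,2) cut[OF a] cut[OF b]] .
  then have eq: "c True (gap True (cut a) (cut b)) = c False (gap False (cut a) (cut b))"
    by (rule gap_in_subgroup[OF below v(2)[folded h_def] v(3)[folded h_def] cut[OF a] cut[OF b]])
  have "\<not> h dvd gap True a b" and "c True (E * gap True a b) = \<delta>"
    using \<delta>[of True "gap True a b"] g(2) by simp_all
  then have "\<not> h dvd gap False a b" and "c False (E * gap False a b) = \<delta>"
    using gap_dvd_iff[OF h(1,2) a b, of True False] eq by (simp_all add: proj_gap)
  then show ?thesis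
    using \<delta>[of False "gap False a b"] g(2) by simp
qed

end

section \<open>The unit case and the induction\<close>

context sring
begin

lemma cinv_mult:
  assumes "coprime m n" and "cinv a (c s (m * x))"
  shows "cinv a (c s x)"
  unfolding cinv_def
proof (intro allI impI)
  fix s' z y assume z: "c s' z = c s x" and y: "a dvd y - z"
  have "a dvd m * y - m * z"
    using y by (simp add: right_diff_distrib[symmetric])
  then have "c s' (m * y) = c s (m * x)"
    using assms(2) mult[OF assms(1) z] unfolding cinv_def by blast
  then show "c s' y = c s x"
    using mult_iff[OF assms(1)] by blast
qed

lemma lam_mult_le:
  assumes "coprime m n" and "a dvd n"
  shows "lam a s x \<le> lam a s (m * x)"
  unfolding lam_def
proof (rule cnt_inj_le[where f = "\<lambda>z. m * z"])
  show "per n (\<lambda>z. c s z = c s (m * x) \<and> a dvd z - m * x)"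
    by (rule per_coset[OF assms(2)])
  show "c s (m * z) = c s (m * x) \<and> a dvd m * z - m * x" if z: "c s z = c s x \<and> a dvd z - x" for z
  proof
    show "c s (m * z) = c s (m * x)"
      by (rule mult[OF assms(1) conjunct1[OF z]])
    show "a dvd m * z - m * x"
      using conjunct2[OF z] by (simp add: right_diff_distrib[symmetric])
  qed
  show "n dvd z - z'" if "n dvd m * z - m * z'" for z z'
    using that assms(1) by (simp add: right_diff_distrib[symmetric] coprime_dvd_mult_right_iff coprime_commute)
qed (rule n_pos)

lemma lam_mult:
  assumes "coprime m n" and "asub a"
  shows "lam a s (m * x) = lam a s x"
proof -
  obtain v where v: "n dvd m * v - 1" "coprime v n"
    using int_coprime_inverse[OF assms(1)] .
  note a = asub_dvd[OF assms(2)]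
  have "lam a s (m * x) \<le> lam a s (v * (m * x))"
    by (rule lam_mult_le[OF v(2) a])
  also have "\<dots> = lam a s x"
  proof (rule lam_cong[OF assms(2)])
    have "n dvd (m * v - 1) * x"
      using v(1) by (rule dvd_mult2)
    then show "c s (v * (m * x)) = c s x"
      by (intro per) (simp add: algebra_simps)
  qed
  finally show ?thesis
    using lam_mult_le[OF assms(1) a, of s x] by simp
qed

end

context pebbled
begin

lemma std_iterate:
  assumes "(p, j + i) \<in> digit_index n" and "0 < j"
  shows "n dvd e True p j - p ^ i * e True p (j + i)"
  using assms(1)
proof (induction i)
  case 0
  then show ?case by simp
next
  case (Suc i)
  have "(p, j + i) \<in> digit_index n"
    using Suc.prems assms(2) by (auto simp: digit_index_def intro: dvd_mult_right)
  then have "n dvd e True p j - p ^ i * e True p (j + i)"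
    by (rule Suc.IH)
  moreover have "n dvd p ^ i * (e True p (j + i) - p * e True p (Suc (j + i)))"
    using std[of p "j + i"] Suc.prems assms(2) by (intro dvd_mult) simp
  ultimately have "n dvd (e True p j - p ^ i * e True p (j + i)) +
      p ^ i * (e True p (j + i) - p * e True p (Suc (j + i)))"
    by (rule dvd_add)
  then show ?case
    by (simp add: algebra_simps)
qed

text \<open>A unit assembled from one generator of each Sylow subgroup; by \<open>std\<close> every
  pebbled element on side \<open>True\<close> is a \<open>p\<close>-power multiple of a projection
  of it.\<close>

definition gen :: int where
  "gen = (\<Sum>p | prime p \<and> p dvd n. e True p (multiplicity p n))"

lemma sylow_index: "prime p \<Longrightarrow> p dvd n \<Longrightarrow> (p, multiplicity p n) \<in> digit_index n"
  using n_pos multiplicity_dvd[of p n] multiplicity_geI[of n p 1]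
  by (auto simp: digit_index_def)

lemma gen_cong:
  assumes p: "prime p" "p dvd n"
  shows "p ^ multiplicity p n dvd gen - e True p (multiplicity p n)"
proof -
  let ?P = "{p. prime p \<and> p dvd n}"
  have fin: "finite ?P"
    by (rule finite_subset[of _ "{p. p dvd n}"]) (use n_pos in auto)
  have "gen = e True p (multiplicity p n) + (\<Sum>q \<in> ?P - {p}. e True q (multiplicity q n))"
    unfolding gen_def by (rule sum.remove[OF fin]) (use p in simp)
  moreover have "p ^ multiplicity p n dvd (\<Sum>q \<in> ?P - {p}. e True q (multiplicity q n))"
  proof (rule dvd_sum)
    fix q assume q: "q \<in> ?P - {p}"
    have mem: "(q, multiplicity q n) \<in> digit_index n"
      using q by (intro sylow_index) auto
    have "\<not> q dvd p ^ multiplicity p n"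
      using q p(1) prime_dvd_power primes_dvd_imp_eq by blast
    then show "p ^ multiplicity p n dvd e True q (multiplicity q n)"
      by (rule exact_orderD(3)[OF ord[OF mem] mem n_pos multiplicity_dvd])
  qed
  ultimately show ?thesis
    by simp
qed

lemma gen_coprime: "coprime gen n"
proof (rule coprime_int_primesI)
  show "n \<noteq> 0"
    using n_pos by simp
  fix q assume q: "prime q" "q dvd gen" "q dvd n"
  have mem: "(q, multiplicity q n) \<in> digit_index n"
    by (rule sylow_index[OF q(1,3)])
  have "q dvd q ^ multiplicity q n"
    by (rule dvd_power) (use digit_indexD(2)[OF mem] in simp)
  then have "q dvd gen - e True q (multiplicity q n)"
    using gen_cong[OF q(1,3)] dvd_trans by blast
  then have "q dvd e True q (multiplicity q n)"
    using q(2) by (simp add: dvd_diff_right_iff)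
  then show False
    using exact_orderD(2)[OF ord[OF mem, of True] mem n_pos] by simp
qed

text \<open>The free pebble goes to the unit \<open>gen\<close>. Its answer \<open>z'\<close> is
  again a unit, and \<open>\<sigma>\<close>, the quotient of \<open>z'\<close> by
  \<open>gen\<close>, takes each pebbled element to its response by \<open>pebble_linear\<close>.
  Hence all differences are scaled by \<open>\<sigma>\<close>.\<close>

lemma gap_in_normal:
  assumes "normal_class n c \<gamma> g" and \<gamma>: "c True (gap True a b) = \<gamma>"
  shows "c True (gap True a b) = c False (gap False a b)"
proof -
  interpret N: normal_class n c \<gamma> g
    by (rule assms(1))
  obtain z' where z': "c True gen = c False z'"
      "\<forall>(p, j) \<in> digit_index n. c True (gen - e True p j) = c False (z' - r p j)"
    using peb by blast
  obtain v where v: "n dvd gen * v - 1" "coprime v n"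
    using int_coprime_inverse[OF gen_coprime] .
  define m where "m = v * g True"
  have m: "coprime m n"
    unfolding m_def using v(2) N.g_unit by simp
  have m_gen: "c True (m * gen) = \<gamma>"
  proof -
    have "n dvd (gen * v - 1) * g True"
      using v(1) by (rule dvd_mult2)
    then have "c True (m * gen) = c True (g True)"
      unfolding m_def by (intro per) (simp add: algebra_simps)
    then show ?thesis
      using N.g_col by simp
  qed
  have m_z': "c False (m * z') = \<gamma>"
    using mult[OF m z'(1)] m_gen by simp
  have "coprime z' n"
    using N.class_units[OF m_z'] by simp
  define h where "h s = (if s then gen else z')" for s
  have h: "coprime (h s) n" "c s (h s) = c True gen" "c s (m * h s) = \<gamma>" for s
    using gen_coprime \<open>coprime z' n\<close> z'(1) m_gen m_z' by (simp_all add: h_def)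
  \<comment> \<open>The unit \<open>m\<close> takes the class of \<open>gen\<close> to
    \<open>\<gamma>\<close>, so the properties of a normal class carry over.\<close>
  interpret H: normal_class n c "c True gen" h
  proof unfold_locales
    show "\<not> cinv a (c True gen)" if "minsub a" for a
    proof
      assume "cinv a (c True gen)"
      have "n dvd (gen * v - 1) * g True"
        using v(1) by (rule dvd_mult2)
      obtain w where w: "n dvd m * w - 1" "coprime w n"
        using int_coprime_inverse[OF m] .
      have "n dvd (m * w - 1) * gen"
        using w(1) by (rule dvd_mult2)
      then have "c True (w * (m * gen)) = c True gen"
        by (intro per) (simp add: algebra_simps)
      then have "cinv a (c True (w * (m * gen)))"
        using \<open>cinv a (c True gen)\<close> by (simp only:)
      then have "cinv a (c True (m * gen))"
        by (rule cinv_mult[OF w(2)])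
      then show False
        using N.not_cinv[OF that] m_gen by simp
    qed
    show "int (lam a s (h s)) \<noteq> n div a - 1" if "minsub a" "\<not> n div a dvd a" for a s
    proof -
      note a = minsub_facts(1)[OF that(1)]
      have "lam a s (h s) = lam a s (m * h s)"
        by (rule lam_mult[OF m a, symmetric])
      also have "\<dots> = lam a s (g s)"
        by (rule lam_cong[OF a]) (simp add: h(3) N.g_col)
      finally show ?thesis
        using N.lam_ne[OF that] by simp
    qed
  qed (use N.n1 N.min_prime h in auto)
  define \<sigma> where "\<sigma> = v * z'"
  have \<sigma>: "n dvd \<sigma> * gen - z'" "coprime \<sigma> n"
  proof -
    have "n dvd (gen * v - 1) * z'"
      using v(1) by (rule dvd_mult2)
    then show "n dvd \<sigma> * gen - z'"
      by (simp add: \<sigma>_def algebra_simps)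
    show "coprime \<sigma> n"
      using v(2) \<open>coprime z' n\<close> by (simp add: \<sigma>_def)
  qed
  have lin: "n dvd e False p j - \<sigma> * e True p j" if mem: "(p, j) \<in> digit_index n" for p j
  proof -
    note d = digit_indexD[OF mem]
    define k where "k = multiplicity p n"
    obtain n' where n': "n = p ^ k * n'" "\<not> p dvd n'"
      using prime_power_split[OF d(1) n_pos] unfolding k_def by blast
    have p0: "p > 0"
      using prime_gt_0_int[OF d(1)] .
    have jk: "j \<le> k"
      using digit_index_le[OF mem n_pos] by (simp add: k_def)
    have pq: "n div (n div p) = p"
      using d(4) n_pos p0 by (metis dvd_div_mult_self nonzero_mult_div_cancel_left div_0 less_irrefl mult_zero_left)
    interpret P: normal_prime n c "c True gen" h "n div p" p k n'
      by unfold_locales (use H.prime_minsub[OF d(1,4)] pq n' in auto)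
    obtain E where E: "p ^ k dvd E - 1" "n' dvd E"
      using coprime_projection[of "p ^ k" n'] P.coprime_n' by (metis coprime_commute)
    define i where "i = k - j"
    have i: "i < k" "j + i = k"
      using jk d(2) by (simp_all add: i_def)
    have n'_e: "n' dvd e s p j" for s
      by (rule exact_orderD(3)[OF ord[OF mem] mem n_pos P.n'_n n'(2)])
    have eE: "n dvd e True p j - E * (p ^ i * h True)"
    proof (rule P.n_dvdI)
      show "n' dvd e True p j - E * (p ^ i * h True)"
        by (rule dvd_diff[OF n'_e dvd_mult2[OF E(2)]])
      have "n dvd e True p j - p ^ i * e True p k"
        using std_iterate[of p j i] sylow_index[OF d(1,4)] d(2) i(2) by (simp add: k_def)
      then have "p ^ k dvd e True p j - p ^ i * e True p k"
        by (rule dvd_trans[OF P.pk_n])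
      moreover have "p ^ k dvd p ^ i * (gen - e True p k)"
        using gen_cong[OF d(1,4)] unfolding k_def by (rule dvd_mult)
      moreover have "p ^ k dvd (E - 1) * (p ^ i * gen)"
        using E(1) by (rule dvd_mult2)
      ultimately have "p ^ k dvd ((e True p j - p ^ i * e True p k) - p ^ i * (gen - e True p k)) - (E - 1) * (p ^ i * gen)"
        by (rule dvd_diff[OF dvd_diff])
      then show "p ^ k dvd e True p j - E * (p ^ i * h True)"
        by (simp add: h_def algebra_simps)
    qed
    have rs: "n dvd r p j - \<sigma> * e True p j"
    proof (rule P.pebble_linear[OF _ \<sigma>(2) E i(1) eE r_col[OF mem]])
      show "n dvd \<sigma> * h True - h False"
        using \<sigma>(1) by (simp add: h_def)
      show "c False (h False - r p j) = c True (h True - e True p j)"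
        using z'(2) mem by (auto simp: h_def)
    qed
    \<comment> \<open>The response is a unit multiple of \<open>e True p j\<close>, so it has
      exactly the order for which \<open>rel\<close> identifies its \<open>p\<close>-part with
      \<open>e False p j\<close>.\<close>
    have r_dvd: "q dvd r p j \<longleftrightarrow> q dvd e True p j" if q: "q dvd n" for q
    proof -
      have "q dvd r p j - \<sigma> * e True p j"
        by (rule dvd_trans[OF q rs])
      then have "q dvd r p j \<longleftrightarrow> q dvd \<sigma> * e True p j"
        by (metis dvd_diff_left_iff dvd_diff_right_iff)
      moreover have "coprime q \<sigma>"
        using \<sigma>(2) q by (meson coprime_divisors coprime_commute dvd_refl)
      ultimately show ?thesis
        by (simp add: coprime_dvd_mult_right_iff)
    qed
    have "p ^ (multiplicity p n - j) dvd n" "p ^ Suc (multiplicity p n - j) dvd n"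
      using jk d(2) by (auto intro!: multiplicity_dvd' simp: k_def simp del: power_Suc)
    then have "p ^ k dvd e False p j - r p j"
      using rel[OF mem] r_dvd exact_orderD(1,2)[OF ord[OF mem, of True] mem n_pos] unfolding k_def by blast
    moreover have "n' dvd e False p j - r p j"
      using r_dvd[OF P.n'_n] n'_e by (intro dvd_diff) auto
    ultimately have "n dvd e False p j - r p j"
      by (rule P.n_dvdI)
    then have "n dvd (e False p j - r p j) + (r p j - \<sigma> * e True p j)"
      using rs by (rule dvd_add)
    then show ?thesis
      by simp
  qed
  have val: "n dvd digit_val n (e False) x - \<sigma> * digit_val n (e True) x" for x
  proof -
    have "n dvd (\<Sum>(p, j) \<in> digit_index n. x p j * e False p j - \<sigma> * (x p j * e True p j))"
    proof (rule dvd_sum)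
      fix z assume z: "z \<in> digit_index n"
      obtain p j where pj: "z = (p, j)"
        by (cases z)
      have "n dvd x p j * (e False p j - \<sigma> * e True p j)"
        using lin z pj by (intro dvd_mult) blast
      then show "n dvd (case z of (p, j) \<Rightarrow> x p j * e False p j - \<sigma> * (x p j * e True p j))"
        using pj by (simp add: algebra_simps)
    qed
    then show ?thesis
      unfolding digit_val_def by (simp add: sum_distrib_left sum_subtractf case_prod_unfold)
  qed
  have "n dvd gap False a b - \<sigma> * gap True a b"
    using dvd_diff[OF val[of a] val[of b]] unfolding gap_def by (simp add: algebra_simps)
  then have "c False (gap False a b) = c False (\<sigma> * gap True a b)"
    by (rule per)
  also have "\<dots> = c False (v * gap True a b * z')"
    by (simp add: \<sigma>_def mult_ac)
  \<comment> \<open>The difference is a unit, hence so is \<open>v * gap True a b\<close>, which can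
    act as a multiplier on the matching pair \<open>gen\<close>, \<open>z'\<close>.\<close>
  also have "\<dots> = c True (v * gap True a b * gen)"
  proof (rule mult[symmetric])
    show "coprime (v * gap True a b) n"
      using v(2) N.class_units[OF \<gamma>] by simp
    show "c True gen = c False z'"
      by (rule z'(1))
  qed
  also have "\<dots> = c True (gap True a b)"
  proof (rule per)
    have "n dvd (gen * v - 1) * gap True a b"
      using v(1) by (rule dvd_mult2)
    then show "n dvd v * gap True a b * gen - gap True a b"
      by (simp add: algebra_simps)
  qed
  finally show ?thesis ..
qed

text \<open>Each case relies on the failure of the earlier ones: a difference in no proper subgroup
  has units in its class, and a class without invariance is a tensor product or normal.\<close>

lemma gap_colour_step:
  assumes below: "linear_below n" and a: "digits n a" and b: "digits n b"
  shows "c True (gap True a b) = c False (gap False a b)"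
proof (cases "n = 1")
  case True
  have "c True (gap True a b) = c False 0" "c False (gap False a b) = c False 0"
    using zero[of True _ False] zero[of False _ False] True by simp_all
  then show ?thesis
    by simp
next
  case False
  then have n1: "n > 1"
    using n_pos by simp
  define \<gamma> where "\<gamma> = c True (gap True a b)"
  show ?thesis
  proof (cases "\<exists>u. asub u \<and> u > 1 \<and> u dvd gap True a b")
    case True
    then show ?thesis
      using gap_in_subgroup[OF below _ _ a b] by blast
  next
    case no_sub: False
    show ?thesis
    proof (cases "\<exists>u. asub u \<and> u \<noteq> n \<and> cinv u \<gamma>")
      case True
      then show ?thesis
        using gap_in_quotient[OF below _ _ a b] unfolding \<gamma>_def by blast
    next
      case no_quot: False
      have only_one: "u = 1" if "asub u" "u dvd gap True a b" for u
        using no_sub that asub_pos[OF that(1)] by force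
      have sr: "sring n c"
        by (rule sring_axioms)
      obtain gT where gT: "coprime gT n" "c True gT = \<gamma>"
        using class_has_unit[OF sr only_one, where s = True] unfolding \<gamma>_def by blast
      obtain y where y: "c False y = \<gamma>"
        using onto[of False True] unfolding \<gamma>_def by blast
      have "u = 1" if "asub u" "u dvd y" for u
        by (rule only_one[OF that(1) asub_dvdD[OF that(1) _ that(2)]]) (use y in \<open>simp add: \<gamma>_def\<close>)
      then obtain gF where gF: "coprime gF n" "c False gF = \<gamma>"
        using class_has_unit[OF sr, where d = y and s = False] y by blast
      have not_inv: "\<not> cinv v \<gamma>" if "minsub v" for v
        using no_quot minsub_facts(1,5)[OF that] that unfolding minsub_def by blast
      show ?thesis
      proof (cases "\<exists>v. minsub v \<and> (prime (n div v) \<longrightarrow> \<not> n div v dvd v \<and> int (lam v True gT) = n div v - 1)")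
        case True
        then obtain v where v: "minsub v"
            and pv: "prime (n div v) \<Longrightarrow> \<not> n div v dvd v" "prime (n div v) \<Longrightarrow> int (lam v True gT) = n div v - 1"
          by blast
        note vf = minsub_facts[OF v]
        have "coprime v (n div v) \<and> asub (n div v) \<and> int (lam v True gT) = n div v - 1"
        proof (cases "prime (n div v)")
          case True
          define p where "p = n div v"
          define p' where "p' = nat p"
          have p: "prime p" "p = int p'" "prime p'"
          proof -
            show "prime p"
              unfolding p_def by (rule True)
            then show "p = int p'"
              using prime_gt_0_int[of p] by (simp add: p'_def)
            show "prime p'"
              unfolding p'_def using iffD1[OF prime_int_nat_transfer \<open>prime p\<close>] by (rule conjunct2)
          qed
          have pn: "p dvd n" "n div p = v"
            using vf(2,3,4) unfolding p_def[symmetric] by (metis dvd_triv_right, metis nonzero_mult_div_cancel_right less_irrefl less_trans zero_less_one)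
          \<comment> \<open>A fibre of size \<open>p - 1\<close> is not divisible by
            \<open>p\<close>, so \<open>p * gT\<close> lies in \<open>powset\<close>. As
            \<open>gT\<close> is a unit, the subgroup generated by \<open>powset\<close> is that of
            the multiples of \<open>p\<close>, the complement needed for a tensor product.\<close>
          have "fib p' True \<gamma> gT = lam v True gT"
            unfolding fib_def lam_def using pn(2) p(2) gT(2) by simp
          then have "int (fib p' True \<gamma> gT) = p - 1"
            using pv(2) True p_def by simp
          then have "fib p' True \<gamma> gT = p' - 1"
            using p(2) by simp
          moreover have "\<not> p' dvd p' - 1"
            using prime_gt_1_nat[OF p(3)] by (auto dest: dvd_imp_le)
          ultimately have "powset p' True \<gamma> (p * gT)"
            using powset_fib[of p' True \<gamma> gT] p pn(1) prime_gt_0_nat[OF p(3)] by simp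
          moreover obtain w where w: "asub w" "p dvd w" "\<And>s x. powset p' s \<gamma> x \<Longrightarrow> w dvd x"
            using powset_gen[OF p(3), of \<gamma>] pn(1) p(2) by metis
          ultimately have "w dvd p * gT"
            by blast
          moreover have "coprime w gT"
            using gT(1) asub_dvd[OF w(1)] by (meson coprime_divisors coprime_commute dvd_refl)
          ultimately have "w dvd p"
            by (simp add: coprime_dvd_mult_left_iff)
          then have "w = p"
            using w(2) asub_pos[OF w(1)] prime_gt_0_int[OF p(1)] zdvd_antisym_nonneg by simp
          moreover have "coprime v p"
            using coprime_primeI[OF p(1)] pv(1)[OF True] unfolding p_def by blast
          ultimately show ?thesis
            using w(1) pv(2)[OF True] unfolding p_def by simp
        next
          case False
          \<comment> \<open>A common prime of order and index would make the class of 1 invariant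
            and, since a unit takes \<open>gT\<close> to 1, also the class of
            \<open>gT\<close>.\<close>
          have cop: "coprime v (n div v)"
          proof (rule coprime_int_primesI)
            show "n div v \<noteq> 0"
              using vf(4) by simp
            fix q assume q: "prime q" "q dvd v" "q dvd n div v"
            define q' where "q' = nat q"
            have q': "q = int q'"
              using prime_gt_0_int[OF q(1)] by (simp add: q'_def)
            moreover have "prime q'"
              unfolding q'_def using iffD1[OF prime_int_nat_transfer q(1)] by (rule conjunct2)
            moreover have "n div v \<noteq> q"
              using False q(1) by metis
            ultimately have "cinv v (c True 1)"
              using class_one_invariant[OF v minsub_mono[OF v False] _, of q'] q by metis
            moreover obtain w where w: "n dvd gT * w - 1" "coprime w n"
              using int_coprime_inverse[OF gT(1)] .
            have "c True (w * gT) = c True 1"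
              using w(1) by (intro per) (simp add: mult.commute)
            ultimately have "cinv v (c True gT)"
              using cinv_mult[OF w(2), of v True gT] by simp
            then show False
              using not_inv[OF v] gT(2) by simp
          qed
          have "\<not> cinv v (c True gT)"
            using not_inv[OF v] gT(2) by simp
          from coprime_composite_class[OF v False cop gT(1) this] cop show ?thesis
            by blast
        qed
        then show ?thesis
          using gap_in_tensor[OF below vf(1) _ vf(4) _ gT(1) _ _ a b] gT(2) unfolding \<gamma>_def by blast
      next
        case no_tensor: False
        define g where "g s = (if s then gT else gF)" for s
        have g: "coprime (g s) n" "c s (g s) = \<gamma>" for s
          using gT gF by (simp_all add: g_def)
        have "normal_class n c \<gamma> g"
        proof unfold_locales
          show "int (lam v s (g s)) \<noteq> n div v - 1" if "minsub v" "\<not> n div v dvd v" for v s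
          proof -
            have "lam v s (g s) = lam v True gT"
              by (rule lam_cong[OF minsub_facts(1)[OF that(1)]]) (use g gT in simp)
            then show ?thesis
              using no_tensor that by auto
          qed
        qed (use n1 g no_tensor not_inv in blast)+
        then show ?thesis
          using gap_in_normal \<gamma>_def by blast
      qed
    qed
  qed
qed

end

lemma linear_below: "linear_below m"
proof -
  have "pebbled n c e r \<Longrightarrow> digits n a \<Longrightarrow> digits n b \<Longrightarrow>
    c True (pebbled.gap n e True a b) = c False (pebbled.gap n e False a b)" for n c e r a b
  proof (induction "nat n" arbitrary: n c e r a b rule: less_induct)
    case less
    interpret pebbled n c e r
      by (rule less.prems(1))
    have "linear_below n"
      unfolding linear_below_def
    proof (intro allI impI)
      fix n' c' e' r' a' b'
      assume *: "n' < n" "pebbled n' c' e' r'" "digits n' a'" "digits n' b'"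
      have "nat n' < nat n"
        using *(1) n_pos by simp
      then show "c' True (pebbled.gap n' e' True a' b') = c' False (pebbled.gap n' e' False a' b')"
        by (rule less.hyps[OF _ *(2-4)])
    qed
    then show ?case
      using gap_colour_step less.prems(2,3) by blast
  qed
  then show ?thesis
    unfolding linear_below_def by blast
qed

theorem pebbled_linear:
  assumes "pebbled n c e r" and "digits n a" and "digits n b"
  shows "c True (digit_val n (e True) a - digit_val n (e True) b) =
    c False (digit_val n (e False) a - digit_val n (e False) b)"
  by (rule linear_belowD[OF linear_below _ assms, of "n + 1"]) simp

section \<open>Weisfeiler-Leman colours\<close>

lemma image_mset_eq_bij:
  assumes "finite A" and "finite B" and "image_mset f (mset_set A) = image_mset g (mset_set B)"
  obtains \<pi> where "bij_betw \<pi> A B" and "\<And>x. x \<in> A \<Longrightarrow> f x = g (\<pi> x)"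
proof -
  have "\<exists>\<pi>. bij_betw \<pi> A B \<and> (\<forall>x \<in> A. f x = g (\<pi> x))"
    using assms
  proof (induction A arbitrary: B rule: finite_induct)
    case empty
    then show ?case
      by (auto simp: mset_set_empty_iff bij_betw_def)
  next
    case (insert a A)
    have "f a \<in># image_mset g (mset_set B)"
      unfolding insert.prems(2)[symmetric] using insert.hyps by simp
    then obtain b where b: "b \<in> B" "g b = f a"
      using insert.prems(1) by auto
    have B: "B = insert b (B - {b})"
      using b(1) by blast
    have "mset_set B = add_mset b (mset_set (B - {b}))"
      using insert.prems(1) b(1) by (simp add: mset_set.remove)
    then have "image_mset f (mset_set A) = image_mset g (mset_set (B - {b}))"
      using insert.prems(2) insert.hyps b(2) by simp
    then obtain \<pi> where \<pi>: "bij_betw \<pi> A (B - {b})" "\<forall>x \<in> A. f x = g (\<pi> x)"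
      using insert.IH[of "B - {b}"] insert.prems(1) by auto
    have "bij_betw (\<pi>(a := b)) (insert a A) B"
    proof (rule bij_betw_imageI)
      show "inj_on (\<pi>(a := b)) (insert a A)"
        using \<pi>(1) insert.hyps(2) by (auto simp: bij_betw_def inj_on_def)
      show "(\<pi>(a := b)) ` insert a A = B"
        using \<pi>(1) insert.hyps(2) B by (auto simp: bij_betw_def)
    qed
    moreover have "\<forall>x \<in> insert a A. f x = g ((\<pi>(a := b)) x)"
      using \<pi>(2) b(2) insert.hyps(2) by auto
    ultimately show ?case
      by blast
  qed
  then show ?thesis
    using that by blast
qed

lemma image_mset_eq_bijI:
  assumes "bij_betw \<pi> A B" and "\<And>x. x \<in> A \<Longrightarrow> f x = g (\<pi> x)"
  shows "image_mset f (mset_set A) = image_mset g (mset_set B)"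
proof -
  have "mset_set B = image_mset \<pi> (mset_set A)"
    using image_mset_mset_set[OF bij_betw_imp_inj_on[OF assms(1)]] bij_betw_imp_surj_on[OF assms(1)] by simp
  moreover have "image_mset f (mset_set A) = image_mset (\<lambda>x. g (\<pi> x)) (mset_set A)"
    by (rule image_mset_cong) (metis assms(2) elem_mset_set infinite_set_mset_mset_set empty_iff)
  ultimately show ?thesis
    by (simp add: multiset.map_comp comp_def)
qed

lemma atomic_type_eq_iff:
  "atomic_type X xs = atomic_type Y ys \<longleftrightarrow> length xs = length ys \<and>
    (\<forall>i < length xs. \<forall>j < length xs. (xs ! i = xs ! j \<longleftrightarrow> ys ! i = ys ! j) \<and>
      ((xs ! i, xs ! j) \<in> parcs X \<longleftrightarrow> (ys ! i, ys ! j) \<in> parcs Y))" (is "?L \<longleftrightarrow> ?R")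
proof
  assume L: ?L
  have "{..<length xs} = {i. (i, i) \<in> fst (atomic_type X xs)}" for X :: "'c pair_pre_digraph" and xs
    by (auto simp: atomic_type_def)
  from this[of xs X] this[of xs X] have "{..<length xs} = {i. (i, i) \<in> fst (atomic_type Y ys)}"
    unfolding L by simp
  also have "\<dots> = {..<length ys}"
    by (auto simp: atomic_type_def)
  finally have len: "length xs = length ys"
    by simp
  have "(i, j) \<in> fst (atomic_type X xs) \<longleftrightarrow> (i, j) \<in> fst (atomic_type Y ys)"
      and "(i, j) \<in> snd (atomic_type X xs) \<longleftrightarrow> (i, j) \<in> snd (atomic_type Y ys)" for i j
    by (simp_all only: L)
  then show ?R
    using len by (auto simp: atomic_type_def)
next
  assume ?R
  then show ?L
    by (auto simp: atomic_type_def)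
qed

lemma atomic_type_reindex:
  assumes "atomic_type X xs = atomic_type Y ys" and "set R \<subseteq> {..<length xs}"
  shows "atomic_type X (map ((!) xs) R) = atomic_type Y (map ((!) ys) R)"
proof -
  have "R ! i < length xs" if "i < length R" for i
    using assms(2) nth_mem[OF that] by auto
  then show ?thesis
    using assms(1) unfolding atomic_type_eq_iff by simp
qed

lemma wl_round_atomic:
  "wl_round X r xs = wl_round Y r ys \<Longrightarrow> atomic_type X xs = atomic_type Y ys"
  by (induction r) auto

lemma wl_round_mono:
  "wl_round X r' xs = wl_round Y r' ys \<Longrightarrow> r \<le> r' \<Longrightarrow> wl_round X r xs = wl_round Y r ys"
  by (induction r' arbitrary: r) (auto simp: le_Suc_eq)

lemma wl_round_SucD:
  assumes "finite (pverts X)" and "finite (pverts Y)" and "wl_round X (Suc r) xs = wl_round Y (Suc r) ys"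
  obtains \<pi> where "bij_betw \<pi> (pverts X) (pverts Y)"
    and "\<And>y. y \<in> pverts X \<Longrightarrow> atomic_type X (xs @ [y]) = atomic_type Y (ys @ [\<pi> y])"
    and "\<And>y i. y \<in> pverts X \<Longrightarrow> i < length xs \<Longrightarrow> wl_round X r (xs[i := y]) = wl_round Y r (ys[i := \<pi> y])"
proof -
  have "length xs = length ys"
    using wl_round_atomic[OF assms(3)] unfolding atomic_type_eq_iff by blast
  obtain \<pi> where "bij_betw \<pi> (pverts X) (pverts Y)" and \<pi>: "\<And>y. y \<in> pverts X \<Longrightarrow>
      (atomic_type X (xs @ [y]), map (\<lambda>i. wl_round X r (xs[i := y])) [0..<length xs]) =
      (atomic_type Y (ys @ [\<pi> y]), map (\<lambda>i. wl_round Y r (ys[i := \<pi> y])) [0..<length ys])"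
    by (rule image_mset_eq_bij[OF assms(1,2)]) (use assms(3) in auto)
  show ?thesis
  proof (rule that[OF \<open>bij_betw \<pi> (pverts X) (pverts Y)\<close>])
    fix y assume y: "y \<in> pverts X"
    show "atomic_type X (xs @ [y]) = atomic_type Y (ys @ [\<pi> y])"
      using \<pi>[OF y] by simp
    show "wl_round X r (xs[i := y]) = wl_round Y r (ys[i := \<pi> y])" if "i < length xs" for i
      using \<pi>[OF y] \<open>length xs = length ys\<close> that by (auto simp: map_eq_conv)
  qed
qed

lemma wl_round_SucI:
  assumes "wl_round X r xs = wl_round Y r ys" and "bij_betw \<pi> (pverts X) (pverts Y)"
    and "\<And>y. y \<in> pverts X \<Longrightarrow> atomic_type X (xs @ [y]) = atomic_type Y (ys @ [\<pi> y])"
    and "\<And>y i. y \<in> pverts X \<Longrightarrow> i < length xs \<Longrightarrow> wl_round X r (xs[i := y]) = wl_round Y r (ys[i := \<pi> y])"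
  shows "wl_round X (Suc r) xs = wl_round Y (Suc r) ys"
proof -
  have "length xs = length ys"
    using wl_round_atomic[OF assms(1)] unfolding atomic_type_eq_iff by blast
  then have "image_mset (\<lambda>y. (atomic_type X (xs @ [y]), map (\<lambda>i. wl_round X r (xs[i := y])) [0..<length xs])) (mset_set (pverts X)) =
      image_mset (\<lambda>y. (atomic_type Y (ys @ [y]), map (\<lambda>i. wl_round Y r (ys[i := y])) [0..<length ys])) (mset_set (pverts Y))"
    using assms(3,4) by (intro image_mset_eq_bijI[OF assms(2)]) auto
  then show ?thesis
    using assms(1) by simp
qed

lemma map_nth_append: "set R \<subseteq> {..<length xs} \<Longrightarrow> map ((!) (xs @ zs)) R = map ((!) xs) R"
  by (auto simp: nth_append)

text \<open>Repetitions in \<open>R\<close> are allowed, so the colour of an \<open>m\<close>-tuple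
  determines the colour of each pair of its entries, padded to length \<open>m\<close>.\<close>

lemma wl_round_reindex:
  assumes fin: "finite (pverts X)" "finite (pverts Y)"
    and "wl_round X r xs = wl_round Y r ys" and "set R \<subseteq> {..<length xs}" and "length R = length xs"
  shows "wl_round X r (map ((!) xs) R) = wl_round Y r (map ((!) ys) R)"
  using assms(3-5)
proof (induction r arbitrary: xs ys R)
  case 0
  then show ?case
    using atomic_type_reindex[of X xs Y ys R] by simp
next
  case (Suc r)
  have len: "length xs = length ys"
    using wl_round_atomic[OF Suc.prems(1)] unfolding atomic_type_eq_iff by blast
  obtain \<pi> where \<pi>: "bij_betw \<pi> (pverts X) (pverts Y)"
      "\<And>y. y \<in> pverts X \<Longrightarrow> atomic_type X (xs @ [y]) = atomic_type Y (ys @ [\<pi> y])"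
      "\<And>y i. y \<in> pverts X \<Longrightarrow> i < length xs \<Longrightarrow> wl_round X r (xs[i := y]) = wl_round Y r (ys[i := \<pi> y])"
    using wl_round_SucD[OF fin Suc.prems(1)] by metis
  show ?case
  proof (rule wl_round_SucI[OF _ \<pi>(1)])
    show "wl_round X r (map ((!) xs) R) = wl_round Y r (map ((!) ys) R)"
      by (rule Suc.IH[OF _ Suc.prems(2,3)]) (use Suc.prems(1) in simp)
  next
    fix y assume y: "y \<in> pverts X"
    have "set (R @ [length xs]) \<subseteq> {..<length (xs @ [y])}"
      using Suc.prems(2) by auto
    from atomic_type_reindex[OF \<pi>(2)[OF y] this]
    show "atomic_type X (map ((!) xs) R @ [y]) = atomic_type Y (map ((!) ys) R @ [\<pi> y])"
      using Suc.prems(2) len by (simp add: map_nth_append nth_append)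
  next
    fix y i assume y: "y \<in> pverts X" and i: "i < length (map ((!) xs) R)"
    \<comment> \<open>An index that \<open>R\<close> takes at most in position \<open>i\<close> holds the moved pebble.\<close>
    have "card ((!) R ` ({..<length xs} - {i})) \<le> card ({..<length xs} - {i})"
      by (rule card_image_le) simp
    also have "\<dots> < card {..<length xs}"
      using i Suc.prems(3) by (intro psubset_card_mono) auto
    finally have "\<not> {..<length xs} \<subseteq> (!) R ` ({..<length xs} - {i})"
      using card_mono[of "(!) R ` ({..<length xs} - {i})" "{..<length xs}"] by auto
    then obtain b where b: "b < length xs" "\<And>j. j < length xs \<Longrightarrow> j \<noteq> i \<Longrightarrow> R ! j \<noteq> b"
      by blast
    have R: "R ! j < length xs" if "j < length xs" for j
    proof -
      have "R ! j \<in> set R"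
        using that Suc.prems(3) by simp
      then show ?thesis
        using Suc.prems(2) by blast
    qed
    have upd_X: "(map ((!) xs) R)[i := y] = map ((!) (xs[b := y])) (R[i := b])"
      using b R i Suc.prems(3) by (intro nth_equalityI) (auto simp: nth_list_update)
    have upd_Y: "(map ((!) ys) R)[i := \<pi> y] = map ((!) (ys[b := \<pi> y])) (R[i := b])"
      using b R i Suc.prems(3) len by (intro nth_equalityI) (auto simp: nth_list_update)
    show "wl_round X r ((map ((!) xs) R)[i := y]) = wl_round Y r ((map ((!) ys) R)[i := \<pi> y])"
      unfolding upd_X upd_Y
    proof (rule Suc.IH[OF \<pi>(3)[OF y b(1)]])
      show "set (R[i := b]) \<subseteq> {..<length (xs[b := y])}"
        using Suc.prems(2) b(1) set_update_subset_insert[of R i b] by auto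
    qed (use Suc.prems(3) in simp)
  qed
qed

lemma wl_round_iso:
  assumes bij: "bij_betw \<phi> (pverts X) (pverts Y)"
    and arcs: "\<And>x y. x \<in> pverts X \<Longrightarrow> y \<in> pverts X \<Longrightarrow> (x, y) \<in> parcs X \<longleftrightarrow> (\<phi> x, \<phi> y) \<in> parcs Y"
    and "set xs \<subseteq> pverts X"
  shows "wl_round X r xs = wl_round Y r (map \<phi> xs)"
  using assms(3)
proof (induction r arbitrary: xs)
  have atomic: "atomic_type X xs = atomic_type Y (map \<phi> xs)" if "set xs \<subseteq> pverts X" for xs
  proof -
    have "xs ! i \<in> pverts X" if "i < length xs" for i
      using \<open>set xs \<subseteq> pverts X\<close> nth_mem[OF that] by blast
    then show ?thesis
      using arcs inj_on_eq_iff[OF bij_betw_imp_inj_on[OF bij]] unfolding atomic_type_eq_iff by simp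
  qed
  {
    case 0
    then show ?case
      using atomic by simp
  next
    case (Suc r)
    show ?case
    proof (rule wl_round_SucI[OF Suc.IH[OF Suc.prems] bij])
      show "atomic_type X (xs @ [y]) = atomic_type Y (map \<phi> xs @ [\<phi> y])" if "y \<in> pverts X" for y
        using atomic[of "xs @ [y]"] that Suc.prems by simp
      show "wl_round X r (xs[i := y]) = wl_round Y r ((map \<phi> xs)[i := \<phi> y])" if "y \<in> pverts X" for y i
        using Suc.IH[of "xs[i := y]"] that Suc.prems set_update_subset_insert[of xs i y] by (auto simp: map_update)
    qed
  }
qed

lemma wl_colouring_eq_iff: "wl_colouring X xs = wl_colouring Y ys \<longleftrightarrow> (\<forall>r. wl_round X r xs = wl_round Y r ys)"
  by (auto simp: wl_colouring_def fun_eq_iff)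

text \<open>Some bijection serves infinitely many rounds, hence all of them.\<close>

lemma wl_colouring_bij:
  assumes fin: "finite (pverts X)" "finite (pverts Y)" and eq: "wl_colouring X xs = wl_colouring Y ys"
  obtains \<pi> where "bij_betw \<pi> (pverts X) (pverts Y)"
    and "\<And>y i. y \<in> pverts X \<Longrightarrow> i < length xs \<Longrightarrow> wl_colouring X (xs[i := y]) = wl_colouring Y (ys[i := \<pi> y])"
proof -
  have "\<forall>r. \<exists>\<pi>. \<pi> \<in> pverts X \<rightarrow>\<^sub>E pverts Y \<and> bij_betw \<pi> (pverts X) (pverts Y) \<and>
      (\<forall>y \<in> pverts X. \<forall>i < length xs. wl_round X r (xs[i := y]) = wl_round Y r (ys[i := \<pi> y]))"
  proof
    fix r
    have "wl_round X (Suc r) xs = wl_round Y (Suc r) ys"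
      using eq wl_colouring_eq_iff by blast
    then obtain \<pi> where \<pi>: "bij_betw \<pi> (pverts X) (pverts Y)"
        "\<And>y i. y \<in> pverts X \<Longrightarrow> i < length xs \<Longrightarrow> wl_round X r (xs[i := y]) = wl_round Y r (ys[i := \<pi> y])"
      using wl_round_SucD[OF fin] by metis
    have "bij_betw (restrict \<pi> (pverts X)) (pverts X) (pverts Y)"
      using \<pi>(1) by (subst bij_betw_cong[of _ _ \<pi>]) auto
    moreover have "restrict \<pi> (pverts X) \<in> pverts X \<rightarrow>\<^sub>E pverts Y"
      using bij_betwE[OF \<pi>(1)] by auto
    ultimately show "\<exists>\<pi>. \<pi> \<in> pverts X \<rightarrow>\<^sub>E pverts Y \<and> bij_betw \<pi> (pverts X) (pverts Y) \<and>
        (\<forall>y \<in> pverts X. \<forall>i < length xs. wl_round X r (xs[i := y]) = wl_round Y r (ys[i := \<pi> y]))"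
      using \<pi>(2) by (intro exI[of _ "restrict \<pi> (pverts X)"]) auto
  qed
  from choice[OF this] obtain P where P: "\<And>r. P r \<in> pverts X \<rightarrow>\<^sub>E pverts Y" "\<And>r. bij_betw (P r) (pverts X) (pverts Y)"
      "\<And>r y i. y \<in> pverts X \<Longrightarrow> i < length xs \<Longrightarrow> wl_round X r (xs[i := y]) = wl_round Y r (ys[i := P r y])"
    by blast
  have "finite (range P)"
    by (rule finite_subset[OF _ finite_PiE[OF fin(1), of "\<lambda>_. pverts Y"]]) (use P(1) fin(2) in auto)
  then obtain r0 where inf: "infinite {r. P r = P r0}"
    using pigeonhole_infinite[of "UNIV :: nat set" P] by auto
  show ?thesis
  proof (rule that[OF P(2)[of r0]])
    fix y i assume y: "y \<in> pverts X" and i: "i < length xs"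
    have "wl_round X r (xs[i := y]) = wl_round Y r (ys[i := P r0 y])" for r
    proof -
      obtain r' where r': "r' \<ge> r" "P r' = P r0"
        using inf unfolding infinite_nat_iff_unbounded_le by blast
      show ?thesis
        using wl_round_mono[OF P(3)[OF y i, of r'] r'(1)] r'(2) by simp
    qed
    then show "wl_colouring X (xs[i := y]) = wl_colouring Y (ys[i := P r0 y])"
      unfolding wl_colouring_eq_iff by blast
  qed
qed

section \<open>The Schur rings of two equivalent graphs\<close>

definition residue_graph :: "int \<Rightarrow> (int \<Rightarrow> bool) \<Rightarrow> int pair_pre_digraph" where
  "residue_graph n D = \<lparr> pverts = {0..<n}, parcs = {(i, j). i \<in> {0..<n} \<and> j \<in> {0..<n} \<and> D ((j - i) mod n)} \<rparr>"

lemma pverts_residue_graph [simp]: "pverts (residue_graph n D) = {0..<n}"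
  and parcs_residue_graph [simp]: "(i, j) \<in> parcs (residue_graph n D) \<longleftrightarrow>
    i \<in> {0..<n} \<and> j \<in> {0..<n} \<and> D ((j - i) mod n)"
  by (simp_all add: residue_graph_def)

locale wl_pair =
  fixes n :: int and m :: nat and D :: "bool \<Rightarrow> int \<Rightarrow> bool"
  assumes n_pos: "n > 0" and m3: "m \<ge> 3"
    and equivalent: "wl_equivalent m (residue_graph n (D True)) (residue_graph n (D False))"
begin

text \<open>Entries are arbitrary integers reduced on the way, so tuples can be translated and
  subtracted without leaving the domain.\<close>

definition w :: "bool \<Rightarrow> int list \<Rightarrow> nat \<Rightarrow> wl_colour" where
  "w s xs = wl_colouring (residue_graph n (D s)) (map (\<lambda>x. x mod n) xs)"

lemma w_cong:
  assumes "length xs = length ys" and "\<And>i. i < length xs \<Longrightarrow> n dvd xs ! i - ys ! i"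
  shows "w s xs = w s ys"
proof -
  have "map (\<lambda>x. x mod n) xs = map (\<lambda>x. x mod n) ys"
    using assms by (intro nth_equalityI) (auto simp: mod_eq_dvd_iff)
  then show ?thesis
    by (simp add: w_def)
qed

lemma w_shift: "w s (map (\<lambda>x. x + k) xs) = w s xs"
proof -
  let ?f = "\<lambda>x. (x + k) mod n"
  have bij: "bij_betw ?f {0..<n} {0..<n}"
  proof (rule bij_betw_byWitness[where f' = "\<lambda>x. (x - k) mod n"])
    show "\<forall>a \<in> {0..<n}. ((a + k) mod n - k) mod n = a"
      by (auto simp: mod_diff_left_eq)
    show "\<forall>a \<in> {0..<n}. ((a - k) mod n + k) mod n = a"
      by (auto simp: mod_add_left_eq)
  qed (use n_pos in auto)
  have arcs: "(x, y) \<in> parcs (residue_graph n (D s)) \<longleftrightarrow> (?f x, ?f y) \<in> parcs (residue_graph n (D s))"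
    if "x \<in> {0..<n}" "y \<in> {0..<n}" for x y
  proof -
    have "(?f y - ?f x) mod n = (y - x) mod n"
      by (simp add: mod_diff_eq)
    moreover have "?f x \<in> {0..<n}" "?f y \<in> {0..<n}"
      using n_pos by simp_all
    ultimately show ?thesis
      using that unfolding parcs_residue_graph by (simp only: simp_thms)
  qed
  have round: "wl_round (residue_graph n (D s)) r (map (\<lambda>x. x mod n) xs) =
      wl_round (residue_graph n (D s)) r (map ?f (map (\<lambda>x. x mod n) xs))" for r
  proof (rule wl_round_iso)
    show "bij_betw ?f (pverts (residue_graph n (D s))) (pverts (residue_graph n (D s)))"
      using bij by simp
    show "set (map (\<lambda>x. x mod n) xs) \<subseteq> pverts (residue_graph n (D s))"
      using n_pos by auto
  qed (use arcs in \<open>simp only: pverts_residue_graph\<close>)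
  have map_eq: "map ?f (map (\<lambda>x. x mod n) xs) = map (\<lambda>x. x mod n) (map (\<lambda>x. x + k) xs)"
    by (simp add: mod_add_left_eq)
  show ?thesis
    unfolding w_def wl_colouring_eq_iff using round[symmetric] unfolding map_eq by blast
qed

lemma w_atomic:
  assumes "w s xs = w s' ys"
  shows "length xs = length ys"
    and "i < length xs \<Longrightarrow> j < length xs \<Longrightarrow> n dvd xs ! i - xs ! j \<longleftrightarrow> n dvd ys ! i - ys ! j"
    and "i < length xs \<Longrightarrow> j < length xs \<Longrightarrow> D s ((xs ! j - xs ! i) mod n) \<longleftrightarrow> D s' ((ys ! j - ys ! i) mod n)"
proof -
  have "atomic_type (residue_graph n (D s)) (map (\<lambda>x. x mod n) xs) =
      atomic_type (residue_graph n (D s')) (map (\<lambda>x. x mod n) ys)"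
    using assms wl_round_atomic[where r = 0] unfolding w_def wl_colouring_eq_iff by blast
  note * = this[unfolded atomic_type_eq_iff]
  then show len: "length xs = length ys"
    by simp
  assume ij: "i < length xs" "j < length xs"
  show "n dvd xs ! i - xs ! j \<longleftrightarrow> n dvd ys ! i - ys ! j"
    using * ij len by (simp add: mod_eq_dvd_iff)
  show "D s ((xs ! j - xs ! i) mod n) \<longleftrightarrow> D s' ((ys ! j - ys ! i) mod n)"
    using * ij len n_pos by (simp add: mod_diff_eq)
qed

lemma w_reindex:
  assumes "w s xs = w s' ys" and "set R \<subseteq> {..<length xs}" and "length R = length xs"
  shows "w s (map ((!) xs) R) = w s' (map ((!) ys) R)"
proof -
  have len: "length xs = length ys"
    by (rule w_atomic(1)[OF assms(1)])
  have map_eq: "map (\<lambda>x. x mod n) (map ((!) zs) R) = map ((!) (map (\<lambda>x. x mod n) zs)) R" if "length zs = length xs" for zs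
    using assms(2) that by (auto simp: subset_iff)
  have "wl_round (residue_graph n (D s)) r (map ((!) (map (\<lambda>x. x mod n) xs)) R) =
      wl_round (residue_graph n (D s')) r (map ((!) (map (\<lambda>x. x mod n) ys)) R)" for r
    by (rule wl_round_reindex) (use assms in \<open>auto simp: w_def wl_colouring_eq_iff\<close>)
  then show ?thesis
    unfolding w_def wl_colouring_eq_iff map_eq[OF refl] map_eq[OF len[symmetric]] by blast
qed

lemma w_move:
  assumes "w s xs = w s' ys"
  obtains \<pi> where "\<And>y y'. n dvd \<pi> y - \<pi> y' \<Longrightarrow> n dvd y - y'"
    and "\<And>y i. i < length xs \<Longrightarrow> w s (xs[i := y]) = w s' (ys[i := \<pi> y])"
proof -
  obtain \<pi> where \<pi>: "bij_betw \<pi> {0..<n} {0..<n}"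
      "\<And>y i. y \<in> {0..<n} \<Longrightarrow> i < length xs \<Longrightarrow>
        wl_colouring (residue_graph n (D s)) ((map (\<lambda>x. x mod n) xs)[i := y]) =
        wl_colouring (residue_graph n (D s')) ((map (\<lambda>x. x mod n) ys)[i := \<pi> y])"
    using wl_colouring_bij[OF _ _ assms[unfolded w_def]] by auto
  have mod: "y mod n \<in> {0..<n}" for y
    using n_pos by simp
  have \<pi>_mod: "\<pi> (y mod n) mod n = \<pi> (y mod n)" for y
    using bij_betwE[OF \<pi>(1)] mod[of y] by auto
  show ?thesis
  proof (rule that[of "\<lambda>y. \<pi> (y mod n)"])
    show "n dvd y - y'" if "n dvd \<pi> (y mod n) - \<pi> (y' mod n)" for y y'
    proof -
      have "\<pi> (y mod n) = \<pi> (y' mod n)"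
        using that \<pi>_mod by (metis mod_eq_dvd_iff)
      then have "y mod n = y' mod n"
        using inj_on_eq_iff[OF bij_betw_imp_inj_on[OF \<pi>(1)] mod mod] by blast
      then show ?thesis
        by (simp add: mod_eq_dvd_iff)
    qed
    show "w s (xs[i := y]) = w s' (ys[i := \<pi> (y mod n)])" if "i < length xs" for y i
      using \<pi>(2)[OF mod that, of y] by (simp add: w_def map_update \<pi>_mod)
  qed
qed

lemma w_match:
  assumes "length xs = m"
  obtains ys where "length ys = m" and "w s' ys = w s xs"
proof -
  let ?C = "\<lambda>s. residue_graph n (D s)"
  have fin: "finite (tuples m (?C s))" for s
    using finite_lists_length_eq[of "{0..<n}" m] by (simp add: tuples_def conj_commute)
  have "image_mset (wl_colouring (?C s)) (mset_set (tuples m (?C s))) =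
      image_mset (wl_colouring (?C s')) (mset_set (tuples m (?C s')))"
    using equivalent unfolding wl_equivalent_def by (cases s; cases s') simp_all
  from arg_cong[OF this, of set_mset]
  have "wl_colouring (?C s) ` tuples m (?C s) = wl_colouring (?C s') ` tuples m (?C s')"
    using fin by simp
  moreover have "map (\<lambda>x. x mod n) xs \<in> tuples m (?C s)"
    using assms n_pos by (auto simp: tuples_def)
  ultimately obtain ys where ys: "ys \<in> tuples m (?C s')"
      "wl_colouring (?C s) (map (\<lambda>x. x mod n) xs) = wl_colouring (?C s') ys"
    by blast
  have "map (\<lambda>x. x mod n) ys = ys"
    using ys(1) by (intro map_idI) (auto simp: tuples_def)
  then show ?thesis
    using that[of ys] ys by (auto simp: tuples_def w_def)
qed

lemma w_match_zero:
  assumes "length xs = m" and "xs ! 0 = 0"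
  obtains ys where "length ys = m" and "ys ! 0 = 0" and "w s' ys = w s xs"
proof -
  obtain ys where ys: "length ys = m" "w s' ys = w s xs"
    by (rule w_match[OF assms(1)])
  show ?thesis
    by (rule that[of "map (\<lambda>x. x + - ys ! 0) ys"]) (use ys m3 w_shift[of s' "- ys ! 0" ys] in auto)
qed

definition pair_colour :: "bool \<Rightarrow> int \<Rightarrow> nat \<Rightarrow> wl_colour" where
  "pair_colour s x = w s (0 # replicate (m - 1) x)"

text \<open>Reindexing extracts the pair of entries, and translation, an automorphism of a residue
  graph, moves its first entry to 0.\<close>

lemma pair_colour_diff:
  assumes "w s xs = w s' ys" and "length xs = m" and "i < m" and "j < m"
  shows "pair_colour s (xs ! j - xs ! i) = pair_colour s' (ys ! j - ys ! i)"
proof -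
  have "w s (map ((!) xs) (i # replicate (m - 1) j)) = w s' (map ((!) ys) (i # replicate (m - 1) j))"
    by (rule w_reindex[OF assms(1)]) (use assms(2-4) m3 in auto)
  moreover have "pair_colour s (zs ! j - zs ! i) = w s (map ((!) zs) (i # replicate (m - 1) j))" for s zs
    using w_shift[of s "- zs ! i" "map ((!) zs) (i # replicate (m - 1) j)"]
    by (simp add: pair_colour_def comp_def)
  ultimately show ?thesis
    by simp
qed

lemma pair_colour_cong: "n dvd x - y \<Longrightarrow> pair_colour s x = pair_colour s y"
  unfolding pair_colour_def by (rule w_cong) (auto simp: nth_Cons')

lemma pair_colour_arc: "pair_colour s x = pair_colour s' y \<Longrightarrow> D s (x mod n) \<longleftrightarrow> D s' (y mod n)"
  using w_atomic(3)[of s "0 # replicate (m - 1) x" s' "0 # replicate (m - 1) y" 0 1] m3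
  by (simp add: pair_colour_def)

lemma finite_pair_colours: "finite (range (case_prod pair_colour))"
proof (rule finite_subset)
  show "range (case_prod pair_colour) \<subseteq> case_prod pair_colour ` (UNIV \<times> {0..<n})"
  proof
    fix z assume "z \<in> range (case_prod pair_colour)"
    then obtain s x where "z = pair_colour s x"
      by auto
    also have "\<dots> = pair_colour s (x mod n)"
      by (rule pair_colour_cong) (simp add: mod_eq_dvd_iff[symmetric])
    finally show "z \<in> case_prod pair_colour ` (UNIV \<times> {0..<n})"
      using n_pos by (intro image_eqI[of _ _ "(s, x mod n)"]) auto
  qed
qed simp

text \<open>\<open>sring\<close> takes colours in \<open>nat\<close>; only finitely many colours of
  pairs occur, so an injection exists.\<close>

definition code :: "(nat \<Rightarrow> wl_colour) \<Rightarrow> nat" where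
  "code = (SOME f. inj_on f (range (case_prod pair_colour)))"

definition col :: "bool \<Rightarrow> int \<Rightarrow> nat" where
  "col s x = code (pair_colour s x)"

lemma col_eq_iff: "col s x = col s' y \<longleftrightarrow> pair_colour s x = pair_colour s' y"
proof -
  have "inj_on code (range (case_prod pair_colour))"
    unfolding code_def using finite_imp_inj_to_nat_seg[OF finite_pair_colours] by (metis someI_ex)
  then show ?thesis
    unfolding col_def by (intro inj_on_eq_iff) auto
qed

text \<open>One refinement step at the third entry of (0, x, x, ...): the bijection of new entries
  respects the colours of \<open>z\<close> and of \<open>z - x\<close>. Equality follows by
  exchanging the roles.\<close>

lemma col_str:
  assumes "col s x = col s' x'"
  shows "cnt n (\<lambda>z. col s z = \<alpha> \<and> col s (z - x) = \<beta>) \<le> cnt n (\<lambda>z. col s' z = \<alpha> \<and> col s' (z - x') = \<beta>)"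
proof -
  let ?t = "\<lambda>x. (0::int) # replicate (m - 1) x"
  have "w s (?t x) = w s' (?t x')"
    using assms unfolding col_eq_iff pair_colour_def .
  then obtain \<pi> where \<pi>: "\<And>y y'. n dvd \<pi> y - \<pi> y' \<Longrightarrow> n dvd y - y'"
      "\<And>y i. i < length (?t x) \<Longrightarrow> w s ((?t x)[i := y]) = w s' ((?t x')[i := \<pi> y])"
    by (rule w_move) blast
  have len: "length (?t x) = m"
    using m3 by simp
  show ?thesis
  proof (rule cnt_inj_le[where f = \<pi>])
    show "per n (\<lambda>z. col s' z = \<alpha> \<and> col s' (z - x') = \<beta>)"
      unfolding per_def
    proof (intro allI impI)
      fix y z assume yz: "n dvd y - z"
      then have "n dvd (y - x') - (z - x')"
        by simp
      then show "(col s' y = \<alpha> \<and> col s' (y - x') = \<beta>) = (col s' z = \<alpha> \<and> col s' (z - x') = \<beta>)"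
        using pair_colour_cong[OF yz, of s'] pair_colour_cong[of "y - x'" "z - x'" s'] by (simp add: col_def)
    qed
    show "col s' (\<pi> z) = \<alpha> \<and> col s' (\<pi> z - x') = \<beta>" if "col s z = \<alpha> \<and> col s (z - x) = \<beta>" for z
    proof -
      have eq: "w s ((?t x)[2 := z]) = w s' ((?t x')[2 := \<pi> z])"
        by (rule \<pi>(2)) (use len m3 in simp)
      have nth: "(?t y)[2 := v] ! 0 = 0" "(?t y)[2 := v] ! 1 = y" "(?t y)[2 := v] ! 2 = v" for y v
        using m3 by (simp_all add: nth_list_update nth_Cons')
      have "pair_colour s z = pair_colour s' (\<pi> z)" "pair_colour s (z - x) = pair_colour s' (\<pi> z - x')"
        using pair_colour_diff[OF eq, of 0 2] pair_colour_diff[OF eq, of 1 2] m3 unfolding nth by simp_all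
      then show ?thesis
        using that col_eq_iff by metis
    qed
  qed (use \<pi>(1) n_pos in auto)
qed

sublocale sring n col
proof unfold_locales
  show "n > 0"
    by (rule n_pos)
  show "n dvd x - y \<Longrightarrow> col s x = col s y" for s x y
    unfolding col_eq_iff by (rule pair_colour_cong)
  show onto: "\<exists>x'. col s' x' = col s x" for s s' x
  proof -
    let ?t = "(0::int) # replicate (m - 1) x"
    obtain ys where ys: "length ys = m" "ys ! 0 = 0" "w s' ys = w s ?t"
      by (rule w_match_zero[of ?t]) (use m3 in auto)
    have "pair_colour s' (ys ! 1) = pair_colour s x"
      using pair_colour_diff[OF ys(3,1), of 0 1] ys(2) m3 by simp
    then show ?thesis
      unfolding col_eq_iff by blast
  qed
  have atomic: "n dvd x \<longleftrightarrow> n dvd y" if "col s x = col s' y" for s s' x y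
    using w_atomic(2)[OF that[unfolded col_eq_iff pair_colour_def], of 1 0] m3 by simp
  show "col s x = col s' 0 \<longleftrightarrow> n dvd x" for s s' x
  proof
    show "n dvd x" if "col s x = col s' 0"
      using atomic[OF that] by simp
    show "col s x = col s' 0" if x: "n dvd x"
    proof -
      obtain y where y: "col s' y = col s x"
        using onto by blast
      then have "n dvd y - 0"
        using atomic[OF y] x by simp
      then show ?thesis
        using y pair_colour_cong[of y 0 s'] unfolding col_eq_iff by metis
    qed
  qed
  show "col s (- x) = col s' (- x')" if "col s x = col s' x'" for s s' x x'
    using pair_colour_diff[OF that[unfolded col_eq_iff pair_colour_def], of 1 0] m3
    unfolding col_eq_iff by simp
  show "cnt n (\<lambda>z. col s z = \<alpha> \<and> col s (z - x) = \<beta>) = cnt n (\<lambda>z. col s' z = \<alpha> \<and> col s' (z - x') = \<beta>)"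
    if "col s x = col s' x'" for s s' x x' \<alpha> \<beta>
    by (rule antisym) (rule col_str, use that in simp)+
qed

end

section \<open>Counting digits and placing pebbles\<close>

lemma digit_index_image:
  assumes "k > 0"
  shows "digit_index (int k) = (\<lambda>(p, j). (int p, j)) ` (SIGMA p:prime_factors k. {1..multiplicity p k})"
    (is "_ = ?f ` ?S")
proof (intro equalityI subsetI)
  fix z assume "z \<in> digit_index (int k)"
  then obtain p j where pj: "z = (p, j)" "(p, j) \<in> digit_index (int k)"
    by (cases z) auto
  note d = digit_indexD[OF pj(2)]
  define p' where "p' = nat p"
  have p': "p = int p'" "prime p'"
    using d(1) prime_gt_0_int[OF d(1)] iffD1[OF prime_int_nat_transfer d(1)] by (auto simp: p'_def)
  have "p' ^ j dvd k"
    using d(3) unfolding p'(1) of_nat_power[symmetric] of_nat_dvd_iff .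
  then have "j \<le> multiplicity p' k"
    using assms p'(2) by (intro multiplicity_geI) auto
  moreover have "p' \<in> prime_factors k"
    using d(4) p' assms by (auto simp: prime_factors_dvd)
  ultimately have "(p', j) \<in> ?S"
    using d(2) by auto
  then show "z \<in> ?f ` ?S"
    unfolding pj(1) p'(1) by (rule rev_image_eqI) simp
next
  fix z assume "z \<in> ?f ` ?S"
  then obtain p j where pj: "z = (int p, j)" "p \<in> prime_factors k" "1 \<le> j" "j \<le> multiplicity p k"
    by auto
  have "p ^ j dvd k"
    using pj(4) by (rule multiplicity_dvd')
  then have "int p ^ j dvd int k"
    unfolding of_nat_power[symmetric] of_nat_dvd_iff .
  then show "z \<in> digit_index (int k)"
    using pj by (auto simp: digit_index_def prime_factors_dvd)
qed

lemma card_digit_index: "k > 0 \<Longrightarrow> card (digit_index (int k)) = big_omega k"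
proof -
  assume k: "k > 0"
  have "card (digit_index (int k)) = card (SIGMA p:prime_factors k. {1..multiplicity p k})"
    unfolding digit_index_image[OF k] by (rule card_image) (auto simp: inj_on_def)
  also have "\<dots> = (\<Sum>p \<in> prime_factors k. multiplicity p k)"
    by simp
  also have "\<dots> = (\<Sum>p \<in> prime_factors k. count (prime_factorization k) p)"
    by (rule sum.cong) (auto simp: count_prime_factorization)
  also have "\<dots> = big_omega k"
    unfolding big_omega_def by (rule size_multiset_overloaded_eq[symmetric])
  finally show ?thesis .
qed

lemma prod_digit_index: "n > 0 \<Longrightarrow> (\<Prod>(p, j) \<in> digit_index n. p) = n"
proof -
  assume n: "n > 0"
  define k where "k = nat n"
  have k: "k > 0" "n = int k"
    using n by (simp_all add: k_def)
  have "(\<Prod>(p, j) \<in> digit_index n. p) = (\<Prod>(p, j) \<in> (SIGMA p:prime_factors k. {1..multiplicity p k}). int p)"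
    unfolding k(2) digit_index_image[OF k(1)]
    by (subst prod.reindex) (auto simp: inj_on_def comp_def case_prod_unfold)
  also have "\<dots> = (\<Prod>p \<in> prime_factors k. \<Prod>j \<in> {1..multiplicity p k}. int p)"
    by (rule prod.Sigma[symmetric]) auto
  also have "\<dots> = int (\<Prod>p \<in> prime_factors k. p ^ multiplicity p k)"
    by simp
  also have "\<dots> = n"
    using k prod_prime_factors[of k] by simp
  finally show ?thesis .
qed

text \<open>Injectivity is \<open>digit_val_agree\<close> at \<open>u = n\<close>, and by
  \<open>prod_digit_index\<close> there are exactly \<open>n\<close> systems of digits.\<close>

lemma digit_val_onto:
  assumes n: "n > 0" and e: "\<And>p j. (p, j) \<in> digit_index n \<Longrightarrow> exact_order n p j (e p j)"
  shows "bij_betw (\<lambda>a. digit_val n e (curry a) mod n) (PiE (digit_index n) (\<lambda>(p, j). {0..<p})) {0..<n}"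
proof -
  let ?A = "PiE (digit_index n) (\<lambda>(p, j). {0..<p})" and ?f = "\<lambda>a. digit_val n e (curry a) mod n"
  have fin: "finite ?A"
    using finite_digit_index[OF n] by (intro finite_PiE) auto
  have dig: "digits n (curry a)" if "a \<in> ?A" for a
    using that unfolding digits_def by (fastforce simp: PiE_iff)
  have inj: "inj_on ?f ?A"
  proof (rule inj_onI)
    fix a b assume a: "a \<in> ?A" and b: "b \<in> ?A" and eq: "?f a = ?f b"
    have "n dvd digit_val n e (curry a) - digit_val n e (curry b)"
      using eq by (simp add: mod_eq_dvd_iff)
    note agree = digit_val_agree[OF n dvd_refl n e dig[OF a] dig[OF b] this]
    have "n div n = 1"
      using n by simp
    show "a = b"
    proof (rule PiE_ext[OF a b])
      fix z assume z: "z \<in> digit_index n"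
      obtain p j where pj: "z = (p, j)"
        by (cases z)
      have "(p, j) \<notin> digit_index (n div n)"
        unfolding \<open>n div n = 1\<close> using digit_indexD(1,4)[of p j 1] not_prime_unit by blast
      then show "a z = b z"
        using agree[of p j] z pj by simp
    qed
  qed
  have "card ?A = nat n"
  proof -
    have "card ?A = (\<Prod>z \<in> digit_index n. nat (fst z))"
      using finite_digit_index[OF n] by (subst card_PiE) (auto intro!: prod.cong)
    also have "int \<dots> = (\<Prod>z \<in> digit_index n. fst z)"
      unfolding of_nat_prod by (rule prod.cong) (auto dest!: digit_indexD(1) prime_ge_0_int)
    also have "\<dots> = n"
      using prod_digit_index[OF n] by (simp add: case_prod_unfold)
    finally show ?thesis
      by simp
  qed
  then have "card (?f ` ?A) = card {0..<n}"
    using inj by (simp add: card_image)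
  moreover have "?f ` ?A \<subseteq> {0..<n}"
    using n by auto
  ultimately have "?f ` ?A = {0..<n}"
    by (intro card_subset_eq) auto
  then show ?thesis
    using inj by (intro bij_betw_imageI)
qed

text \<open>If the \<open>p\<close>-part of \<open>y\<close> has order \<open>p ^ j\<close>, it is
  the witness, obtained as \<open>E * y\<close>; otherwise \<open>n div p ^ j\<close> serves as a
  default, so that digit expansions exist in any case.\<close>

lemma exact_order_part:
  assumes mem: "(p, j) \<in> digit_index n" and n: "n > 0"
  obtains x where "exact_order n p j x"
    and "p ^ (multiplicity p n - j) dvd y \<Longrightarrow> \<not> p ^ Suc (multiplicity p n - j) dvd y \<Longrightarrow> p ^ multiplicity p n dvd x - y"
proof (cases "p ^ (multiplicity p n - j) dvd y \<and> \<not> p ^ Suc (multiplicity p n - j) dvd y")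
  case False
  have "\<not> p dvd 1"
    using digit_indexD(1)[OF mem] not_prime_unit by blast
  then have "exact_order n p j (n div p ^ j * 1)"
    unfolding exact_order_def by blast
  then show ?thesis
    using that False by blast
next
  case True
  note d = digit_indexD[OF mem]
  define k where "k = multiplicity p n"
  have p0: "p > 0"
    using prime_gt_0_int[OF d(1)] .
  have jk: "j \<le> k"
    using digit_index_le[OF mem n] by (simp add: k_def)
  obtain n' where n': "n = p ^ k * n'" "\<not> p dvd n'"
    using prime_power_split[OF d(1) n] unfolding k_def by blast
  have cop: "coprime (p ^ i) n'" for i
    using n'(2) by (metis coprime_commute prime_imp_power_coprime d(1))
  have "n = p ^ j * (p ^ (k - j) * n')"
    using n'(1) jk by (simp add: mult.assoc[symmetric] power_add[symmetric])
  then have q: "n div p ^ j = p ^ (k - j) * n'"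
    using p0 by simp
  obtain E where E: "p ^ k dvd E - 1" "n' dvd E"
    using coprime_projection[OF cop] by blast
  have Ey: "p ^ k dvd E * y - y"
    using dvd_mult2[OF E(1), of y] by (simp add: algebra_simps)
  have iff: "p ^ i dvd E * y \<longleftrightarrow> p ^ i dvd y" if "i \<le> k" for i
  proof -
    have "p ^ i dvd E * y - y"
      using le_imp_power_dvd[OF that] Ey by (rule dvd_trans)
    then show ?thesis
      by (metis dvd_diff_left_iff dvd_diff_right_iff)
  qed
  have "p ^ (k - j) * n' dvd E * y"
    using True iff[of "k - j"] E(2) cop unfolding k_def[symmetric] by (intro divides_mult) auto
  then obtain w where w: "E * y = p ^ (k - j) * n' * w"
    by blast
  have "\<not> p dvd w"
  proof
    assume "p dvd w"
    then have "p ^ (k - j) * p dvd p ^ (k - j) * (n' * w)"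
      by (intro mult_dvd_mono) auto
    then have "p ^ Suc (k - j) dvd E * y"
      using w by (simp add: mult_ac)
    moreover have "Suc (k - j) \<le> k"
      using d(2) jk by simp
    ultimately show False
      using True iff[of "Suc (k - j)"] unfolding k_def[symmetric] by blast
  qed
  then have "exact_order n p j (E * y)"
    using w q unfolding exact_order_def by metis
  then show ?thesis
    using that Ey k_def by blast
qed

lemma exact_order_standard:
  assumes "(p, j) \<in> digit_index n"
  shows "exact_order n p j (n div p ^ j)"
proof -
  have "\<not> p dvd 1"
    using digit_indexD(1)[OF assms] not_prime_unit by blast
  moreover have "n div p ^ j = n div p ^ j * 1"
    by simp
  ultimately show ?thesis
    unfolding exact_order_def by blast
qed

lemma (in wl_pair) pebbling:
  assumes m: "m = card (digit_index n) + 3"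
  obtains e r where "pebbled n col e r"
proof -
  obtain L where L: "set L = digit_index n" "length L = card (digit_index n)"
    using finite_distinct_list[OF finite_digit_index[OF n_pos]] distinct_card by metis
  \<comment> \<open>Entry 0 is the base point, followed by the pebbles; the last entry is the free
    pebble, moved to an arbitrary \<open>x\<close> below.\<close>
  define xs where "xs = 0 # map (\<lambda>(p, j). n div p ^ j) L @ [0, 0]"
  have len: "length xs = m"
    using L m by (simp add: xs_def)
  obtain ys where ys: "length ys = m" "ys ! 0 = 0" "w False ys = w True xs"
    by (rule w_match_zero[OF len]) (simp add: xs_def)
  have "\<forall>z \<in> digit_index n. \<exists>i < length L. L ! i = z"
    using L(1) by (metis in_set_conv_nth)
  then obtain t where t: "\<And>z. z \<in> digit_index n \<Longrightarrow> t z < length L" "\<And>z. z \<in> digit_index n \<Longrightarrow> L ! t z = z"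
    by metis
  define r where "r p j = ys ! Suc (t (p, j))" for p j
  have "\<forall>z \<in> digit_index n. \<exists>x. exact_order n (fst z) (snd z) x \<and>
      (fst z ^ (multiplicity (fst z) n - snd z) dvd r (fst z) (snd z) \<longrightarrow>
       \<not> fst z ^ Suc (multiplicity (fst z) n - snd z) dvd r (fst z) (snd z) \<longrightarrow>
       fst z ^ multiplicity (fst z) n dvd x - r (fst z) (snd z))"
    using exact_order_part[OF _ n_pos] by (metis prod.collapse)
  then obtain f where f: "\<And>z. z \<in> digit_index n \<Longrightarrow> exact_order n (fst z) (snd z) (f z)"
      "\<And>z. z \<in> digit_index n \<Longrightarrow> fst z ^ (multiplicity (fst z) n - snd z) dvd r (fst z) (snd z) \<Longrightarrow>
       \<not> fst z ^ Suc (multiplicity (fst z) n - snd z) dvd r (fst z) (snd z) \<Longrightarrow>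
       fst z ^ multiplicity (fst z) n dvd f z - r (fst z) (snd z)"
    by metis
  define e where "e s p j = (if s then n div p ^ j else f (p, j))" for s p j
  have "pebbled n col e r"
  proof unfold_locales
    fix p j s assume pj: "(p, j) \<in> digit_index n"
    show "exact_order n p j (e s p j)"
      using f(1)[OF pj] exact_order_standard[OF pj] by (simp add: e_def)
  next
    fix p j assume pj: "(p, Suc j) \<in> digit_index n" "0 < j"
    have p0: "p > 0"
      using prime_gt_0_int[OF digit_indexD(1)[OF pj(1)]] .
    obtain q where "n = p ^ Suc j * q"
      using digit_indexD(3)[OF pj(1)] by blast
    then have "n div p ^ j = p * q" "n div p ^ Suc j = q"
      using p0 by (simp_all add: mult.assoc power_Suc2 del: power_Suc)
    then show "n dvd e True p j - p * e True p (Suc j)"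
      by (simp add: e_def)
  next
    fix x
    obtain \<pi> where \<pi>: "\<And>y i. i < length xs \<Longrightarrow> w True (xs[i := y]) = w False (ys[i := \<pi> y])"
      using w_move[OF ys(3)[symmetric]] by metis
    define xs' ys' where "xs' = xs[m - 1 := x]" and "ys' = ys[m - 1 := \<pi> x]"
    have eq: "w True xs' = w False ys'"
      unfolding xs'_def ys'_def by (rule \<pi>) (use len m3 in simp)
    have len': "length xs' = m"
      using len by (simp add: xs'_def)
    have "xs ! 0 = 0"
      by (simp add: xs_def)
    then have last: "xs' ! (m - 1) = x" "ys' ! (m - 1) = \<pi> x" "xs' ! 0 = 0" "ys' ! 0 = 0"
      using len ys m3 by (simp_all add: xs'_def ys'_def nth_list_update)
    have "pair_colour True x = pair_colour False (\<pi> x)"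
      using pair_colour_diff[OF eq len', of 0 "m - 1"] last m3 by simp
    moreover have "pair_colour True (x - e True p j) = pair_colour False (\<pi> x - r p j)" if pj: "(p, j) \<in> digit_index n" for p j
    proof -
      have lt: "Suc (t (p, j)) < m - 1"
        using t(1)[OF pj] L(2) m by simp
      have "xs' ! Suc (t (p, j)) = e True p j"
      proof -
        have "xs ! Suc (t (p, j)) = e True p j"
          using t[OF pj] by (simp add: xs_def e_def nth_append)
        then show ?thesis
          using lt by (simp add: xs'_def)
      qed
      moreover have "ys' ! Suc (t (p, j)) = r p j"
        using lt by (simp add: ys'_def r_def nth_list_update)
      ultimately show ?thesis
        using pair_colour_diff[OF eq len', of "Suc (t (p, j))" "m - 1"] last(1,2) lt by simp
    qed
    ultimately show "\<exists>x'. col True x = col False x' \<and>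
        (\<forall>(p, j) \<in> digit_index n. col True (x - e True p j) = col False (x' - r p j))"
      unfolding col_eq_iff by blast
  next
    fix p j assume pj: "(p, j) \<in> digit_index n"
      and "p ^ (multiplicity p n - j) dvd r p j" and "\<not> p ^ Suc (multiplicity p n - j) dvd r p j"
    then show "p ^ multiplicity p n dvd e False p j - r p j"
      using f(2)[OF pj] by (simp add: e_def)
  qed
  then show ?thesis
    by (rule that)
qed

lemma (in wl_pair) residue_graphs_isomorphic:
  assumes m: "m = card (digit_index n) + 3"
  obtains f where "bij_betw f {0..<n} {0..<n}"
    and "\<And>x y. x \<in> {0..<n} \<Longrightarrow> y \<in> {0..<n} \<Longrightarrow> D True ((y - x) mod n) \<longleftrightarrow> D False ((f y - f x) mod n)"
proof -
  obtain e r where "pebbled n col e r"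
    by (rule pebbling[OF m])
  then interpret P: pebbled n col e r .
  let ?A = "PiE (digit_index n) (\<lambda>(p, j). {0..<p})"
  define F where "F s a = digit_val n (e s) (curry a) mod n" for s a
  have F: "bij_betw (F s) ?A {0..<n}" for s
    unfolding F_def by (rule digit_val_onto[OF n_pos P.ord])
  \<comment> \<open>Digits are read with the elements of side \<open>True\<close> and evaluated with
    those of side \<open>False\<close>.\<close>
  define f where "f = F False \<circ> inv_into ?A (F True)"
  have arcs: "D True ((F True b - F True a) mod n) \<longleftrightarrow> D False ((F False b - F False a) mod n)"
    if "a \<in> ?A" "b \<in> ?A" for a b
  proof -
    have dig: "digits n (curry a)" if "a \<in> ?A" for a
      using that unfolding digits_def by (fastforce simp: PiE_iff)
    have "pair_colour True (digit_val n (e True) (curry b) - digit_val n (e True) (curry a)) =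
        pair_colour False (digit_val n (e False) (curry b) - digit_val n (e False) (curry a))"
      using pebbled_linear[OF P.pebbled_axioms dig[OF that(2)] dig[OF that(1)]] unfolding col_eq_iff .
    from pair_colour_arc[OF this] show ?thesis
      unfolding F_def mod_diff_eq .
  qed
  show ?thesis
  proof (rule that)
    show "bij_betw f {0..<n} {0..<n}"
      unfolding f_def by (rule bij_betw_trans[OF bij_betw_inv_into[OF F] F])
    fix x y assume "x \<in> {0..<n}" "y \<in> {0..<n}"
    then have im: "x \<in> F True ` ?A" "y \<in> F True ` ?A"
      unfolding bij_betw_imp_surj_on[OF F] .
    obtain a where a: "x = F True a" "a \<in> ?A"
      using im(1) by (rule imageE)
    obtain b where b: "y = F True b" "b \<in> ?A"
      using im(2) by (rule imageE)
    have inv: "inv_into ?A (F True) x = a" "inv_into ?A (F True) y = b"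
      unfolding a(1) b(1) by (rule bij_betw_inv_into_left[OF F a(2)], rule bij_betw_inv_into_left[OF F b(2)])
    show "D True ((y - x) mod n) \<longleftrightarrow> D False ((f y - f x) mod n)"
      using arcs[OF a(2) b(2)] unfolding f_def comp_def inv unfolding a(1) b(1) .
  qed
qed

section \<open>From residue graphs to circulant graphs\<close>

text \<open>\<open>\<psi>\<close> is the inverse of a discrete logarithm: arcs of a Cayley graph
  depend only on the difference of the exponents of a generator.\<close>

lemma circulant_residue_graph:
  assumes "circulant X"
  obtains D \<psi> where "finite (pverts X)" and "pverts X \<noteq> {}" and "parcs X \<subseteq> pverts X \<times> pverts X"
    and "bij_betw \<psi> {0..<int (card (pverts X))} (pverts X)"
    and "\<And>i j. i \<in> {0..<int (card (pverts X))} \<Longrightarrow> j \<in> {0..<int (card (pverts X))} \<Longrightarrow>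
      (i, j) \<in> parcs (residue_graph (int (card (pverts X))) D) \<longleftrightarrow> (\<psi> i, \<psi> j) \<in> parcs X"
proof -
  obtain G T where G: "group G" "cyclic_group G" "finite (carrier G)" "T \<subseteq> carrier G" "X = cayley_graph G T"
    using assms unfolding circulant_def by blast
  interpret group G
    by (rule G(1))
  obtain x where x: "x \<in> carrier G" "carrier G = range (\<lambda>n::int. x [^]\<^bsub>G\<^esub> n)"
    using G(2) unfolding cyclic_group by blast
  define \<psi> where "\<psi> i = x [^]\<^bsub>G\<^esub> (i::int)" for i
  define n where "n = int (ord x)"
  have n0: "n > 0"
    using ord_ge_1[OF G(3) x(1)] by (simp add: n_def)
  have \<psi>_eq: "\<psi> i = \<psi> j \<longleftrightarrow> n dvd j - i" for i j
    unfolding \<psi>_def n_def by (rule int_pow_eq[OF x(1)])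
  have \<psi>_mod: "\<psi> (i mod n) = \<psi> i" for i
    unfolding \<psi>_eq by (simp add: dvd_minus_mod)
  have verts: "pverts X = carrier G"
    by (simp add: G(5) cayley_graph_def)
  have bij: "bij_betw \<psi> {0..<n} (carrier G)"
  proof (rule bij_betw_imageI)
    show "inj_on \<psi> {0..<n}"
    proof (rule inj_onI)
      fix i j assume ij: "i \<in> {0..<n}" "j \<in> {0..<n}" "\<psi> i = \<psi> j"
      then have "n dvd j - i"
        using \<psi>_eq by blast
      then show "i = j"
        using dvd_imp_eq[of n j i] ij by simp
    qed
    have "carrier G \<subseteq> \<psi> ` {0..<n}"
    proof
      fix g assume "g \<in> carrier G"
      then obtain i where i: "g = \<psi> i"
        using x(2) unfolding \<psi>_def by blast
      show "g \<in> \<psi> ` {0..<n}"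
        unfolding i \<psi>_mod[of i, symmetric] by (rule imageI) (use n0 in simp)
    qed
    moreover have "\<psi> ` {0..<n} \<subseteq> carrier G"
      using x(1) by (auto simp: \<psi>_def)
    ultimately show "\<psi> ` {0..<n} = carrier G"
      by blast
  qed
  have card: "int (card (pverts X)) = n"
    using bij_betw_same_card[OF bij] n0 by (simp add: verts)
  have arcs: "(\<psi> i, \<psi> j) \<in> parcs X \<longleftrightarrow> \<psi> ((j - i) mod n) \<in> T" for i j
  proof -
    have closed: "\<psi> i \<in> carrier G" for i
      using x(1) by (simp add: \<psi>_def)
    have split: "\<psi> j = \<psi> (j - i) \<otimes>\<^bsub>G\<^esub> \<psi> i"
      using int_pow_mult[OF x(1), of "j - i" i] by (simp add: \<psi>_def)
    have "(\<psi> i, \<psi> j) \<in> parcs X \<longleftrightarrow> (\<exists>t \<in> T. \<psi> j = t \<otimes>\<^bsub>G\<^esub> \<psi> i)"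
      using closed[of i] by (auto simp: G(5) cayley_graph_def)
    also have "\<dots> \<longleftrightarrow> \<psi> (j - i) \<in> T"
      using split right_cancel[OF closed[of i]] closed[of "j - i"] G(4) by (metis subsetD)
    finally show ?thesis
      by (simp add: \<psi>_mod)
  qed
  show ?thesis
  proof (rule that[of \<psi> "\<lambda>d. \<psi> d \<in> T"], unfold card)
    show "finite (pverts X)"
      using G(3) by (simp add: verts)
    show "pverts X \<noteq> {}"
      using x(1) verts by blast
    show "parcs X \<subseteq> pverts X \<times> pverts X"
      using G(4) by (auto simp: G(5) cayley_graph_def)
    show "bij_betw \<psi> {0..<n} (pverts X)"
      using bij by (simp add: verts)
    show "(i, j) \<in> parcs (residue_graph n (\<lambda>d. \<psi> d \<in> T)) \<longleftrightarrow> (\<psi> i, \<psi> j) \<in> parcs X"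
      if "i \<in> {0..<n}" "j \<in> {0..<n}" for i j
      unfolding parcs_residue_graph arcs using that by blast
  qed
qed

lemma tuples_bij:
  assumes "bij_betw f (pverts X) (pverts Y)"
  shows "bij_betw (map f) (tuples m X) (tuples m Y)"
proof (rule bij_betw_byWitness[where f' = "map (inv_into (pverts X) f)"])
  note inv = bij_betw_inv_into_left[OF assms] bij_betw_inv_into_right[OF assms]
    bij_betwE[OF assms] bij_betwE[OF bij_betw_inv_into[OF assms]]
  show "\<forall>xs \<in> tuples m X. map (inv_into (pverts X) f) (map f xs) = xs"
    using inv(1) by (auto simp: tuples_def intro!: map_idI)
  show "\<forall>ys \<in> tuples m Y. map f (map (inv_into (pverts X) f) ys) = ys"
    using inv(2) by (auto simp: tuples_def intro!: map_idI)
  show "map f ` tuples m X \<subseteq> tuples m Y"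
    using inv(3) by (auto simp: tuples_def subset_iff)
  show "map (inv_into (pverts X) f) ` tuples m Y \<subseteq> tuples m X"
    using inv(4) by (auto simp: tuples_def subset_iff)
qed

lemma finite_tuples: "finite (pverts X) \<Longrightarrow> finite (tuples m X)"
  using finite_lists_length_eq[of "pverts X" m] by (simp add: tuples_def conj_commute)

lemma wl_colours_iso:
  assumes bij: "bij_betw f (pverts X) (pverts Y)"
    and arcs: "\<And>x y. x \<in> pverts X \<Longrightarrow> y \<in> pverts X \<Longrightarrow> (x, y) \<in> parcs X \<longleftrightarrow> (f x, f y) \<in> parcs Y"
  shows "image_mset (wl_colouring X) (mset_set (tuples m X)) = image_mset (wl_colouring Y) (mset_set (tuples m Y))"
proof (rule image_mset_eq_bijI[OF tuples_bij[OF bij]])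
  fix xs assume "xs \<in> tuples m X"
  then have "set xs \<subseteq> pverts X"
    by (simp add: tuples_def)
  then show "wl_colouring X xs = wl_colouring Y (map f xs)"
    unfolding wl_colouring_eq_iff using wl_round_iso[OF bij arcs] by blast
qed

text \<open>Two tuples of equal colour already provide a bijection between the vertex sets, so the
  second graph has the same order and both use the same modulus.\<close>

lemma wl_equivalent_card:
  assumes fin: "finite (pverts X)" "finite (pverts Y)" and ne: "pverts X \<noteq> {}" and eq: "wl_equivalent m X Y"
  shows "card (pverts X) = card (pverts Y)"
proof -
  obtain v where v: "v \<in> pverts X"
    using ne by blast
  have "wl_colouring X ` tuples m X = wl_colouring Y ` tuples m Y"
    using arg_cong[OF eq[unfolded wl_equivalent_def], of set_mset] fin by (simp add: finite_tuples)
  moreover have "replicate m v \<in> tuples m X"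
    using v by (auto simp: tuples_def)
  ultimately obtain ys where "wl_colouring X (replicate m v) = wl_colouring Y ys"
    by blast
  then obtain \<pi> where "bij_betw \<pi> (pverts X) (pverts Y)"
    using wl_colouring_bij[OF fin] by blast
  then show ?thesis
    by (rule bij_betw_same_card)
qed

lemma graph_isomorphicI:
  assumes bij: "bij_betw f (pverts X) (pverts Y)"
    and X: "parcs X \<subseteq> pverts X \<times> pverts X" and Y: "parcs Y \<subseteq> pverts Y \<times> pverts Y"
    and arcs: "\<And>x y. x \<in> pverts X \<Longrightarrow> y \<in> pverts X \<Longrightarrow> (x, y) \<in> parcs X \<longleftrightarrow> (f x, f y) \<in> parcs Y"
  shows "graph_isomorphic X Y"
proof -
  define h where "h = \<lparr> iso_verts = f, iso_arcs = map_prod f f, iso_head = snd, iso_tail = fst \<rparr>"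
  have inj: "inj_on f (pverts X)"
    by (rule bij_betw_imp_inj_on[OF bij])
  have "wf_digraph (with_proj X)"
    by unfold_locales (use X in auto)
  moreover have "inj_on (map_prod f f) (parcs X)"
    by (rule inj_on_subset[OF map_prod_inj_on[OF inj inj] X])
  ultimately have iso: "pre_digraph.digraph_isomorphism (with_proj X) h"
    using inj unfolding pre_digraph.digraph_isomorphism_def by (simp add: h_def)
  have "map_prod f f ` parcs X = parcs Y"
  proof (intro equalityI subsetI)
    fix z assume "z \<in> map_prod f f ` parcs X"
    then obtain x y where "z = (f x, f y)" "(x, y) \<in> parcs X"
      by auto
    then show "z \<in> parcs Y"
      using arcs X by blast
  next
    fix z assume z: "z \<in> parcs Y"
    then have "fst z \<in> pverts Y" "snd z \<in> pverts Y"
      using Y by auto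
    then obtain x y where xy: "x \<in> pverts X" "y \<in> pverts X" "fst z = f x" "snd z = f y"
      using bij_betw_imp_surj_on[OF bij] by (metis imageE)
    then have "z = (f x, f y)"
      by (simp add: prod_eq_iff)
    moreover have "(x, y) \<in> parcs X"
      using arcs[OF xy(1,2)] z \<open>z = (f x, f y)\<close> by simp
    ultimately show "z \<in> map_prod f f ` parcs X"
      by force
  qed
  then have "with_proj Y = app_iso h (with_proj X)"
    using bij_betw_imp_surj_on[OF bij] by (simp add: app_iso_def with_proj_def h_def)
  then show ?thesis
    using iso unfolding graph_isomorphic_def digraph_iso_def by blast
qed

lemma circulant_wl_equivalent_iso:
  assumes X: "circulant X" and Y: "circulant Y"
    and eq: "wl_equivalent (big_omega (card (pverts X)) + 3) X Y"
  shows "graph_isomorphic X Y"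
proof -
  define k where "k = card (pverts X)"
  define m where "m = big_omega k + 3"
  obtain DX \<phi> where fX: "finite (pverts X)" "pverts X \<noteq> {}" "parcs X \<subseteq> pverts X \<times> pverts X"
    and \<phi>: "bij_betw \<phi> {0..<int (card (pverts X))} (pverts X)"
      "\<And>i j. i \<in> {0..<int (card (pverts X))} \<Longrightarrow> j \<in> {0..<int (card (pverts X))} \<Longrightarrow>
        (i, j) \<in> parcs (residue_graph (int (card (pverts X))) DX) \<longleftrightarrow> (\<phi> i, \<phi> j) \<in> parcs X"
    using circulant_residue_graph[OF X] by metis
  obtain DY \<psi> where fY: "finite (pverts Y)" "pverts Y \<noteq> {}" "parcs Y \<subseteq> pverts Y \<times> pverts Y"
    and \<psi>: "bij_betw \<psi> {0..<int (card (pverts Y))} (pverts Y)"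
      "\<And>i j. i \<in> {0..<int (card (pverts Y))} \<Longrightarrow> j \<in> {0..<int (card (pverts Y))} \<Longrightarrow>
        (i, j) \<in> parcs (residue_graph (int (card (pverts Y))) DY) \<longleftrightarrow> (\<psi> i, \<psi> j) \<in> parcs Y"
    using circulant_residue_graph[OF Y] by metis
  have card: "card (pverts X) = k" "card (pverts Y) = k"
    using wl_equivalent_card[OF fX(1) fY(1) fX(2) eq] by (simp_all add: k_def)
  note \<phi> = \<phi>[unfolded card] and \<psi> = \<psi>[unfolded card]
  have k0: "k > 0"
    using fX(1,2) by (simp add: k_def card_gt_0_iff)
  define D where "D s = (if s then DX else DY)" for s
  have "image_mset (wl_colouring (residue_graph (int k) DX)) (mset_set (tuples m (residue_graph (int k) DX))) =
      image_mset (wl_colouring X) (mset_set (tuples m X))"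
    by (rule wl_colours_iso) (simp_all only: pverts_residue_graph \<phi>)
  moreover have "image_mset (wl_colouring (residue_graph (int k) DY)) (mset_set (tuples m (residue_graph (int k) DY))) =
      image_mset (wl_colouring Y) (mset_set (tuples m Y))"
    by (rule wl_colours_iso) (simp_all only: pverts_residue_graph \<psi>)
  ultimately have "wl_equivalent m (residue_graph (int k) (D True)) (residue_graph (int k) (D False))"
    using eq unfolding wl_equivalent_def D_def m_def k_def by simp
  then interpret wl_pair "int k" m D
    by unfold_locales (use k0 in \<open>simp_all add: m_def\<close>)
  obtain f where f: "bij_betw f {0..<int k} {0..<int k}"
      "\<And>x y. x \<in> {0..<int k} \<Longrightarrow> y \<in> {0..<int k} \<Longrightarrow> D True ((y - x) mod int k) \<longleftrightarrow> D False ((f y - f x) mod int k)"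
    using residue_graphs_isomorphic card_digit_index[OF k0] unfolding m_def by metis
  have f_arcs: "(x, y) \<in> parcs (residue_graph (int k) DX) \<longleftrightarrow> (f x, f y) \<in> parcs (residue_graph (int k) DY)"
    if "x \<in> {0..<int k}" "y \<in> {0..<int k}" for x y
    using f(2)[OF that] that bij_betwE[OF f(1)] unfolding parcs_residue_graph D_def by simp
  let ?g = "inv_into {0..<int k} \<phi>"
  have g: "bij_betw ?g (pverts X) {0..<int k}"
    by (rule bij_betw_inv_into[OF \<phi>(1)])
  show ?thesis
  proof (rule graph_isomorphicI[OF _ fX(3) fY(3)])
    show "bij_betw (\<psi> \<circ> (f \<circ> ?g)) (pverts X) (pverts Y)"
      by (rule bij_betw_trans[OF bij_betw_trans[OF g f(1)] \<psi>(1)])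
    fix x y assume xy: "x \<in> pverts X" "y \<in> pverts X"
    have mem: "?g x \<in> {0..<int k}" "?g y \<in> {0..<int k}"
      using bij_betwE[OF g] xy by blast+
    have fmem: "f (?g x) \<in> {0..<int k}" "f (?g y) \<in> {0..<int k}"
      using bij_betwE[OF f(1)] mem by blast+
    have "(x, y) \<in> parcs X \<longleftrightarrow> (?g x, ?g y) \<in> parcs (residue_graph (int k) DX)"
      unfolding \<phi>(2)[OF mem] bij_betw_inv_into_right[OF \<phi>(1) xy(1)] bij_betw_inv_into_right[OF \<phi>(1) xy(2)] ..
    also have "\<dots> \<longleftrightarrow> (\<psi> (f (?g x)), \<psi> (f (?g y))) \<in> parcs Y"
      unfolding f_arcs[OF mem] by (rule \<psi>(2)[OF fmem])
    finally show "(x, y) \<in> parcs X \<longleftrightarrow> ((\<psi> \<circ> (f \<circ> ?g)) x, (\<psi> \<circ> (f \<circ> ?g)) y) \<in> parcs Y"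
      by simp
  qed
qed

theorem theorem1p1:
  fixes X :: "'a pair_pre_digraph" and n :: nat
  assumes "circulant X" and "card (pverts X) = n"
  shows "wl_dimension {Y :: 'b pair_pre_digraph. circulant Y} X \<le> enat (big_omega n + 3) \<and>
    (\<forall>Y :: 'b pair_pre_digraph.
       circulant Y \<and> wl_equivalent (big_omega n + 3) X Y \<longrightarrow> graph_isomorphic X Y)"
proof
  show iso: "\<forall>Y :: 'b pair_pre_digraph. circulant Y \<and> wl_equivalent (big_omega n + 3) X Y \<longrightarrow> graph_isomorphic X Y"
    using circulant_wl_equivalent_iso[OF assms(1)] assms(2) by blast
  then show "wl_dimension {Y :: 'b pair_pre_digraph. circulant Y} X \<le> enat (big_omega n + 3)"
    unfolding wl_dimension_def by (intro Inf_lower imageI) simp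
qed

end
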